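(* Let $n\in\mathbb N$, $1<p<\infty$, $-\frac np<r<0$, $\frac1p+\frac1{p'}=1$, $-n<\varrho<-\frac n{p'}$. Let $T$ be an operator with domain $D(\mathbb R^n)$ satisfying $$\|Tf|L_2(\mathbb R^n)\|\le c_1\|f|L_2(\mathbb R^n)\|,$$ where the constant $c_1$ is independent of $f\in D(\mathbb R^n)$, and $$(Tf)(y)=\lim_{\varepsilon\searrow0}\int_{z\in\mathbb R^n,\ |y-z|\ge\varepsilon}K(y,z)f(z)\,dz$$ almost everywhere for all $f\in D(\mathbb R^n)$, where the complex-valued function $K(\cdot,\cdot)$, defined on $\mathbb R^n\times\mathbb R^n\setminus\{(x,x):x\in\mathbb R^n\}$, satisfies for some constants $c_2>0$, $\delta>0$ the conditions $|K(x,y)|\le c_2|x-y|^{-n}$, $$|K(x,y)-K(x',y)|\le c_2\frac{|x-x'|^\delta}{(|x-y|+|x'-y|)^{n+\delta}}\quad\text{whenever } 2|x-x'|\le\max(|x-y|,|x'-y|),$$ $$|K(x,y)-K(x,y')|\le c_2\frac{|y-y'|^\delta}{(|x-y|+|x-y'|)^{n+\delta}}\quad\text{whenever } 2|y-y'|\le\max(|x-y|,|x-y'|).$$ Then the following statements hold. 1. There are linear and bounded extensions of $T$ to $L^r_p(\mathbb R^n)$. 2. There is a unique linear and bounded extension of $T$ to $\overset{\circ}{L}{}^r_p(\mathbb R^n)$ and a unique linear and bounded extension of $T$ to $H^\varrho L_{p'}(\mathbb R^n)$.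
   Context: Functions are complex-valued; $D(\mathbb R^n)=C_0^\infty(\mathbb R^n)$. A bounded operator $\widetilde T:X\to X$ (i.e. $\|\widetilde Tx|X\|\le c\|x|X\|$ for all $x \in X$), where $D(\mathbb R^n)$ is contained in $X$, is called an extension of $T$ to $X$ if it coincides with $T$ on $D(\mathbb R^n)$. For $J\in\mathbb Z$, $M\in\mathbb Z^n$ put $Q_{J,M}=2^{-J}(M+[-1,1]^n)$. Morrey space: for $1<p<\infty$, $-\frac np\le r<0$, $L^r_p(\mathbb R^n)$ is the set of all $f\in L_p^{\rm loc}(\mathbb R^n)$ with $\|f|L^r_p(\mathbb R^n)\|=\sup_{J\in\mathbb Z,M\in\mathbb Z^n}2^{J(\frac np+r)}\|f|L_p(Q_{J,M})\|<\infty$; $\overset{\circ}{L}{}^r_p(\mathbb R^n)$ is the closure of $D(\mathbb R^n)$ in it. Predual Morrey space: for $1<p<\infty$, $-n<\varrho<-\frac np$, $H^\varrho L_p(\mathbb R^n)$ is the set of all $h\in S'(\mathbb R^n)$ which can be represented as $h=\sum_{J\in\mathbb Z,M\in\mathbb Z^n}\lambda_{J,M}a_{J,M}$ (convergence in $S'(\mathbb R^n)$) with $\operatorname{supp}a_{J,M}\subset Q_{J,M}$, $\|a_{J,M}|L_p(\mathbb R^n)\|\le2^{-J(\frac np+\varrho)}$ and $\sum_{J,M}|\lambda_{J,M}|<\infty$; its norm is the infimum of $\sum_{J,M}|\lambda_{J,M}|$ over all such representations. (Here this is used with $p'$ in place of $p$.) *)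

theory Defs
  imports "HOL-Analysis.Analysis"
begin

text \<open>
  Elements of function spaces are Lebesgue measurable functions; two such functions are
  the same element if they agree almost everywhere.  Sets of functions below are closed under this
  identification (except for spaces of smooth functions), and operators between function
  spaces are compared up to it.
\<close>

section \<open>Test functions and tempered distributions\<close>

definition partial_deriv :: "'n \<Rightarrow> (real ^ 'n \<Rightarrow> complex) \<Rightarrow> real ^ 'n \<Rightarrow> complex"
  where "partial_deriv i f x = frechet_derivative f (at x) (axis i 1)"

text \<open>Iterated partial derivatives, indexed by the list of directions rather than by a multi-index.\<close>

definition partial_derivs :: "'n list \<Rightarrow> (real ^ 'n \<Rightarrow> complex) \<Rightarrow> real ^ 'n \<Rightarrow> complex"
  where "partial_derivs is f = foldr partial_deriv is f"

definition smooth :: "(real ^ 'n \<Rightarrow> complex) \<Rightarrow> bool"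
  where "smooth f \<longleftrightarrow> (\<forall>is x. partial_derivs is f differentiable (at x))"

definition test_functions :: "(real ^ 'n \<Rightarrow> complex) set"
  where "test_functions = {f. smooth f \<and> compact (closure {x. f x \<noteq> 0})}"

definition schwartz_space :: "(real ^ 'n \<Rightarrow> complex) set"
  where "schwartz_space =
    {f. smooth f \<and> (\<forall>k is. bounded (range (\<lambda>x. (1 + norm x) ^ k *\<^sub>R partial_derivs is f x)))}"

definition schwartz_seminorm :: "nat \<Rightarrow> nat \<Rightarrow> (real ^ 'n \<Rightarrow> complex) \<Rightarrow> real"
  where "schwartz_seminorm k l f =
    (SUP x. (1 + norm x) ^ k * (\<Sum>is | length is \<le> l. norm (partial_derivs is f x)))"

text \<open>
  A tempered distribution is a continuous linear functional on the Schwartz space.  It is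
  represented by a total function with the value 0 outside the Schwartz space, so that equality
  of distributions is equality of functions, and sums and scalar multiples are pointwise.
\<close>

definition tempered_distributions :: "((real ^ 'n \<Rightarrow> complex) \<Rightarrow> complex) set"
  where "tempered_distributions = {u.
    (\<forall>\<phi>. \<phi> \<notin> schwartz_space \<longrightarrow> u \<phi> = 0) \<and>
    (\<forall>\<phi>\<in>schwartz_space. \<forall>\<psi>\<in>schwartz_space. u (\<lambda>x. \<phi> x + \<psi> x) = u \<phi> + u \<psi>) \<and>
    (\<forall>c. \<forall>\<phi>\<in>schwartz_space. u (\<lambda>x. c * \<phi> x) = c * u \<phi>) \<and>
    (\<exists>C k l. \<forall>\<phi>\<in>schwartz_space. norm (u \<phi>) \<le> C * schwartz_seminorm k l \<phi>)}"

definition regular_distribution ::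
    "(real ^ 'n \<Rightarrow> complex) \<Rightarrow> (real ^ 'n \<Rightarrow> complex) \<Rightarrow> complex"
  where "regular_distribution f \<phi> =
    (if \<phi> \<in> schwartz_space then LINT x|lebesgue. f x * \<phi> x else 0)"


section \<open>Lebesgue spaces\<close>

definition Lp_space :: "real \<Rightarrow> (real ^ 'n \<Rightarrow> complex) set"
  where "Lp_space p =
    {f \<in> borel_measurable lebesgue. integrable lebesgue (\<lambda>x. norm (f x) powr p)}"

definition Lp_loc :: "real \<Rightarrow> (real ^ 'n \<Rightarrow> complex) set"
  where "Lp_loc p = {f \<in> borel_measurable lebesgue.
    \<forall>A. compact A \<longrightarrow> set_integrable lebesgue A (\<lambda>x. norm (f x) powr p)}"

definition Lp_norm_on :: "real \<Rightarrow> (real ^ 'n) set \<Rightarrow> (real ^ 'n \<Rightarrow> complex) \<Rightarrow> real"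
  where "Lp_norm_on p A f = (LINT x:A|lebesgue. norm (f x) powr p) powr (1 / p)"

abbreviation Lp_norm :: "real \<Rightarrow> (real ^ 'n \<Rightarrow> complex) \<Rightarrow> real"
  where "Lp_norm p \<equiv> Lp_norm_on p UNIV"

text \<open>
  The support of the almost everywhere class of a function: the complement of the largest open
  set on which the function vanishes almost everywhere.
\<close>

definition ess_support :: "(real ^ 'n \<Rightarrow> complex) \<Rightarrow> (real ^ 'n) set"
  where "ess_support f = - \<Union>{U. open U \<and> (AE x in lebesgue. x \<in> U \<longrightarrow> f x = 0)}"


section \<open>Morrey spaces and their preduals\<close>

definition dyadic_cube :: "int \<Rightarrow> int ^ 'n \<Rightarrow> (real ^ 'n) set"
  where "dyadic_cube J M =
    (\<lambda>x. (2 powi (- J)) *\<^sub>R ((\<chi> i. real_of_int (M $ i)) + x)) ` {x. \<forall>i. x $ i \<in> {-1..1}}"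

definition morrey_norm :: "real \<Rightarrow> real \<Rightarrow> (real ^ 'n \<Rightarrow> complex) \<Rightarrow> real"
  where "morrey_norm p r f =
    (SUP (J, M). 2 powr (real_of_int J * (real CARD('n) / p + r)) * Lp_norm_on p (dyadic_cube J M) f)"

definition morrey_space :: "real \<Rightarrow> real \<Rightarrow> (real ^ 'n \<Rightarrow> complex) set"
  where "morrey_space p r = {f \<in> Lp_loc p. bdd_above (range (\<lambda>(J, M).
    2 powr (real_of_int J * (real CARD('n) / p + r)) * Lp_norm_on p (dyadic_cube J M) f))}"

definition morrey_space0 :: "real \<Rightarrow> real \<Rightarrow> (real ^ 'n \<Rightarrow> complex) set"
  where "morrey_space0 p r = {f \<in> morrey_space p r.
    \<forall>e>0. \<exists>g\<in>test_functions. morrey_norm p r (\<lambda>x. f x - g x) < e}"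

text \<open>
  Convergence of the atomic series in the space of tempered distributions is (unordered)
  convergence of the sums obtained by testing against each Schwartz function.
\<close>

definition atomic_representation ::
    "real \<Rightarrow> real \<Rightarrow> ((real ^ 'n \<Rightarrow> complex) \<Rightarrow> complex) \<Rightarrow>
     (int \<times> (int ^ 'n) \<Rightarrow> complex) \<Rightarrow> (int \<times> (int ^ 'n) \<Rightarrow> real ^ 'n \<Rightarrow> complex) \<Rightarrow> bool"
  where "atomic_representation p \<rho> h lam a \<longleftrightarrow>
    (\<forall>J M. a (J, M) \<in> Lp_space p \<and> ess_support (a (J, M)) \<subseteq> dyadic_cube J M \<and>
       Lp_norm p (a (J, M)) \<le> 2 powr (- real_of_int J * (real CARD('n) / p + \<rho>))) \<and>
    (\<lambda>k. norm (lam k)) summable_on UNIV \<and>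
    (\<forall>\<phi>\<in>schwartz_space. ((\<lambda>k. lam k * regular_distribution (a k) \<phi>) has_sum h \<phi>) UNIV)"

definition predual_morrey_space :: "real \<Rightarrow> real \<Rightarrow> ((real ^ 'n \<Rightarrow> complex) \<Rightarrow> complex) set"
  where "predual_morrey_space p \<rho> =
    {h \<in> tempered_distributions. \<exists>lam a. atomic_representation p \<rho> h lam a}"

definition predual_morrey_norm :: "real \<Rightarrow> real \<Rightarrow> ((real ^ 'n \<Rightarrow> complex) \<Rightarrow> complex) \<Rightarrow> real"
  where "predual_morrey_norm p \<rho> h =
    Inf {(\<Sum>\<^sub>\<infinity>k. norm (lam k)) | lam a. atomic_representation p \<rho> h lam a}"


section \<open>Linear and bounded extensions\<close>

text \<open>
  The same notion for spaces of functions modulo equality almost everywhere and for spaces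
  of tempered distributions, into which functions are embedded as regular distributions.
\<close>

definition linear_bounded_extension ::
    "(real ^ 'n \<Rightarrow> complex) set \<Rightarrow> ((real ^ 'n \<Rightarrow> complex) \<Rightarrow> real) \<Rightarrow>
     ((real ^ 'n \<Rightarrow> complex) \<Rightarrow> real ^ 'n \<Rightarrow> complex) \<Rightarrow>
     ((real ^ 'n \<Rightarrow> complex) \<Rightarrow> real ^ 'n \<Rightarrow> complex) \<Rightarrow> bool"
  where "linear_bounded_extension X N T T' \<longleftrightarrow>
    test_functions \<subseteq> X \<and>
    (\<forall>f\<in>X. T' f \<in> X) \<and>
    (\<forall>f\<in>X. \<forall>g\<in>X. (AE x in lebesgue. f x = g x) \<longrightarrow> (AE x in lebesgue. T' f x = T' g x)) \<and>
    (\<forall>f\<in>X. \<forall>g\<in>X. AE x in lebesgue. T' (\<lambda>y. f y + g y) x = T' f x + T' g x) \<and>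
    (\<forall>c. \<forall>f\<in>X. AE x in lebesgue. T' (\<lambda>y. c * f y) x = c * T' f x) \<and>
    (\<exists>C. \<forall>f\<in>X. N (T' f) \<le> C * N f) \<and>
    (\<forall>f\<in>test_functions. AE x in lebesgue. T' f x = T f x)"

definition linear_bounded_distr_extension ::
    "((real ^ 'n \<Rightarrow> complex) \<Rightarrow> complex) set \<Rightarrow> (((real ^ 'n \<Rightarrow> complex) \<Rightarrow> complex) \<Rightarrow> real) \<Rightarrow>
     ((real ^ 'n \<Rightarrow> complex) \<Rightarrow> real ^ 'n \<Rightarrow> complex) \<Rightarrow>
     (((real ^ 'n \<Rightarrow> complex) \<Rightarrow> complex) \<Rightarrow> (real ^ 'n \<Rightarrow> complex) \<Rightarrow> complex) \<Rightarrow> bool"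
  where "linear_bounded_distr_extension X N T T' \<longleftrightarrow>
    regular_distribution ` test_functions \<subseteq> X \<and>
    (\<forall>h\<in>X. T' h \<in> X) \<and>
    (\<forall>h\<in>X. \<forall>g\<in>X. T' (\<lambda>\<phi>. h \<phi> + g \<phi>) = (\<lambda>\<phi>. T' h \<phi> + T' g \<phi>)) \<and>
    (\<forall>c. \<forall>h\<in>X. T' (\<lambda>\<phi>. c * h \<phi>) = (\<lambda>\<phi>. c * T' h \<phi>)) \<and>
    (\<exists>C. \<forall>h\<in>X. N (T' h) \<le> C * N h) \<and>
    (\<forall>f\<in>test_functions. T' (regular_distribution f) = regular_distribution (T f))"

end

theory Submission
  imports Defs
begin

text \<open>
  Everything rests on the boundedness of \<open>T\<close> in \<open>L\<^sub>q\<close> for every \<open>1 < q < \<infinity>\<close>.  Testing \<open>T\<close> with smooth bumps against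
  indicators of small dyadic cells turns it into matrices indexed by the integer lattice, which satisfy
  discrete kernel conditions with constants independent of the mesh; for these the Calder\'on--Zygmund
  decomposition and Marcinkiewicz interpolation are finite combinatorics.

  The Lebesgue space with exponent \<open>u = - n / r > p\<close> embeds into the Morrey space and the predual with parameter
  \<open>\<rho>\<close> embeds into the Lebesgue space with exponent \<open>s = - n / \<rho> < p'\<close>, so both extensions are governed by the
  extensions of \<open>T\<close> to Lebesgue spaces.  On a cube, the Morrey extension is the local \<open>L\<^sub>p\<close> part plus the kernel
  integral over dyadic annuli, where the Morrey norm gains a geometric factor.  Dually, the image of an atom
  splits over the annuli of its cube into multiples of atoms of the ancestor cubes, with summable
  coefficients that do not depend on the atom.
\<close>

text \<open>\<open>T\<close> acts only on smooth functions and its kernel formula holds only off the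
  support, whereas the Calderon-Zygmund decomposition cuts and averages, and exponents above 2 call
  for an adjoint. Matrices remove both obstacles: cutting and averaging stay within finite
  sequences, and transposition replaces the adjoint. The entries are asymmetric, with smooth bumps
  as input and indicators as output, and the constants must ignore the mesh because it is refined to
  zero in the end.

  Test functions are not dense in the Morrey space, so extension by continuity is impossible there.
  The operator is a limit of truncations, which exists because r < 0, and uniqueness is confined to
  the closure of the test functions. To preserve this closure, the image \<open>T g\<close> of a
  test function, itself no test function, is approximated in the Lebesgue space with exponent
  \<open>u\<close>.

  Atoms of the predual are measured in one exponent while their series is summed in the exponent
  \<open>s\<close>. The two extensions of \<open>T\<close> must therefore agree on atoms, which is
  why test functions are shown to be dense in two Lebesgue norms at once. The annular coefficients
  are summable because n + \<rho> > 0.\<close>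

section \<open>Distances and dyadic cubes in the integer lattice\<close>

definition sup_dist :: "int ^ 'n \<Rightarrow> int ^ 'n \<Rightarrow> real"
  where "sup_dist m m' = real_of_int (MAX i. \<bar>m $ i - m' $ i\<bar>)"

lemma sup_dist_le_iff: "sup_dist m m' \<le> R \<longleftrightarrow> (\<forall>i. real_of_int \<bar>m $ i - m' $ i\<bar> \<le> R)"
proof -
  have "sup_dist m m' \<le> R \<longleftrightarrow> (MAX i. \<bar>m $ i - m' $ i\<bar>) \<le> \<lfloor>R\<rfloor>"
    unfolding sup_dist_def by (simp add: le_floor_iff)
  also have "\<dots> \<longleftrightarrow> (\<forall>i. \<bar>m $ i - m' $ i\<bar> \<le> \<lfloor>R\<rfloor>)"
    by (subst Max_le_iff) auto
  finally show ?thesis by (simp add: le_floor_iff)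
qed

lemma sup_dist_component: "real_of_int \<bar>m $ i - m' $ i\<bar> \<le> sup_dist m m'"
  using sup_dist_le_iff[of m m' "sup_dist m m'"] by simp

lemma sup_dist_attained: "\<exists>i. sup_dist m m' = real_of_int \<bar>m $ i - m' $ i\<bar>"
proof -
  have "(MAX i. \<bar>m $ i - m' $ i\<bar>) \<in> range (\<lambda>i. \<bar>m $ i - m' $ i\<bar>)"
    by (rule Max_in) auto
  then obtain i where "(MAX i. \<bar>m $ i - m' $ i\<bar>) = \<bar>m $ i - m' $ i\<bar>" by blast
  thus ?thesis unfolding sup_dist_def by auto
qed

lemma sup_dist_nonneg: "0 \<le> sup_dist m m'"
  using sup_dist_attained[of m m'] by auto

lemma sup_dist_commute: "sup_dist m m' = sup_dist m' m"
  unfolding sup_dist_def by (simp add: abs_minus_commute)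

lemma sup_dist_triangle: "sup_dist a c \<le> sup_dist a b + sup_dist b c"
proof -
  obtain i where i: "sup_dist a c = real_of_int \<bar>a $ i - c $ i\<bar>" using sup_dist_attained by blast
  show ?thesis unfolding i using sup_dist_component[of a i b] sup_dist_component[of b i c] by simp
qed

lemma card_vec_box:
  fixes S :: "'n::finite \<Rightarrow> int set"
  assumes "\<And>i. finite (S i)"
  shows "finite {m::int^'n. \<forall>i. m $ i \<in> S i}"
    and "card {m::int^'n. \<forall>i. m $ i \<in> S i} = (\<Prod>i\<in>UNIV. card (S i))"
proof -
  have bij: "bij_betw (\<lambda>m::int^'n. vec_nth m) {m. \<forall>i. m $ i \<in> S i} (PiE UNIV S)"
  proof (rule bij_betwI[where g = "\<lambda>f. vec_lambda f"])
    show "(\<lambda>m::int^'n. vec_nth m) \<in> {m. \<forall>i. m $ i \<in> S i} \<rightarrow> PiE UNIV S" by (auto simp: PiE_def)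
  qed (auto simp: PiE_def)
  have "finite (PiE UNIV S)" using assms by (intro finite_PiE) auto
  thus "finite {m::int^'n. \<forall>i. m $ i \<in> S i}" using bij_betw_finite[OF bij] by simp
  show "card {m::int^'n. \<forall>i. m $ i \<in> S i} = (\<Prod>i\<in>UNIV. card (S i))"
    using bij_betw_same_card[OF bij] by (simp add: card_PiE)
qed

text \<open>In the maximum distance a ball is a box of integers, so its points are counted
  coordinatewise; this is the reason for measuring lattice distances in this way.\<close>

lemma
  fixes c :: "int ^ 'n"
  shows finite_sup_ball: "finite {m. sup_dist m c \<le> R}"
    and card_sup_ball: "0 \<le> R \<Longrightarrow> real (card {m. sup_dist m c \<le> R}) \<le> (2 * R + 1) ^ CARD('n)"
proof -
  have eq: "{m. sup_dist m c \<le> R} = {m. \<forall>i. m $ i \<in> {c $ i - \<lfloor>R\<rfloor> .. c $ i + \<lfloor>R\<rfloor>}}"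
    unfolding sup_dist_le_iff le_floor_iff[symmetric] by (intro Collect_cong iff_allI) auto
  show "finite {m. sup_dist m c \<le> R}" unfolding eq by (rule card_vec_box) auto
  assume R: "0 \<le> R"
  have "real (card {m. sup_dist m c \<le> R}) = (\<Prod>i\<in>(UNIV::'n set). real (nat (2 * \<lfloor>R\<rfloor> + 1)))"
    unfolding eq by (subst card_vec_box) (auto simp: algebra_simps)
  also have "\<dots> = real (nat (2 * \<lfloor>R\<rfloor> + 1)) ^ CARD('n)" by simp
  also have "\<dots> \<le> (2 * R + 1) ^ CARD('n)"
    using R by (intro power_mono) (auto simp: of_nat_nat)
  finally show "real (card {m. sup_dist m c \<le> R}) \<le> (2 * R + 1) ^ CARD('n)" .
qed

text \<open>Lattice form of the decay of the integral of |x|^-(n + \<delta>) outside a ball. The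
  points are sorted into shells by the integer part of the binary logarithm of distance /
  \<open>R\<close>. Shell \<open>i\<close> has at most (5 R 2^i)^n points, because 4 R 2^i + 1 <= 5
  R 2^i for R >= 1, so it contributes at most 5^n (R 2^i)^-\<delta>, the term of a geometric
  series.\<close>

lemma sum_sup_dist_decay:
  fixes c :: "int ^ 'n"
  assumes F: "finite F" and far: "\<And>m. m \<in> F \<Longrightarrow> R \<le> sup_dist m c" and R: "1 \<le> R" and \<delta>: "0 < \<delta>"
  shows "(\<Sum>m\<in>F. sup_dist m c powr (- (real CARD('n) + \<delta>)))
    \<le> 5 ^ CARD('n) / (1 - 2 powr (-\<delta>)) * R powr (-\<delta>)"
proof -
  define n where "n = CARD('n)"
  define l where "l m = nat \<lfloor>log 2 (sup_dist m c / R)\<rfloor>" for m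
  \<comment> \<open>The inserted 0 keeps \<open>Max\<close> meaningful for empty
    \<open>F\<close>.\<close>
  define L where "L = Max (insert 0 (l ` F))"
  have lL: "l m \<le> L" if "m \<in> F" for m using that F unfolding L_def by (intro Max_ge) auto
  have lower: "R * 2 ^ l m \<le> sup_dist m c" and upper: "sup_dist m c \<le> R * 2 ^ Suc (l m)" if m: "m \<in> F" for m
  proof -
    have q: "1 \<le> sup_dist m c / R" using far[OF m] R by simp
    hence "0 \<le> log 2 (sup_dist m c / R)" by simp
    hence e: "real (l m) \<le> log 2 (sup_dist m c / R)" "log 2 (sup_dist m c / R) \<le> real (Suc (l m))"
      unfolding l_def by linarith+
    have "2 powr real (l m) \<le> sup_dist m c / R" using e(1) q by (subst (asm) le_log_iff) auto
    thus "R * 2 ^ l m \<le> sup_dist m c" using R by (simp add: powr_realpow field_simps)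
    have "sup_dist m c / R \<le> 2 powr real (Suc (l m))" using e(2) q by (subst (asm) log_le_iff) auto
    thus "sup_dist m c \<le> R * 2 ^ Suc (l m)" using R by (subst (asm) powr_realpow) (auto simp: field_simps)
  qed
  have "(\<Sum>m\<in>F. sup_dist m c powr (- (real n + \<delta>)))
      = (\<Sum>i\<in>{..L}. \<Sum>m | m \<in> F \<and> l m = i. sup_dist m c powr (- (real n + \<delta>)))"
    by (rule sum.group[symmetric]) (use F lL in auto)
  also have "\<dots> \<le> (\<Sum>i\<in>{..L}. 5 ^ n * R powr (-\<delta>) * (2 powr (-\<delta>)) ^ i)"
  proof (rule sum_mono)
    fix i
    have "(\<Sum>m | m \<in> F \<and> l m = i. sup_dist m c powr (- (real n + \<delta>)))
        \<le> (\<Sum>m | m \<in> F \<and> l m = i. (R * 2 ^ i) powr (- (real n + \<delta>)))"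
    proof (rule sum_mono)
      fix m assume "m \<in> {m \<in> F. l m = i}"
      thus "sup_dist m c powr (- (real n + \<delta>)) \<le> (R * 2 ^ i) powr (- (real n + \<delta>))"
        using lower[of m] R \<delta> by (intro powr_mono2') auto
    qed
    also have "\<dots> = real (card {m \<in> F. l m = i}) * (R * 2 ^ i) powr (- (real n + \<delta>))" by simp
    also have "\<dots> \<le> (5 * (R * 2 ^ i)) ^ n * (R * 2 ^ i) powr (- (real n + \<delta>))"
    proof (rule mult_right_mono)
      have "real (card {m \<in> F. l m = i}) \<le> real (card {m. sup_dist m c \<le> R * 2 ^ Suc i})"
        using upper by (intro of_nat_mono card_mono finite_sup_ball) auto
      also have "\<dots> \<le> (2 * (R * 2 ^ Suc i) + 1) ^ n" unfolding n_def using R by (intro card_sup_ball) auto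
      also have "\<dots> \<le> (5 * (R * 2 ^ i)) ^ n"
      proof (rule power_mono)
        have "1 * 1 \<le> R * 2 ^ i" using R by (intro mult_mono) auto
        thus "2 * (R * 2 ^ Suc i) + 1 \<le> 5 * (R * 2 ^ i)" by simp
      qed (use R in auto)
      finally show "real (card {m \<in> F. l m = i}) \<le> (5 * (R * 2 ^ i)) ^ n" .
    qed simp
    also have "\<dots> = 5 ^ n * ((R * 2 ^ i) powr real n * (R * 2 ^ i) powr (- (real n + \<delta>)))"
      using R by (simp add: powr_realpow power_mult_distrib)
    also have "(R * 2 ^ i) powr real n * (R * 2 ^ i) powr (- (real n + \<delta>)) = (R * 2 ^ i) powr (-\<delta>)"
      by (subst powr_add[symmetric]) simp
    also have "\<dots> = R powr (-\<delta>) * (2 powr (-\<delta>)) ^ i"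
    proof -
      have "(2 ^ i) powr (-\<delta>) = (2 powr (-\<delta>)) ^ i" by (induction i) (simp_all add: powr_mult)
      thus ?thesis using R by (simp add: powr_mult)
    qed
    finally show "(\<Sum>m | m \<in> F \<and> l m = i. sup_dist m c powr (- (real n + \<delta>)))
        \<le> 5 ^ n * R powr (-\<delta>) * (2 powr (-\<delta>)) ^ i" by (simp add: mult.assoc)
  qed
  also have "\<dots> = 5 ^ n * R powr (-\<delta>) * (\<Sum>i\<in>{..L}. (2 powr (-\<delta>)) ^ i)" by (simp add: sum_distrib_left)
  also have "\<dots> \<le> 5 ^ n * R powr (-\<delta>) * (1 / (1 - 2 powr (-\<delta>)))"
  proof (rule mult_left_mono)
    have lt: "2 powr (-\<delta>) < 1" using \<delta> by (simp add: powr_less_one)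
    have "(\<Sum>i\<in>{..L}. (2 powr (-\<delta>)) ^ i) \<le> (\<Sum>i. (2 powr (-\<delta>)) ^ i)"
      using lt by (intro sum_le_suminf summable_geometric) auto
    thus "(\<Sum>i\<in>{..L}. (2 powr (-\<delta>)) ^ i) \<le> 1 / (1 - 2 powr (-\<delta>))"
      using lt by (subst (asm) suminf_geometric) auto
  qed simp
  finally show ?thesis by (simp add: n_def mult.commute)
qed

text \<open>\<open>div\<close> rounds towards minus infinity, so each level partitions the whole
  lattice into cubes with 2^k points per edge, across the origin as well.\<close>

definition dyadic_class :: "nat \<Rightarrow> int ^ 'n \<Rightarrow> (int ^ 'n) set"
  where "dyadic_class k m = {m'. \<forall>i. m' $ i div 2 ^ k = m $ i div 2 ^ k}"

definition dyadic_corner :: "nat \<Rightarrow> int ^ 'n \<Rightarrow> int ^ 'n"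
  where "dyadic_corner k m = (\<chi> i. (m $ i div 2 ^ k) * 2 ^ k)"

lemma self_in_dyadic_class: "m \<in> dyadic_class k m"
  by (simp add: dyadic_class_def)

lemma dyadic_class_eq: "m' \<in> dyadic_class k m \<Longrightarrow> dyadic_class k m' = dyadic_class k m"
  by (simp add: dyadic_class_def)

lemma dyadic_corner_eq: "m' \<in> dyadic_class k m \<Longrightarrow> dyadic_corner k m' = dyadic_corner k m"
  by (simp add: dyadic_class_def dyadic_corner_def)

text \<open>Division by 2^l is division by 2^k followed by division by 2^(l - k).\<close>

lemma dyadic_class_mono: 
  assumes "k \<le> l" shows "dyadic_class k m \<subseteq> dyadic_class l m"
proof -
  have "x div 2 ^ l = (x div 2 ^ k) div 2 ^ (l - k)" for x :: int
    using assms zdiv_zmult2_eq[of "2 ^ (l - k)" x "2 ^ k"] by (simp flip: power_add)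
  thus ?thesis by (auto simp: dyadic_class_def)
qed

lemma dyadic_class_box:
  "dyadic_class k m = {m'. \<forall>i. m' $ i \<in> {(m $ i div 2 ^ k) * 2 ^ k ..< (m $ i div 2 ^ k) * 2 ^ k + 2 ^ k}}"
proof -
  have "x div d = q \<longleftrightarrow> x \<in> {q * d ..< q * d + d}" if "0 < d" for x d q :: int
  proof
    assume "x div d = q"
    thus "x \<in> {q * d ..< q * d + d}"
      using pos_mod_sign[OF that, of x] pos_mod_bound[OF that, of x] div_mult_mod_eq[of x d] 
      by (auto simp del: minus_mod_eq_div_mult div_mult_mod_eq)
  next
    assume "x \<in> {q * d ..< q * d + d}"
    thus "x div d = q" using that by (intro int_div_pos_eq[where r = "x - q * d"]) (auto simp: mult.commute)
  qed
  thus ?thesis unfolding dyadic_class_def by simp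
qed

lemma finite_dyadic_class: "finite (dyadic_class k m)"
  unfolding dyadic_class_box by (rule card_vec_box) auto

lemma card_dyadic_class: "card (dyadic_class k (m :: int ^ 'n)) = (2 ^ k) ^ CARD('n)"
  unfolding dyadic_class_box by (subst card_vec_box) (auto simp: nat_power_eq)

lemma sup_dist_dyadic_corner: "sup_dist (dyadic_corner k m) m \<le> 2 ^ k"
proof -
  have "m \<in> dyadic_class k m" by (rule self_in_dyadic_class)
  hence "(m $ i div 2 ^ k) * 2 ^ k \<le> m $ i \<and> m $ i < (m $ i div 2 ^ k) * 2 ^ k + 2 ^ k" for i
    unfolding dyadic_class_box by simp
  hence *: "dyadic_corner k m $ i \<le> m $ i" "m $ i < dyadic_corner k m $ i + 2 ^ k" for i
    by (simp_all only: dyadic_corner_def vec_lambda_beta)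
  have "\<bar>dyadic_corner k m $ i - m $ i\<bar> \<le> 2 ^ k" for i
    using *[of i] by linarith
  hence "real_of_int \<bar>dyadic_corner k m $ i - m $ i\<bar> \<le> real_of_int (2 ^ k)" for i
    using of_int_le_iff by blast
  thus ?thesis unfolding sup_dist_le_iff by simp
qed

text \<open>After exchanging the sums, membership in a block is symmetric because points of one
  block have equal blocks; so \<open>h m'\<close> is counted once for each point of its block, each
  time with the reciprocal size of the block. The scalars are general because the lemma is applied
  to moduli and to complex values.\<close>

lemma sum_partition_average:
  fixes h :: "'a \<Rightarrow> 'b :: field_char_0"
  assumes fin: "finite \<Omega>" and sub: "\<And>m. m \<in> \<Omega> \<Longrightarrow> Q m \<subseteq> \<Omega>"
    and self: "\<And>m. m \<in> \<Omega> \<Longrightarrow> m \<in> Q m" and eq: "\<And>m m'. m \<in> \<Omega> \<Longrightarrow> m' \<in> Q m \<Longrightarrow> Q m' = Q m"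
  shows "(\<Sum>m\<in>\<Omega>. (\<Sum>m'\<in>Q m. h m') / of_nat (card (Q m))) = (\<Sum>m\<in>\<Omega>. h m)"
proof -
  have "(\<Sum>m\<in>\<Omega>. (\<Sum>m'\<in>Q m. h m') / of_nat (card (Q m)))
      = (\<Sum>m\<in>\<Omega>. \<Sum>m'\<in>\<Omega>. if m' \<in> Q m then h m' / of_nat (card (Q m')) else 0)"
  proof (rule sum.cong[OF refl])
    fix m assume m: "m \<in> \<Omega>"
    have "(\<Sum>m'\<in>\<Omega>. if m' \<in> Q m then h m' / of_nat (card (Q m')) else 0)
        = (\<Sum>m'\<in>\<Omega> \<inter> Q m. h m' / of_nat (card (Q m')))" using fin by (simp add: sum.inter_restrict)
    also have "\<Omega> \<inter> Q m = Q m" using sub m by blast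
    also have "(\<Sum>m'\<in>Q m. h m' / of_nat (card (Q m'))) = (\<Sum>m'\<in>Q m. h m' / of_nat (card (Q m)))"
      by (rule sum.cong) (use eq m in auto)
    finally show "(\<Sum>m'\<in>Q m. h m') / of_nat (card (Q m))
        = (\<Sum>m'\<in>\<Omega>. if m' \<in> Q m then h m' / of_nat (card (Q m')) else 0)" by (simp add: sum_divide_distrib)
  qed
  also have "\<dots> = (\<Sum>m'\<in>\<Omega>. \<Sum>m\<in>\<Omega>. if m' \<in> Q m then h m' / of_nat (card (Q m')) else 0)" by (rule sum.swap)
  also have "\<dots> = (\<Sum>m'\<in>\<Omega>. h m')"
  proof (rule sum.cong[OF refl])
    fix m' assume m': "m' \<in> \<Omega>"
    have "(\<Sum>m\<in>\<Omega>. if m' \<in> Q m then h m' / of_nat (card (Q m')) else 0)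
        = (\<Sum>m\<in>\<Omega>. if m \<in> Q m' then h m' / of_nat (card (Q m')) else 0)"
    proof (rule sum.cong[OF refl])
      fix m assume "m \<in> \<Omega>"
      hence "m' \<in> Q m \<longleftrightarrow> m \<in> Q m'" using self eq m' by blast
      thus "(if m' \<in> Q m then h m' / of_nat (card (Q m')) else 0)
          = (if m \<in> Q m' then h m' / of_nat (card (Q m')) else 0)" by (simp only:)
    qed
    also have "\<dots> = (\<Sum>m\<in>\<Omega> \<inter> Q m'. h m' / of_nat (card (Q m')))" by (rule sum.inter_restrict[OF fin, symmetric])
    also have "\<Omega> \<inter> Q m' = Q m'" using sub m' by blast
    also have "(\<Sum>m\<in>Q m'. h m' / of_nat (card (Q m'))) = h m'"
    proof -
      have "finite (Q m')" using sub[OF m'] fin finite_subset by blast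
      hence "card (Q m') \<noteq> 0" using self[OF m'] by auto
      thus ?thesis by simp
    qed
    finally show "(\<Sum>m\<in>\<Omega>. if m' \<in> Q m then h m' / of_nat (card (Q m')) else 0) = h m'" .
  qed
  finally show ?thesis .
qed

subsection \<open>The discrete Calder\'on--Zygmund decomposition\<close>

locale cz_decomposition =
  fixes f :: "int ^ 'n \<Rightarrow> complex" and S :: "(int ^ 'n) set" and t :: real
  assumes finite_S: "finite S" and zero_off_S: "\<And>m. m \<notin> S \<Longrightarrow> f m = 0" and t_pos: "0 < t"
begin

definition "average k m = (\<Sum>m'\<in>dyadic_class k m. norm (f m')) / (2 ^ k) ^ CARD('n)"
definition "levels m = {k. t < average k m}"
definition "bad_set = {m. levels m \<noteq> {}}"
text \<open>The largest level above the height, so \<open>cube m\<close> is a maximal cube and its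
  parent already has average at most \<open>t\<close>. The maximum exists because large cubes dilute
  the finite mass.\<close>

definition "level m = Max (levels m)"
definition "cube m = dyadic_class (level m) m"
text \<open>Despite its name this is a corner. The cancellation argument uses a reference point that
  depends on the cube alone and lies within its edge length of every point of the cube.\<close>

definition "centre m = dyadic_corner (level m) m"
definition "good m = (if m \<in> bad_set then (\<Sum>m'\<in>cube m. f m') / of_nat (card (cube m)) else f m)"
definition "mass = (\<Sum>m\<in>S. norm (f m))"

lemma average_le_mass: "average k m \<le> mass / (2 ^ k) ^ CARD('n)"
proof -
  have "(\<Sum>m'\<in>dyadic_class k m. norm (f m')) = (\<Sum>m'\<in>dyadic_class k m \<inter> S. norm (f m'))"
    by (rule sum.mono_neutral_right) (use finite_dyadic_class zero_off_S in auto)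
  also have "\<dots> \<le> mass" unfolding mass_def by (rule sum_mono2) (use finite_S in auto)
  finally show ?thesis unfolding average_def by (simp add: divide_right_mono)
qed

text \<open>A crude bound from (2^k)^n < mass / t and k <= 2^k; it serves to make the set of levels
  finite.\<close>

lemma level_bound:
  assumes "k \<in> levels m" shows "real k < mass / t"
proof -
  have "t < mass / (2 ^ k) ^ CARD('n)" using assms average_le_mass[of k m] by (simp add: levels_def)
  hence "(2 ^ k) ^ CARD('n) < mass / t" using t_pos by (simp add: field_simps)
  moreover have "real k \<le> 2 ^ k" using of_nat_less_two_power[of k, where 'a = real] by simp
  moreover have "(2::real) ^ k \<le> (2 ^ k) ^ CARD('n)"
    by (rule self_le_power) (auto simp: zero_less_card_finite)
  ultimately show ?thesis by linarith
qed

lemma finite_levels: "finite (levels m)"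
proof (rule finite_subset[OF _ finite_lessThan[of "nat \<lceil>mass / t\<rceil>"]], rule subsetI)
  fix k assume "k \<in> levels m"
  from level_bound[OF this] show "k \<in> {..<nat \<lceil>mass / t\<rceil>}" by simp linarith
qed

lemma level_in: "m \<in> bad_set \<Longrightarrow> level m \<in> levels m"
  unfolding level_def bad_set_def using Max_in finite_levels by auto

lemma level_max: "k \<in> levels m \<Longrightarrow> k \<le> level m"
  unfolding level_def using finite_levels by simp

lemma levels_cong: "m' \<in> dyadic_class k m \<Longrightarrow> k \<in> levels m' \<longleftrightarrow> k \<in> levels m"
  unfolding levels_def average_def by (simp add: dyadic_class_eq)

text \<open>Maximal cubes are equal or disjoint. For \<open>m'\<close> in \<open>cube m\<close> the
  level of \<open>m\<close> also qualifies for \<open>m'\<close>, so \<open>level m'\<close> is at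
  least as large; the class of \<open>m'\<close> at that level then contains \<open>m\<close>, and
  maximality at \<open>m\<close> forces equality.\<close>

lemma cube_partition:
  assumes m: "m \<in> bad_set" and m': "m' \<in> cube m"
  shows "m' \<in> bad_set" "level m' = level m" "cube m' = cube m" "centre m' = centre m"
proof -
  have 1: "level m \<in> levels m'" using levels_cong[of m' "level m" m] level_in m m' by (simp add: cube_def)
  thus b: "m' \<in> bad_set" by (auto simp: bad_set_def)
  have le: "level m \<le> level m'" using level_max[OF 1] .
  have "m' \<in> dyadic_class (level m') m" using m' dyadic_class_mono[OF le] by (auto simp: cube_def)
  hence "level m' \<in> levels m" using levels_cong[of m' "level m'" m] level_in[OF b] by blast
  thus l: "level m' = level m" using level_max le by (simp add: le_antisym)
  show "cube m' = cube m" using m' unfolding cube_def l by (rule dyadic_class_eq)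
  show "centre m' = centre m" using m' unfolding cube_def centre_def l by (rule dyadic_corner_eq)
qed

lemma self_in_cube: "m \<in> cube m"
  by (simp add: cube_def self_in_dyadic_class)

lemma card_cube: "card (cube m) = (2 ^ level m) ^ CARD('n)"
  by (simp add: cube_def card_dyadic_class)

text \<open>A bad cube has a positive average, hence meets \<open>S\<close>, and its level is
  bounded.\<close>

lemma finite_bad_set: "finite bad_set"
proof -
  have "bad_set \<subseteq> (\<Union>m\<in>S. \<Union>k<nat \<lceil>mass / t\<rceil>. dyadic_class k m)"
  proof
    fix m assume m: "m \<in> bad_set"
    have lev: "level m \<in> levels m" using level_in m .
    hence "average (level m) m \<noteq> 0" using t_pos by (auto simp: levels_def)
    then obtain m' where m': "m' \<in> dyadic_class (level m) m" "f m' \<noteq> 0"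
      unfolding average_def by (auto elim!: sum.not_neutral_contains_not_neutral)
    hence "m' \<in> S" using zero_off_S by blast
    moreover have "m \<in> dyadic_class (level m) m'" using m'(1) self_in_dyadic_class dyadic_class_eq by blast
    moreover have "level m < nat \<lceil>mass / t\<rceil>" using level_bound[OF lev] by linarith
    ultimately show "m \<in> (\<Union>m\<in>S. \<Union>k<nat \<lceil>mass / t\<rceil>. dyadic_class k m)" by blast
  qed
  thus ?thesis by (rule finite_subset) (use finite_S finite_dyadic_class in auto)
qed

lemma cube_average:
  fixes h :: "int ^ 'n \<Rightarrow> 'b :: field_char_0"
  shows "(\<Sum>m\<in>bad_set. (\<Sum>m'\<in>cube m. h m') / of_nat (card (cube m))) = (\<Sum>m\<in>bad_set. h m)"
proof (rule sum_partition_average[OF finite_bad_set])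
  show "cube m \<subseteq> bad_set" if "m \<in> bad_set" for m using cube_partition(1)[OF that] by blast
  show "cube m' = cube m" if "m \<in> bad_set" "m' \<in> cube m" for m m' by (rule cube_partition(3)[OF that])
qed (rule self_in_cube)

lemma sum_bad_set_le_mass: "(\<Sum>m\<in>bad_set. norm (f m)) \<le> mass"
proof -
  have "(\<Sum>m\<in>bad_set. norm (f m)) = (\<Sum>m\<in>bad_set \<inter> S. norm (f m))"
    by (rule sum.mono_neutral_right) (use finite_bad_set zero_off_S in auto)
  also have "\<dots> \<le> mass" unfolding mass_def by (rule sum_mono2) (use finite_S in auto)
  finally show ?thesis .
qed

lemma average_cube: "average (level m) m = (\<Sum>m'\<in>cube m. norm (f m')) / real (card (cube m))"
  by (simp add: average_def cube_def card_dyadic_class)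

text \<open>Each bad point is charged the average over its cube, which exceeds \<open>t\<close>;
  replacing values by cube averages does not change the total.\<close>

lemma card_bad_set: "t * card bad_set \<le> mass"
proof -
  have "t * card bad_set = (\<Sum>m\<in>bad_set. t)" by simp
  also have "\<dots> \<le> (\<Sum>m\<in>bad_set. average (level m) m)"
    by (rule sum_mono) (use level_in in \<open>force simp: levels_def\<close>)
  also have "\<dots> = (\<Sum>m\<in>bad_set. norm (f m))" unfolding average_cube by (rule cube_average)
  finally show ?thesis using sum_bad_set_le_mass by linarith
qed

lemma norm_good_le_average: "m \<in> bad_set \<Longrightarrow> norm (good m) \<le> average (level m) m"
  unfolding good_def average_cube by (simp add: norm_divide divide_right_mono norm_sum)

text \<open>The factor 2^n is the size ratio between the parent cube and the cube, and the parent
  has average at most \<open>t\<close> by maximality. Outside the bad set level 0 does not qualify,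
  and the average at level 0 is the modulus of the value itself.\<close>

lemma norm_good_le: "norm (good m) \<le> 2 ^ CARD('n) * t"
proof (cases "m \<in> bad_set")
  case True
  have "Suc (level m) \<notin> levels m" using level_max[of "Suc (level m)" m] by auto
  hence "(\<Sum>m'\<in>dyadic_class (Suc (level m)) m. norm (f m')) \<le> t * (2 ^ Suc (level m)) ^ CARD('n)"
    by (simp add: levels_def average_def field_simps)
  moreover have "(\<Sum>m'\<in>cube m. norm (f m')) \<le> (\<Sum>m'\<in>dyadic_class (Suc (level m)) m. norm (f m'))"
    unfolding cube_def by (rule sum_mono2) (use finite_dyadic_class dyadic_class_mono[of "level m" "Suc (level m)" m] in auto)
  ultimately have "average (level m) m \<le> 2 ^ CARD('n) * t"
    unfolding average_cube card_cube by (simp add: field_simps power_mult_distrib)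
  thus ?thesis using norm_good_le_average[OF True] by linarith
next
  case False
  hence "0 \<notin> levels m" unfolding bad_set_def by auto
  hence "average 0 m \<le> t" by (simp add: levels_def)
  moreover have "dyadic_class 0 m = {m}" by (auto simp: dyadic_class_def vec_eq_iff)
  moreover have "1 * t \<le> 2 ^ CARD('n) * t" using t_pos by (intro mult_right_mono) auto
  ultimately show ?thesis using False by (simp add: average_def good_def)
qed

lemma sum_norm_good: "finite G \<Longrightarrow> (\<Sum>m\<in>G. norm (good m)) \<le> mass"
proof -
  assume G: "finite G"
  have "(\<Sum>m\<in>G. norm (good m)) = (\<Sum>m\<in>G \<inter> bad_set. norm (good m)) + (\<Sum>m\<in>G - bad_set. norm (good m))"
    using G by (subst sum.union_disjoint[symmetric]) (auto intro!: sum.cong)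
  also have "(\<Sum>m\<in>G \<inter> bad_set. norm (good m)) \<le> (\<Sum>m\<in>bad_set. norm (good m))"
    by (rule sum_mono2) (use finite_bad_set in auto)
  also have "\<dots> \<le> (\<Sum>m\<in>bad_set. average (level m) m)" by (rule sum_mono) (rule norm_good_le_average)
  also have "\<dots> = (\<Sum>m\<in>bad_set. norm (f m))" unfolding average_cube by (rule cube_average)
  also have "\<dots> = (\<Sum>m\<in>bad_set \<inter> S. norm (f m))"
    by (rule sum.mono_neutral_right) (use finite_bad_set zero_off_S in auto)
  also have "(\<Sum>m\<in>G - bad_set. norm (good m)) = (\<Sum>m\<in>G - bad_set. norm (f m))"
    by (rule sum.cong) (auto simp: good_def)
  also have "\<dots> = (\<Sum>m\<in>(G - bad_set) \<inter> S. norm (f m))"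
    by (rule sum.mono_neutral_right) (use G zero_off_S in auto)
  also have "\<dots> \<le> (\<Sum>m\<in>S - bad_set. norm (f m))" by (rule sum_mono2) (use finite_S in auto)
  also have "(\<Sum>m\<in>bad_set \<inter> S. norm (f m)) + (\<Sum>m\<in>S - bad_set. norm (f m)) = mass"
    unfolding mass_def using finite_S by (subst sum.union_disjoint[symmetric]) (auto intro!: sum.cong)
  finally show ?thesis by simp
qed

lemma sum_bad_le: "(\<Sum>m\<in>bad_set. norm (f m - good m)) \<le> 2 * mass"
proof -
  have "(\<Sum>m\<in>bad_set. norm (f m - good m)) \<le> (\<Sum>m\<in>bad_set. norm (f m) + norm (good m))"
    by (rule sum_mono) (rule norm_triangle_ineq4)
  thus ?thesis using sum_bad_set_le_mass sum_norm_good[OF finite_bad_set] by (simp add: sum.distrib)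
qed

text \<open>The bad part has mean zero on every cube, and \<open>\<phi> (centre m)\<close> is
  constant on cubes. Summing over points instead of over cubes states this for all cubes at once,
  without choosing one representative per cube.\<close>

lemma bad_cancellation: "(\<Sum>m\<in>bad_set. \<phi> (centre m) * (f m - good m)) = 0"
proof -
  have "(\<Sum>m\<in>bad_set. \<phi> (centre m) * good m)
      = (\<Sum>m\<in>bad_set. (\<Sum>m'\<in>cube m. \<phi> (centre m') * f m') / of_nat (card (cube m)))"
  proof (rule sum.cong[OF refl])
    fix m assume m: "m \<in> bad_set"
    have "(\<Sum>m'\<in>cube m. \<phi> (centre m') * f m') = (\<Sum>m'\<in>cube m. \<phi> (centre m) * f m')"
      by (rule sum.cong) (simp_all add: cube_partition(4)[OF m])
    thus "\<phi> (centre m) * good m = (\<Sum>m'\<in>cube m. \<phi> (centre m') * f m') / of_nat (card (cube m))"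
      using m by (simp add: good_def sum_distrib_left)
  qed
  also have "\<dots> = (\<Sum>m\<in>bad_set. \<phi> (centre m) * f m)" by (rule cube_average)
  finally show ?thesis by (simp add: right_diff_distrib sum_subtractf)
qed

text \<open>Dividing each ball by the size of its cube counts every cube once.\<close>

lemma card_enlarged_bad_set:
  assumes "0 \<le> D"
  shows "finite (\<Union>m\<in>bad_set. {x. sup_dist x (centre m) \<le> D * 2 ^ level m})" (is "finite ?E")
    and "t * card (\<Union>m\<in>bad_set. {x. sup_dist x (centre m) \<le> D * 2 ^ level m}) \<le> (2 * D + 1) ^ CARD('n) * mass"
proof -
  let ?B = "\<lambda>m. {x. sup_dist x (centre m) \<le> D * 2 ^ level m}"
  show finE: "finite ?E" using finite_bad_set finite_sup_ball by auto
  have "real (card ?E) = (\<Sum>x\<in>?E. 1)" by simp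
  also have "\<dots> \<le> (\<Sum>x\<in>?E. \<Sum>m\<in>bad_set. if x \<in> ?B m then 1 / real (card (cube m)) else 0)"
  proof (rule sum_mono)
    fix x assume "x \<in> ?E"
    then obtain m0 where m0: "m0 \<in> bad_set" "x \<in> ?B m0" by blast
    have sub: "cube m0 \<subseteq> bad_set" using cube_partition m0 by blast
    have "1 = (\<Sum>m\<in>cube m0. 1 / real (card (cube m0)))" by (simp add: card_cube)
    also have "\<dots> = (\<Sum>m\<in>cube m0. if x \<in> ?B m then 1 / real (card (cube m)) else 0)"
      by (rule sum.cong) (use m0(2) cube_partition(2-4)[OF m0(1)] in simp_all)
    also have "\<dots> \<le> (\<Sum>m\<in>bad_set. if x \<in> ?B m then 1 / real (card (cube m)) else 0)"
      by (rule sum_mono2) (use finite_bad_set sub in auto)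
    finally show "1 \<le> (\<Sum>m\<in>bad_set. if x \<in> ?B m then 1 / real (card (cube m)) else 0)" .
  qed
  also have "\<dots> = (\<Sum>m\<in>bad_set. \<Sum>x\<in>?E. if x \<in> ?B m then 1 / real (card (cube m)) else 0)" by (rule sum.swap)
  also have "\<dots> \<le> (\<Sum>m\<in>bad_set. (2 * D + 1) ^ CARD('n))"
  proof (rule sum_mono)
    fix m assume m: "m \<in> bad_set"
    have "(\<Sum>x\<in>?E. if x \<in> ?B m then 1 / real (card (cube m)) else 0)
        = (\<Sum>x\<in>?E \<inter> ?B m. 1 / real (card (cube m)))" using finE by (subst sum.inter_restrict) auto
    also have "?E \<inter> ?B m = ?B m" using m by blast
    also have "(\<Sum>x\<in>?B m. 1 / real (card (cube m))) = real (card (?B m)) / real (card (cube m))" by simp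
    also have "\<dots> \<le> (2 * D + 1) ^ CARD('n)"
    proof -
      have "real (card (?B m)) \<le> (2 * (D * 2 ^ level m) + 1) ^ CARD('n)"
        using assms by (intro card_sup_ball) auto
      also have "\<dots> \<le> ((2 * D + 1) * 2 ^ level m) ^ CARD('n)"
        using assms by (intro power_mono) (auto simp: algebra_simps)
      finally show ?thesis unfolding card_cube by (simp add: power_mult_distrib divide_le_eq)
    qed
    finally show "(\<Sum>x\<in>?E. if x \<in> ?B m then 1 / real (card (cube m)) else 0) \<le> (2 * D + 1) ^ CARD('n)" .
  qed
  also have "\<dots> = (2 * D + 1) ^ CARD('n) * card bad_set" by simp
  finally have "t * card ?E \<le> t * ((2 * D + 1) ^ CARD('n) * card bad_set)" using t_pos by simp
  also have "\<dots> = (2 * D + 1) ^ CARD('n) * (t * card bad_set)" by simp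
  also have "\<dots> \<le> (2 * D + 1) ^ CARD('n) * mass" using assms by (intro mult_left_mono card_bad_set) auto
  finally show "t * card ?E \<le> (2 * D + 1) ^ CARD('n) * mass" .
qed

end

subsection \<open>Discrete singular integrals on sequence spaces\<close>

text \<open>The l2 bound is bilinear with separate finite supports, so it reads the same for the
  transposed matrix. Regularity is imposed on the column index; regularity in the row index is the
  same axiom for the transpose.\<close>

locale discrete_singular_integral =
  fixes a :: "int ^ 'n \<Rightarrow> int ^ 'n \<Rightarrow> complex" and B H D \<delta> :: real
  assumes B: "0 \<le> B" and H: "0 \<le> H" and D: "1 \<le> D" and \<delta>: "0 < \<delta>"
    and l2_bound: "\<And>S G f g. finite S \<Longrightarrow> finite G \<Longrightarrow>
      norm (\<Sum>m\<in>G. \<Sum>m'\<in>S. a m m' * f m' * g m)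
        \<le> B * sqrt (\<Sum>m'\<in>S. (norm (f m'))\<^sup>2) * sqrt (\<Sum>m\<in>G. (norm (g m))\<^sup>2)"
    and hoelder: "\<And>m m' m''. D * sup_dist m' m'' \<le> sup_dist m m' \<Longrightarrow> 0 < sup_dist m m' \<Longrightarrow>
      norm (a m m' - a m m'') \<le> H * (sup_dist m' m'' powr \<delta> * sup_dist m m' powr (- (real CARD('n) + \<delta>)))"
begin

definition "apply_on S f m = (\<Sum>m'\<in>S. a m m' * f m')"

text \<open>Testing the bilinear bound with the conjugate of the image gives X <= B sqrt Y sqrt X,
  and sqrt X is cancelled.\<close>

lemma l2_operator_bound:
  assumes "finite S" "finite G"
  shows "(\<Sum>m\<in>G. (norm (apply_on S f m))\<^sup>2) \<le> B\<^sup>2 * (\<Sum>m'\<in>S. (norm (f m'))\<^sup>2)"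
proof -
  define X where "X = (\<Sum>m\<in>G. (norm (apply_on S f m))\<^sup>2)"
  define Y where "Y = (\<Sum>m'\<in>S. (norm (f m'))\<^sup>2)"
  have X0: "0 \<le> X" and Y0: "0 \<le> Y" unfolding X_def Y_def by (simp_all add: sum_nonneg)
  have "(\<Sum>m\<in>G. \<Sum>m'\<in>S. a m m' * f m' * cnj (apply_on S f m)) = (\<Sum>m\<in>G. apply_on S f m * cnj (apply_on S f m))"
    by (simp add: apply_on_def sum_distrib_right)
  also have "\<dots> = of_real X" unfolding X_def by (simp add: complex_norm_square[symmetric])
  finally have "norm (\<Sum>m\<in>G. \<Sum>m'\<in>S. a m m' * f m' * cnj (apply_on S f m)) = X" using X0 by simp
  with l2_bound[OF assms, of f "\<lambda>m. cnj (apply_on S f m)"]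
  have le: "X \<le> B * sqrt Y * sqrt X" by (simp add: X_def Y_def)
  show ?thesis
  proof (cases "X = 0")
    case True
    thus ?thesis using Y0 B unfolding X_def[symmetric] Y_def[symmetric] by simp
  next
    case False
    have "sqrt X * sqrt X \<le> B * sqrt Y * sqrt X" using le X0 by simp
    hence "sqrt X \<le> B * sqrt Y" by (rule mult_right_le_imp_le) (use False X0 in simp)
    hence "(sqrt X)\<^sup>2 \<le> (B * sqrt Y)\<^sup>2" using X0 by (intro power_mono) auto
    thus ?thesis using X0 Y0 unfolding X_def[symmetric] Y_def[symmetric] by (simp add: power_mult_distrib)
  qed
qed

definition "decay_const = 5 ^ CARD('n) / (1 - 2 powr (-\<delta>))"
text \<open>The terms belong to the good part, the enlarged cubes and the bad part. The factors 4
  come from the halved height t / 2: squared by Chebyshev's inequality for the good part, and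
  combined with the doubled mass of the bad part.\<close>

definition "weak_const = 4 * B\<^sup>2 * 2 ^ CARD('n) + (2 * D + 1) ^ CARD('n) + 4 * (H * decay_const)"

lemma decay_const_nonneg: "0 \<le> decay_const"
  unfolding decay_const_def using \<delta> powr_less_one[of 2 "-\<delta>"] by simp

lemma weak_const_nonneg: "0 \<le> weak_const"
  unfolding weak_const_def using H D decay_const_nonneg by simp

text \<open>Hoermander's condition as a consequence of pointwise regularity: the factor R^\<delta>
  from the displacement cancels the decay R^-\<delta> of the sum outside the ball. D >= 1 ensures
  that all points summed over are at distance at least \<open>R\<close> from
  \<open>c\<close>.\<close>

lemma sum_hoermander:
  assumes F: "finite F" and R: "1 \<le> R" and c: "sup_dist c m' \<le> R"
    and far: "\<And>m. m \<in> F \<Longrightarrow> D * R < sup_dist m c"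
  shows "(\<Sum>m\<in>F. norm (a m m' - a m c)) \<le> H * decay_const"
proof -
  have DR: "1 \<le> D * R" using D R mult_mono[of 1 D 1 R] by simp
  have "(\<Sum>m\<in>F. norm (a m m' - a m c))
      \<le> (\<Sum>m\<in>F. H * R powr \<delta> * sup_dist m c powr (- (real CARD('n) + \<delta>)))"
  proof (rule sum_mono)
    fix m assume m: "m \<in> F"
    have "D * sup_dist c m' \<le> D * R" using D c by (intro mult_left_mono) auto
    hence *: "D * sup_dist c m' \<le> sup_dist m c" "0 < sup_dist m c" using far[OF m] DR by auto
    have "norm (a m m' - a m c) = norm (a m c - a m m')" by (rule norm_minus_commute)
    also have "\<dots> \<le> H * (sup_dist c m' powr \<delta> * sup_dist m c powr (- (real CARD('n) + \<delta>)))"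
      by (rule hoelder[OF *])
    also have "\<dots> \<le> H * (R powr \<delta> * sup_dist m c powr (- (real CARD('n) + \<delta>)))"
      using H c \<delta> sup_dist_nonneg by (intro mult_left_mono mult_right_mono powr_mono2) auto
    finally show "norm (a m m' - a m c) \<le> H * R powr \<delta> * sup_dist m c powr (- (real CARD('n) + \<delta>))"
      by (simp add: mult.assoc)
  qed
  also have "\<dots> = H * R powr \<delta> * (\<Sum>m\<in>F. sup_dist m c powr (- (real CARD('n) + \<delta>)))"
    by (simp add: sum_distrib_left)
  also have "\<dots> \<le> H * R powr \<delta> * (decay_const * R powr (-\<delta>))"
  proof (rule mult_left_mono)
    have "1 * R \<le> D * R" using D R by (intro mult_right_mono) auto
    hence "R \<le> sup_dist m c" if "m \<in> F" for m using far[OF that] by linarith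
    thus "(\<Sum>m\<in>F. sup_dist m c powr (- (real CARD('n) + \<delta>))) \<le> decay_const * R powr (-\<delta>)"
      unfolding decay_const_def by (intro sum_sup_dist_decay F R \<delta>) auto
  qed (use H in auto)
  also have "\<dots> = H * decay_const" using R by (simp add: powr_minus field_simps)
  finally show ?thesis .
qed

text \<open>Values above \<open>t\<close> are attributed to three sources: the good part, controlled
  in l2; the enlarged cubes, controlled by their number of points; and the bad part outside them,
  controlled by cancellation and regularity.\<close>

lemma weak_type_1_1:
  assumes S: "finite S" and G: "finite G" and t: "0 < t"
  shows "t * card {m \<in> G. t < norm (apply_on S f m)} \<le> weak_const * (\<Sum>m'\<in>S. norm (f m'))"
proof -
  \<comment> \<open>The decomposition requires a function that vanishes off
    \<open>S\<close>.\<close>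
  define f0 where "f0 m = (if m \<in> S then f m else 0)" for m
  interpret cz: cz_decomposition f0 S t by unfold_locales (auto simp: f0_def S t)
  define M where "M = (\<Sum>m'\<in>S. norm (f m'))"
  have mass: "cz.mass = M" unfolding cz.mass_def M_def by (rule sum.cong) (auto simp: f0_def)
  \<comment> \<open>Averaging spreads the good part over whole cubes, beyond
    \<open>S\<close>.\<close>
  define U where "U = S \<union> cz.bad_set"
  have U: "finite U" unfolding U_def using S cz.finite_bad_set by simp
  define b where "b m = f0 m - cz.good m" for m
  have b0: "b m = 0" if "m \<notin> cz.bad_set" for m using that by (simp add: b_def cz.good_def)
  have split: "apply_on S f m = apply_on U cz.good m + apply_on cz.bad_set b m" for m
  proof -
    have "apply_on S f m = apply_on U f0 m"
      unfolding apply_on_def by (rule sum.mono_neutral_cong_left) (use U in \<open>auto simp: U_def f0_def\<close>)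
    also have "\<dots> = apply_on U cz.good m + apply_on U b m"
      unfolding apply_on_def by (simp add: b_def algebra_simps flip: sum.distrib)
    also have "apply_on U b m = apply_on cz.bad_set b m"
      unfolding apply_on_def by (rule sum.mono_neutral_right) (use U b0 in \<open>auto simp: U_def\<close>)
    finally show ?thesis .
  qed
  define E where "E = (\<Union>m\<in>cz.bad_set. {x. sup_dist x (cz.centre m) \<le> D * 2 ^ cz.level m})"
  have E: "finite E" "t * card E \<le> (2 * D + 1) ^ CARD('n) * M"
    unfolding E_def using cz.card_enlarged_bad_set[of D] D mass by auto
  define G1 where "G1 = {m \<in> G. t / 2 < norm (apply_on U cz.good m)}"
  define G2 where "G2 = {m \<in> G - E. t / 2 < norm (apply_on cz.bad_set b m)}"
  have fin: "finite G1" "finite G2" using G by (auto simp: G1_def G2_def)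
  have sub: "{m \<in> G. t < norm (apply_on S f m)} \<subseteq> G1 \<union> E \<union> G2"
  proof
    fix m assume m: "m \<in> {m \<in> G. t < norm (apply_on S f m)}"
    have "norm (apply_on S f m) \<le> norm (apply_on U cz.good m) + norm (apply_on cz.bad_set b m)"
      unfolding split by (rule norm_triangle_ineq)
    thus "m \<in> G1 \<union> E \<union> G2" using m unfolding G1_def G2_def by auto
  qed
  have "card {m \<in> G. t < norm (apply_on S f m)} \<le> card (G1 \<union> E \<union> G2)"
    by (rule card_mono) (use fin E sub in auto)
  also have "\<dots> \<le> card G1 + card E + card G2"
    using card_Un_le[of "G1 \<union> E" G2] card_Un_le[of G1 E] by linarith
  finally have "t * real (card {m \<in> G. t < norm (apply_on S f m)}) \<le> t * real (card G1 + card E + card G2)"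
    using t by (intro mult_left_mono of_nat_mono) auto
  hence main: "t * card {m \<in> G. t < norm (apply_on S f m)} \<le> t * card G1 + t * card E + t * card G2"
    by (simp add: algebra_simps)
  have g1: "t * card G1 \<le> 4 * B\<^sup>2 * 2 ^ CARD('n) * M"
  proof -
    have "t / 4 * (t * card G1) = (\<Sum>m\<in>G1. (t / 2)\<^sup>2)" by (simp add: power2_eq_square)
    also have "\<dots> \<le> (\<Sum>m\<in>G1. (norm (apply_on U cz.good m))\<^sup>2)"
      by (rule sum_mono, rule power_mono) (use t in \<open>auto simp: G1_def\<close>)
    also have "\<dots> \<le> B\<^sup>2 * (\<Sum>m\<in>U. (norm (cz.good m))\<^sup>2)" by (rule l2_operator_bound[OF U fin(1)])
    also have "\<dots> \<le> B\<^sup>2 * (2 ^ CARD('n) * t * M)"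
    proof (rule mult_left_mono)
      \<comment> \<open>One factor of the square is bounded by 2^n t, the other is summed in
        l1.\<close>
      have "(\<Sum>m\<in>U. (norm (cz.good m))\<^sup>2) \<le> (\<Sum>m\<in>U. 2 ^ CARD('n) * t * norm (cz.good m))"
        unfolding power2_eq_square by (rule sum_mono, rule mult_right_mono[OF cz.norm_good_le]) simp
      also have "\<dots> = 2 ^ CARD('n) * t * (\<Sum>m\<in>U. norm (cz.good m))" by (simp add: sum_distrib_left)
      also have "\<dots> \<le> 2 ^ CARD('n) * t * M"
        using t cz.sum_norm_good[OF U] mass by (intro mult_left_mono) auto
      finally show "(\<Sum>m\<in>U. (norm (cz.good m))\<^sup>2) \<le> 2 ^ CARD('n) * t * M" .
    qed simp
    finally have "t / 4 * (t * card G1) \<le> t / 4 * (4 * B\<^sup>2 * 2 ^ CARD('n) * M)" by (simp add: algebra_simps)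
    thus ?thesis by (rule mult_left_le_imp_le) (use t in simp)
  qed
  have g2: "t * card G2 \<le> 4 * (H * decay_const) * M"
  proof -
    have bound: "norm (apply_on cz.bad_set b m) \<le> (\<Sum>m'\<in>cz.bad_set. norm (a m m' - a m (cz.centre m')) * norm (b m'))" for m
    proof -
      \<comment> \<open>The entries at the reference points may be subtracted without changing the
        sum, since the bad part has mean zero on each cube.\<close>
      have "apply_on cz.bad_set b m = (\<Sum>m'\<in>cz.bad_set. (a m m' - a m (cz.centre m')) * b m')"
        using cz.bad_cancellation[of "a m"]
        unfolding apply_on_def b_def by (simp add: left_diff_distrib sum_subtractf)
      thus ?thesis by (simp add: norm_mult[symmetric] norm_sum)
    qed
    have "t / 2 * card G2 = (\<Sum>m\<in>G2. t / 2)" by simp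
    also have "\<dots> \<le> (\<Sum>m\<in>G2. norm (apply_on cz.bad_set b m))" by (rule sum_mono) (auto simp: G2_def)
    also have "\<dots> \<le> (\<Sum>m\<in>G2. \<Sum>m'\<in>cz.bad_set. norm (a m m' - a m (cz.centre m')) * norm (b m'))"
      by (rule sum_mono) (rule bound)
    also have "\<dots> = (\<Sum>m'\<in>cz.bad_set. (\<Sum>m\<in>G2. norm (a m m' - a m (cz.centre m'))) * norm (b m'))"
      by (subst sum.swap) (simp add: sum_distrib_right)
    also have "\<dots> \<le> (\<Sum>m'\<in>cz.bad_set. H * decay_const * norm (b m'))"
    proof (rule sum_mono, rule mult_right_mono)
      fix m' assume m': "m' \<in> cz.bad_set"
      show "(\<Sum>m\<in>G2. norm (a m m' - a m (cz.centre m'))) \<le> H * decay_const"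
      proof (rule sum_hoermander[where R = "2 ^ cz.level m'", OF fin(2)])
        show "sup_dist (cz.centre m') m' \<le> 2 ^ cz.level m'"
          unfolding cz.centre_def by (rule sup_dist_dyadic_corner)
        fix m assume "m \<in> G2"
        hence "m \<notin> E" by (simp add: G2_def)
        thus "D * 2 ^ cz.level m' < sup_dist m (cz.centre m')" using m' unfolding E_def by force
      qed simp
    qed simp
    also have "\<dots> = H * decay_const * (\<Sum>m'\<in>cz.bad_set. norm (b m'))" by (simp add: sum_distrib_left)
    also have "\<dots> \<le> H * decay_const * (2 * M)"
      unfolding b_def using cz.sum_bad_le mass H decay_const_nonneg by (intro mult_left_mono) auto
    finally show ?thesis by simp
  qed
  show ?thesis using main g1 g2 E(2) unfolding weak_const_def M_def[symmetric] by (simp add: algebra_simps)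
qed

end

section \<open>Marcinkiewicz interpolation for matrices\<close>

text \<open>A geometric sum is controlled by its largest term; the exponents are reindexed by their
  distance from the integer part of log 2 v.\<close>

lemma sum_geometric_below:
  assumes I: "finite I" and s: "0 < s" and v: "0 < v" and le: "\<And>i. i \<in> I \<Longrightarrow> 2 powr real_of_int i \<le> v"
  shows "(\<Sum>i\<in>I. 2 powr (s * real_of_int i)) \<le> v powr s / (1 - 2 powr (-s))"
proof -
  define i0 where "i0 = \<lfloor>log 2 v\<rfloor>"
  have top: "i \<le> i0" if "i \<in> I" for i
    using le[OF that] v unfolding i0_def by (simp add: le_floor_iff le_log_iff)
  have lt: "2 powr (-s) < 1" using s by (simp add: powr_less_one)
  have "(\<Sum>i\<in>I. 2 powr (s * real_of_int i)) = (\<Sum>i\<in>I. 2 powr (s * i0) * (2 powr (-s)) ^ nat (i0 - i))"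
  proof (rule sum.cong[OF refl])
    fix i assume "i \<in> I"
    hence "real (nat (i0 - i)) = real_of_int i0 - real_of_int i" using top by simp
    hence "(2 powr (-s)) ^ nat (i0 - i) = 2 powr (- s * (real_of_int i0 - real_of_int i))"
      by (subst powr_realpow[symmetric]) (simp_all add: powr_powr)
    hence "2 powr (s * i0) * (2 powr (-s)) ^ nat (i0 - i) = 2 powr (s * i0 + - s * (real_of_int i0 - real_of_int i))"
      by (simp only: powr_add)
    thus "2 powr (s * real_of_int i) = 2 powr (s * i0) * (2 powr (-s)) ^ nat (i0 - i)"
      by (simp add: algebra_simps)
  qed
  also have "\<dots> = 2 powr (s * i0) * (\<Sum>j\<in>(\<lambda>i. nat (i0 - i)) ` I. (2 powr (-s)) ^ j)"
    by (subst sum.reindex) (auto simp: sum_distrib_left inj_on_def dest!: top)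
  also have "\<dots> \<le> 2 powr (s * i0) * (\<Sum>j. (2 powr (-s)) ^ j)"
    using lt I by (intro mult_left_mono sum_le_suminf summable_geometric) auto
  also have "\<dots> = 2 powr (s * i0) / (1 - 2 powr (-s))" using lt by (subst suminf_geometric) auto
  also have "\<dots> \<le> v powr s / (1 - 2 powr (-s))"
  proof (rule divide_right_mono)
    have "2 powr real_of_int i0 \<le> v" using v unfolding i0_def by (subst le_log_iff[symmetric]) auto
    hence "(2 powr real_of_int i0) powr s \<le> v powr s" using s by (intro powr_mono2) auto
    thus "2 powr (s * i0) \<le> v powr s" by (simp add: powr_powr mult.commute)
  qed (use lt in simp)
  finally show ?thesis .
qed

lemma sum_geometric_above:
  assumes I: "finite I" and s: "0 < s" and v: "0 < v" and le: "\<And>i. i \<in> I \<Longrightarrow> v \<le> 2 powr real_of_int i"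
  shows "(\<Sum>i\<in>I. 2 powr (- s * real_of_int i)) \<le> v powr (-s) / (1 - 2 powr (-s))"
proof -
  have "(\<Sum>i\<in>I. 2 powr (- s * real_of_int i)) = (\<Sum>i\<in>uminus ` I. 2 powr (s * real_of_int i))"
    by (subst sum.reindex) auto
  also have "\<dots> \<le> (1 / v) powr s / (1 - 2 powr (-s))"
  proof (rule sum_geometric_below)
    fix i assume "i \<in> uminus ` I"
    then obtain j where "j \<in> I" "i = - j" by blast
    thus "2 powr real_of_int i \<le> 1 / v" using le[of j] v by (simp add: powr_minus field_simps)
  qed (use I s v in auto)
  also have "(1 / v) powr s = v powr (-s)" using v by (simp add: powr_minus powr_divide field_simps)
  finally show ?thesis .
qed

text \<open>Young's inequality for the two functions divided by their norms, integrated. The measure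
  is arbitrary so that the counting measure supplies the version for finite sums.\<close>

lemma hoelder_inequality:
  fixes f g :: "'a \<Rightarrow> 'b :: real_normed_algebra_1"
  assumes pq: "1 < p" "1 < q" "1 / p + 1 / q = (1::real)"
    and f: "f \<in> borel_measurable M" "integrable M (\<lambda>x. norm (f x) powr p)"
    and g: "g \<in> borel_measurable M" "integrable M (\<lambda>x. norm (g x) powr q)"
  shows "integrable M (\<lambda>x. norm (f x) * norm (g x))"
    and "(LINT x|M. norm (f x) * norm (g x))
      \<le> (LINT x|M. norm (f x) powr p) powr (1 / p) * (LINT x|M. norm (g x) powr q) powr (1 / q)"
proof -
  define a where "a = (LINT x|M. norm (f x) powr p)"
  define b where "b = (LINT x|M. norm (g x) powr q)"
  show int: "integrable M (\<lambda>x. norm (f x) * norm (g x))"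
  proof (rule Bochner_Integration.integrable_bound)
    show "integrable M (\<lambda>x. norm (f x) powr p / p + norm (g x) powr q / q)" using f g by simp
    show "AE x in M. norm (norm (f x) * norm (g x)) \<le> norm (norm (f x) powr p / p + norm (g x) powr q / q)"
      using Youngs_inequality[OF pq norm_ge_zero norm_ge_zero] pq by (intro AE_I2) (simp add: abs_of_nonneg)
  qed (use f g in measurable)
  have ab: "0 \<le> a" "0 \<le> b" unfolding a_def b_def by simp_all
  show "(LINT x|M. norm (f x) * norm (g x)) \<le> a powr (1 / p) * b powr (1 / q)"
  proof (cases "a = 0 \<or> b = 0")
    case True
    hence "(AE x in M. norm (f x) powr p = 0) \<or> (AE x in M. norm (g x) powr q = 0)"
      unfolding a_def b_def using f g by (simp add: integral_nonneg_eq_0_iff_AE)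
    hence "AE x in M. norm (f x) * norm (g x) = 0" by auto
    hence "(LINT x|M. norm (f x) * norm (g x)) = 0" by (rule integral_eq_zero_AE)
    thus ?thesis by simp
  next
    case False
    hence pos: "0 < a" "0 < b" using ab by auto
    define A where "A = a powr (1 / p)"
    define B where "B = b powr (1 / q)"
    have AB: "0 < A" "0 < B" "A powr p = a" "B powr q = b" using pos pq by (auto simp: A_def B_def powr_powr)
    have "(LINT x|M. norm (f x) * norm (g x)) / (A * B) = (LINT x|M. (norm (f x) / A) * (norm (g x) / B))"
      by simp
    also have "\<dots> \<le> (LINT x|M. norm (f x) powr p / a / p + norm (g x) powr q / b / q)"
    proof (rule integral_mono)
      show "integrable M (\<lambda>x. (norm (f x) / A) * (norm (g x) / B))" using int by simp
      show "integrable M (\<lambda>x. norm (f x) powr p / a / p + norm (g x) powr q / b / q)" using f g by simp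
      fix x
      have "(norm (f x) / A) powr p = norm (f x) powr p / a" "(norm (g x) / B) powr q = norm (g x) powr q / b"
        using AB by (simp_all add: powr_divide)
      thus "(norm (f x) / A) * (norm (g x) / B) \<le> norm (f x) powr p / a / p + norm (g x) powr q / b / q"
        using Youngs_inequality[OF pq, of "norm (f x) / A" "norm (g x) / B"] AB by simp
    qed
    also have "\<dots> = a / a / p + b / b / q" unfolding a_def b_def using f g by simp
    also have "\<dots> = 1" using pos pq by simp
    finally show ?thesis using AB unfolding A_def[symmetric] B_def[symmetric] by (simp add: divide_le_eq)
  qed
qed

lemma hoelder_inequality_sum:
  fixes f g :: "'a \<Rightarrow> 'b :: {real_normed_algebra_1, second_countable_topology}"
  assumes pq: "1 < p" "1 < q" "1 / p + 1 / q = (1::real)" and S: "finite S"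
  shows "(\<Sum>x\<in>S. norm (f x) * norm (g x))
      \<le> (\<Sum>x\<in>S. norm (f x) powr p) powr (1 / p) * (\<Sum>x\<in>S. norm (g x) powr q) powr (1 / q)"
  using hoelder_inequality(2)[OF pq, of f "count_space S" g] S
  by (simp add: integrable_count_space lebesgue_integral_count_space_finite)

context discrete_singular_integral
begin

text \<open>The factor 4 powr q comes from replacing a value by a dyadic height that is smaller by a
  factor of at most 4. The two quotients sum the heights below and above the modulus of an entry and
  blow up at q = 1 and q = 2.\<close>

definition "strong_const q = 4 powr q * (weak_const / (1 - 2 powr (- (q - 1))) + B\<^sup>2 / (1 - 2 powr (- (2 - q))))"

text \<open>Marcinkiewicz interpolation between the weak (1,1) and the (2,2) bound, over the dyadic heights.\<close>

lemma strong_type_below_2: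
  assumes S: "finite S" and G: "finite G" and q: "1 < q" "q < 2"
  shows "(\<Sum>m\<in>G. norm (apply_on S f m) powr q) \<le> strong_const q * (\<Sum>m'\<in>S. norm (f m') powr q)"
proof -
  define t where "t m = norm (apply_on S f m)" for m
  \<comment> \<open>Chosen so that 2 h < t m <= 4 h for the height h of level \<open>lev m\<close>;
    the lower inequality is strict because the weak bound counts values strictly above a height. For
    t m = 0 the level is irrelevant.\<close>
  define lev where "lev m = \<lceil>log 2 (t m)\<rceil> - 2" for m
  define I where "I = lev ` G"
  have I: "finite I" using G by (simp add: I_def)
  define h where "h i = 2 powr real_of_int i" for i :: int
  have h: "0 < h i" for i by (simp add: h_def)
  have hq: "h i powr s = 2 powr (s * real_of_int i)" for i s by (simp add: h_def powr_powr mult.commute)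
  define N where "N i = real (card {m \<in> G. 2 * h i < t m})" for i
  define hi where "hi i m' = (if h i < norm (f m') then f m' else 0)" for i m'
  define lo where "lo i m' = (if h i < norm (f m') then 0 else f m')" for i m'
  have N: "h i powr q * N i \<le> weak_const * (\<Sum>m'\<in>S. h i powr (q - 1) * norm (hi i m'))
      + B\<^sup>2 * (\<Sum>m'\<in>S. h i powr (- (2 - q)) * (norm (lo i m'))\<^sup>2)" for i
  proof -
    define G1 where "G1 = {m \<in> G. h i < norm (apply_on S (hi i) m)}"
    define G2 where "G2 = {m \<in> G. h i < norm (apply_on S (lo i) m)}"
    have fin: "finite G1" "finite G2" using G by (auto simp: G1_def G2_def)
    have split: "apply_on S f m = apply_on S (hi i) m + apply_on S (lo i) m" for m
      unfolding apply_on_def sum.distrib[symmetric] by (rule sum.cong) (auto simp: hi_def lo_def)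
    have "{m \<in> G. 2 * h i < t m} \<subseteq> G1 \<union> G2"
    proof
      fix m assume m: "m \<in> {m \<in> G. 2 * h i < t m}"
      have "t m \<le> norm (apply_on S (hi i) m) + norm (apply_on S (lo i) m)"
        unfolding t_def split by (rule norm_triangle_ineq)
      thus "m \<in> G1 \<union> G2" using m unfolding G1_def G2_def by auto
    qed
    hence "card {m \<in> G. 2 * h i < t m} \<le> card G1 + card G2"
      using card_mono[of "G1 \<union> G2"] card_Un_le[of G1 G2] fin by (meson finite_UnI le_trans)
    hence "h i powr q * N i \<le> h i powr q * (real (card G1) + real (card G2))"
      unfolding N_def by (intro mult_left_mono) auto
    also have "\<dots> = h i powr (q - 1) * (h i * card G1) + h i powr (- (2 - q)) * ((h i)\<^sup>2 * card G2)"
    proof -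
      have "h i powr q = h i powr (q - 1) * h i" using h[of i] by (simp add: powr_diff)
      moreover have "h i powr q = h i powr (- (2 - q)) * (h i)\<^sup>2"
        using h[of i] by (simp add: powr_diff)
      ultimately show ?thesis by (metis distrib_left mult.assoc)
    qed
    also have "\<dots> \<le> h i powr (q - 1) * (weak_const * (\<Sum>m'\<in>S. norm (hi i m')))
        + h i powr (- (2 - q)) * (B\<^sup>2 * (\<Sum>m'\<in>S. (norm (lo i m'))\<^sup>2))"
    proof (intro add_mono mult_left_mono)
      show "h i * card G1 \<le> weak_const * (\<Sum>m'\<in>S. norm (hi i m'))"
        unfolding G1_def by (rule weak_type_1_1[OF S G h])
      have "(h i)\<^sup>2 * card G2 = (\<Sum>m\<in>G2. (h i)\<^sup>2)" by simp
      also have "\<dots> \<le> (\<Sum>m\<in>G2. (norm (apply_on S (lo i) m))\<^sup>2)"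
        by (rule sum_mono, rule power_mono) (use h[of i] in \<open>auto simp: G2_def\<close>)
      also have "\<dots> \<le> B\<^sup>2 * (\<Sum>m'\<in>S. (norm (lo i m'))\<^sup>2)" by (rule l2_operator_bound[OF S fin(2)])
      finally show "(h i)\<^sup>2 * card G2 \<le> B\<^sup>2 * (\<Sum>m'\<in>S. (norm (lo i m'))\<^sup>2)" .
    qed auto
    also have "\<dots> = weak_const * (\<Sum>m'\<in>S. h i powr (q - 1) * norm (hi i m'))
      + B\<^sup>2 * (\<Sum>m'\<in>S. h i powr (- (2 - q)) * (norm (lo i m'))\<^sup>2)"
      by (simp add: sum_distrib_left mult_ac)
    finally show ?thesis .
  qed
  \<comment> \<open>A discrete layer-cake formula: only the finitely many heights that occur are
    used, and for each \<open>m\<close> the term of its own height is already large enough.\<close>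
  have "(\<Sum>m\<in>G. t m powr q) \<le> (\<Sum>m\<in>G. \<Sum>i\<in>I. if 2 * h i < t m then 4 powr q * h i powr q else 0)"
  proof (rule sum_mono)
    fix m assume m: "m \<in> G"
    show "t m powr q \<le> (\<Sum>i\<in>I. if 2 * h i < t m then 4 powr q * h i powr q else 0)"
    proof (cases "t m = 0")
      case False
      hence tm: "0 < t m" by (simp add: t_def)
      have "log 2 (t m) \<le> real_of_int (lev m + 2)" "real_of_int (lev m + 1) < log 2 (t m)"
        unfolding lev_def by linarith+
      hence "t m \<le> 2 powr real_of_int (lev m + 2)" "2 powr real_of_int (lev m + 1) < t m"
        using tm by (simp_all add: log_le_iff less_log_iff)
      hence b: "t m \<le> 4 * h (lev m)" "2 * h (lev m) < t m" by (simp_all add: h_def powr_add)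
      have "t m powr q \<le> (4 * h (lev m)) powr q" using b tm q by (intro powr_mono2) auto
      also have "\<dots> = (if 2 * h (lev m) < t m then 4 powr q * h (lev m) powr q else 0)"
        using b h[of "lev m"] by (simp add: powr_mult)
      also have "\<dots> \<le> (\<Sum>i\<in>I. if 2 * h i < t m then 4 powr q * h i powr q else 0)"
        by (rule member_le_sum) (use I m in \<open>auto simp: I_def\<close>)
      finally show ?thesis .
    qed (simp add: sum_nonneg)
  qed
  also have "\<dots> = (\<Sum>i\<in>I. \<Sum>m\<in>G. if 2 * h i < t m then 4 powr q * h i powr q else 0)" by (rule sum.swap)
  also have "\<dots> = 4 powr q * (\<Sum>i\<in>I. h i powr q * N i)"
    unfolding sum_distrib_left N_def using G by (intro sum.cong refl) (simp add: sum.If_cases Int_def)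
  also have "\<dots> \<le> 4 powr q * (\<Sum>i\<in>I. weak_const * (\<Sum>m'\<in>S. h i powr (q - 1) * norm (hi i m'))
      + B\<^sup>2 * (\<Sum>m'\<in>S. h i powr (- (2 - q)) * (norm (lo i m'))\<^sup>2))"
    by (intro mult_left_mono sum_mono N) simp
  also have "\<dots> = 4 powr q * (weak_const * (\<Sum>m'\<in>S. \<Sum>i\<in>I. h i powr (q - 1) * norm (hi i m'))
      + B\<^sup>2 * (\<Sum>m'\<in>S. \<Sum>i\<in>I. h i powr (- (2 - q)) * (norm (lo i m'))\<^sup>2))"
    unfolding sum.swap[of "\<lambda>m' i. h i powr (q - 1) * norm (hi i m')"]
      sum.swap[of "\<lambda>m' i. h i powr (- (2 - q)) * (norm (lo i m'))\<^sup>2"]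
    by (simp only: sum.distrib sum_distrib_left)
  \<comment> \<open>For a fixed entry, only heights below its modulus meet its high part and only
    heights at or above it meet its low part. With q > 1 and q < 2 both geometric sums are dominated
    by the height nearest to the modulus and give multiples of |f|^q.\<close>
  also have "\<dots> \<le> 4 powr q * (weak_const * (\<Sum>m'\<in>S. norm (f m') powr q / (1 - 2 powr (- (q - 1))))
      + B\<^sup>2 * (\<Sum>m'\<in>S. norm (f m') powr q / (1 - 2 powr (- (2 - q)))))"
  proof (intro mult_left_mono add_mono sum_mono)
    fix m' assume "m' \<in> S"
    define v where "v = norm (f m')"
    show "(\<Sum>i\<in>I. h i powr (q - 1) * norm (hi i m')) \<le> norm (f m') powr q / (1 - 2 powr (- (q - 1)))"
    proof (cases "v = 0")
      case False
      hence v: "0 < v" by (simp add: v_def)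
      have "(\<Sum>i\<in>I. h i powr (q - 1) * norm (hi i m')) = (\<Sum>i\<in>{i\<in>I. h i < v}. 2 powr ((q - 1) * real_of_int i)) * v"
        unfolding sum_distrib_right by (rule sum.mono_neutral_cong_right) (use I in \<open>auto simp: hi_def v_def hq\<close>)
      also have "\<dots> \<le> v powr (q - 1) / (1 - 2 powr (- (q - 1))) * v"
        by (intro mult_right_mono sum_geometric_below) (use I q v in \<open>auto simp: h_def\<close>)
      also have "\<dots> = v powr q / (1 - 2 powr (- (q - 1)))" using v by (simp add: powr_diff)
      finally show ?thesis by (simp add: v_def)
    next
      case True
      hence "hi i m' = 0" for i using h[of i] by (simp add: v_def hi_def)
      thus ?thesis using True by (simp add: v_def)
    qed
    show "(\<Sum>i\<in>I. h i powr (- (2 - q)) * (norm (lo i m'))\<^sup>2) \<le> norm (f m') powr q / (1 - 2 powr (- (2 - q)))"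
    proof (cases "v = 0")
      case False
      hence v: "0 < v" by (simp add: v_def)
      have "(\<Sum>i\<in>I. h i powr (- (2 - q)) * (norm (lo i m'))\<^sup>2)
          = (\<Sum>i\<in>{i\<in>I. v \<le> h i}. 2 powr (- (2 - q) * real_of_int i)) * v\<^sup>2"
        unfolding sum_distrib_right by (rule sum.mono_neutral_cong_right) (use I in \<open>auto simp: lo_def v_def hq\<close>)
      also have "\<dots> \<le> v powr (- (2 - q)) / (1 - 2 powr (- (2 - q))) * v\<^sup>2"
        by (intro mult_right_mono sum_geometric_above) (use I q v in \<open>auto simp: h_def\<close>)
      also have "\<dots> = v powr q / (1 - 2 powr (- (2 - q)))" using v by (simp add: powr_diff)
      finally show ?thesis by (simp add: v_def)
    next
      case True
      hence "lo i m' = 0" for i by (simp add: v_def lo_def)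
      thus ?thesis using True by (simp add: v_def)
    qed
  qed (use weak_const_nonneg in auto)
  also have "\<dots> = strong_const q * (\<Sum>m'\<in>S. norm (f m') powr q)"
    unfolding strong_const_def sum_divide_distrib[symmetric] by (simp add: algebra_simps)
  finally show ?thesis by (simp add: t_def)
qed

text \<open>The bound is brought into the bilinear form, in which transposing the matrix is a mere
  exchange of \<open>f\<close> and \<open>g\<close>.\<close>

lemma bilinear_bound_below_2:
  assumes S: "finite S" and G: "finite G" and q: "1 < q" "q < 2" and q': "1 / q + 1 / q' = 1"
  shows "norm (\<Sum>m\<in>G. \<Sum>m'\<in>S. a m m' * f m' * g m) \<le> strong_const q powr (1 / q) *
    (\<Sum>m'\<in>S. norm (f m') powr q) powr (1 / q) * (\<Sum>m\<in>G. norm (g m) powr q') powr (1 / q')"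
proof -
  have q'1: "1 < q'"
  proof -
    have "1 / q' = 1 - 1 / q" "0 < 1 - 1 / q" "1 - 1 / q < 1" using q q' by auto
    hence "0 < 1 / q'" "1 / q' < 1" by simp_all
    thus ?thesis by (simp add: divide_less_eq_1 zero_less_divide_iff)
  qed
  have "norm (\<Sum>m\<in>G. \<Sum>m'\<in>S. a m m' * f m' * g m) = norm (\<Sum>m\<in>G. apply_on S f m * g m)"
    by (simp add: apply_on_def sum_distrib_right)
  also have "\<dots> \<le> (\<Sum>m\<in>G. norm (apply_on S f m) * norm (g m))"
    by (rule order_trans[OF norm_sum]) (simp add: norm_mult)
  also have "\<dots> \<le> (\<Sum>m\<in>G. norm (apply_on S f m) powr q) powr (1 / q) * (\<Sum>m\<in>G. norm (g m) powr q') powr (1 / q')"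
    by (rule hoelder_inequality_sum[OF q(1) q'1 q' G])
  also have "\<dots> \<le> (strong_const q * (\<Sum>m'\<in>S. norm (f m') powr q)) powr (1 / q) * (\<Sum>m\<in>G. norm (g m) powr q') powr (1 / q')"
    using q by (intro mult_right_mono powr_mono2 strong_type_below_2 S G) (auto intro: sum_nonneg)
  also have "(strong_const q * (\<Sum>m'\<in>S. norm (f m') powr q)) powr (1 / q)
      = strong_const q powr (1 / q) * (\<Sum>m'\<in>S. norm (f m') powr q) powr (1 / q)"
    by (rule powr_mult)
  finally show ?thesis .
qed

end

text \<open>The class of kernels is closed under transposition, which settles the exponents above 2.\<close>

theorem discrete_calderon_zygmund:
  fixes B H D \<delta> q q' :: real
  assumes "0 \<le> B" "0 \<le> H" "1 \<le> D" "0 < \<delta>" and q: "1 < q" and q': "1 / q + 1 / q' = 1"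
  shows "\<exists>C\<ge>0. \<forall>(a :: int ^ 'n \<Rightarrow> int ^ 'n \<Rightarrow> complex) (S :: (int ^ 'n) set) (G :: (int ^ 'n) set) f g.
    discrete_singular_integral a B H D \<delta> \<longrightarrow> discrete_singular_integral (\<lambda>m m'. a m' m) B H D \<delta> \<longrightarrow>
    finite S \<longrightarrow> finite G \<longrightarrow>
    norm (\<Sum>m\<in>G. \<Sum>m'\<in>S. a m m' * f m' * g m)
      \<le> C * (\<Sum>m'\<in>S. norm (f m') powr q) powr (1 / q) * (\<Sum>m\<in>G. norm (g m) powr q') powr (1 / q')"
proof -
  have q'0: "0 < q'" using q q' by (smt (verit) divide_less_eq_1 divide_nonneg_nonpos)
  \<comment> \<open>In each case the witness depends on the parameters only and not on the matrix,
    so one constant will serve all meshes.\<close>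
  consider "q < 2" | "q = 2" | "2 < q" by linarith
  thus ?thesis
  proof cases
    case 1
    show ?thesis
      by (intro exI[of _ "discrete_singular_integral.strong_const TYPE('n) B H D \<delta> q powr (1 / q)"] conjI allI impI
          discrete_singular_integral.bilinear_bound_below_2) (use q q' 1 in auto)
  next
    case 2
    hence "q' = 2" using q' by (simp add: field_simps)
    show ?thesis
    proof (intro exI[of _ B] conjI allI impI)
      fix a :: "int ^ 'n \<Rightarrow> int ^ 'n \<Rightarrow> complex" and S G :: "(int ^ 'n) set" and f g
      assume a: "discrete_singular_integral a B H D \<delta>" and fin: "finite S" "finite G"
      show "norm (\<Sum>m\<in>G. \<Sum>m'\<in>S. a m m' * f m' * g m)
        \<le> B * (\<Sum>m'\<in>S. norm (f m') powr q) powr (1 / q) * (\<Sum>m\<in>G. norm (g m) powr q') powr (1 / q')"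
        using discrete_singular_integral.l2_bound[OF a fin, of f g] unfolding \<open>q = 2\<close> \<open>q' = 2\<close>
        by (simp add: powr_half_sqrt sum_nonneg)
    qed (use assms in simp)
  next
    case 3
    have q'2: "1 < q'" "q' < 2"
    proof -
      have "1 / q' = 1 - 1 / q" using q' by simp
      moreover have "1 / q < 1 / 2" "0 < 1 / q" using 3 by (auto simp: field_simps)
      ultimately have "1 / 2 < 1 / q'" "1 / q' < 1" by linarith+
      thus "1 < q'" "q' < 2" using q'0 by (auto simp: field_simps)
    qed
    show ?thesis
    proof (intro exI[of _ "discrete_singular_integral.strong_const TYPE('n) B H D \<delta> q' powr (1 / q')"] conjI allI impI)
      fix a :: "int ^ 'n \<Rightarrow> int ^ 'n \<Rightarrow> complex" and S G :: "(int ^ 'n) set" and f g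
      assume a: "discrete_singular_integral (\<lambda>m m'. a m' m) B H D \<delta>" and fin: "finite S" "finite G"
      have eq: "(\<Sum>m'\<in>S. \<Sum>m\<in>G. a m m' * g m * f m') = (\<Sum>m\<in>G. \<Sum>m'\<in>S. a m m' * f m' * g m)"
        by (subst sum.swap) (simp add: mult_ac)
      have "1 / q' + 1 / q = 1" using q' by simp
      from discrete_singular_integral.bilinear_bound_below_2[OF a fin(2,1) q'2 this, of g f]
      show "norm (\<Sum>m\<in>G. \<Sum>m'\<in>S. a m m' * f m' * g m)
        \<le> discrete_singular_integral.strong_const TYPE('n) B H D \<delta> q' powr (1 / q') *
          (\<Sum>m'\<in>S. norm (f m') powr q) powr (1 / q) * (\<Sum>m\<in>G. norm (g m) powr q') powr (1 / q')"
        unfolding eq by (simp add: mult_ac)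
    qed simp
  qed
qed

section \<open>Lebesgue spaces\<close>

abbreviation cut :: "(real ^ 'n) set \<Rightarrow> (real ^ 'n \<Rightarrow> complex) \<Rightarrow> real ^ 'n \<Rightarrow> complex"
  where "cut A f \<equiv> \<lambda>x. indicator A x * f x"

abbreviation Lp_tendsto :: "real \<Rightarrow> (nat \<Rightarrow> real ^ 'n \<Rightarrow> complex) \<Rightarrow> (real ^ 'n \<Rightarrow> complex) \<Rightarrow> bool"
  where "Lp_tendsto p u f \<equiv> (\<lambda>i. Lp_norm p (\<lambda>x. f x - u i x)) \<longlonglongrightarrow> 0"

lemma Lp_norm_eq: "Lp_norm p f = (LINT x|lebesgue. norm (f x) powr p) powr (1 / p)"
  by (simp add: Lp_norm_on_def set_lebesgue_integral_def)

lemma Lp_norm_on_eq_cut: "Lp_norm_on p A f = Lp_norm p (cut A f)"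
proof -
  have "indicator A x *\<^sub>R norm (f x) powr p = norm (indicator A x * f x) powr p" for x
    by (simp add: indicator_def)
  thus ?thesis by (simp add: Lp_norm_eq Lp_norm_on_def set_lebesgue_integral_def)
qed

lemma Lp_norm_nonneg: "0 \<le> Lp_norm p f"
  by (simp add: Lp_norm_on_def)

lemma Lp_norm_powr: "0 < p \<Longrightarrow> Lp_norm p f powr p = (LINT x|lebesgue. norm (f x) powr p)"
  by (simp add: Lp_norm_eq powr_powr)

lemma Lp_norm_le_iff:
  assumes "0 < p" "0 \<le> c"
  shows "Lp_norm p f \<le> c \<longleftrightarrow> (LINT x|lebesgue. norm (f x) powr p) \<le> c powr p"
  using assms Lp_norm_nonneg[of p f] powr_mono2[of p "Lp_norm p f" c] powr_less_mono2[of p c "Lp_norm p f"]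
  by (auto simp: Lp_norm_powr not_le[symmetric])

lemma Lp_spaceD:
  assumes "f \<in> Lp_space p"
  shows "f \<in> borel_measurable lebesgue" "integrable lebesgue (\<lambda>x. norm (f x) powr p)"
  using assms by (auto simp: Lp_space_def)

lemma Lp_norm_zero [simp]: "Lp_norm p (\<lambda>x. 0) = 0"
  by (simp add: Lp_norm_eq)

lemma zero_in_Lp_space [simp]: "(\<lambda>x. 0) \<in> Lp_space p"
  by (simp add: Lp_space_def)

lemma
  assumes p: "0 < p" and f: "f \<in> Lp_space p" and g: "g \<in> borel_measurable lebesgue"
    and le: "AE x in lebesgue. norm (g x) \<le> norm (f x)"
  shows Lp_space_dominated: "g \<in> Lp_space p" and Lp_norm_mono: "Lp_norm p g \<le> Lp_norm p f"
proof -
  have *: "AE x in lebesgue. norm (g x) powr p \<le> norm (f x) powr p"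
    using le by (rule AE_mp) (auto intro!: AE_I2 powr_mono2 simp: p less_imp_le)
  have "integrable lebesgue (\<lambda>x. norm (g x) powr p)"
    by (rule Bochner_Integration.integrable_bound[OF Lp_spaceD(2)[OF f]]) (use g * in auto)
  thus "g \<in> Lp_space p" using g by (simp add: Lp_space_def)
  have "(LINT x|lebesgue. norm (g x) powr p) \<le> (LINT x|lebesgue. norm (f x) powr p)"
    by (rule integral_mono_AE[OF \<open>integrable lebesgue (\<lambda>x. norm (g x) powr p)\<close> Lp_spaceD(2)[OF f] *])
  thus "Lp_norm p g \<le> Lp_norm p f"
    unfolding Lp_norm_eq using p by (intro powr_mono2) auto
qed

lemma
  assumes p: "0 < p" and f: "f \<in> Lp_space p" and g: "g \<in> borel_measurable lebesgue"
    and eq: "AE x in lebesgue. f x = g x"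
  shows Lp_space_AE_cong: "g \<in> Lp_space p" and Lp_norm_AE_cong: "Lp_norm p g = Lp_norm p f"
proof -
  show mem: "g \<in> Lp_space p" using eq by (intro Lp_space_dominated[OF p f g]) (auto elim: AE_mp)
  show "Lp_norm p g = Lp_norm p f"
    by (intro antisym Lp_norm_mono[OF p f g] Lp_norm_mono[OF p mem Lp_spaceD(1)[OF f]])
      (use eq in \<open>auto elim: AE_mp\<close>)
qed

lemma cut_in_Lp_space:
  assumes "0 < p" "f \<in> Lp_space p" "A \<in> sets lebesgue"
  shows "cut A f \<in> Lp_space p" and "Lp_norm p (cut A f) \<le> Lp_norm p f"
proof -
  have m: "cut A f \<in> borel_measurable lebesgue"
    using Lp_spaceD(1)[OF assms(2)] assms(3) by (intro borel_measurable_times borel_measurable_indicator) auto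
  have "AE x in lebesgue. norm (cut A f x) \<le> norm (f x)" by (intro AE_I2) (simp add: indicator_def)
  thus "cut A f \<in> Lp_space p" "Lp_norm p (cut A f) \<le> Lp_norm p f"
    using Lp_space_dominated[OF assms(1,2) m] Lp_norm_mono[OF assms(1,2) m] by auto
qed

lemma Lp_norm_eq_0_iff:
  assumes "0 < p" "f \<in> Lp_space p"
  shows "Lp_norm p f = 0 \<longleftrightarrow> (AE x in lebesgue. f x = 0)"
proof -
  have "Lp_norm p f = 0 \<longleftrightarrow> (LINT x|lebesgue. norm (f x) powr p) = 0"
    unfolding Lp_norm_eq by simp
  also have "\<dots> \<longleftrightarrow> (AE x in lebesgue. norm (f x) powr p = 0)"
    by (rule integral_nonneg_eq_0_iff_AE[OF Lp_spaceD(2)[OF assms(2)]]) auto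
  finally show ?thesis by simp
qed

lemma
  assumes p: "0 < p" and f: "f \<in> Lp_space p"
  shows Lp_space_scale: "(\<lambda>x. c * f x) \<in> Lp_space p"
    and Lp_norm_scale: "Lp_norm p (\<lambda>x. c * f x) = norm c * Lp_norm p f"
  using p Lp_spaceD[OF f] by (auto simp: Lp_space_def Lp_norm_eq norm_mult powr_mult powr_powr)

text \<open>Convexity of the p-th power is used with weights a / (a + b) and b / (a + b), where a
  and b are numbers strictly above the two norms. This avoids division by a norm that is zero;
  letting a and b approach the norms gives the inequality.\<close>

lemma Minkowski_inequality:
  assumes p: "1 \<le> p" and f: "f \<in> Lp_space p" and g: "g \<in> Lp_space p"
  shows Lp_space_add: "(\<lambda>x. f x + g x) \<in> Lp_space p"
    and Lp_norm_add: "Lp_norm p (\<lambda>x. f x + g x) \<le> Lp_norm p f + Lp_norm p g"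
proof -
  have convex: "(s * x + t * y) powr p \<le> s * x powr p + t * y powr p"
    if "0 < s" "0 < t" "s + t = 1" "0 \<le> x" "0 \<le> y" for s t x y :: real
  proof -
    have le: "r powr p \<le> r" if "0 < r" "r \<le> 1" for r :: real
      using powr_mono'[of 1 p r] that p by simp
    have "x = 0 \<or> y = 0 \<or> 0 < x \<and> 0 < y" using that by auto
    then consider "x = 0" | "y = 0" | "0 < x" "0 < y" by blast
    thus ?thesis
    proof cases
      case 1
      thus ?thesis using le[of t] that by (simp add: powr_mult mult_right_mono)
    next
      case 2
      thus ?thesis using le[of s] that by (simp add: powr_mult mult_right_mono)
    next
      case 3
      have "s = 1 - t" using that by simp
      thus ?thesis using convex_onD[OF powr_convex[OF p], of t x y] 3 that(1,2) by simp
    qed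
  qed
  have pw: "norm (f x + g x) powr p \<le> (a + b) powr p * (norm (f x) powr p / a powr p * (a / (a + b))
      + norm (g x) powr p / b powr p * (b / (a + b)))" if ab: "0 < a" "0 < b" for a b x
  proof -
    have "norm (f x + g x) powr p \<le> (norm (f x) + norm (g x)) powr p"
      using p by (intro powr_mono2 norm_triangle_ineq) auto
    also have "norm (f x) + norm (g x) = (a + b) * (a / (a + b) * (norm (f x) / a) + b / (a + b) * (norm (g x) / b))"
    proof -
      have "(a + b) * (a / (a + b) * (norm (f x) / a)) = norm (f x)" "(a + b) * (b / (a + b) * (norm (g x) / b)) = norm (g x)"
        using ab by simp_all
      thus ?thesis by (simp only: distrib_left)
    qed
    also have "\<dots> powr p = (a + b) powr p * (a / (a + b) * (norm (f x) / a) + b / (a + b) * (norm (g x) / b)) powr p"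
      by (rule powr_mult)
    also have "\<dots> \<le> (a + b) powr p * (a / (a + b) * (norm (f x) / a) powr p + b / (a + b) * (norm (g x) / b) powr p)"
      using ab by (intro mult_left_mono convex) (auto simp: add_divide_distrib[symmetric])
    also have "\<dots> = (a + b) powr p * (norm (f x) powr p / a powr p * (a / (a + b))
      + norm (g x) powr p / b powr p * (b / (a + b)))"
      using ab by (simp add: powr_divide mult.commute)
    finally show ?thesis .
  qed
  have m: "(\<lambda>x. f x + g x) \<in> borel_measurable lebesgue" using Lp_spaceD[OF f] Lp_spaceD[OF g] by simp
  have int: "integrable lebesgue (\<lambda>x. (a + b) powr p * (norm (f x) powr p / a powr p * (a / (a + b))
      + norm (g x) powr p / b powr p * (b / (a + b))))" for a b
    using Lp_spaceD[OF f] Lp_spaceD[OF g] by simp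
  have int2: "integrable lebesgue (\<lambda>x. norm (f x + g x) powr p)"
    by (rule Bochner_Integration.integrable_bound[OF int[of 1 1]])
      (use m pw[of 1 1] in \<open>auto intro!: AE_I2 order_trans[OF _ abs_ge_self]\<close>)
  thus mem: "(\<lambda>x. f x + g x) \<in> Lp_space p" using m by (simp add: Lp_space_def)
  have le: "Lp_norm p (\<lambda>x. f x + g x) \<le> a + b"
    if ab: "Lp_norm p f < a" "Lp_norm p g < b" for a b
  proof -
    have pos: "0 < a" "0 < b" using ab Lp_norm_nonneg[of p f] Lp_norm_nonneg[of p g] by linarith+
    have "(LINT x|lebesgue. norm (f x + g x) powr p) \<le> (LINT x|lebesgue. (a + b) powr p *
        (norm (f x) powr p / a powr p * (a / (a + b)) + norm (g x) powr p / b powr p * (b / (a + b))))"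
      by (rule integral_mono[OF int2 int]) (rule pw[OF pos])
    also have "\<dots> = (a + b) powr p * ((LINT x|lebesgue. norm (f x) powr p) / a powr p * (a / (a + b))
        + (LINT x|lebesgue. norm (g x) powr p) / b powr p * (b / (a + b)))"
      using Lp_spaceD[OF f] Lp_spaceD[OF g] by simp
    also have "\<dots> \<le> (a + b) powr p * (1 * (a / (a + b)) + 1 * (b / (a + b)))"
    proof (intro mult_left_mono add_mono mult_right_mono)
      show "(LINT x|lebesgue. norm (f x) powr p) / a powr p \<le> 1"
        using Lp_norm_le_iff[of p a f] ab pos p by simp
      show "(LINT x|lebesgue. norm (g x) powr p) / b powr p \<le> 1"
        using Lp_norm_le_iff[of p b g] ab pos p by simp
    qed (use pos in auto)
    also have "\<dots> = (a + b) powr p" using pos by (simp add: add_divide_distrib[symmetric])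
    finally show ?thesis using p pos by (subst Lp_norm_le_iff) auto
  qed
  show "Lp_norm p (\<lambda>x. f x + g x) \<le> Lp_norm p f + Lp_norm p g"
  proof (rule field_le_epsilon)
    fix e :: real assume "0 < e"
    thus "Lp_norm p (\<lambda>x. f x + g x) \<le> Lp_norm p f + Lp_norm p g + e"
      using le[of "Lp_norm p f + e / 2" "Lp_norm p g + e / 2"] by simp
  qed
qed

lemma
  assumes p: "1 \<le> p" and f: "f \<in> Lp_space p" and g: "g \<in> Lp_space p"
  shows Lp_space_diff: "(\<lambda>x. f x - g x) \<in> Lp_space p"
    and Lp_norm_diff: "Lp_norm p (\<lambda>x. f x - g x) \<le> Lp_norm p f + Lp_norm p g"
  using Lp_space_add[OF p f, of "\<lambda>x. (-1) * g x"] Lp_norm_add[OF p f, of "\<lambda>x. (-1) * g x"]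
    Lp_space_scale[OF _ g, of "-1"] Lp_norm_scale[OF _ g, of "-1"] p by auto

lemma Lp_norm_diff_commute: "Lp_norm p (\<lambda>x. f x - g x) = Lp_norm p (\<lambda>x. g x - f x)"
  by (simp add: Lp_norm_eq norm_minus_commute)

lemma Lp_norm_triangle:
  assumes p: "1 \<le> p" and "f \<in> Lp_space p" "g \<in> Lp_space p" "h \<in> Lp_space p"
  shows "Lp_norm p (\<lambda>x. f x - h x) \<le> Lp_norm p (\<lambda>x. f x - g x) + Lp_norm p (\<lambda>x. g x - h x)"
  using Lp_norm_add[OF p Lp_space_diff[OF p assms(2,3)] Lp_space_diff[OF p assms(3,4)]] by simp

lemma
  assumes p: "1 \<le> p" and f: "\<And>i. i \<in> I \<Longrightarrow> f i \<in> Lp_space p"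
  shows Lp_space_sum: "(\<lambda>x. \<Sum>i\<in>I. f i x) \<in> Lp_space p"
    and Lp_norm_sum: "Lp_norm p (\<lambda>x. \<Sum>i\<in>I. f i x) \<le> (\<Sum>i\<in>I. Lp_norm p (f i))"
proof -
  have "(\<lambda>x. \<Sum>i\<in>I. f i x) \<in> Lp_space p \<and> Lp_norm p (\<lambda>x. \<Sum>i\<in>I. f i x) \<le> (\<Sum>i\<in>I. Lp_norm p (f i))"
    using f
  proof (induction I rule: infinite_finite_induct)
    case (insert i I)
    hence IH: "(\<lambda>x. \<Sum>i\<in>I. f i x) \<in> Lp_space p" "Lp_norm p (\<lambda>x. \<Sum>i\<in>I. f i x) \<le> (\<Sum>i\<in>I. Lp_norm p (f i))"
      and i: "f i \<in> Lp_space p" by auto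
    show ?case using Lp_space_add[OF p i IH(1)] Lp_norm_add[OF p i IH(1)] IH(2) insert(1,2) by simp
  qed auto
  thus "(\<lambda>x. \<Sum>i\<in>I. f i x) \<in> Lp_space p" "Lp_norm p (\<lambda>x. \<Sum>i\<in>I. f i x) \<le> (\<Sum>i\<in>I. Lp_norm p (f i))" by auto
qed

lemma conjugate_exponent:
  fixes q q' :: real
  assumes "1 < q" "1 / q + 1 / q' = 1" shows "1 < q'"
proof -
  have "1 / q' = 1 - 1 / q" "0 < 1 - 1 / q" "1 - 1 / q < 1" using assms by auto
  hence "0 < 1 / q'" "1 / q' < 1" by simp_all
  thus ?thesis by (simp add: divide_less_eq_1 zero_less_divide_iff)
qed

lemma
  assumes q: "1 < q" "1 / q + 1 / q' = 1" and f: "f \<in> Lp_space q" and g: "g \<in> Lp_space q'"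
  shows Lp_hoelder_integrable: "integrable lebesgue (\<lambda>x. f x * g x)"
    and Lp_hoelder: "norm (LINT x|lebesgue. f x * g x) \<le> Lp_norm q f * Lp_norm q' g"
proof -
  note h = hoelder_inequality[OF q(1) conjugate_exponent[OF q] q(2) Lp_spaceD[OF f] Lp_spaceD[OF g]]
  have "integrable lebesgue (\<lambda>x. norm (f x * g x))" using h(1) by (simp add: norm_mult)
  thus "integrable lebesgue (\<lambda>x. f x * g x)"
    by (rule integrable_norm_cancel) (use Lp_spaceD[OF f] Lp_spaceD[OF g] in simp)
  have le: "(LINT x|lebesgue. norm (f x) * norm (g x)) \<le> Lp_norm q f * Lp_norm q' g"
    using h(2) by (simp add: Lp_norm_eq)
  have "norm (LINT x|lebesgue. f x * g x) \<le> (LINT x|lebesgue. norm (f x * g x))" by (rule integral_norm_bound)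
  thus "norm (LINT x|lebesgue. f x * g x) \<le> Lp_norm q f * Lp_norm q' g" using le by (simp add: norm_mult)
qed

lemma Lp_dominated_convergence:
  assumes p: "1 \<le> p" and w: "w \<in> Lp_space p" and u: "\<And>i. u i \<in> borel_measurable lebesgue"
    and f: "f \<in> borel_measurable lebesgue" and lim: "AE x in lebesgue. (\<lambda>i. u i x) \<longlonglongrightarrow> f x"
    and bound: "\<And>i. AE x in lebesgue. norm (u i x) \<le> norm (w x)"
  shows "\<And>i. u i \<in> Lp_space p" "f \<in> Lp_space p" "Lp_tendsto p u f"
proof -
  have p0: "0 < p" using p by simp
  show ui: "u i \<in> Lp_space p" for i by (rule Lp_space_dominated[OF p0 w u bound])
  have bf: "AE x in lebesgue. norm (f x) \<le> norm (w x)"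
  proof -
    have "AE x in lebesgue. \<forall>i. norm (u i x) \<le> norm (w x)" using bound by (simp add: AE_all_countable)
    thus ?thesis using lim
      by (rule AE_mp[OF _ AE_mp]) (auto intro!: AE_I2 LIMSEQ_le_const2 tendsto_norm)
  qed
  show fp: "f \<in> Lp_space p" by (rule Lp_space_dominated[OF p0 w f bf])
  have "(\<lambda>i. LINT x|lebesgue. norm (f x - u i x) powr p) \<longlonglongrightarrow> (LINT x|(lebesgue :: (real ^ 'a) measure). 0)"
  proof (rule integral_dominated_convergence)
    show "integrable lebesgue (\<lambda>x. 2 powr p * norm (w x) powr p)" using Lp_spaceD[OF w] by simp
    show "AE x in lebesgue. (\<lambda>i. norm (f x - u i x) powr p) \<longlonglongrightarrow> 0"
      using lim
    proof (rule AE_mp, intro AE_I2 impI)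
      fix x assume "(\<lambda>i. u i x) \<longlonglongrightarrow> f x"
      hence "(\<lambda>i. norm (f x - u i x)) \<longlonglongrightarrow> norm (f x - f x)" by (intro tendsto_intros)
      hence "(\<lambda>i. norm (f x - u i x)) \<longlonglongrightarrow> 0" by simp
      thus "(\<lambda>i. norm (f x - u i x) powr p) \<longlonglongrightarrow> 0"
        using p0 by (intro tendsto_zero_powrI[OF _ tendsto_const]) auto
    qed
    fix i
    show "AE x in lebesgue. norm (norm (f x - u i x) powr p) \<le> 2 powr p * norm (w x) powr p"
      using bf bound[of i]
    proof (rule AE_mp[OF _ AE_mp], intro AE_I2 impI)
      fix x assume a: "norm (f x) \<le> norm (w x)" "norm (u i x) \<le> norm (w x)"
      have "norm (f x - u i x) \<le> 2 * norm (w x)" using norm_triangle_ineq4[of "f x" "u i x"] a by linarith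
      hence "norm (f x - u i x) powr p \<le> (2 * norm (w x)) powr p" using p0 by (intro powr_mono2) auto
      thus "norm (norm (f x - u i x) powr p) \<le> 2 powr p * norm (w x) powr p" by (simp add: powr_mult)
    qed
  qed (use f u in measurable)
  hence "(\<lambda>i. (LINT x|lebesgue. norm (f x - u i x) powr p) powr (1 / p)) \<longlonglongrightarrow> 0"
    using p0 by (intro tendsto_zero_powrI[OF _ tendsto_const]) auto
  thus "Lp_tendsto p u f" by (simp add: Lp_norm_eq)
qed

lemma Lp_limit_subseq:
  assumes p: "1 \<le> p" and u: "\<And>i. u i \<in> Lp_space p" and f: "f \<in> Lp_space p"
    and lim: "Lp_tendsto p u f"
  shows "\<exists>r. strict_mono r \<and> (AE x in lebesgue. (\<lambda>i. u (r i) x) \<longlonglongrightarrow> f x)"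
proof -
  have p0: "0 < p" using p by simp
  have "(\<lambda>i. Lp_norm p (\<lambda>x. f x - u i x) powr p) \<longlonglongrightarrow> 0"
    using lim p0 by (intro tendsto_zero_powrI[OF _ tendsto_const]) (auto simp: Lp_norm_nonneg)
  hence "(\<lambda>i. LINT x|lebesgue. norm (norm (f x - u i x) powr p)) \<longlonglongrightarrow> 0"
    using p0 by (simp add: Lp_norm_powr)
  from tendsto_L1_AE_subseq[OF _ this]
  obtain r where r: "strict_mono r" "AE x in lebesgue. (\<lambda>i. norm (f x - u (r i) x) powr p) \<longlonglongrightarrow> 0"
    using Lp_spaceD[OF Lp_space_diff[OF p f u]] by auto
  have "AE x in lebesgue. (\<lambda>i. u (r i) x) \<longlonglongrightarrow> f x"
    using r(2)
  proof (rule AE_mp, intro AE_I2 impI)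
    fix x assume "(\<lambda>i. norm (f x - u (r i) x) powr p) \<longlonglongrightarrow> 0"
    from tendsto_zero_powrI[OF this tendsto_const, of "1 / p"]
    have "(\<lambda>i. (norm (f x - u (r i) x) powr p) powr (1 / p)) \<longlonglongrightarrow> 0" using p0 by simp
    hence "(\<lambda>i. norm (f x - u (r i) x)) \<longlonglongrightarrow> 0" using p0 by (simp add: powr_powr)
    hence "(\<lambda>i. norm (u (r i) x - f x)) \<longlonglongrightarrow> 0" by (simp only: norm_minus_commute)
    hence "(\<lambda>i. u (r i) x - f x) \<longlonglongrightarrow> 0" by (simp only: tendsto_norm_zero_iff)
    thus "(\<lambda>i. u (r i) x) \<longlonglongrightarrow> f x" by (simp add: LIM_zero_iff)
  qed
  thus ?thesis using r(1) by blast
qed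

text \<open>Limits in two different spaces are compared through almost everywhere convergent
  subsequences. This is what makes the extensions of \<open>T\<close> for different exponents
  agree.\<close>

lemma Lp_limit_unique:
  assumes "1 \<le> p" "1 \<le> q" "\<And>i. u i \<in> Lp_space p" "\<And>i. u i \<in> Lp_space q"
    and "f \<in> Lp_space p" "g \<in> Lp_space q"
    and "Lp_tendsto p u f" "Lp_tendsto q u g"
  shows "AE x in lebesgue. f x = g x"
proof -
  obtain r where r: "strict_mono r" "AE x in lebesgue. (\<lambda>i. u (r i) x) \<longlonglongrightarrow> f x"
    using Lp_limit_subseq[OF assms(1,3,5,7)] by blast
  have "Lp_tendsto q (\<lambda>i. u (r i)) g"
    using LIMSEQ_subseq_LIMSEQ[OF assms(8) r(1)] by (simp add: o_def)
  from Lp_limit_subseq[OF assms(2,4,6) this]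
  obtain r' where r': "strict_mono r'" "AE x in lebesgue. (\<lambda>i. u (r (r' i)) x) \<longlonglongrightarrow> g x" by auto
  show ?thesis using r(2) r'(2)
  proof (rule AE_mp[OF _ AE_mp], intro AE_I2 impI)
    fix x assume "(\<lambda>i. u (r i) x) \<longlonglongrightarrow> f x" and g: "(\<lambda>i. u (r (r' i)) x) \<longlonglongrightarrow> g x"
    hence "(\<lambda>i. u (r (r' i)) x) \<longlonglongrightarrow> f x" using LIMSEQ_subseq_LIMSEQ[OF _ r'(1)] by (fastforce simp: o_def)
    thus "f x = g x" using g LIMSEQ_unique by blast
  qed
qed

text \<open>Uniform bounds on approximants give both membership and norm bound of a pointwise limit,
  for which integrability is not known beforehand.\<close>

lemma
  assumes p: "1 \<le> p" and u: "\<And>i. u i \<in> Lp_space p" and f: "f \<in> borel_measurable lebesgue"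
    and lim: "AE x in lebesgue. (\<lambda>i. u i x) \<longlonglongrightarrow> f x" and bound: "\<And>i. Lp_norm p (u i) \<le> C"
  shows Lp_space_Fatou: "f \<in> Lp_space p" and Lp_norm_Fatou: "Lp_norm p f \<le> C"
proof -
  have p0: "0 < p" using p by simp
  have C: "0 \<le> C" using order_trans[OF Lp_norm_nonneg bound] .
  have "(\<integral>\<^sup>+x. ennreal (norm (f x) powr p) \<partial>lebesgue) = (\<integral>\<^sup>+x. liminf (\<lambda>i. ennreal (norm (u i x) powr p)) \<partial>lebesgue)"
  proof (rule nn_integral_cong_AE, rule AE_mp[OF lim], intro AE_I2 impI)
    fix x assume "(\<lambda>i. u i x) \<longlonglongrightarrow> f x"
    hence "(\<lambda>i. ennreal (norm (u i x) powr p)) \<longlonglongrightarrow> ennreal (norm (f x) powr p)"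
      using p0 by (intro tendsto_intros tendsto_powr2) auto
    thus "ennreal (norm (f x) powr p) = liminf (\<lambda>i. ennreal (norm (u i x) powr p))"
      using lim_imp_Liminf[OF sequentially_bot] by metis
  qed
  also have "\<dots> \<le> liminf (\<lambda>i. \<integral>\<^sup>+x. ennreal (norm (u i x) powr p) \<partial>lebesgue)"
    by (rule nn_integral_liminf) (use Lp_spaceD[OF u] in measurable)
  also have "\<dots> \<le> liminf (\<lambda>i. ennreal (C powr p))"
  proof (rule Liminf_mono, intro always_eventually allI)
    fix i
    have "(\<integral>\<^sup>+x. ennreal (norm (u i x) powr p) \<partial>lebesgue) = ennreal (LINT x|lebesgue. norm (u i x) powr p)"
      by (rule nn_integral_eq_integral) (use Lp_spaceD[OF u] in auto)
    also have "\<dots> \<le> ennreal (C powr p)" using bound[of i] C p0 by (intro ennreal_leI) (simp add: Lp_norm_le_iff)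
    finally show "(\<integral>\<^sup>+x. ennreal (norm (u i x) powr p) \<partial>lebesgue) \<le> ennreal (C powr p)" .
  qed
  also have "\<dots> = ennreal (C powr p)" by (simp add: Liminf_const)
  finally have le: "(\<integral>\<^sup>+x. ennreal (norm (f x) powr p) \<partial>lebesgue) \<le> ennreal (C powr p)" .
  have int: "integrable lebesgue (\<lambda>x. norm (f x) powr p)"
  proof (rule integrableI_bounded)
    show "(\<integral>\<^sup>+x. ennreal (norm (norm (f x) powr p)) \<partial>lebesgue) < \<infinity>" using le_less_trans[OF le] by simp
  qed (use f in measurable)
  thus "f \<in> Lp_space p" using f by (simp add: Lp_space_def)
  have "(\<integral>\<^sup>+x. ennreal (norm (f x) powr p) \<partial>lebesgue) = ennreal (LINT x|lebesgue. norm (f x) powr p)"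
    by (rule nn_integral_eq_integral[OF int]) auto
  thus "Lp_norm p f \<le> C" using le C p0 by (simp add: Lp_norm_le_iff)
qed

text \<open>Riesz-Fischer with a tail estimate. The partial sums of the moduli increase and are
  bounded in norm, so monotone convergence makes them bounded at almost every point. Each tail is a
  pointwise limit of finite blocks, and Fatou's lemma transfers their norm bound. The tail estimate
  later lets functionals pass through the series.\<close>

lemma Lp_series:
  assumes p: "1 \<le> p" and f: "\<And>i. f i \<in> Lp_space p" and summ: "summable (\<lambda>i. Lp_norm p (f i))"
  shows "AE x in lebesgue. summable (\<lambda>i. norm (f i x))"
    and "(\<lambda>x. \<Sum>i. f i x) \<in> Lp_space p"
    and "Lp_norm p (\<lambda>x. (\<Sum>i. f i x) - (\<Sum>i<N. f i x)) \<le> (\<Sum>i. Lp_norm p (f (i + N)))"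
proof -
  have p0: "0 < p" using p by simp
  note m [measurable] = Lp_spaceD(1)[OF f]
  define S where "S = (\<Sum>i. Lp_norm p (f i))"
  have S0: "0 \<le> S" unfolding S_def by (intro suminf_nonneg summ Lp_norm_nonneg)
  define G where "G N x = (\<Sum>i<N. norm (f i x))" for N x
  have G0: "0 \<le> G N x" for N x by (simp add: G_def sum_nonneg)
  have Gm [measurable]: "G N \<in> borel_measurable lebesgue" for N unfolding G_def by measurable
  have Gint: "(\<integral>\<^sup>+x. ennreal (G N x powr p) \<partial>lebesgue) \<le> ennreal (S powr p)" for N
  proof -
    have cf: "(\<lambda>x. complex_of_real (norm (f i x))) \<in> Lp_space p" for i
      by (rule Lp_space_dominated[OF p0 f[of i]]) auto
    have cn: "Lp_norm p (\<lambda>x. complex_of_real (norm (f i x))) = Lp_norm p (f i)" for i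
      by (simp add: Lp_norm_eq)
    have Gs: "(\<lambda>x. \<Sum>i<N. complex_of_real (norm (f i x))) \<in> Lp_space p"
      by (rule Lp_space_sum[OF p cf])
    have eq: "norm (\<Sum>i<N. complex_of_real (norm (f i x))) = G N x" for x
      using G0[of N x] unfolding G_def of_real_sum[symmetric] norm_of_real by simp
    have "Lp_norm p (\<lambda>x. \<Sum>i<N. complex_of_real (norm (f i x))) \<le> (\<Sum>i<N. Lp_norm p (f i))"
      by (rule order_trans[OF Lp_norm_sum[OF p cf]]) (simp add: cn)
    also have "\<dots> \<le> S" unfolding S_def by (rule sum_le_suminf[OF summ]) (auto simp: Lp_norm_nonneg)
    finally have "(LINT x|lebesgue. G N x powr p) \<le> S powr p"
      using S0 p0 by (simp add: Lp_norm_le_iff eq)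
    moreover have "integrable lebesgue (\<lambda>x. G N x powr p)" using Lp_spaceD(2)[OF Gs] by (simp add: eq)
    hence "(\<integral>\<^sup>+x. ennreal (G N x powr p) \<partial>lebesgue) = ennreal (LINT x|lebesgue. G N x powr p)"
      by (rule nn_integral_eq_integral) auto
    ultimately show ?thesis by (simp add: ennreal_leI)
  qed
  have "(\<integral>\<^sup>+x. (SUP N. ennreal (G N x powr p)) \<partial>lebesgue) = (SUP N. \<integral>\<^sup>+x. ennreal (G N x powr p) \<partial>lebesgue)"
  proof (rule nn_integral_monotone_convergence_SUP)
    show "incseq (\<lambda>N x. ennreal (G N x powr p))"
    proof (rule incseq_SucI, rule le_funI, rule ennreal_leI)
      fix N x show "G N x powr p \<le> G (Suc N) x powr p"
        using p0 G0 by (intro powr_mono2) (auto simp: G_def)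
    qed
  qed measurable
  also have "\<dots> \<le> ennreal (S powr p)" by (rule SUP_least) (rule Gint)
  finally have "(\<integral>\<^sup>+x. (SUP N. ennreal (G N x powr p)) \<partial>lebesgue) \<noteq> \<infinity>" by (auto simp: top_unique)
  hence "AE x in lebesgue. (SUP N. ennreal (G N x powr p)) \<noteq> \<infinity>"
    by (intro nn_integral_PInf_AE) measurable
  thus summ_AE: "AE x in lebesgue. summable (\<lambda>i. norm (f i x))"
  proof (rule AE_mp, intro AE_I2 impI)
    fix x assume "(SUP N. ennreal (G N x powr p)) \<noteq> \<infinity>"
    then obtain c where c: "0 \<le> c" "(SUP N. ennreal (G N x powr p)) = ennreal c"
      by (cases "SUP N. ennreal (G N x powr p)") auto
    have "G N x \<le> c powr (1 / p)" for N
    proof -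
      have "ennreal (G N x powr p) \<le> ennreal c" unfolding c(2)[symmetric] by (rule SUP_upper) simp
      hence "G N x powr p \<le> c" using c(1) by simp
      hence "(G N x powr p) powr (1 / p) \<le> c powr (1 / p)" using p0 by (intro powr_mono2) auto
      thus ?thesis using p0 G0 by (simp add: powr_powr)
    qed
    thus "summable (\<lambda>i. norm (f i x))"
      by (intro summableI_nonneg_bounded[where x = "c powr (1 / p)"]) (auto simp: G_def)
  qed
  have Fm [measurable]: "(\<lambda>x. \<Sum>i. f i x) \<in> borel_measurable lebesgue" by measurable
  have tail: "(\<lambda>x. (\<Sum>i. f i x) - (\<Sum>i<N. f i x)) \<in> Lp_space p \<and>
      Lp_norm p (\<lambda>x. (\<Sum>i. f i x) - (\<Sum>i<N. f i x)) \<le> (\<Sum>i. Lp_norm p (f (i + N)))" for N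
  proof -
    have sN: "summable (\<lambda>i. Lp_norm p (f (i + N)))" using summ by (rule summable_ignore_initial_segment)
    have u: "(\<lambda>x. \<Sum>i<K. f (i + N) x) \<in> Lp_space p" for K by (rule Lp_space_sum[OF p]) (rule f)
    have lim: "AE x in lebesgue. (\<lambda>K. \<Sum>i<K. f (i + N) x) \<longlonglongrightarrow> (\<Sum>i. f i x) - (\<Sum>i<N. f i x)"
      using summ_AE
    proof (rule AE_mp, intro AE_I2 impI)
      fix x assume "summable (\<lambda>i. norm (f i x))"
      hence s: "summable (\<lambda>i. f i x)" by (rule summable_norm_cancel)
      hence "summable (\<lambda>i. f (i + N) x)" by (rule summable_ignore_initial_segment)
      from summable_LIMSEQ[OF this] show "(\<lambda>K. \<Sum>i<K. f (i + N) x) \<longlonglongrightarrow> (\<Sum>i. f i x) - (\<Sum>i<N. f i x)"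
        using suminf_minus_initial_segment[OF s, of N] by simp
    qed
    have bound: "Lp_norm p (\<lambda>x. \<Sum>i<K. f (i + N) x) \<le> (\<Sum>i. Lp_norm p (f (i + N)))" for K
    proof -
      have "Lp_norm p (\<lambda>x. \<Sum>i<K. f (i + N) x) \<le> (\<Sum>i<K. Lp_norm p (f (i + N)))"
        by (rule Lp_norm_sum[OF p]) (rule f)
      also have "\<dots> \<le> (\<Sum>i. Lp_norm p (f (i + N)))" by (rule sum_le_suminf[OF sN]) (auto simp: Lp_norm_nonneg)
      finally show ?thesis .
    qed
    have fm: "(\<lambda>x. (\<Sum>i. f i x) - (\<Sum>i<N. f i x)) \<in> borel_measurable lebesgue" by measurable
    show ?thesis using Lp_space_Fatou[OF p u fm lim bound] Lp_norm_Fatou[OF p u fm lim bound] by blast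
  qed
  from tail[of 0] show "(\<lambda>x. \<Sum>i. f i x) \<in> Lp_space p" by simp
  from tail[of N] show "Lp_norm p (\<lambda>x. (\<Sum>i. f i x) - (\<Sum>i<N. f i x)) \<le> (\<Sum>i. Lp_norm p (f (i + N)))" by simp
qed

text \<open>Geometrically fast Cauchy sequences suffice, because approximants are chosen with error
  (1 / 2)^i; their increments form a norm-summable series.\<close>

lemma Lp_complete:
  assumes p: "1 \<le> p" and u: "\<And>i. u i \<in> Lp_space p"
    and fast: "\<And>i. Lp_norm p (\<lambda>x. u (Suc i) x - u i x) \<le> C * (1 / 2) ^ i"
  shows "\<exists>F\<in>Lp_space p. Lp_tendsto p u F"
proof -
  define d where "d i = (\<lambda>x. u (Suc i) x - u i x)" for i
  have d: "d i \<in> Lp_space p" for i unfolding d_def by (rule Lp_space_diff[OF p u u])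
  have summ: "summable (\<lambda>i. Lp_norm p (d i))"
    by (rule summable_comparison_test[OF _ summable_mult[OF summable_geometric[of "1 / 2 :: real"], of C]])
      (use fast in \<open>auto simp: d_def Lp_norm_nonneg\<close>)
  define F where "F x = u 0 x + (\<Sum>i. d i x)" for x
  have F: "F \<in> Lp_space p" unfolding F_def by (rule Lp_space_add[OF p u Lp_series(2)[OF p d summ]])
  have "Lp_tendsto p u F"
  proof (rule tendsto_sandwich[OF _ _ tendsto_const])
    show "(\<lambda>N. \<Sum>i. Lp_norm p (d (i + N))) \<longlonglongrightarrow> 0" by (rule suminf_exist_split2[OF summ])
    have "F x - u N x = (\<Sum>i. d i x) - (\<Sum>i<N. d i x)" for N x
      unfolding F_def d_def by (subst sum_lessThan_telescope) simp
    thus "\<forall>\<^sub>F N in sequentially. Lp_norm p (\<lambda>x. F x - u N x) \<le> (\<Sum>i. Lp_norm p (d (i + N)))"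
      using Lp_series(3)[OF p d summ] by simp
  qed (simp add: Lp_norm_nonneg)
  thus ?thesis using F by blast
qed

section \<open>Test functions\<close>

text \<open>The derivative is quantified inside the recursion; in this form sums, products and
  affine substitutions go through by induction on the order.\<close>

fun times_differentiable :: "nat \<Rightarrow> (real \<Rightarrow> real) \<Rightarrow> bool"
  where "times_differentiable 0 f \<longleftrightarrow> True"
  | "times_differentiable (Suc k) f \<longleftrightarrow> (\<exists>f'. (\<forall>x. (f has_real_derivative f' x) (at x)) \<and> times_differentiable k f')"

lemma times_differentiable_pred: "times_differentiable (Suc k) f \<Longrightarrow> times_differentiable k f"
proof (induction k arbitrary: f)
  case (Suc k)
  then obtain f' where "\<forall>x. (f has_real_derivative f' x) (at x)" "times_differentiable (Suc k) f'"
    by (meson times_differentiable.simps(2))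
  thus ?case using Suc.IH by auto
qed simp

lemma times_differentiable_add:
  "times_differentiable k f \<Longrightarrow> times_differentiable k g \<Longrightarrow> times_differentiable k (\<lambda>x. f x + g x)"
proof (induction k arbitrary: f g)
  case (Suc k)
  then obtain f' g' where "\<forall>x. (f has_real_derivative f' x) (at x)" "times_differentiable k f'"
    "\<forall>x. (g has_real_derivative g' x) (at x)" "times_differentiable k g'" by auto
  thus ?case using Suc.IH by (auto intro!: exI[of _ "\<lambda>x. f' x + g' x"] DERIV_add)
qed simp

lemma times_differentiable_mult:
  "times_differentiable k f \<Longrightarrow> times_differentiable k g \<Longrightarrow> times_differentiable k (\<lambda>x. f x * g x)"
proof (induction k arbitrary: f g)
  case (Suc k)
  then obtain f' g' where *: "\<forall>x. (f has_real_derivative f' x) (at x)" "times_differentiable k f'"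
    "\<forall>x. (g has_real_derivative g' x) (at x)" "times_differentiable k g'" by auto
  have "times_differentiable k (\<lambda>x. f' x * g x + g' x * f x)"
    using Suc * times_differentiable_pred by (intro times_differentiable_add Suc.IH) auto
  thus ?case using * by (auto intro!: exI[of _ "\<lambda>x. f' x * g x + g' x * f x"] DERIV_mult)
qed simp

lemma times_differentiable_affine:
  "times_differentiable k f \<Longrightarrow> times_differentiable k (\<lambda>x. s * f (a * x + b))"
proof (induction k arbitrary: f s)
  case (Suc k)
  then obtain f' where *: "\<forall>x. (f has_real_derivative f' x) (at x)" "times_differentiable k f'" by auto
  have "((\<lambda>x. s * f (a * x + b)) has_real_derivative (s * a) * f' (a * x + b)) (at x)" for x
  proof -
    have "((\<lambda>x. f (a * x + b)) has_real_derivative f' (a * x + b) * a) (at x)"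
      by (rule DERIV_chain2[where f = f]) (use * in \<open>auto intro!: derivative_eq_intros\<close>)
    thus ?thesis by (auto intro!: derivative_eq_intros)
  qed
  moreover have "times_differentiable k (\<lambda>x. (s * a) * f' (a * x + b))" by (rule Suc.IH[OF *(2)])
  ultimately show ?case by (auto intro!: exI[of _ "\<lambda>x. (s * a) * f' (a * x + b)"])
qed simp

definition smooth_real :: "(real \<Rightarrow> real) \<Rightarrow> bool"
  where "smooth_real f \<longleftrightarrow> (\<forall>k. times_differentiable k f)"

text \<open>Each order comes with its own witness for the derivative; uniqueness of derivatives
  makes all of them the same function.\<close>

lemma smooth_real_derivative:
  assumes "smooth_real f"
  obtains f' where "\<And>x. (f has_real_derivative f' x) (at x)" "smooth_real f'"
proof -
  have 1: "times_differentiable (Suc k) f" for k using assms by (simp add: smooth_real_def)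
  from 1[of 0] obtain f' where f': "\<And>x. (f has_real_derivative f' x) (at x)" by auto
  have "times_differentiable k f'" for k
  proof -
    obtain g where g: "\<And>x. (f has_real_derivative g x) (at x)" "times_differentiable k g" using 1[of k] by auto
    have "g = f'" using DERIV_unique[OF g(1) f'] by blast
    thus ?thesis using g(2) by simp
  qed
  hence "smooth_real f'" by (simp add: smooth_real_def)
  thus ?thesis using that f' by blast
qed

lemma smooth_real_mult: "smooth_real f \<Longrightarrow> smooth_real g \<Longrightarrow> smooth_real (\<lambda>x. f x * g x)"
  by (simp add: smooth_real_def times_differentiable_mult)

lemma smooth_real_affine: "smooth_real f \<Longrightarrow> smooth_real (\<lambda>x. f (a * x + b))"
  using times_differentiable_affine[of _ f 1 a b] by (simp add: smooth_real_def)

text \<open>The single function exp(-1 / x), continued by 0, is enlarged by polynomial factors in 1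
  / x in order to obtain a family that is closed under differentiation.\<close>

definition flat_exp :: "real poly \<Rightarrow> real \<Rightarrow> real"
  where "flat_exp q x = (if 0 < x then poly q (1 / x) * exp (- (1 / x)) else 0)"

lemma flat_exp_tendsto_0: "(flat_exp q \<longlongrightarrow> 0) (at 0)"
proof -
  have "((\<lambda>t. poly q t * exp (- t)) \<longlongrightarrow> 0) at_top"
  proof -
    have "((\<lambda>t. \<Sum>i\<le>degree q. coeff q i * (t ^ i / exp t)) \<longlongrightarrow> (\<Sum>i\<le>degree q. coeff q i * 0)) at_top"
      by (intro tendsto_sum tendsto_mult tendsto_const tendsto_power_div_exp_0)
    moreover have "(\<Sum>i\<le>degree q. coeff q i * (t ^ i / exp t)) = poly q t * exp (- t)" for t
      unfolding poly_altdef sum_distrib_right by (rule sum.cong) (simp_all add: exp_minus divide_inverse)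
    ultimately show ?thesis by simp
  qed
  hence "((\<lambda>x. poly q (inverse x) * exp (- inverse x)) \<longlongrightarrow> 0) (at_right 0)"
    by (rule filterlim_compose[OF _ filterlim_inverse_at_top_right])
  moreover have "eventually (\<lambda>x. poly q (inverse x) * exp (- inverse x) = flat_exp q x) (at_right 0)"
    by (auto simp: flat_exp_def inverse_eq_divide eventually_at_right[of 0 1] intro!: exI[of _ 1])
  ultimately have r: "(flat_exp q \<longlongrightarrow> 0) (at_right 0)" by (rule Lim_transform_eventually)
  have "eventually (\<lambda>x. 0 = flat_exp q x) (at_left 0)"
    by (auto simp: flat_exp_def eventually_at_left[of "-1" 0] intro!: exI[of _ "-1"])
  from Lim_transform_eventually[OF tendsto_const this] have "(flat_exp q \<longlongrightarrow> 0) (at_left 0)" .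
  with r show ?thesis by (simp add: filterlim_at_split)
qed

text \<open>By the chain rule both the polynomial and the exponential contribute a factor of size 1
  / x^2, which is the polynomial \<open>[:0, 0, 1:]\<close> evaluated at 1 / x.\<close>

lemma flat_exp_derivative:
  "(flat_exp q has_real_derivative flat_exp ([:0, 0, 1:] * (q - pderiv q)) x) (at x)"
proof -
  consider "x < 0" | "x = 0" | "0 < x" by linarith
  thus ?thesis
  proof cases
    case 1
    have "((\<lambda>x. 0) has_real_derivative 0) (at x)" by simp
    from has_field_derivative_transform_within_open[OF this, of "{..<0}" "flat_exp q"]
    show ?thesis using 1 by (simp add: flat_exp_def)
  next
    case 2
    \<comment> \<open>At 0 the difference quotient is again a function of the family, with one more
      factor 1 / x in the polynomial, so it tends to 0.\<close>
    have "((\<lambda>h. (flat_exp q (0 + h) - flat_exp q 0) / h) \<longlongrightarrow> 0) (at 0)"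
    proof (rule Lim_transform_eventually[OF flat_exp_tendsto_0[of "pCons 0 q"]])
      show "\<forall>\<^sub>F h in at 0. flat_exp (pCons 0 q) h = (flat_exp q (0 + h) - flat_exp q 0) / h"
        by (rule always_eventually) (simp add: flat_exp_def)
    qed
    thus ?thesis using 2 by (simp add: DERIV_def flat_exp_def)
  next
    case 3
    have "((\<lambda>x. poly q (1 / x) * exp (- (1 / x))) has_real_derivative
        flat_exp ([:0, 0, 1:] * (q - pderiv q)) x) (at x)"
      using 3 by (auto intro!: derivative_eq_intros simp: flat_exp_def power2_eq_square field_simps)
    from has_field_derivative_transform_within_open[OF this, of "{0<..}" "flat_exp q"]
    show ?thesis using 3 by (simp add: flat_exp_def)
  qed
qed

lemma smooth_real_flat_exp: "smooth_real (flat_exp q)"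
proof -
  have "times_differentiable k (flat_exp q)" for k
  proof (induction k arbitrary: q)
    case (Suc k)
    thus ?case using flat_exp_derivative[of q] by auto
  qed simp
  thus ?thesis by (simp add: smooth_real_def)
qed

text \<open>As \<open>N\<close> grows, these functions increase to the indicator of the open unit interval.\<close>

definition unit_bump :: "nat \<Rightarrow> real \<Rightarrow> real"
  where "unit_bump N t = flat_exp 1 (real (Suc N) * t + 0) * flat_exp 1 (- real (Suc N) * t + real (Suc N))"

lemma smooth_real_unit_bump: "smooth_real (unit_bump N)"
  unfolding unit_bump_def by (intro smooth_real_mult smooth_real_affine smooth_real_flat_exp)

lemma unit_bump_range: "0 \<le> unit_bump N t" "unit_bump N t \<le> 1"
proof -
  have "0 \<le> flat_exp 1 x" "flat_exp 1 x \<le> 1" for x by (auto simp: flat_exp_def)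
  thus "0 \<le> unit_bump N t" "unit_bump N t \<le> 1" unfolding unit_bump_def by (auto intro: mult_le_one)
qed

lemma unit_bump_eq_0: "t \<le> 0 \<or> 1 \<le> t \<Longrightarrow> unit_bump N t = 0"
proof -
  assume "t \<le> 0 \<or> 1 \<le> t"
  hence "real (Suc N) * t \<le> 0 \<or> real (Suc N) * 1 \<le> real (Suc N) * t"
    by (meson mult_left_mono mult_nonneg_nonpos of_nat_0_le_iff)
  hence "real (Suc N) * t + 0 \<le> 0 \<or> - real (Suc N) * t + real (Suc N) \<le> 0"
    by (auto simp del: of_nat_Suc)
  thus ?thesis unfolding unit_bump_def flat_exp_def by auto
qed

lemma unit_bump_tendsto: "0 < t \<Longrightarrow> t < 1 \<Longrightarrow> (\<lambda>N. unit_bump N t) \<longlonglongrightarrow> 1"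
proof -
  assume t: "0 < t" "t < 1"
  have one: "(\<lambda>N. flat_exp 1 (real (Suc N) * s)) \<longlonglongrightarrow> 1" if s: "0 < s" for s
  proof -
    have "(\<lambda>N. exp (- (1 / s * inverse (real (Suc N))))) \<longlonglongrightarrow> exp (- (1 / s * 0))"
      by (intro tendsto_intros LIMSEQ_inverse_real_of_nat)
    moreover have "exp (- (1 / s * inverse (real (Suc N)))) = flat_exp 1 (real (Suc N) * s)" for N
      using s by (simp add: flat_exp_def field_simps del: of_nat_Suc)
    ultimately show ?thesis by simp
  qed
  have "(\<lambda>N. flat_exp 1 (real (Suc N) * t) * flat_exp 1 (real (Suc N) * (1 - t))) \<longlonglongrightarrow> 1 * 1"
    using t by (intro tendsto_mult one) auto
  thus ?thesis unfolding unit_bump_def by (simp add: algebra_simps)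
qed

definition product_function :: "('n \<Rightarrow> real \<Rightarrow> real) \<Rightarrow> real ^ 'n \<Rightarrow> complex"
  where "product_function \<psi> x = complex_of_real (\<Prod>i\<in>UNIV. \<psi> i (x $ i))"

lemma product_function_derivative:
  fixes \<psi> :: "'n::finite \<Rightarrow> real \<Rightarrow> real"
  assumes "\<And>i x. (\<psi> i has_real_derivative \<psi>' i x) (at x)"
  shows "product_function \<psi> differentiable (at x)"
    and "partial_deriv j (product_function \<psi>) = product_function (\<psi>(j := \<psi>' j))"
proof -
  have d: "(product_function \<psi> has_derivative
      (\<lambda>y. complex_of_real (\<Sum>i\<in>UNIV. y $ i * \<psi>' i (x $ i) * (\<Prod>j\<in>UNIV - {i}. \<psi> j (x $ j))))) (at x)" for x
  proof -
    have "((\<lambda>x. \<psi> i (x $ i)) has_derivative (\<lambda>y. y $ i * \<psi>' i (x $ i))) (at x)" for i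
    proof -
      have 1: "((\<lambda>x :: real ^ 'n. x $ i) has_derivative (\<lambda>y. y $ i)) (at x)"
        by (rule bounded_linear_imp_has_derivative) (rule bounded_linear_vec_nth)
      have 2: "(\<psi> i has_derivative (\<lambda>y. y * \<psi>' i (x $ i))) (at (x $ i))"
        using assms[of i "x $ i"] by (simp add: has_field_derivative_def mult_commute_abs)
      show ?thesis using has_derivative_compose[OF 1 2] .
    qed
    hence "((\<lambda>x. \<Prod>i\<in>UNIV. \<psi> i (x $ i)) has_derivative
      (\<lambda>y. \<Sum>i\<in>UNIV. y $ i * \<psi>' i (x $ i) * (\<Prod>j\<in>UNIV - {i}. \<psi> j (x $ j)))) (at x)"
      by (rule has_derivative_prod)
    from has_derivative_of_real[OF this] show ?thesis unfolding product_function_def[abs_def] .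
  qed
  show "product_function \<psi> differentiable (at x)" using d by (rule differentiableI)
  show "partial_deriv j (product_function \<psi>) = product_function (\<psi>(j := \<psi>' j))"
  proof
    fix x
    have "partial_deriv j (product_function \<psi>) x
        = complex_of_real (\<Sum>i\<in>UNIV. axis j 1 $ i * \<psi>' i (x $ i) * (\<Prod>j\<in>UNIV - {i}. \<psi> j (x $ j)))"
      unfolding partial_deriv_def frechet_derivative_at[OF d, symmetric] ..
    also have "(\<Sum>i\<in>UNIV. axis j 1 $ i * \<psi>' i (x $ i) * (\<Prod>j\<in>UNIV - {i}. \<psi> j (x $ j)))
        = \<psi>' j (x $ j) * (\<Prod>j\<in>UNIV - {j}. \<psi> j (x $ j))"
      by (subst sum.remove[of _ j]) (auto simp: axis_def intro!: sum.neutral)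
    also have "\<dots> = (\<Prod>i\<in>UNIV. (\<psi>(j := \<psi>' j)) i (x $ i))"
      by (subst (2) prod.remove[of _ j]) (auto intro!: prod.cong)
    finally show "partial_deriv j (product_function \<psi>) x = product_function (\<psi>(j := \<psi>' j)) x"
      unfolding product_function_def[of "\<psi>(j := \<psi>' j)"] .
  qed
qed

text \<open>A partial derivative differentiates one factor and leaves a function of the same product
  form, so the induction over the list of directions closes.\<close>

lemma smooth_product_function:
  assumes "\<And>i. smooth_real (\<psi> i)" shows "smooth (product_function \<psi>)"
proof -
  have "\<exists>\<psi>'. (\<forall>i. smooth_real (\<psi>' i)) \<and> partial_derivs is (product_function \<psi>) = product_function \<psi>'" for "is"
  proof (induction "is")
    case Nil
    thus ?case using assms by (auto simp: partial_derivs_def)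
  next
    case (Cons j js)
    then obtain \<psi>' where \<psi>': "\<And>i. smooth_real (\<psi>' i)" "partial_derivs js (product_function \<psi>) = product_function \<psi>'" by auto
    have "\<forall>i. \<exists>d. (\<forall>x. (\<psi>' i has_real_derivative d x) (at x)) \<and> smooth_real d"
      using smooth_real_derivative[OF \<psi>'(1)] by metis
    then obtain D where D: "\<And>i x. (\<psi>' i has_real_derivative D i x) (at x)" "\<And>i. smooth_real (D i)" by metis
    have "partial_derivs (j # js) (product_function \<psi>) = product_function (\<psi>'(j := D j))"
      using product_function_derivative(2)[of \<psi>' D, OF D(1)] \<psi>'(2) by (simp add: partial_derivs_def)
    moreover have "\<forall>i. smooth_real ((\<psi>'(j := D j)) i)" using \<psi>'(1) D(2) by simp
    ultimately show ?case by blast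
  qed
  moreover have "product_function \<psi>' differentiable (at x)" if "\<And>i. smooth_real (\<psi>' i)" for \<psi>' x
  proof -
    have "\<forall>i. \<exists>d. (\<forall>x. (\<psi>' i has_real_derivative d x) (at x))"
      using smooth_real_derivative[OF that] by metis
    then obtain D where "\<And>i x. (\<psi>' i has_real_derivative D i x) (at x)" by metis
    thus ?thesis by (rule product_function_derivative(1))
  qed
  ultimately show ?thesis unfolding smooth_def by metis
qed

lemma partial_derivs_linear:
  assumes "smooth f" "smooth g"
  shows "partial_derivs is (\<lambda>x. c * f x + d * g x) = (\<lambda>x. c * partial_derivs is f x + d * partial_derivs is g x)"
proof (induction "is")
  case (Cons j js)
  let ?f = "partial_derivs js f" and ?g = "partial_derivs js g"
  have diff: "?f differentiable (at x)" "?g differentiable (at x)" for x using assms by (auto simp: smooth_def)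
  have "partial_derivs (j # js) (\<lambda>x. c * f x + d * g x) = partial_deriv j (\<lambda>x. c * ?f x + d * ?g x)"
    using Cons by (simp add: partial_derivs_def)
  also have "\<dots> = (\<lambda>x. c * partial_deriv j ?f x + d * partial_deriv j ?g x)"
  proof
    fix x
    note D = diff[of x, unfolded frechet_derivative_works]
    have "((\<lambda>x. c * ?f x + d * ?g x) has_derivative
        (\<lambda>y. c * frechet_derivative ?f (at x) y + d * frechet_derivative ?g (at x) y)) (at x)"
      by (intro has_derivative_add has_derivative_mult_right D)
    from frechet_derivative_at[OF this, symmetric]
    show "partial_deriv j (\<lambda>x. c * ?f x + d * ?g x) x = c * partial_deriv j ?f x + d * partial_deriv j ?g x"
      unfolding partial_deriv_def by simp
  qed
  finally show ?case by (simp add: partial_derivs_def)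
qed (simp add: partial_derivs_def)

lemma smooth_linear:
  assumes "smooth f" "smooth g" shows "smooth (\<lambda>x. c * f x + d * g x)"
  unfolding smooth_def partial_derivs_linear[OF assms] using assms
  by (auto simp: smooth_def intro!: derivative_intros)

lemma test_functions_iff: "f \<in> test_functions \<longleftrightarrow> smooth f \<and> bounded {x. f x \<noteq> 0}"
  by (simp add: test_functions_def compact_closure)

lemma test_functions_linear:
  assumes "f \<in> test_functions" "g \<in> test_functions" shows "(\<lambda>x. c * f x + d * g x) \<in> test_functions"
proof -
  have "bounded {x. c * f x + d * g x \<noteq> 0}"
    by (rule bounded_subset[of "{x. f x \<noteq> 0} \<union> {x. g x \<noteq> 0}"]) (use assms in \<open>auto simp: test_functions_iff\<close>)
  thus ?thesis using assms smooth_linear by (auto simp: test_functions_iff)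
qed

lemma zero_test_function: "(\<lambda>x. 0) \<in> test_functions"
proof -
  have "smooth_real (\<lambda>x. 0)"
  proof -
    have "times_differentiable k (\<lambda>x. 0)" for k by (induction k) (auto intro!: exI[of _ "\<lambda>x. 0"])
    thus ?thesis by (simp add: smooth_real_def)
  qed
  from smooth_product_function[of "\<lambda>i. \<lambda>x. 0", OF this] show ?thesis
    by (simp add: test_functions_iff product_function_def[abs_def] power_0_left)
qed

lemma test_functions_sum:
  "(\<And>i. i \<in> I \<Longrightarrow> f i \<in> test_functions) \<Longrightarrow> (\<lambda>x. \<Sum>i\<in>I. c i * f i x) \<in> test_functions"
proof (induction I rule: infinite_finite_induct)
  case (insert i I)
  thus ?case using test_functions_linear[of "f i" "\<lambda>x. \<Sum>i\<in>I. c i * f i x" "c i" 1] by simp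
qed (simp_all add: zero_test_function)

lemma test_function_continuous: "f \<in> test_functions \<Longrightarrow> continuous_on UNIV (partial_derivs is f)"
  unfolding test_functions_def smooth_def
  by (auto intro!: continuous_at_imp_continuous_on differentiable_imp_continuous_within)

lemma test_function_partial_derivs_support:
  assumes "f \<in> test_functions" "x \<notin> closure {x. f x \<noteq> 0}" shows "partial_derivs is f x = 0"
  using assms(2)
proof (induction "is" arbitrary: x)
  case Nil
  thus ?case using closure_subset[of "{x. f x \<noteq> 0}"] by (auto simp: partial_derivs_def)
next
  case (Cons j js)
  have "((\<lambda>x. 0) has_derivative (\<lambda>x. 0)) (at x)" by simp
  hence "(partial_derivs js f has_derivative (\<lambda>x. 0)) (at x)"
    by (rule has_derivative_transform_within_open[of _ _ _ _ "- closure {x. f x \<noteq> 0}"])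
      (use Cons in \<open>auto simp: open_Compl\<close>)
  from frechet_derivative_at[OF this, symmetric] show ?case
    by (simp add: partial_derivs_def partial_deriv_def)
qed

lemma test_function_weighted_bounded:
  assumes "f \<in> test_functions" shows "bounded (range (\<lambda>x. (1 + norm x) ^ k *\<^sub>R partial_derivs is f x))"
proof -
  let ?S = "closure {x. f x \<noteq> 0}" and ?g = "\<lambda>x. (1 + norm x) ^ k *\<^sub>R partial_derivs is f x"
  have "continuous_on ?S ?g"
    by (intro continuous_intros continuous_on_subset[OF test_function_continuous[OF assms]]) auto
  moreover have "compact ?S" using assms by (simp add: test_functions_def)
  ultimately have "bounded (?g ` ?S)" by (intro compact_imp_bounded compact_continuous_image)
  moreover have "range ?g \<subseteq> insert 0 (?g ` ?S)"
  proof
    fix y assume "y \<in> range ?g"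
    then obtain x where "y = ?g x" by blast
    thus "y \<in> insert 0 (?g ` ?S)" using test_function_partial_derivs_support[OF assms, of x] by (cases "x \<in> ?S") auto
  qed
  ultimately show ?thesis by (meson bounded_insert bounded_subset)
qed

lemma test_function_is_schwartz: "f \<in> test_functions \<Longrightarrow> f \<in> schwartz_space"
  using test_function_weighted_bounded by (auto simp: schwartz_space_def test_functions_def)

section \<open>Dyadic cells and density of test functions\<close>

lemma borel_set_lebesgue: "A \<in> sets borel \<Longrightarrow> A \<in> sets (lebesgue :: 'a::euclidean_space measure)"
  by (rule sets_completionI_sets) simp

lemma continuous_measurable_lebesgue:
  fixes f :: "'a::euclidean_space \<Rightarrow> 'b::euclidean_space"
  shows "continuous_on UNIV f \<Longrightarrow> f \<in> borel_measurable lebesgue"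
  by (rule measurable_completion) (simp add: borel_measurable_continuous_onI)

text \<open>Half-open, so that at each level every point lies in exactly one cell, the one named by
  \<open>cell_index\<close>.\<close>

definition cell :: "nat \<Rightarrow> int ^ 'n \<Rightarrow> (real ^ 'n) set"
  where "cell j m = {x. \<forall>i. real_of_int (m $ i) \<le> 2 ^ j * x $ i \<and> 2 ^ j * x $ i < real_of_int (m $ i) + 1}"

definition cell_index :: "nat \<Rightarrow> real ^ 'n \<Rightarrow> int ^ 'n"
  where "cell_index j x = (\<chi> i. \<lfloor>2 ^ j * x $ i\<rfloor>)"

definition cell_corner :: "nat \<Rightarrow> int ^ 'n \<Rightarrow> real ^ 'n"
  where "cell_corner j m = (\<chi> i. real_of_int (m $ i) / 2 ^ j)"

definition cell_bump :: "nat \<Rightarrow> nat \<Rightarrow> int ^ 'n \<Rightarrow> real ^ 'n \<Rightarrow> complex"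
  where "cell_bump N j m = product_function (\<lambda>i t. unit_bump N (2 ^ j * t + (- real_of_int (m $ i))))"

text \<open>Indices of the level-j cells that tile the half-open cube of half edge \<open>R\<close>;
  no cell sticks out because \<open>R\<close> is an integer.\<close>

definition grid :: "nat \<Rightarrow> nat \<Rightarrow> (int ^ 'n) set"
  where "grid j R = {m. \<forall>i. m $ i \<in> {- int R * 2 ^ j ..< int R * 2 ^ j}}"

lemma cell_iff: "x \<in> cell j m \<longleftrightarrow> cell_index j x = m"
  unfolding cell_def cell_index_def vec_eq_iff by (auto simp: floor_eq_iff)

lemma finite_grid: "finite (grid j R)"
  unfolding grid_def by (rule card_vec_box) auto

lemma cell_index_in_grid: "cell_index j x \<in> grid j R \<longleftrightarrow> (\<forall>i. x $ i \<in> {- real R ..< real R})"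
proof -
  have "\<lfloor>2 ^ j * t\<rfloor> \<in> {- int R * 2 ^ j ..< int R * 2 ^ j} \<longleftrightarrow> t \<in> {- real R ..< real R}" for t
  proof -
    have "- int R * 2 ^ j \<le> \<lfloor>2 ^ j * t\<rfloor> \<longleftrightarrow> real_of_int (- int R * 2 ^ j) \<le> 2 ^ j * t" by (rule le_floor_iff)
    also have "\<dots> \<longleftrightarrow> 2 ^ j * (- real R) \<le> 2 ^ j * t" by (simp add: mult.commute)
    also have "\<dots> \<longleftrightarrow> - real R \<le> t" by (subst mult_le_cancel_left_pos) auto
    finally have 1: "- int R * 2 ^ j \<le> \<lfloor>2 ^ j * t\<rfloor> \<longleftrightarrow> - real R \<le> t" .
    have "\<lfloor>2 ^ j * t\<rfloor> < int R * 2 ^ j \<longleftrightarrow> 2 ^ j * t < real_of_int (int R * 2 ^ j)" by (rule floor_less_iff)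
    also have "\<dots> \<longleftrightarrow> 2 ^ j * t < 2 ^ j * real R" by (simp add: mult.commute)
    also have "\<dots> \<longleftrightarrow> t < real R" by (subst mult_less_cancel_left_pos) auto
    finally show ?thesis using 1 by simp
  qed
  thus ?thesis unfolding grid_def cell_index_def by simp
qed

lemma cell_corner_close: "\<bar>cell_corner j (cell_index j x) $ i - x $ i\<bar> \<le> 1 / 2 ^ j"
proof -
  have "real_of_int \<lfloor>2 ^ j * x $ i\<rfloor> / 2 ^ j - x $ i = (real_of_int \<lfloor>2 ^ j * x $ i\<rfloor> - 2 ^ j * x $ i) / 2 ^ j"
    by (simp add: diff_divide_distrib)
  also have "\<bar>\<dots>\<bar> \<le> 1 / 2 ^ j" unfolding abs_divide by (intro frac_le) (auto, linarith+)
  finally show ?thesis by (simp add: cell_corner_def cell_index_def)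
qed

lemma norm_le_component_bound:
  fixes x :: "real ^ 'n"
  assumes "\<And>i. \<bar>x $ i\<bar> \<le> c" shows "norm x \<le> real CARD('n) * c"
proof -
  have "norm x \<le> (\<Sum>i\<in>UNIV. \<bar>x $ i\<bar>)" by (rule norm_le_l1_cart)
  also have "\<dots> \<le> (\<Sum>i\<in>(UNIV :: 'n set). c)" by (rule sum_mono) (rule assms)
  finally show ?thesis by simp
qed

lemma cell_corner_dist:
  fixes x :: "real ^ 'n"
  shows "x \<in> cell j m \<Longrightarrow> dist (cell_corner j m) x \<le> real CARD('n) / 2 ^ j"
  using norm_le_component_bound[of "cell_corner j m - x" "1 / 2 ^ j"] cell_corner_close[of j x]
  by (simp add: cell_iff dist_norm)

lemma mesh_tendsto_0: "(\<lambda>j. c / 2 ^ j :: real) \<longlonglongrightarrow> 0"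
proof -
  have "(\<lambda>j. c * (1 / 2) ^ j :: real) \<longlonglongrightarrow> c * 0" by (intro tendsto_intros LIMSEQ_power_zero) simp
  thus ?thesis by (simp add: power_divide)
qed

lemma cell_corner_tendsto: "(\<lambda>j. cell_corner j (cell_index j x)) \<longlonglongrightarrow> (x :: real ^ 'n)"
proof (rule metric_LIMSEQ_I)
  fix e :: real assume "0 < e"
  then obtain J where J: "\<And>j. J \<le> j \<Longrightarrow> real CARD('n) / 2 ^ j < e"
    using order_tendstoD(2)[OF mesh_tendsto_0] unfolding eventually_sequentially by blast
  have "dist (cell_corner j (cell_index j x)) x \<le> real CARD('n) / 2 ^ j" for j
    by (rule cell_corner_dist) (simp add: cell_iff)
  thus "\<exists>J. \<forall>j\<ge>J. dist (cell_corner j (cell_index j x)) x < e" using J by (meson le_less_trans)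
qed

lemma cell_sets [measurable]: "cell j m \<in> sets lebesgue"
proof -
  have "cell j m \<in> sets borel" unfolding cell_def by measurable
  thus ?thesis by (rule borel_set_lebesgue)
qed

lemma cell_box:
  "box (cell_corner j m) (cell_corner j m + (\<chi> i. 1 / 2 ^ j)) \<subseteq> cell j m"
  "cell j m \<subseteq> cbox (cell_corner j m) (cell_corner j m + (\<chi> i. 1 / 2 ^ j))"
  by (auto simp: cell_def cell_corner_def mem_box_cart field_simps less_imp_le)

lemma
  fixes m :: "int ^ 'n"
  shows cell_lmeasurable: "cell j m \<in> lmeasurable"
    and measure_cell: "measure lebesgue (cell j m) = (1 / 2 ^ j) ^ CARD('n)"
proof -
  let ?a = "cell_corner j m" and ?b = "cell_corner j m + (\<chi> i. 1 / 2 ^ j)"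
  show "cell j m \<in> lmeasurable" by (rule fmeasurableI2[OF lmeasurable_cbox cell_box(2)]) simp
  have "negligible (cbox ?a ?b - cell j m \<union> (cell j m - cbox ?a ?b))"
    by (rule negligible_subset[OF negligible_frontier_interval[of ?a ?b]]) (use cell_box[of j m] in auto)
  from measure_negligible_symdiff[OF lmeasurable_cbox this]
  have "measure lebesgue (cell j m) = measure lborel (cbox ?a ?b)" by simp
  also have "\<dots> = (\<Prod>i\<in>UNIV. ?b $ i - ?a $ i)" by (rule content_cbox_cart) (simp add: interval_ne_empty_cart)
  finally show "measure lebesgue (cell j m) = (1 / 2 ^ j) ^ CARD('n)" by (simp add: power_divide)
qed

lemma cell_bounded: "bounded (cell j m)"
  using bounded_subset[OF bounded_cbox cell_box(2)] .

lemma smooth_cell_bump: "smooth (cell_bump N j m)"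
  unfolding cell_bump_def by (intro smooth_product_function smooth_real_affine smooth_real_unit_bump)

lemma cell_bump_off_cell: "x \<notin> cell j m \<Longrightarrow> cell_bump N j m x = 0"
proof -
  assume "x \<notin> cell j m"
  then obtain i where "\<not> (real_of_int (m $ i) \<le> 2 ^ j * x $ i \<and> 2 ^ j * x $ i < real_of_int (m $ i) + 1)"
    unfolding cell_def by blast
  hence "2 ^ j * x $ i + (- real_of_int (m $ i)) \<le> 0 \<or> 1 \<le> 2 ^ j * x $ i + (- real_of_int (m $ i))"
    by linarith
  hence "unit_bump N (2 ^ j * x $ i + (- real_of_int (m $ i))) = 0" by (rule unit_bump_eq_0)
  thus ?thesis unfolding cell_bump_def product_function_def by (auto simp: prod_zero_iff intro!: bexI[of _ i])
qed

lemma norm_cell_bump_le: "norm (cell_bump N j m x) \<le> indicator (cell j m) x"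
proof (cases "x \<in> cell j m")
  case True
  have "norm (cell_bump N j m x) = (\<Prod>i\<in>UNIV. unit_bump N (2 ^ j * x $ i + (- real_of_int (m $ i))))"
    unfolding cell_bump_def product_function_def norm_of_real by (simp add: prod_nonneg unit_bump_range)
  also have "\<dots> \<le> 1" by (rule prod_le_1) (simp add: unit_bump_range)
  finally show ?thesis using True by simp
qed (simp add: cell_bump_off_cell)

lemma cell_bump_test_function: "cell_bump N j m \<in> test_functions"
proof -
  have "{x. cell_bump N j m x \<noteq> 0} \<subseteq> cell j m" using cell_bump_off_cell by blast
  thus ?thesis using smooth_cell_bump bounded_subset[OF cell_bounded] by (auto simp: test_functions_iff)
qed

text \<open>Convergence fails on the lower faces: they belong to the half-open cell, but every bump
  vanishes on them. They lie in finitely many hyperplanes.\<close>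

lemma cell_bump_tendsto: "AE x in lebesgue. (\<lambda>N. cell_bump N j m x) \<longlonglongrightarrow> indicator (cell j m) (x :: real ^ 'n)"
proof -
  let ?H = "\<Union>i::'n. {x :: real ^ 'n. x $ i = cell_corner j m $ i}"
  have "negligible ?H" by (rule negligible_Union) (auto simp: cart_eq_inner_axis negligible_standard_hyperplane)
  moreover have "(\<lambda>N. cell_bump N j m x) \<longlonglongrightarrow> indicator (cell j m) x" if x: "x \<notin> ?H" for x
  proof (cases "x \<in> cell j m")
    case True
    have "(\<lambda>N. unit_bump N (2 ^ j * x $ i + (- real_of_int (m $ i)))) \<longlonglongrightarrow> 1" for i
    proof (rule unit_bump_tendsto)
      have "x $ i \<noteq> real_of_int (m $ i) / 2 ^ j" using x by (auto simp: cell_corner_def)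
      hence "2 ^ j * x $ i \<noteq> real_of_int (m $ i)" by (auto simp: field_simps)
      moreover have "real_of_int (m $ i) \<le> 2 ^ j * x $ i" "2 ^ j * x $ i < real_of_int (m $ i) + 1"
        using True unfolding cell_def by auto
      ultimately show "0 < 2 ^ j * x $ i + - real_of_int (m $ i)" "2 ^ j * x $ i + - real_of_int (m $ i) < 1"
        by linarith+
    qed
    hence "(\<lambda>N. \<Prod>i\<in>UNIV. unit_bump N (2 ^ j * x $ i + (- real_of_int (m $ i)))) \<longlonglongrightarrow> (\<Prod>i\<in>(UNIV::'n set). 1)"
      by (intro tendsto_prod)
    hence "(\<lambda>N. cell_bump N j m x) \<longlonglongrightarrow> of_real 1"
      unfolding cell_bump_def product_function_def by (intro tendsto_of_real) simp
    thus ?thesis using True by simp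
  qed (simp add: cell_bump_off_cell)
  ultimately show ?thesis unfolding eventually_ae_filter_negligible by blast
qed

lemma bounded_in_Lp_space:
  fixes f :: "real ^ 'n \<Rightarrow> complex"
  assumes p: "0 < p" and f: "f \<in> borel_measurable lebesgue" and B: "\<And>x. norm (f x) \<le> B"
    and S: "bounded S" "\<And>x. x \<notin> S \<Longrightarrow> f x = 0"
  shows "f \<in> Lp_space p"
proof -
  obtain a b where ab: "S \<subseteq> cbox a b" using bounded_subset_cbox_symmetric[OF S(1)] by metis
  have "integrable lebesgue (\<lambda>x. norm (f x) powr p)"
  proof (rule Bochner_Integration.integrable_bound)
    show "integrable lebesgue (\<lambda>x. indicator (cbox a b) x * B powr p)"
      by (intro integrable_mult_left) (simp flip: lmeasurable_iff_integrable)
    show "AE x in lebesgue. norm (norm (f x) powr p) \<le> norm (indicator (cbox a b) x * B powr p)"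
    proof (intro AE_I2)
      fix x show "norm (norm (f x) powr p) \<le> norm (indicator (cbox a b) x * B powr p)"
      proof (cases "x \<in> S")
        case True
        hence "x \<in> cbox a b" using ab by blast
        thus ?thesis using B[of x] p by (simp add: powr_mono2)
      qed (simp add: S(2))
    qed
  qed (use f in measurable)
  thus ?thesis using f by (simp add: Lp_space_def)
qed

lemma test_function_measurable: "f \<in> test_functions \<Longrightarrow> f \<in> borel_measurable lebesgue"
  using test_function_continuous[of f "[]"] by (intro continuous_measurable_lebesgue) (simp add: partial_derivs_def)

lemma test_function_bounded: "f \<in> test_functions \<Longrightarrow> \<exists>B. \<forall>x. norm (f x) \<le> B"
  using test_function_weighted_bounded[of f 0 "[]"] by (auto simp: partial_derivs_def bounded_iff)

lemma test_function_in_Lp_space: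
  assumes "0 < p" "f \<in> test_functions" shows "f \<in> Lp_space p"
proof -
  obtain B where "\<And>x. norm (f x) \<le> B" using test_function_bounded[OF assms(2)] by blast
  thus ?thesis using assms
    by (intro bounded_in_Lp_space[where S = "{x. f x \<noteq> 0}"] test_function_measurable) (auto simp: test_functions_iff)
qed

lemma indicator_cell_in_Lp_space: "0 < p \<Longrightarrow> indicator (cell j m) \<in> Lp_space p"
  by (rule bounded_in_Lp_space[where B = 1 and S = "cell j m"]) (auto simp: cell_bounded indicator_def)

lemma cell_step_in_Lp_space: "1 \<le> p \<Longrightarrow> (\<lambda>x. \<Sum>m\<in>M. c m * indicator (cell j m) x) \<in> Lp_space p"
  by (intro Lp_space_sum Lp_space_scale indicator_cell_in_Lp_space) auto

text \<open>One function has to approximate in two norms at once; separate approximations would not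
  show that the extensions for two exponents agree.\<close>

definition approximable ::
    "real \<Rightarrow> real \<Rightarrow> (real ^ 'n \<Rightarrow> complex) set \<Rightarrow> (real ^ 'n \<Rightarrow> complex) \<Rightarrow> bool"
  where "approximable q s \<A> f \<longleftrightarrow>
    (\<forall>e>0. \<exists>g\<in>\<A>. Lp_norm q (\<lambda>x. f x - g x) < e \<and> Lp_norm s (\<lambda>x. f x - g x) < e)"

text \<open>The passage to the limit common to all stages of the density argument: dominated
  convergence in both norms, with a majorant that lies in both spaces.\<close>

lemma approximable_limit:
  assumes qs: "1 \<le> q" "1 \<le> s" and A: "\<A> \<subseteq> Lp_space q \<inter> Lp_space s"
    and w: "w \<in> Lp_space q" "w \<in> Lp_space s" and u: "\<And>i. u i \<in> borel_measurable lebesgue"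
    and f: "f \<in> borel_measurable lebesgue" and lim: "AE x in lebesgue. (\<lambda>i. u i x) \<longlonglongrightarrow> f x"
    and bound: "\<And>i. AE x in lebesgue. norm (u i x) \<le> norm (w x)"
    and near: "\<And>i. approximable q s \<A> (u i)"
  shows "approximable q s \<A> f"
  unfolding approximable_def
proof (intro allI impI)
  fix e :: real assume e: "0 < e"
  note dq = Lp_dominated_convergence[OF qs(1) w(1) u f lim bound]
  note ds = Lp_dominated_convergence[OF qs(2) w(2) u f lim bound]
  have "\<forall>\<^sub>F i in sequentially. Lp_norm q (\<lambda>x. f x - u i x) < e / 2 \<and> Lp_norm s (\<lambda>x. f x - u i x) < e / 2"
    by (intro eventually_conj order_tendstoD(2)[OF dq(3)] order_tendstoD(2)[OF ds(3)]) (use e in auto)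
  then obtain i where i: "Lp_norm q (\<lambda>x. f x - u i x) < e / 2" "Lp_norm s (\<lambda>x. f x - u i x) < e / 2"
    by (auto simp: eventually_sequentially)
  obtain g where g: "g \<in> \<A>" "Lp_norm q (\<lambda>x. u i x - g x) < e / 2" "Lp_norm s (\<lambda>x. u i x - g x) < e / 2"
    using near[of i] e unfolding approximable_def by (meson half_gt_zero)
  have "Lp_norm q (\<lambda>x. f x - g x) < e"
    using Lp_norm_triangle[OF qs(1) dq(2) dq(1)[of i], of g] i g A by auto
  moreover have "Lp_norm s (\<lambda>x. f x - g x) < e"
    using Lp_norm_triangle[OF qs(2) ds(2) ds(1)[of i], of g] i g A by auto
  ultimately show "\<exists>g\<in>\<A>. Lp_norm q (\<lambda>x. f x - g x) < e \<and> Lp_norm s (\<lambda>x. f x - g x) < e" using g(1) by blast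
qed

lemma approximable_self: "f \<in> \<A> \<Longrightarrow> approximable q s \<A> f"
  unfolding approximable_def by (auto intro!: bexI[of _ f])

text \<open>The lower bound on the level makes the cells as small as the later control of supports
  demands.\<close>

definition cell_steps :: "nat \<Rightarrow> (real ^ 'n \<Rightarrow> complex) set"
  where "cell_steps J = {\<lambda>x. \<Sum>m\<in>M. c m * indicator (cell j m) x | j M c. J \<le> j \<and> finite M}"

definition half_open_cube :: "nat \<Rightarrow> (real ^ 'n) set"
  where "half_open_cube R = {x. \<forall>i. x $ i \<in> {- real R ..< real R}}"

lemma bounded_half_open_cube: "bounded (half_open_cube R :: (real ^ 'n) set)"
  by (rule bounded_subset[OF bounded_cbox[of "\<chi> i. - real R" "\<chi> i. real R"]])
    (auto simp: half_open_cube_def mem_box_cart less_imp_le)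

lemma half_open_cube_sets [measurable]: "half_open_cube R \<in> sets lebesgue"
proof -
  have "half_open_cube R \<in> sets borel" unfolding half_open_cube_def by measurable
  thus ?thesis by (rule borel_set_lebesgue)
qed

lemma norm_less_half_open_cube: "norm x < real R \<Longrightarrow> x \<in> half_open_cube R"
proof -
  assume "norm x < real R"
  hence "\<bar>x $ i\<bar> < real R" for i using component_le_norm_cart[of x i] by linarith
  hence "- real R \<le> x $ i \<and> x $ i < real R" for i by (meson abs_less_iff less_imp_le minus_less_iff)
  thus "x \<in> half_open_cube R" unfolding half_open_cube_def by simp
qed

definition truncation_set :: "(real ^ 'n \<Rightarrow> complex) \<Rightarrow> nat \<Rightarrow> (real ^ 'n) set"
  where "truncation_set f k = {x. norm (f x) \<le> real k} \<inter> half_open_cube k"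

lemma truncation_set_sets: "f \<in> borel_measurable lebesgue \<Longrightarrow> truncation_set f k \<in> sets lebesgue"
proof -
  assume [measurable]: "f \<in> borel_measurable lebesgue"
  show ?thesis unfolding truncation_set_def by measurable
qed

lemma truncation_tendsto: "(\<lambda>k. cut (truncation_set f k) f x) \<longlonglongrightarrow> f x"
proof -
  obtain k where "max (norm (f x)) (norm x) < real k" using reals_Archimedean2 by blast
  hence "x \<in> truncation_set f l" if "k \<le> l" for l
    using that norm_less_half_open_cube[of x l] by (auto simp: truncation_set_def)
  hence "\<forall>\<^sub>F l in sequentially. f x = cut (truncation_set f l) f x" by (intro eventually_sequentiallyI[of k]) simp
  thus ?thesis by (rule Lim_transform_eventually[OF tendsto_const])
qed

lemma sum_over_grid:
  "(\<Sum>m\<in>grid j R. c m * indicator (cell j m) x) = (if x \<in> half_open_cube R then c (cell_index j x) else (0::complex))"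
proof -
  have "(\<Sum>m\<in>grid j R. c m * indicator (cell j m) x) = (\<Sum>m\<in>grid j R. if m = cell_index j x then c m else 0)"
    by (rule sum.cong) (auto simp: indicator_def cell_iff)
  also have "\<dots> = (if cell_index j x \<in> grid j R then c (cell_index j x) else 0)"
    by (rule sum.delta[OF finite_grid])
  finally show ?thesis by (simp add: cell_index_in_grid half_open_cube_def)
qed

text \<open>Bounded continuous functions on a cube are sampled at the corners of cells; bounded
  measurable functions are limits of continuous ones; general functions are limits of truncations in
  height and domain.\<close>

lemma approximable_by_cell_steps:
  fixes f :: "real ^ 'n \<Rightarrow> complex"
  assumes qs: "1 \<le> q" "1 \<le> s" and f: "f \<in> Lp_space q" "f \<in> Lp_space s"
  shows "approximable q s (cell_steps J) f"
proof -
  have pos: "0 < q" "0 < s" using qs by auto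
  have sub: "cell_steps J \<subseteq> Lp_space q \<inter> Lp_space s"
    unfolding cell_steps_def using cell_step_in_Lp_space qs by blast
  define w where "w B R = (\<lambda>x. complex_of_real B * indicator (half_open_cube R) (x :: real ^ 'n))" for B R
  have w: "w B R \<in> Lp_space p" if "0 < p" for p B R
    by (rule bounded_in_Lp_space[OF that, where B = "\<bar>B\<bar>" and S = "half_open_cube R"])
      (auto simp: w_def bounded_half_open_cube indicator_def)
  have cont: "approximable q s (cell_steps J) (\<lambda>x. if x \<in> half_open_cube R then g x else 0)"
    if g: "continuous_on UNIV g" and B: "\<And>x. norm (g x) \<le> B" for g :: "real ^ 'n \<Rightarrow> complex" and B R
  proof -
    define u where "u j x = (\<Sum>m\<in>grid (j + J) R. g (cell_corner (j + J) m) * indicator (cell (j + J) m) x)" for j x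
    show ?thesis
  proof (rule approximable_limit[OF qs sub w[OF pos(1), of B R] w[OF pos(2)], of u])
    show "u j \<in> borel_measurable lebesgue" for j unfolding u_def by measurable
    show "(\<lambda>x. if x \<in> half_open_cube R then g x else 0) \<in> borel_measurable lebesgue"
      using continuous_measurable_lebesgue[OF g] by measurable
    show "AE x in lebesgue. (\<lambda>j. u j x) \<longlonglongrightarrow> (if x \<in> half_open_cube R then g x else 0)"
    proof (intro AE_I2)
      fix x :: "real ^ 'n"
      have "(\<lambda>j. cell_corner (j + J) (cell_index (j + J) x)) \<longlonglongrightarrow> x"
        using LIMSEQ_ignore_initial_segment[OF cell_corner_tendsto] .
      hence "(\<lambda>j. g (cell_corner (j + J) (cell_index (j + J) x))) \<longlonglongrightarrow> g x"
        by (rule continuous_on_tendsto_compose[OF g]) auto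
      thus "(\<lambda>j. u j x) \<longlonglongrightarrow> (if x \<in> half_open_cube R then g x else 0)" unfolding u_def sum_over_grid by simp
    qed
    have B0: "0 \<le> B" using order_trans[OF norm_ge_zero B] .
    show "AE x in lebesgue. norm (u j x) \<le> norm (w B R x)" for j
      unfolding u_def sum_over_grid using B B0 by (intro AE_I2) (simp add: w_def norm_mult)
    show "approximable q s (cell_steps J) (u j)" for j
    proof (rule approximable_self)
      show "u j \<in> cell_steps J" unfolding cell_steps_def u_def[abs_def]
        by (rule CollectI, rule exI[of _ "j + J"], rule exI[of _ "grid (j + J) R"],
            rule exI[of _ "\<lambda>m. g (cell_corner (j + J) m)"]) (simp add: finite_grid)
    qed
  qed
  qed
  have bdd: "approximable q s (cell_steps J) h"
    if h: "h \<in> borel_measurable lebesgue" and B: "\<And>x. norm (h x) \<le> B" "0 < B"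
      and supp: "\<And>x. x \<notin> half_open_cube R \<Longrightarrow> h x = 0" for h :: "real ^ 'n \<Rightarrow> complex" and B R
  proof -
    have "h measurable_on UNIV" using h by (simp add: measurable_on_iff_borel_measurable lebesgue_on_UNIV_eq)
    then obtain N g where N: "negligible N" and g: "\<And>n. continuous_on UNIV (g n)"
      and lim: "\<And>x. x \<notin> N \<Longrightarrow> (\<lambda>n. g n x) \<longlonglongrightarrow> h x" by (auto simp: measurable_on_def)
    \<comment> \<open>Radial retraction onto the disc of radius \<open>B\<close>: it is continuous,
      it fixes the values of \<open>h\<close>, and it supplies the majorant for the approximating
      continuous functions.\<close>
    define clip where "clip z = of_real (B / max B (norm z)) * z" for z :: complex
    have clip_cont: "continuous_on UNIV clip"
      unfolding clip_def using B(2) by (intro continuous_intros) (auto simp: max_def)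
    have clip_le: "norm (clip z) \<le> B" for z
      using B(2) by (auto simp: clip_def norm_mult norm_divide max_def field_simps)
    have clip_id: "clip z = z" if "norm z \<le> B" for z using that B(2) by (simp add: clip_def max_def)
    have gc: "continuous_on UNIV (\<lambda>x. clip (g n x))" for n
      by (rule continuous_on_compose2[OF clip_cont g]) auto
    define v where "v n x = (if x \<in> half_open_cube R then clip (g n x) else 0)" for n x
    show ?thesis
    proof (rule approximable_limit[OF qs sub w[OF pos(1), of B R] w[OF pos(2)] _ h, of v])
      show "v n \<in> borel_measurable lebesgue" for n
        unfolding v_def using continuous_measurable_lebesgue[OF gc] by measurable
      have "(\<lambda>n. v n x) \<longlonglongrightarrow> h x" if "x \<notin> N" for x
      proof (cases "x \<in> half_open_cube R")
        case True
        have "(\<lambda>n. clip (g n x)) \<longlonglongrightarrow> clip (h x)"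
          by (rule continuous_on_tendsto_compose[OF clip_cont lim[OF that]]) auto
        thus ?thesis using True B(1) by (simp add: clip_id v_def)
      qed (simp add: supp v_def)
      thus "AE x in lebesgue. (\<lambda>n. v n x) \<longlonglongrightarrow> h x"
        unfolding eventually_ae_filter_negligible using N by blast
      show "AE x in lebesgue. norm (v n x) \<le> norm (w B R x)" for n
        using clip_le B(2) by (intro AE_I2) (simp add: w_def v_def norm_mult)
      show "approximable q s (cell_steps J) (v n)" for n unfolding v_def by (rule cont[OF gc clip_le])
    qed
  qed
  let ?A = "truncation_set f"
  note [measurable] = Lp_spaceD(1)[OF f(1)] truncation_set_sets[OF Lp_spaceD(1)[OF f(1)]]
  show ?thesis
  proof (rule approximable_limit[OF qs sub f])
    show "cut (?A k) f \<in> borel_measurable lebesgue" for k by measurable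
    show "AE x in lebesgue. (\<lambda>k. cut (?A k) f x) \<longlonglongrightarrow> f x" by (intro AE_I2 truncation_tendsto)
    show "AE x in lebesgue. norm (cut (?A k) f x) \<le> norm (f x)" for k
      by (intro AE_I2) (simp add: indicator_def)
    show "approximable q s (cell_steps J) (cut (?A k) f)" for k
      by (rule bdd[of "cut (?A k) f" "real k + 1" k]) (measurable, auto simp: truncation_set_def indicator_def)
  qed simp
qed

lemma cell_diameter:
  fixes x y :: "real ^ 'n"
  assumes "x \<in> cell j m" "y \<in> cell j m" shows "dist x y \<le> 2 * real CARD('n) / 2 ^ j"
  using cell_corner_dist[OF assms(1)] cell_corner_dist[OF assms(2)] dist_triangle3[of x y "cell_corner j m"] by simp

text \<open>The last conclusion keeps the support of \<open>g\<close> near that of \<open>f\<close>.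
  The kernel formula off the support and the approximation of atoms within slightly larger cubes
  depend on it.\<close>

lemma test_functions_dense:
  fixes f :: "real ^ 'n \<Rightarrow> complex"
  assumes qs: "1 \<le> q" "1 \<le> s" and f: "f \<in> Lp_space q" "f \<in> Lp_space s" and e: "0 < e" and d: "0 < d"
  shows "\<exists>g\<in>test_functions. Lp_norm q (\<lambda>x. f x - g x) < e \<and> Lp_norm s (\<lambda>x. f x - g x) < e \<and>
    (\<forall>x. g x \<noteq> 0 \<longrightarrow> (\<exists>y. f y \<noteq> 0 \<and> dist x y < d))"
proof -
  have pos: "0 < q" "0 < s" using qs by auto
  have "\<forall>\<^sub>F j in sequentially. 2 * real CARD('n) / 2 ^ j < d"
    by (rule order_tendstoD(2)[OF mesh_tendsto_0 d])
  then obtain J where J: "\<And>j. J \<le> j \<Longrightarrow> 2 * real CARD('n) / 2 ^ j < d" by (auto simp: eventually_sequentially)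
  have "approximable q s (cell_steps J) f" by (rule approximable_by_cell_steps[OF qs f])
  with e obtain v where "v \<in> cell_steps J" and v: "Lp_norm q (\<lambda>x. f x - v x) < e" "Lp_norm s (\<lambda>x. f x - v x) < e"
    unfolding approximable_def by blast
  then obtain j M c where j: "J \<le> j" and M: "finite M" and v_eq: "v = (\<lambda>x. \<Sum>m\<in>M. c m * indicator (cell j m) x)"
    unfolding cell_steps_def by blast
  \<comment> \<open>Cells on which \<open>f\<close> vanishes identically are dropped. This can only
    improve the approximation, and every remaining cell is small and meets the set where
    \<open>f\<close> is nonzero.\<close>
  define M' where "M' = {m \<in> M. \<exists>y\<in>cell j m. f y \<noteq> 0}"
  have M': "finite M'" using M by (simp add: M'_def)
  define v' where "v' x = (\<Sum>m\<in>M'. c m * indicator (cell j m) x)" for x :: "real ^ 'n"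
  define b where "b N x = (\<Sum>m\<in>M'. c m * cell_bump N j m x)" for N and x :: "real ^ 'n"
  have v_at: "v x = (if cell_index j x \<in> M then c (cell_index j x) else 0)" for x
  proof -
    have "v x = (\<Sum>m\<in>M. if m = cell_index j x then c m else 0)"
      unfolding v_eq by (rule sum.cong) (auto simp: indicator_def cell_iff)
    thus ?thesis using sum.delta[OF M, of "cell_index j x" c] by simp
  qed
  have v'_at: "v' x = (if cell_index j x \<in> M' then c (cell_index j x) else 0)" for x
  proof -
    have "v' x = (\<Sum>m\<in>M'. if m = cell_index j x then c m else 0)"
      unfolding v'_def by (rule sum.cong) (auto simp: indicator_def cell_iff)
    thus ?thesis using sum.delta[OF M', of "cell_index j x" c] by simp
  qed
  have closer: "norm (f x - v' x) \<le> norm (f x - v x)" for x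
  proof (cases "cell_index j x \<in> M'")
    case True
    hence "cell_index j x \<in> M" by (simp add: M'_def)
    thus ?thesis using True by (simp add: v_at v'_at)
  next
    case False
    show ?thesis
    proof (cases "f x = 0")
      case False
      hence "cell_index j x \<notin> M" using \<open>cell_index j x \<notin> M'\<close> unfolding M'_def by (auto simp: cell_iff)
      thus ?thesis using \<open>cell_index j x \<notin> M'\<close> by (simp add: v_at v'_at)
    qed (use False in \<open>simp add: v'_at\<close>)
  qed
  have v'L: "v' \<in> Lp_space p" if "1 \<le> p" for p unfolding v'_def[abs_def] by (rule cell_step_in_Lp_space[OF that])
  have vL: "v \<in> Lp_space p" if "1 \<le> p" for p unfolding v_eq by (rule cell_step_in_Lp_space[OF that])
  have v'_close: "Lp_norm p (\<lambda>x. f x - v' x) \<le> Lp_norm p (\<lambda>x. f x - v x)" if p: "1 \<le> p" "f \<in> Lp_space p" for p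
    by (rule Lp_norm_mono) (use p closer Lp_space_diff[OF p(1,2) vL[OF p(1)]] Lp_spaceD(1)[OF Lp_space_diff[OF p(1,2) v'L[OF p(1)]]] in auto)
  have b_test: "b N \<in> test_functions" for N
    unfolding b_def[abs_def] by (rule test_functions_sum) (rule cell_bump_test_function)
  have "approximable q s (range b) v'"
  proof (rule approximable_limit[OF qs, where u = b and w = "\<lambda>x. \<Sum>m\<in>M'. complex_of_real (norm (c m)) * indicator (cell j m) x"])
    show "range b \<subseteq> Lp_space q \<inter> Lp_space s" using b_test test_function_in_Lp_space pos by blast
    show "b N \<in> borel_measurable lebesgue" for N by (rule test_function_measurable[OF b_test])
    show "v' \<in> borel_measurable lebesgue" using Lp_spaceD(1)[OF v'L[OF qs(1)]] .
    have "AE x in lebesgue. \<forall>m\<in>M'. (\<lambda>N. cell_bump N j m x) \<longlonglongrightarrow> indicator (cell j m) x"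
      unfolding AE_finite_all[OF M'] using cell_bump_tendsto by blast
    thus "AE x in lebesgue. (\<lambda>N. b N x) \<longlonglongrightarrow> v' x"
      by (rule AE_mp) (auto intro!: AE_I2 tendsto_sum tendsto_mult simp: b_def v'_def)
    show "AE x in lebesgue. norm (b N x) \<le> norm (\<Sum>m\<in>M'. complex_of_real (norm (c m)) * indicator (cell j m) x)" for N
    proof (intro AE_I2)
      fix x
      have "norm (b N x) \<le> (\<Sum>m\<in>M'. norm (c m) * indicator (cell j m) x)"
        unfolding b_def by (rule order_trans[OF norm_sum sum_mono]) (simp add: norm_mult mult_left_mono norm_cell_bump_le)
      also have "\<dots> = norm (complex_of_real (\<Sum>m\<in>M'. norm (c m) * indicator (cell j m) x))"
        unfolding norm_of_real by (simp add: sum_nonneg)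
      also have "complex_of_real (\<Sum>m\<in>M'. norm (c m) * indicator (cell j m) x)
          = (\<Sum>m\<in>M'. complex_of_real (norm (c m)) * indicator (cell j m) x)"
        unfolding of_real_sum by (rule sum.cong) (auto simp: indicator_def)
      finally show "norm (b N x) \<le> norm (\<Sum>m\<in>M'. complex_of_real (norm (c m)) * indicator (cell j m) x)" .
    qed
    show "approximable q s (range b) (b N)" for N by (rule approximable_self) simp
    show "(\<lambda>x. \<Sum>m\<in>M'. complex_of_real (norm (c m)) * indicator (cell j m) x) \<in> Lp_space q"
      by (rule cell_step_in_Lp_space[OF qs(1)])
    show "(\<lambda>x. \<Sum>m\<in>M'. complex_of_real (norm (c m)) * indicator (cell j m) x) \<in> Lp_space s"
      by (rule cell_step_in_Lp_space[OF qs(2)])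
  qed
  moreover have "0 < min (e - Lp_norm q (\<lambda>x. f x - v x)) (e - Lp_norm s (\<lambda>x. f x - v x))" using v by simp
  ultimately obtain g where g: "g \<in> range b"
    "Lp_norm q (\<lambda>x. v' x - g x) < min (e - Lp_norm q (\<lambda>x. f x - v x)) (e - Lp_norm s (\<lambda>x. f x - v x))"
    "Lp_norm s (\<lambda>x. v' x - g x) < min (e - Lp_norm q (\<lambda>x. f x - v x)) (e - Lp_norm s (\<lambda>x. f x - v x))"
    unfolding approximable_def by blast
  have gt: "g \<in> test_functions" using g(1) b_test by blast
  have "Lp_norm q (\<lambda>x. f x - g x) < e"
    using Lp_norm_triangle[OF qs(1) f(1) v'L[OF qs(1)] test_function_in_Lp_space[OF pos(1) gt]] v'_close[OF qs(1) f(1)] g(2) by simp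
  moreover have "Lp_norm s (\<lambda>x. f x - g x) < e"
    using Lp_norm_triangle[OF qs(2) f(2) v'L[OF qs(2)] test_function_in_Lp_space[OF pos(2) gt]] v'_close[OF qs(2) f(2)] g(3) by simp
  moreover have "\<exists>y. f y \<noteq> 0 \<and> dist x y < d" if "g x \<noteq> 0" for x
  proof -
    obtain N where N: "g = b N" using g(1) by blast
    from that obtain m where m: "m \<in> M'" "c m * cell_bump N j m x \<noteq> 0"
      unfolding N b_def by (auto elim!: sum.not_neutral_contains_not_neutral)
    hence "x \<in> cell j m" using cell_bump_off_cell by fastforce
    moreover obtain y where "y \<in> cell j m" "f y \<noteq> 0" using m(1) by (auto simp: M'_def)
    ultimately show ?thesis using cell_diameter J[OF j] by (meson le_less_trans)
  qed
  ultimately show ?thesis using gt by blast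
qed

lemma test_functions_dense_seq:
  fixes f :: "real ^ 'n \<Rightarrow> complex"
  assumes qs: "1 \<le> q" "1 \<le> s" and f: "f \<in> Lp_space q" "f \<in> Lp_space s" and d: "0 < d"
  obtains g where "\<And>i. g i \<in> test_functions"
    "\<And>i. Lp_norm q (\<lambda>x. f x - g i x) < (1 / 2) ^ i" "\<And>i. Lp_norm s (\<lambda>x. f x - g i x) < (1 / 2) ^ i"
    "\<And>i x. g i x \<noteq> 0 \<Longrightarrow> \<exists>y. f y \<noteq> 0 \<and> dist x y < d"
proof -
  have "\<forall>i. \<exists>g. g \<in> test_functions \<and> Lp_norm q (\<lambda>x. f x - g x) < (1 / 2) ^ i \<and> Lp_norm s (\<lambda>x. f x - g x) < (1 / 2) ^ i \<and>
    (\<forall>x. g x \<noteq> 0 \<longrightarrow> (\<exists>y. f y \<noteq> 0 \<and> dist x y < d))"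
    using test_functions_dense[OF qs f _ d] unfolding Bex_def by simp
  from choice[OF this] obtain g where "\<And>i. g i \<in> test_functions \<and> Lp_norm q (\<lambda>x. f x - g i x) < (1 / 2) ^ i \<and>
      Lp_norm s (\<lambda>x. f x - g i x) < (1 / 2) ^ i \<and> (\<forall>x. g i x \<noteq> 0 \<longrightarrow> (\<exists>y. f y \<noteq> 0 \<and> dist x y < d))"
    by blast
  thus ?thesis using that by blast
qed

lemma half_power_tendsto_0: 
  assumes "\<And>i. 0 \<le> a i" "\<And>i. a i \<le> C * (1 / 2) ^ i" shows "a \<longlonglongrightarrow> (0::real)"
proof (rule tendsto_sandwich[OF _ _ tendsto_const])
  have "(\<lambda>i. C * (1 / 2) ^ i) \<longlonglongrightarrow> C * 0" by (intro tendsto_intros LIMSEQ_power_zero) simp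
  thus "(\<lambda>i. C * (1 / 2) ^ i) \<longlonglongrightarrow> 0" by simp
qed (use assms in auto)

lemma Lp_pairing_tendsto:
  assumes q: "1 < q" "1 / q + 1 / q' = 1" and h: "h \<in> Lp_space q" and g: "g \<in> Lp_space q'"
    and u: "\<And>i. u i \<in> Lp_space q'" and lim: "Lp_tendsto q' u g"
  shows "(\<lambda>i. LINT x|lebesgue. h x * u i x) \<longlonglongrightarrow> (LINT x|lebesgue. h x * g x)"
proof -
  have q'1: "1 \<le> q'" using conjugate_exponent[OF q] by simp
  have "(\<lambda>i. (LINT x|lebesgue. h x * u i x) - (LINT x|lebesgue. h x * g x)) \<longlonglongrightarrow> 0"
  proof (rule Lim_null_comparison)
    show "(\<lambda>i. Lp_norm q h * Lp_norm q' (\<lambda>x. g x - u i x)) \<longlonglongrightarrow> 0"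
      by (rule tendsto_mult_right_zero[OF lim])
    show "\<forall>\<^sub>F i in sequentially. norm ((LINT x|lebesgue. h x * u i x) - (LINT x|lebesgue. h x * g x))
        \<le> Lp_norm q h * Lp_norm q' (\<lambda>x. g x - u i x)"
    proof (intro always_eventually allI)
      fix i
      have "(LINT x|lebesgue. h x * g x) - (LINT x|lebesgue. h x * u i x) = (LINT x|lebesgue. h x * (g x - u i x))"
        using Lp_hoelder_integrable[OF q h g] Lp_hoelder_integrable[OF q h u] by (simp add: right_diff_distrib)
      hence "norm ((LINT x|lebesgue. h x * u i x) - (LINT x|lebesgue. h x * g x)) = norm (LINT x|lebesgue. h x * (g x - u i x))"
        by (subst norm_minus_commute) simp
      thus "norm ((LINT x|lebesgue. h x * u i x) - (LINT x|lebesgue. h x * g x))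
        \<le> Lp_norm q h * Lp_norm q' (\<lambda>x. g x - u i x)"
        using Lp_hoelder[OF q h Lp_space_diff[OF q'1 g u]] by simp
    qed
  qed
  thus ?thesis by (simp add: LIM_zero_iff)
qed

text \<open>Membership of \<open>h\<close> in L_2 lets the bound pass from test functions to every
  \<open>g\<close> that lies in L_2 and in L_q'. The q-norm of \<open>h\<close> is not yet known to
  be finite, so the extremal \<open>g\<close> is formed on truncations of \<open>h\<close>; the
  resulting bounds are uniform, and Fatou's lemma removes the truncation.\<close>

lemma Lp_converse_hoelder:
  fixes h :: "real ^ 'n \<Rightarrow> complex"
  assumes q: "1 < q" "1 / q + 1 / q' = 1" and h: "h \<in> Lp_space 2" and C: "0 \<le> C"
    and bound: "\<And>g. g \<in> test_functions \<Longrightarrow> norm (LINT x|lebesgue. h x * g x) \<le> C * Lp_norm q' g"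
  shows "h \<in> Lp_space q" "Lp_norm q h \<le> C"
proof -
  have q'1: "1 < q'" using conjugate_exponent[OF q] .
  note [measurable] = Lp_spaceD(1)[OF h]
  have bound': "norm (LINT x|lebesgue. h x * g x) \<le> C * Lp_norm q' g"
    if g: "g \<in> Lp_space 2" "g \<in> Lp_space q'" for g
  proof -
    obtain u where u: "\<And>i. u i \<in> test_functions" "\<And>i. Lp_norm 2 (\<lambda>x. g x - u i x) < (1 / 2) ^ i"
        "\<And>i. Lp_norm q' (\<lambda>x. g x - u i x) < (1 / 2) ^ i" "\<And>i x. u i x \<noteq> 0 \<Longrightarrow> \<exists>y. g y \<noteq> 0 \<and> dist x y < 1"
      by (rule test_functions_dense_seq[of 2 q' g 1]) (use g q'1 in auto)
    have uL: "u i \<in> Lp_space p" if "0 < p" for p i by (rule test_function_in_Lp_space[OF that u(1)])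
    have l2: "Lp_tendsto 2 u g"
      by (rule half_power_tendsto_0[where C = 1]) (use u(2) less_imp_le in \<open>auto simp: Lp_norm_nonneg\<close>)
    have lq: "Lp_tendsto q' u g"
      by (rule half_power_tendsto_0[where C = 1]) (use u(3) less_imp_le in \<open>auto simp: Lp_norm_nonneg\<close>)
    have lim1: "(\<lambda>i. norm (LINT x|lebesgue. h x * u i x)) \<longlonglongrightarrow> norm (LINT x|lebesgue. h x * g x)"
      by (intro tendsto_norm Lp_pairing_tendsto[where q = 2 and q' = 2] h g(1) uL l2) auto
    have lim2: "(\<lambda>i. C * (Lp_norm q' g + Lp_norm q' (\<lambda>x. g x - u i x))) \<longlonglongrightarrow> C * (Lp_norm q' g + 0)"
      by (intro tendsto_intros lq)
    have "norm (LINT x|lebesgue. h x * u i x) \<le> C * (Lp_norm q' g + Lp_norm q' (\<lambda>x. g x - u i x))" for i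
    proof -
      have "Lp_norm q' (u i) \<le> Lp_norm q' g + Lp_norm q' (\<lambda>x. g x - u i x)"
        using Lp_norm_diff[OF _ g(2) Lp_space_diff[OF _ g(2) uL[of q' i]]] q'1 by simp
      thus ?thesis using bound[OF u(1)[of i]] C by (meson mult_left_mono order_trans)
    qed
    thus ?thesis using LIMSEQ_le[OF lim1 lim2] by auto
  qed
  define A where "A = truncation_set h"
  note A_def' = A_def truncation_set_def
  have A [measurable]: "A k \<in> sets lebesgue" for k unfolding A_def by (rule truncation_set_sets[OF Lp_spaceD(1)[OF h]])
  have cutL: "cut (A k) h \<in> Lp_space p" if "0 < p" for k p
    by (rule bounded_in_Lp_space[OF that, where B = "real k" and S = "half_open_cube k"])
      (measurable, auto simp: A_def' indicator_def bounded_half_open_cube)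
  have cut_le: "Lp_norm q (cut (A k) h) \<le> C" for k
  proof -
    \<comment> \<open>The equality case of Hoelder's inequality: on the truncation set h g = |h|^q
      and |g|^q' = |h|^q.\<close>
    define g where "g x = indicator (A k) x * (cnj (h x) * complex_of_real (norm (h x) powr (q - 2)))" for x
    have [measurable]: "(\<lambda>x. cnj (h x)) \<in> borel_measurable lebesgue"
      by (rule measurable_compose[OF _ borel_measurable_continuous_onI]) (auto intro: continuous_intros)
    have [measurable]: "(\<lambda>x. complex_of_real (norm (h x) powr (q - 2))) \<in> borel_measurable lebesgue"
      by (rule measurable_compose[OF _ borel_measurable_of_real]) measurable
    have gm: "g \<in> borel_measurable lebesgue" unfolding g_def by measurable
    have ng: "norm (g x) = norm (cut (A k) h x) powr (q - 1)" for x
    proof (cases "h x = 0")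
      case False
      hence "norm (h x) * norm (h x) powr (q - 2) = norm (h x) powr (1 + (q - 2))"
        by (subst powr_add) simp
      thus ?thesis by (auto simp: g_def norm_mult indicator_def)
    qed (simp add: g_def)
    have gL: "g \<in> Lp_space p" if "0 < p" for p
    proof (rule bounded_in_Lp_space[OF that gm, where B = "real k powr (q - 1)" and S = "half_open_cube k"])
      fix x
      have "norm (cut (A k) h x) \<le> real k" by (auto simp: A_def' indicator_def)
      thus "norm (g x) \<le> real k powr (q - 1)" unfolding ng using q by (intro powr_mono2) auto
      show "g x = 0" if "x \<notin> half_open_cube k" using that by (simp add: g_def A_def')
    qed (rule bounded_half_open_cube)
    define I where "I = (LINT x|lebesgue. norm (cut (A k) h x) powr q)"
    have I0: "0 \<le> I" by (simp add: I_def)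
    have hg: "h x * g x = complex_of_real (norm (cut (A k) h x) powr q)" for x
    proof (cases "h x = 0 \<or> x \<notin> A k")
      case False
      hence "h x * g x = h x * cnj (h x) * complex_of_real (norm (h x) powr (q - 2))" by (simp add: g_def)
      also have "h x * cnj (h x) = complex_of_real (norm (h x) powr 2)"
        using False by (simp add: powr_numeral complex_norm_square[symmetric] del: of_real_power)
      also have "\<dots> * complex_of_real (norm (h x) powr (q - 2)) = complex_of_real (norm (h x) powr (2 + (q - 2)))"
        by (simp only: of_real_mult powr_add)
      finally show ?thesis using False by simp
    qed (auto simp: g_def)
    have "(LINT x|lebesgue. h x * g x) = complex_of_real I" unfolding hg I_def by simp
    hence "I \<le> C * Lp_norm q' g" using bound'[OF gL gL] I0 q'1 by simp
    also have "Lp_norm q' g = I powr (1 / q')"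
    proof -
      have "q * q' * (1 / q + 1 / q') = q' + q" using q(1) q'1 by (simp add: distrib_left)
      hence "(q - 1) * q' = q" unfolding q(2) by (simp add: left_diff_distrib)
      thus ?thesis unfolding Lp_norm_eq ng I_def by (simp add: powr_powr)
    qed
    finally have le: "I \<le> C * I powr (1 / q')" .
    have "Lp_norm q (cut (A k) h) = I powr (1 / q)" by (simp add: Lp_norm_eq I_def)
    also have "\<dots> \<le> C"
    proof (cases "I = 0")
      case False
      hence Ip: "0 < I" using I0 by simp
      have "I powr (1 / q) * I powr (1 / q') = I" using q(2) Ip by (simp add: powr_add[symmetric])
      hence "I powr (1 / q) * I powr (1 / q') \<le> C * I powr (1 / q')" using le by simp
      thus ?thesis by (rule mult_right_le_imp_le) (use Ip in simp)
    qed (use C in simp)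
    finally show ?thesis .
  qed
  have lim: "AE x in lebesgue. (\<lambda>k. cut (A k) h x) \<longlonglongrightarrow> h x" unfolding A_def by (intro AE_I2 truncation_tendsto)
  have q1: "1 \<le> q" "0 < q" using q by auto
  show "h \<in> Lp_space q" by (rule Lp_space_Fatou[OF q1(1) cutL[OF q1(2)] _ lim cut_le]) simp
  show "Lp_norm q h \<le> C" by (rule Lp_norm_Fatou[OF q1(1) cutL[OF q1(2)] _ lim cut_le]) simp
qed

section \<open>Calder\'on--Zygmund operators\<close>

lemma lebesgue_translation:
  fixes v :: "'a::euclidean_space"
  shows "(+) v \<in> lebesgue \<rightarrow>\<^sub>M lebesgue" and "distr lebesgue lebesgue ((+) v) = lebesgue"
proof -
  have eq: "(\<lambda>x :: 'a. v + (\<Sum>j\<in>Basis. (1 * (x \<bullet> j)) *\<^sub>R j)) = (+) v"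
    by (simp add: euclidean_representation fun_eq_iff)
  show "(+) v \<in> lebesgue \<rightarrow>\<^sub>M lebesgue"
    using lebesgue_affine_measurable[of "\<lambda>_. 1" v] unfolding eq by simp
  show "distr lebesgue lebesgue ((+) v) = lebesgue"
    using lebesgue_affine_euclidean[of "\<lambda>_. 1" v] unfolding eq by (simp add: density_1)
qed

lemma integral_lebesgue_translation:
  fixes f :: "'a::euclidean_space \<Rightarrow> 'b::{banach, second_countable_topology}"
  assumes "f \<in> borel_measurable lebesgue"
  shows "(LINT x|lebesgue. f (v + x)) = (LINT x|lebesgue. f x)"
  using integral_distr[OF lebesgue_translation(1)[of v] assms] lebesgue_translation(2)[of v] by simp

lemma integrable_lebesgue_translation:
  fixes f :: "'a::euclidean_space \<Rightarrow> 'b::{banach, second_countable_topology}"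
  assumes "integrable lebesgue f" shows "integrable lebesgue (\<lambda>x. f (v + x))"
  using integrable_distr[OF lebesgue_translation(1)[of v], of f] assms lebesgue_translation(2)[of v] by simp

lemma AE_lebesgue_translation:
  assumes "AE x in lebesgue. P x" shows "AE x in lebesgue. P (v + (x :: 'a::euclidean_space))"
proof -
  obtain N where N: "N \<in> null_sets lebesgue" "{x. \<not> P x} \<subseteq> N"
    using assms by (auto simp: eventually_ae_filter)
  have "AE x in distr lebesgue lebesgue ((+) v). x \<notin> N"
    unfolding lebesgue_translation(2) using N(1) by (rule AE_not_in)
  moreover have "{x \<in> space lebesgue. x \<notin> N} \<in> sets lebesgue"
  proof -
    have "N \<in> sets lebesgue" using N(1) by (rule null_setsD2)
    hence "space lebesgue - N \<in> sets lebesgue" by (rule sets.compl_sets)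
    thus ?thesis by (simp add: set_diff_eq)
  qed
  ultimately have "AE x in lebesgue. v + x \<notin> N"
    by (subst (asm) AE_distr_iff[OF lebesgue_translation(1)])
  thus ?thesis using N(2) by (auto elim: AE_mp)
qed

text \<open>A single point does not affect measurability, so the values of the kernel on the
  diagonal are harmless.\<close>

lemma measurable_off_point:
  fixes f :: "real ^ 'n \<Rightarrow> complex"
  assumes "continuous_on (- {y}) f" shows "f \<in> borel_measurable lebesgue"
proof -
  have "(\<lambda>x. indicator (- {y}) x *\<^sub>R f x) \<in> borel_measurable borel"
    by (rule borel_measurable_continuous_on_indicator[OF _ assms]) simp
  hence [measurable]: "(\<lambda>x. indicator (- {y}) x *\<^sub>R f x) \<in> borel_measurable lebesgue"
    by (intro measurable_completion) simp
  have [measurable]: "{y} \<in> sets lebesgue" by simp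
  have "(\<lambda>x. indicator (- {y}) x *\<^sub>R f x + indicator {y} x *\<^sub>R f y) \<in> borel_measurable lebesgue" by measurable
  also have "(\<lambda>x. indicator (- {y}) x *\<^sub>R f x + indicator {y} x *\<^sub>R f y) = f" by (auto simp: fun_eq_iff indicator_def)
  finally show ?thesis .
qed

text \<open>Serves to derive measurability of the kernel in its second variable from the regularity
  condition.\<close>

lemma hoelder_continuous_off_point:
  fixes f :: "real ^ 'n \<Rightarrow> complex"
  assumes "0 < \<delta>" "0 \<le> c"
    and "\<And>x x'. x \<noteq> y \<Longrightarrow> x' \<noteq> y \<Longrightarrow> 2 * norm (x - x') \<le> norm (x - y) \<Longrightarrow>
      norm (f x - f x') \<le> c * (norm (x - x') powr \<delta> * norm (x - y) powr (- s))"
  shows "continuous_on (- {y}) f"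
proof (rule continuous_at_imp_continuous_on, rule ballI)
  fix x assume "x \<in> - {y}"
  hence x: "0 < norm (x - y)" by simp
  have "((\<lambda>x'. f x' - f x) \<longlongrightarrow> 0) (at x)"
  proof (rule Lim_null_comparison)
    show "\<forall>\<^sub>F x' in at x. norm (f x' - f x) \<le> c * (norm (x - x') powr \<delta> * norm (x - y) powr (- s))"
      unfolding eventually_at
    proof (intro exI[of _ "norm (x - y) / 2"] conjI ballI impI)
      fix x' assume "x' \<noteq> x \<and> dist x' x < norm (x - y) / 2"
      hence d: "2 * norm (x - x') < norm (x - y)" by (simp add: dist_norm norm_minus_commute)
      hence "x' \<noteq> y" using x by auto
      thus "norm (f x' - f x) \<le> c * (norm (x - x') powr \<delta> * norm (x - y) powr (- s))"
        using assms(3)[of x x'] d x by (simp add: norm_minus_commute)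
    qed (use x in simp)
    have "((\<lambda>x'. norm (x - x') powr \<delta>) \<longlongrightarrow> 0) (at x)"
    proof (rule tendsto_zero_powrI[OF _ tendsto_const])
      have "((\<lambda>x'. norm (x - x')) \<longlongrightarrow> norm (x - x)) (at x)" by (intro tendsto_intros)
      thus "((\<lambda>x'. norm (x - x')) \<longlongrightarrow> 0) (at x)" by simp
    qed (use assms in auto)
    hence "((\<lambda>x'. c * (norm (x - x') powr \<delta> * norm (x - y) powr (- s))) \<longlongrightarrow> c * (0 * norm (x - y) powr (- s))) (at x)"
      by (intro tendsto_intros)
    thus "((\<lambda>x'. c * (norm (x - x') powr \<delta> * norm (x - y) powr (- s))) \<longlongrightarrow> 0) (at x)" by simp
  qed
  thus "isCont f x" by (simp add: isCont_def LIM_zero_iff)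
qed

locale calderon_zygmund =
  fixes T :: "(real ^ 'n \<Rightarrow> complex) \<Rightarrow> real ^ 'n \<Rightarrow> complex"
    and K :: "real ^ 'n \<Rightarrow> real ^ 'n \<Rightarrow> complex"
    and c1 c2 \<delta> :: real
  assumes T_L2: "\<And>f. f \<in> test_functions \<Longrightarrow> T f \<in> Lp_space 2 \<and> Lp_norm 2 (T f) \<le> c1 * Lp_norm 2 f"
    and principal_value: "\<And>f. f \<in> test_functions \<Longrightarrow> AE y in lebesgue.
           ((\<lambda>\<epsilon>. LINT z:{z. norm (y - z) \<ge> \<epsilon>}|lebesgue. K y z * f z) \<longlongrightarrow> T f y) (at_right 0)"
    and c2: "0 < c2" and \<delta>: "0 < \<delta>"
    and size: "\<And>x y. x \<noteq> y \<Longrightarrow> norm (K x y) \<le> c2 * norm (x - y) powr (- real CARD('n))"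
    and regular1: "\<And>x x' y. x \<noteq> y \<Longrightarrow> x' \<noteq> y \<Longrightarrow>
           2 * norm (x - x') \<le> max (norm (x - y)) (norm (x' - y)) \<Longrightarrow>
           norm (K x y - K x' y) \<le>
             c2 * (norm (x - x') powr \<delta> / (norm (x - y) + norm (x' - y)) powr (real CARD('n) + \<delta>))"
    and regular2: "\<And>x y y'. x \<noteq> y \<Longrightarrow> x \<noteq> y' \<Longrightarrow>
           2 * norm (y - y') \<le> max (norm (x - y)) (norm (x - y')) \<Longrightarrow>
           norm (K x y - K x y') \<le>
             c2 * (norm (y - y') powr \<delta> / (norm (x - y) + norm (x - y')) powr (real CARD('n) + \<delta>))"
begin

lemma powr_sum_le: "0 < a \<Longrightarrow> 0 \<le> b \<Longrightarrow> d / (a + b) powr (real CARD('n) + \<delta>) \<le> d * a powr (- (real CARD('n) + \<delta>))"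
  if "0 \<le> d" for a b d
proof -
  assume ab: "0 < a" "0 \<le> b"
  have "d / (a + b) powr (real CARD('n) + \<delta>) = d * (a + b) powr (- (real CARD('n) + \<delta>))"
    by (simp only: powr_minus divide_inverse)
  also have "\<dots> \<le> d * a powr (- (real CARD('n) + \<delta>))"
    using that ab \<delta> by (intro mult_left_mono powr_mono2') auto
  finally show ?thesis .
qed

lemma regular1':
  assumes "x \<noteq> y" "x' \<noteq> y" "2 * norm (x - x') \<le> norm (x - y)"
  shows "norm (K x y - K x' y) \<le> c2 * (norm (x - x') powr \<delta> * norm (x - y) powr (- (real CARD('n) + \<delta>)))"
proof -
  have "norm (K x y - K x' y) \<le> c2 * (norm (x - x') powr \<delta> / (norm (x - y) + norm (x' - y)) powr (real CARD('n) + \<delta>))"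
    by (rule regular1) (use assms in auto)
  also have "\<dots> \<le> c2 * (norm (x - x') powr \<delta> * norm (x - y) powr (- (real CARD('n) + \<delta>)))"
    using c2 assms by (intro mult_left_mono powr_sum_le) auto
  finally show ?thesis .
qed

lemma regular2':
  assumes "x \<noteq> y" "x \<noteq> y'" "2 * norm (y - y') \<le> norm (x - y)"
  shows "norm (K x y - K x y') \<le> c2 * (norm (y - y') powr \<delta> * norm (x - y) powr (- (real CARD('n) + \<delta>)))"
proof -
  have "norm (K x y - K x y') \<le> c2 * (norm (y - y') powr \<delta> / (norm (x - y) + norm (x - y')) powr (real CARD('n) + \<delta>))"
    by (rule regular2) (use assms in auto)
  also have "\<dots> \<le> c2 * (norm (y - y') powr \<delta> * norm (x - y) powr (- (real CARD('n) + \<delta>)))"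
    using c2 assms by (intro mult_left_mono powr_sum_le) auto
  finally show ?thesis .
qed

lemma kernel_measurable [measurable]: "K y \<in> borel_measurable lebesgue"
proof (rule measurable_off_point, rule hoelder_continuous_off_point)
  fix x x' assume "x \<noteq> y" "x' \<noteq> y" "2 * norm (x - x') \<le> norm (x - y)"
  thus "norm (K y x - K y x') \<le> c2 * (norm (x - x') powr \<delta> * norm (x - y) powr (- (real CARD('n) + \<delta>)))"
    using regular2'[of y x x'] by (simp add: norm_minus_commute)
qed (use c2 \<delta> in auto)

lemma size_far: "0 < d \<Longrightarrow> d \<le> norm (y - z) \<Longrightarrow> norm (K y z) \<le> c2 * d powr (- real CARD('n))"
proof -
  assume d: "0 < d" "d \<le> norm (y - z)"
  have "norm (K y z) \<le> c2 * norm (y - z) powr (- real CARD('n))" by (rule size) (use d in auto)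
  also have "\<dots> \<le> c2 * d powr (- real CARD('n))" using d c2 by (intro mult_left_mono powr_mono2') auto
  finally show ?thesis .
qed

lemma truncated_integrable:
  assumes f: "integrable lebesgue f" and d: "0 < d"
  shows "set_integrable lebesgue {z. d \<le> norm (y - z)} (\<lambda>z. K y z * f z)"
  unfolding set_integrable_def
proof (rule Bochner_Integration.integrable_bound)
  show "integrable lebesgue (\<lambda>z. c2 * d powr (- real CARD('n)) * norm (f z))" using f by simp
  have "closed {z. d \<le> norm (y - z)}" by (intro closed_Collect_le continuous_intros)
  hence [measurable]: "{z. d \<le> norm (y - z)} \<in> sets lebesgue" by (intro borel_set_lebesgue borel_closed)
  have [measurable]: "f \<in> borel_measurable lebesgue" using f by (rule borel_measurable_integrable)
  show "(\<lambda>z. indicator {z. d \<le> norm (y - z)} z *\<^sub>R (K y z * f z)) \<in> borel_measurable lebesgue" by measurable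
  show "AE z in lebesgue. norm (indicator {z. d \<le> norm (y - z)} z *\<^sub>R (K y z * f z))
      \<le> norm (c2 * d powr (- real CARD('n)) * norm (f z))"
    using size_far[OF d, of y] c2
    by (intro AE_I2) (simp add: indicator_def norm_mult mult_right_mono)
qed

lemma test_function_integrable: "f \<in> test_functions \<Longrightarrow> integrable lebesgue f"
  using Lp_spaceD[OF test_function_in_Lp_space[of 1 f]] by (auto intro: integrable_norm_cancel)

text \<open>As soon as the truncation radius is below \<open>d\<close>, truncation changes nothing
  and the principal value is an ordinary integral. The quantifier over \<open>d\<close> stands
  inside \<open>AE\<close>, so one null set serves all distances.\<close>

lemma T_off_support:
  assumes f: "f \<in> test_functions"
  shows "AE y in lebesgue. \<forall>d>0. (\<forall>z. f z \<noteq> 0 \<longrightarrow> d \<le> norm (y - z)) \<longrightarrow> T f y = (LINT z|lebesgue. K y z * f z)"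
  using principal_value[OF f]
proof (rule AE_mp, intro AE_I2 impI allI)
  fix y d
  assume lim: "((\<lambda>\<epsilon>. LINT z:{z. norm (y - z) \<ge> \<epsilon>}|lebesgue. K y z * f z) \<longlongrightarrow> T f y) (at_right 0)"
    and d: "0 < d" and far: "\<forall>z. f z \<noteq> 0 \<longrightarrow> d \<le> norm (y - z)"
  have eq: "(LINT z:{z. norm (y - z) \<ge> \<epsilon>}|lebesgue. K y z * f z) = (LINT z|lebesgue. K y z * f z)" if "\<epsilon> < d" for \<epsilon>
  proof -
    have "indicator {z. norm (y - z) \<ge> \<epsilon>} z *\<^sub>R (K y z * f z) = K y z * f z" for z
      using far that by (cases "f z = 0") (auto simp: indicator_def)
    thus ?thesis by (simp add: set_lebesgue_integral_def)
  qed
  have "\<forall>\<^sub>F \<epsilon> in at_right 0. (LINT z|lebesgue. K y z * f z) = (LINT z:{z. norm (y - z) \<ge> \<epsilon>}|lebesgue. K y z * f z)"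
    unfolding eventually_at_right_field using d eq by (intro exI[of _ d]) auto
  from Lim_transform_eventually[OF tendsto_const this]
  show "T f y = (LINT z|lebesgue. K y z * f z)" using tendsto_unique[OF _ lim] by simp
qed

text \<open>The truncated integrals are linear in the function, and linearity survives the limit at
  every point where all three principal values exist.\<close>

lemma T_linear:
  assumes f: "f \<in> test_functions" and g: "g \<in> test_functions"
  shows "AE y in lebesgue. T (\<lambda>x. c * f x + d * g x) y = c * T f y + d * T g y"
  using principal_value[OF f] principal_value[OF g] principal_value[OF test_functions_linear[OF f g, of c d]]
proof (rule AE_mp[OF _ AE_mp[OF _ AE_mp]], intro AE_I2 impI)
  fix y
  let ?I = "\<lambda>f \<epsilon>. LINT z:{z. norm (y - z) \<ge> \<epsilon>}|lebesgue. K y z * f z"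
  assume lim: "(?I f \<longlongrightarrow> T f y) (at_right 0)" "(?I g \<longlongrightarrow> T g y) (at_right 0)"
    "(?I (\<lambda>x. c * f x + d * g x) \<longlongrightarrow> T (\<lambda>x. c * f x + d * g x) y) (at_right 0)"
  have eq: "?I (\<lambda>x. c * f x + d * g x) \<epsilon> = c * ?I f \<epsilon> + d * ?I g \<epsilon>" if "0 < \<epsilon>" for \<epsilon>
  proof -
    note i = truncated_integrable[OF test_function_integrable[OF f] that, of y]
      truncated_integrable[OF test_function_integrable[OF g] that, of y]
    have "?I (\<lambda>x. c * f x + d * g x) \<epsilon>
        = (LINT z:{z. norm (y - z) \<ge> \<epsilon>}|lebesgue. c * (K y z * f z) + d * (K y z * g z))"
      by (simp add: algebra_simps)
    also have "\<dots> = c * ?I f \<epsilon> + d * ?I g \<epsilon>"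
      using i by (subst set_integral_add) auto
    finally show ?thesis .
  qed
  have "((\<lambda>\<epsilon>. c * ?I f \<epsilon> + d * ?I g \<epsilon>) \<longlongrightarrow> c * T f y + d * T g y) (at_right 0)"
    using lim by (intro tendsto_intros)
  moreover have "\<forall>\<^sub>F \<epsilon> in at_right 0. c * ?I f \<epsilon> + d * ?I g \<epsilon> = ?I (\<lambda>x. c * f x + d * g x) \<epsilon>"
    unfolding eventually_at_right_field using eq by (intro exI[of _ 1]) auto
  ultimately have "(?I (\<lambda>x. c * f x + d * g x) \<longlongrightarrow> c * T f y + d * T g y) (at_right 0)"
    by (rule Lim_transform_eventually)
  thus "T (\<lambda>x. c * f x + d * g x) y = c * T f y + d * T g y"
    using tendsto_unique[OF _ lim(3)] by simp
qed

lemma T_zero: "AE y in lebesgue. T (\<lambda>x. 0) y = 0"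
  using T_linear[OF zero_test_function zero_test_function, of 0 0] by simp

lemma T_sum:
  assumes "\<And>i. i \<in> I \<Longrightarrow> f i \<in> test_functions"
  shows "AE y in lebesgue. T (\<lambda>x. \<Sum>i\<in>I. c i * f i x) y = (\<Sum>i\<in>I. c i * T (f i) y)"
  using assms
proof (induction I rule: infinite_finite_induct)
  case (insert i I)
  have fs: "(\<lambda>x. \<Sum>i\<in>I. c i * f i x) \<in> test_functions" by (rule test_functions_sum) (use insert in auto)
  have "AE y in lebesgue. T (\<lambda>x. c i * f i x + 1 * (\<Sum>i\<in>I. c i * f i x)) y = c i * T (f i) y + 1 * T (\<lambda>x. \<Sum>i\<in>I. c i * f i x) y"
    by (rule T_linear) (use insert fs in auto)
  moreover have "AE y in lebesgue. T (\<lambda>x. \<Sum>i\<in>I. c i * f i x) y = (\<Sum>i\<in>I. c i * T (f i) y)"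
    using insert by auto
  ultimately show ?case by (rule AE_mp[OF _ AE_mp]) (use insert in \<open>auto intro!: AE_I2\<close>)
qed (use T_zero in simp_all)

lemma c1_bound: "f \<in> test_functions \<Longrightarrow> Lp_norm 2 (T f) \<le> max 0 c1 * Lp_norm 2 f"
  using T_L2[of f] mult_right_mono[of c1 "max 0 c1" "Lp_norm 2 f"] Lp_norm_nonneg[of 2 f] by auto

end

section \<open>From the operator to matrices over the lattice\<close>

lemma cell_step_at:
  assumes "finite M"
  shows "(\<Sum>m\<in>M. c m * indicator (cell j m) x) = (if cell_index j x \<in> M then c (cell_index j x) else (0 :: 'b :: semiring_1))"
proof -
  have "(\<Sum>m\<in>M. c m * indicator (cell j m) x) = (\<Sum>m\<in>M. if m = cell_index j x then c m else 0)"
    by (rule sum.cong) (auto simp: indicator_def cell_iff)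
  thus ?thesis using sum.delta[OF assms, of "cell_index j x" c] by simp
qed

text \<open>Cells of one level are disjoint, so this is a sequence norm times a power of the cell
  volume. For conjugate exponents the two powers multiply to the volume itself, which the
  normalisation of the matrix removes.\<close>

lemma Lp_norm_cell_step:
  fixes c :: "int ^ 'n \<Rightarrow> complex"
  assumes p: "0 < p" and M: "finite M"
  shows "Lp_norm p (\<lambda>x. \<Sum>m\<in>M. c m * indicator (cell j m) x)
    = (\<Sum>m\<in>M. norm (c m) powr p) powr (1 / p) * ((1 / 2 ^ j) ^ CARD('n)) powr (1 / p)"
proof -
  have "(LINT x|lebesgue. norm (\<Sum>m\<in>M. c m * indicator (cell j m) x) powr p)
      = (LINT x|lebesgue. (\<Sum>m\<in>M. norm (c m) powr p * indicator (cell j m) x))"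
    unfolding cell_step_at[OF M] by (intro Bochner_Integration.integral_cong) auto
  also have "\<dots> = (\<Sum>m\<in>M. norm (c m) powr p * measure lebesgue (cell j m))"
    using cell_lmeasurable by (subst Bochner_Integration.integral_sum) (auto simp: lmeasurable_iff_integrable)
  also have "\<dots> = (\<Sum>m\<in>M. norm (c m) powr p) * (1 / 2 ^ j) ^ CARD('n)"
    by (simp add: measure_cell sum_distrib_right)
  finally show ?thesis unfolding Lp_norm_eq by (simp only: powr_mult)
qed

lemma norm_bump_sum_le:
  assumes "finite M"
  shows "norm (\<Sum>m\<in>M. c m * cell_bump N j m x) \<le> norm (\<Sum>m\<in>M. c m * indicator (cell j m) x)"
proof -
  have "(\<Sum>m\<in>M. c m * cell_bump N j m x) = (\<Sum>m\<in>M. if m = cell_index j x then c m * cell_bump N j m x else 0)"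
  proof (rule sum.cong[OF refl])
    fix m show "c m * cell_bump N j m x = (if m = cell_index j x then c m * cell_bump N j m x else 0)"
      using cell_bump_off_cell[of x j m N] by (auto simp: cell_iff)
  qed
  also have "\<dots> = (if cell_index j x \<in> M then c (cell_index j x) * cell_bump N j (cell_index j x) x else 0)"
    using sum.delta[OF assms, of "cell_index j x" "\<lambda>m. c m * cell_bump N j m x"] by simp
  finally show ?thesis
    unfolding cell_step_at[OF assms] using norm_cell_bump_le[of N j "cell_index j x" x]
    by (auto simp: norm_mult cell_iff intro: mult_left_le)
qed

text \<open>Translating by the difference of two corners carries one cell to the other. Together
  with the same fact for bumps it turns differences of matrix entries into differences of the
  kernel.\<close>

lemma cell_translate: "cell_corner j m'' - cell_corner j m' + x \<in> cell j m'' \<longleftrightarrow> x \<in> cell j m'"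
proof -
  have *: "2 ^ j * (real_of_int (m'' $ i) / 2 ^ j - real_of_int (m' $ i) / 2 ^ j + x $ i)
      = real_of_int (m'' $ i) - real_of_int (m' $ i) + 2 ^ j * x $ i" for i
    by (simp add: algebra_simps)
  have "real_of_int (m'' $ i) \<le> 2 ^ j * (cell_corner j m'' - cell_corner j m' + x) $ i \<and>
      2 ^ j * (cell_corner j m'' - cell_corner j m' + x) $ i < real_of_int (m'' $ i) + 1 \<longleftrightarrow>
      real_of_int (m' $ i) \<le> 2 ^ j * x $ i \<and> 2 ^ j * x $ i < real_of_int (m' $ i) + 1" for i
    unfolding cell_corner_def vector_add_component vector_minus_component vec_lambda_beta *
    by (intro conj_cong iffI; linarith)
  thus ?thesis unfolding cell_def by simp
qed

lemma cell_bump_translate: "cell_bump N j m'' (cell_corner j m'' - cell_corner j m' + x) = cell_bump N j m' x"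
proof -
  have "2 ^ j * (real_of_int (m'' $ i) / 2 ^ j - real_of_int (m' $ i) / 2 ^ j + x $ i) + - real_of_int (m'' $ i)
      = 2 ^ j * x $ i + - real_of_int (m' $ i)" for i
    by (simp add: algebra_simps)
  thus ?thesis unfolding cell_bump_def product_function_def by (simp add: cell_corner_def)
qed

lemma norm_cell_corner_diff:
  fixes m' m'' :: "int ^ 'n"
  shows "norm (cell_corner j m'' - cell_corner j m') \<le> real CARD('n) * (sup_dist m' m'' / 2 ^ j)"
proof (rule norm_le_component_bound)
  fix i
  have "\<bar>(cell_corner j m'' - cell_corner j m') $ i\<bar> = real_of_int \<bar>m' $ i - m'' $ i\<bar> / 2 ^ j"
    by (simp add: cell_corner_def diff_divide_distrib[symmetric] abs_divide abs_minus_commute flip: of_int_diff of_int_abs)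
  thus "\<bar>(cell_corner j m'' - cell_corner j m') $ i\<bar> \<le> sup_dist m' m'' / 2 ^ j"
    using sup_dist_component[of m' i m''] by (simp add: divide_right_mono)
qed

text \<open>Points of cells at index distance d differ by at least d - 1 mesh units in some
  coordinate, and d - 1 >= d / 2 from d = 2 on.\<close>

lemma cell_separation:
  assumes x: "x \<in> cell j m" and z: "z \<in> cell j m'" and sep: "2 \<le> sup_dist m m'"
  shows "sup_dist m m' / 2 ^ Suc j \<le> norm (x - z)"
proof -
  obtain i where i: "sup_dist m m' = real_of_int \<bar>m $ i - m' $ i\<bar>" using sup_dist_attained by blast
  have "real_of_int (m $ i) \<le> 2 ^ j * x $ i" "2 ^ j * x $ i < real_of_int (m $ i) + 1"
    "real_of_int (m' $ i) \<le> 2 ^ j * z $ i" "2 ^ j * z $ i < real_of_int (m' $ i) + 1"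
    using x z unfolding cell_def by auto
  hence "sup_dist m m' - 1 \<le> \<bar>2 ^ j * x $ i - 2 ^ j * z $ i\<bar>" unfolding i by linarith
  also have "\<dots> = 2 ^ j * \<bar>(x - z) $ i\<bar>" by (simp add: right_diff_distrib[symmetric] abs_mult)
  also have "\<dots> \<le> 2 ^ j * norm (x - z)" by (intro mult_left_mono component_le_norm_cart) simp
  finally have "sup_dist m m' / 2 \<le> 2 ^ j * norm (x - z)" using sep by linarith
  thus ?thesis by (simp add: field_simps)
qed

context calderon_zygmund
begin

text \<open>Bumps are used as input because \<open>T\<close> needs smooth functions; the output is
  only paired, so indicators are enough. Division by the cell volume turns the entries into averages
  of \<open>T b\<close> over a cell and makes the l2 bound and the regularity constant independent
  of \<open>j\<close> and \<open>N\<close>.\<close>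

definition cz_matrix :: "nat \<Rightarrow> nat \<Rightarrow> int ^ 'n \<Rightarrow> int ^ 'n \<Rightarrow> complex"
  where "cz_matrix N j m m' = (2 ^ j) ^ CARD('n) * (LINT x|lebesgue. T (cell_bump N j m') x * indicator (cell j m) x)"

lemma T_bump_integrable: "integrable lebesgue (\<lambda>x. T (cell_bump N j m') x * indicator (cell j m) x)"
  by (rule Lp_hoelder_integrable[where q = 2 and q' = 2, OF _ _ conjunct1[OF T_L2[OF cell_bump_test_function]] indicator_cell_in_Lp_space]) auto

lemma cz_matrix_form:
  assumes S: "finite S" and G: "finite G"
  shows "(\<Sum>m\<in>G. \<Sum>m'\<in>S. cz_matrix N j m m' * f m' * g m) = (2 ^ j) ^ CARD('n) *
    (LINT x|lebesgue. T (\<lambda>x. \<Sum>m'\<in>S. f m' * cell_bump N j m' x) x * (\<Sum>m\<in>G. g m * indicator (cell j m) x))"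
proof -
  have "(LINT x|lebesgue. T (\<lambda>x. \<Sum>m'\<in>S. f m' * cell_bump N j m' x) x * (\<Sum>m\<in>G. g m * indicator (cell j m) x))
    = (LINT x|lebesgue. (\<Sum>m\<in>G. \<Sum>m'\<in>S. f m' * g m * (T (cell_bump N j m') x * indicator (cell j m) x)))"
  proof (rule integral_cong_AE)
    have bt: "(\<lambda>x. \<Sum>m'\<in>S. f m' * cell_bump N j m' x) \<in> test_functions"
      by (rule test_functions_sum) (rule cell_bump_test_function)
    have [measurable]: "T (\<lambda>x. \<Sum>m'\<in>S. f m' * cell_bump N j m' x) \<in> borel_measurable lebesgue"
      using T_L2[OF bt] Lp_spaceD by blast
    show "(\<lambda>x. T (\<lambda>x. \<Sum>m'\<in>S. f m' * cell_bump N j m' x) x * (\<Sum>m\<in>G. g m * indicator (cell j m) x)) \<in> borel_measurable lebesgue"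
      by measurable
    show "(\<lambda>x. \<Sum>m\<in>G. \<Sum>m'\<in>S. f m' * g m * (T (cell_bump N j m') x * indicator (cell j m) x)) \<in> borel_measurable lebesgue"
    proof -
      have [measurable]: "T (cell_bump N j m') \<in> borel_measurable lebesgue" for m'
        using T_L2[OF cell_bump_test_function] Lp_spaceD by blast
      show ?thesis by measurable
    qed
    have "AE x in lebesgue. T (\<lambda>x. \<Sum>m'\<in>S. f m' * cell_bump N j m' x) x = (\<Sum>m'\<in>S. f m' * T (cell_bump N j m') x)"
      by (rule T_sum) (rule cell_bump_test_function)
    thus "AE x in lebesgue. T (\<lambda>x. \<Sum>m'\<in>S. f m' * cell_bump N j m' x) x * (\<Sum>m\<in>G. g m * indicator (cell j m) x)
        = (\<Sum>m\<in>G. \<Sum>m'\<in>S. f m' * g m * (T (cell_bump N j m') x * indicator (cell j m) x))"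
    proof (rule AE_mp, intro AE_I2 impI)
      fix x assume eq: "T (\<lambda>x. \<Sum>m'\<in>S. f m' * cell_bump N j m' x) x = (\<Sum>m'\<in>S. f m' * T (cell_bump N j m') x)"
      show "T (\<lambda>x. \<Sum>m'\<in>S. f m' * cell_bump N j m' x) x * (\<Sum>m\<in>G. g m * indicator (cell j m) x)
        = (\<Sum>m\<in>G. \<Sum>m'\<in>S. f m' * g m * (T (cell_bump N j m') x * indicator (cell j m) x))"
        unfolding eq sum_product by (subst sum.swap) (simp add: mult_ac)
    qed
  qed
  also have "\<dots> = (\<Sum>m\<in>G. \<Sum>m'\<in>S. f m' * g m * (LINT x|lebesgue. T (cell_bump N j m') x * indicator (cell j m) x))"
    using T_bump_integrable by (simp add: Bochner_Integration.integral_sum)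
  finally show ?thesis by (simp add: cz_matrix_def sum_distrib_left mult_ac)
qed

lemma cz_matrix_l2:
  assumes S: "finite S" and G: "finite G"
  shows "norm (\<Sum>m\<in>G. \<Sum>m'\<in>S. cz_matrix N j m m' * f m' * g m)
    \<le> max 0 c1 * sqrt (\<Sum>m'\<in>S. (norm (f m'))\<^sup>2) * sqrt (\<Sum>m\<in>G. (norm (g m))\<^sup>2)"
proof -
  let ?F = "\<lambda>x. \<Sum>m'\<in>S. f m' * cell_bump N j m' x" and ?G = "\<lambda>x. \<Sum>m\<in>G. g m * indicator (cell j m) x"
  let ?s = "((1 / 2 ^ j) ^ CARD('n)) powr (1 / 2) :: real"
  have F: "?F \<in> test_functions" by (rule test_functions_sum) (rule cell_bump_test_function)
  have G2: "?G \<in> Lp_space 2" by (rule cell_step_in_Lp_space) simp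
  have step: "Lp_norm 2 (\<lambda>x. \<Sum>m\<in>M. c m * indicator (cell j m) x) = sqrt (\<Sum>m\<in>M. (norm (c m))\<^sup>2) * ?s"
    if "finite M" for M and c :: "int ^ 'n \<Rightarrow> complex"
    using Lp_norm_cell_step[of 2 M c j] that by (simp add: powr_half_sqrt sum_nonneg)
  have "norm (LINT x|lebesgue. T ?F x * ?G x) \<le> Lp_norm 2 (T ?F) * Lp_norm 2 ?G"
    by (rule Lp_hoelder) (use T_L2[OF F] G2 in auto)
  also have "\<dots> \<le> (max 0 c1 * Lp_norm 2 ?F) * Lp_norm 2 ?G"
    by (intro mult_right_mono c1_bound F Lp_norm_nonneg)
  also have "\<dots> \<le> (max 0 c1 * Lp_norm 2 (\<lambda>x. \<Sum>m'\<in>S. f m' * indicator (cell j m') x)) * Lp_norm 2 ?G"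
    by (intro mult_right_mono mult_left_mono Lp_norm_nonneg Lp_norm_mono cell_step_in_Lp_space test_function_measurable F
        AE_I2 norm_bump_sum_le S) auto
  also have "\<dots> = max 0 c1 * sqrt (\<Sum>m'\<in>S. (norm (f m'))\<^sup>2) * sqrt (\<Sum>m\<in>G. (norm (g m))\<^sup>2) * (?s * ?s)"
    unfolding step[OF S] step[OF G] by (simp only: mult_ac)
  also have "?s * ?s = (1 / 2 ^ j) ^ CARD('n)" by (subst powr_add[symmetric]) simp
  finally have le: "norm (LINT x|lebesgue. T ?F x * ?G x)
    \<le> max 0 c1 * sqrt (\<Sum>m'\<in>S. (norm (f m'))\<^sup>2) * sqrt (\<Sum>m\<in>G. (norm (g m))\<^sup>2) * (1 / 2 ^ j) ^ CARD('n)" .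
  have "norm (\<Sum>m\<in>G. \<Sum>m'\<in>S. cz_matrix N j m m' * f m' * g m) = (2 ^ j) ^ CARD('n) * norm (LINT x|lebesgue. T ?F x * ?G x)"
    unfolding cz_matrix_form[OF S G] by (simp add: norm_mult norm_power)
  also have "\<dots> \<le> (2 ^ j) ^ CARD('n) * (max 0 c1 * sqrt (\<Sum>m'\<in>S. (norm (f m'))\<^sup>2) * sqrt (\<Sum>m\<in>G. (norm (g m))\<^sup>2) * (1 / 2 ^ j) ^ CARD('n))"
    by (intro mult_left_mono le) simp
  also have "\<dots> = max 0 c1 * sqrt (\<Sum>m'\<in>S. (norm (f m'))\<^sup>2) * sqrt (\<Sum>m\<in>G. (norm (g m))\<^sup>2)"
    by (simp add: power_divide)
  finally show ?thesis .
qed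

text \<open>The power of the dimension compares the Euclidean length of a translation with the
  lattice distance; the power of 2 pays for the halved distance in
  \<open>cell_separation\<close>.\<close>

definition "hoelder_const = c2 * real CARD('n) powr \<delta> * 2 powr (real CARD('n) + \<delta>)"

lemma hoelder_const_nonneg: "0 \<le> hoelder_const"
  using c2 by (simp add: hoelder_const_def)

lemma kernel_bump_integrable:
  assumes "x \<in> cell j m" "2 \<le> sup_dist m m'"
  shows "integrable lebesgue (\<lambda>z. K x z * cell_bump N j m' z)"
proof (rule Bochner_Integration.integrable_bound)
  let ?d = "sup_dist m m' / 2 ^ Suc j"
  have d: "0 < ?d" using assms by simp
  show "integrable lebesgue (\<lambda>z. c2 * ?d powr (- real CARD('n)) * norm (cell_bump N j m' z))"
    by (intro integrable_mult_right integrable_norm test_function_integrable cell_bump_test_function)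
  show "AE z in lebesgue. norm (K x z * cell_bump N j m' z) \<le> norm (c2 * ?d powr (- real CARD('n)) * norm (cell_bump N j m' z))"
  proof (intro AE_I2)
    fix z
    show "norm (K x z * cell_bump N j m' z) \<le> norm (c2 * ?d powr (- real CARD('n)) * norm (cell_bump N j m' z))"
    proof (cases "z \<in> cell j m'")
      case True
      have "norm (K x z) \<le> c2 * ?d powr (- real CARD('n))"
        by (rule size_far[OF d cell_separation[OF assms(1) True assms(2)]])
      thus ?thesis using c2 by (simp add: norm_mult mult_right_mono)
    qed (simp add: cell_bump_off_cell)
  qed
  have [measurable]: "cell_bump N j m' \<in> borel_measurable lebesgue" by (rule test_function_measurable[OF cell_bump_test_function])
  show "(\<lambda>z. K x z * cell_bump N j m' z) \<in> borel_measurable lebesgue" by measurable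
qed

lemma T_bump_formula:
  assumes "2 \<le> sup_dist m m'"
  shows "AE x in lebesgue. x \<in> cell j m \<longrightarrow> T (cell_bump N j m') x = (LINT z|lebesgue. K x z * cell_bump N j m' z)"
  using T_off_support[OF cell_bump_test_function]
proof (rule AE_mp, intro AE_I2 impI)
  fix x assume *: "\<forall>d>0. (\<forall>z. cell_bump N j m' z \<noteq> 0 \<longrightarrow> d \<le> norm (x - z)) \<longrightarrow>
      T (cell_bump N j m') x = (LINT z|lebesgue. K x z * cell_bump N j m' z)" and x: "x \<in> cell j m"
  show "T (cell_bump N j m') x = (LINT z|lebesgue. K x z * cell_bump N j m' z)"
  proof (rule *[rule_format])
    show "0 < sup_dist m m' / 2 ^ Suc j" using assms by simp
    fix z assume "cell_bump N j m' z \<noteq> 0"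
    hence "z \<in> cell j m'" using cell_bump_off_cell by blast
    thus "sup_dist m m' / 2 ^ Suc j \<le> norm (x - z)" by (rule cell_separation[OF x _ assms])
  qed
qed

lemma integral_bump_le: "(LINT z|lebesgue. norm (cell_bump N j m z)) \<le> (1 / 2 ^ j) ^ CARD('n)" for m :: "int ^ 'n"
proof -
  have "(LINT z|lebesgue. norm (cell_bump N j m z)) \<le> (LINT z|lebesgue. indicator (cell j m) z)"
    using test_function_integrable[OF cell_bump_test_function] cell_lmeasurable norm_cell_bump_le
    by (intro integral_mono) (auto simp: lmeasurable_iff_integrable)
  thus ?thesis by (simp add: measure_cell)
qed

text \<open>The factor \<open>4 n\<close> makes the translation vector at most half of the distance of the two cells.\<close>

lemma hoelder_scaling:
  fixes m m' m'' :: "int ^ 'n"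
  assumes close: "4 * real CARD('n) * sup_dist m' m'' \<le> sup_dist m m'" and ne: "0 < sup_dist m' m''"
    and d: "sup_dist m m' / 2 ^ Suc j \<le> d" and v: "norm v \<le> real CARD('n) * (sup_dist m' m'' / 2 ^ j)"
  shows "2 * norm v \<le> d"
    and "c2 * (norm v powr \<delta> * d powr (- (real CARD('n) + \<delta>))) \<le>
      hoelder_const * (2 ^ j) ^ CARD('n) * (sup_dist m' m'' powr \<delta> * sup_dist m m' powr (- (real CARD('n) + \<delta>)))"
proof -
  have "2 * norm v \<le> 2 * (real CARD('n) * (sup_dist m' m'' / 2 ^ j))" using v by simp
  also have "\<dots> = (4 * real CARD('n) * sup_dist m' m'') / 2 ^ Suc j" by simp
  also have "\<dots> \<le> sup_dist m m' / 2 ^ Suc j" using close by (intro divide_right_mono) auto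
  finally show "2 * norm v \<le> d" using d by linarith
  have n1: "1 \<le> real CARD('n)" by (simp add: Suc_leI)
  have pos: "0 < sup_dist m m'"
    using close ne n1 mult_pos_pos[of "4 * real CARD('n)" "sup_dist m' m''"] by linarith
  have "norm v powr \<delta> * d powr (- (real CARD('n) + \<delta>))
      \<le> (real CARD('n) * (sup_dist m' m'' / 2 ^ j)) powr \<delta> * (sup_dist m m' / 2 ^ Suc j) powr (- (real CARD('n) + \<delta>))"
    using v d pos \<delta> by (intro mult_mono powr_mono2 powr_mono2') auto
  also have "\<dots> = real CARD('n) powr \<delta> * 2 powr (real CARD('n) + \<delta>) * (2 ^ j) ^ CARD('n) *
      (sup_dist m' m'' powr \<delta> * sup_dist m m' powr (- (real CARD('n) + \<delta>)))"
  proof -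
    have A: "(2 ^ j) powr s = (2 powr (real j * s) :: real)" for s
      by (simp add: powr_powr flip: powr_realpow)
    have B: "(2 ^ j) ^ CARD('n) = (2 powr (real j * real CARD('n)) :: real)"
      by (simp add: powr_realpow flip: power_mult of_nat_mult)
    have C: "(real CARD('n) * (sup_dist m' m'' / 2 ^ j)) powr \<delta> = real CARD('n) powr \<delta> * sup_dist m' m'' powr \<delta> * 2 powr (- (real j * \<delta>))"
      unfolding powr_mult powr_divide A by (simp add: powr_minus divide_inverse)
    have D: "(sup_dist m m' / 2 ^ Suc j) powr (- (real CARD('n) + \<delta>))
        = sup_dist m m' powr (- (real CARD('n) + \<delta>)) * (2 powr (real CARD('n) + \<delta>) * 2 powr (real j * (real CARD('n) + \<delta>)))"
    proof -
      have *: "(2 * 2 ^ j :: real) powr (- (real CARD('n) + \<delta>))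
          = inverse (2 powr (real CARD('n) + \<delta>) * 2 powr (real j * (real CARD('n) + \<delta>)))"
        unfolding powr_minus powr_mult A ..
      show ?thesis unfolding power_Suc powr_divide * by (simp only: divide_inverse inverse_inverse_eq)
    qed
    have E: "2 powr (- (real j * \<delta>)) * 2 powr (real j * (real CARD('n) + \<delta>)) = (2 powr (real j * real CARD('n)) :: real)"
      by (simp add: algebra_simps flip: powr_add)
    show ?thesis unfolding C D B E[symmetric] by (simp only: mult_ac)
  qed
  finally have "c2 * (norm v powr \<delta> * d powr (- (real CARD('n) + \<delta>))) \<le> c2 * (real CARD('n) powr \<delta> * 2 powr (real CARD('n) + \<delta>) *
      (2 ^ j) ^ CARD('n) * (sup_dist m' m'' powr \<delta> * sup_dist m m' powr (- (real CARD('n) + \<delta>))))"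
    by (rule mult_left_mono) (use c2 in simp)
  thus "c2 * (norm v powr \<delta> * d powr (- (real CARD('n) + \<delta>))) \<le>
      hoelder_const * (2 ^ j) ^ CARD('n) * (sup_dist m' m'' powr \<delta> * sup_dist m m' powr (- (real CARD('n) + \<delta>)))"
    by (simp only: hoelder_const_def mult.assoc)
qed

end

context calderon_zygmund
begin

text \<open>A distance ratio of at least 4 leaves both \<open>m'\<close> and \<open>m''\<close> at
  index distance 2 or more from \<open>m\<close>, as the kernel formula on cells requires.\<close>

lemma close_cells:
  fixes m m' m'' :: "int ^ 'n"
  assumes close: "4 * real CARD('n) * sup_dist m' m'' \<le> sup_dist m m'" and ne: "m' \<noteq> m''"
  shows "1 \<le> sup_dist m' m''" "2 \<le> sup_dist m m'" "2 \<le> sup_dist m m''"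
proof -
  obtain i where i: "sup_dist m' m'' = real_of_int \<bar>m' $ i - m'' $ i\<bar>" using sup_dist_attained by blast
  have "sup_dist m' m'' \<noteq> 0" using sup_dist_component[of m' _ m''] ne by (auto simp: vec_eq_iff)
  hence "1 \<le> \<bar>m' $ i - m'' $ i\<bar>" unfolding i by simp
  thus ge1: "1 \<le> sup_dist m' m''" unfolding i using of_int_le_iff[of 1, where 'a = real] by simp
  have "1 \<le> real CARD('n)" by (simp add: Suc_leI)
  hence "4 * sup_dist m' m'' \<le> 4 * real CARD('n) * sup_dist m' m''" using ge1 by simp
  hence "4 * sup_dist m' m'' \<le> sup_dist m m'" using close by linarith
  thus "2 \<le> sup_dist m m'" "2 \<le> sup_dist m m''"
    using ge1 sup_dist_triangle[of m m' m''] sup_dist_commute[of m' m''] by linarith+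
qed

text \<open>The factor (2^j)^n is compensated by the integral of a bump, which is at most the cell
  volume.\<close>

lemma norm_integral_bump_le:
  fixes D :: "real ^ 'n \<Rightarrow> complex"
  assumes int: "integrable lebesgue (\<lambda>z. D z * cell_bump N j m z)" and C: "0 \<le> C"
    and le: "\<And>z. z \<in> cell j m \<Longrightarrow> norm (D z) \<le> (2 ^ j) ^ CARD('n) * C"
  shows "norm (LINT z|lebesgue. D z * cell_bump N j m z) \<le> C"
proof -
  have "norm (LINT z|lebesgue. D z * cell_bump N j m z) \<le> (LINT z|lebesgue. norm (D z * cell_bump N j m z))"
    by (rule integral_norm_bound)
  also have "\<dots> \<le> (LINT z|lebesgue. (2 ^ j) ^ CARD('n) * C * norm (cell_bump N j m z))"
  proof (rule integral_mono[OF integrable_norm[OF int]])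
    show "integrable lebesgue (\<lambda>z. (2 ^ j) ^ CARD('n) * C * norm (cell_bump N j m z))"
      by (intro integrable_mult_right integrable_norm test_function_integrable cell_bump_test_function)
    show "norm (D z * cell_bump N j m z) \<le> (2 ^ j) ^ CARD('n) * C * norm (cell_bump N j m z)" for z
      using le[of z] by (cases "z \<in> cell j m") (simp_all add: norm_mult mult_right_mono cell_bump_off_cell)
  qed
  also have "\<dots> = (2 ^ j) ^ CARD('n) * C * (LINT z|lebesgue. norm (cell_bump N j m z))" by simp
  also have "\<dots> \<le> (2 ^ j) ^ CARD('n) * C * (1 / 2 ^ j) ^ CARD('n)"
    using C by (intro mult_left_mono integral_bump_le mult_nonneg_nonneg) auto
  also have "\<dots> = C" by (simp add: power_divide)
  finally show ?thesis .
qed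

lemma cell_average_le:
  fixes F :: "real ^ 'n \<Rightarrow> complex"
  assumes int: "integrable lebesgue (\<lambda>x. F x * indicator (cell j m) x)"
    and le: "AE x in lebesgue. x \<in> cell j m \<longrightarrow> norm (F x) \<le> C"
  shows "norm ((2 ^ j) ^ CARD('n) * (LINT x|lebesgue. F x * indicator (cell j m) x)) \<le> C"
proof -
  have "norm (LINT x|lebesgue. F x * indicator (cell j m) x) \<le> (LINT x|lebesgue. C * indicator (cell j m) x)"
  proof (rule order_trans[OF integral_norm_bound], rule integral_mono_AE[OF integrable_norm[OF int]])
    show "integrable lebesgue (\<lambda>x. C * indicator (cell j m) x)"
      using cell_lmeasurable[of j m] by (simp add: lmeasurable_iff_integrable)
    show "AE x in lebesgue. norm (F x * indicator (cell j m) x) \<le> C * indicator (cell j m) x"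
      using le by (rule AE_mp) (auto intro!: AE_I2 simp: indicator_def)
  qed
  also have "\<dots> = C * (1 / 2 ^ j) ^ CARD('n)" by (simp add: measure_cell)
  finally have "(2 ^ j) ^ CARD('n) * norm (LINT x|lebesgue. F x * indicator (cell j m) x) \<le> (2 ^ j) ^ CARD('n) * (C * (1 / 2 ^ j) ^ CARD('n))"
    by (rule mult_left_mono) simp
  thus ?thesis by (simp add: norm_mult norm_power power_divide)
qed

text \<open>Uses regularity in the second kernel variable. The bump on \<open>m''\<close> is a
  translate of the bump on \<open>m'\<close>, so a change of variables writes the difference of the
  two images at \<open>x\<close> as the integral of K x z - K x (v + z) against a single bump.
  Averaging over the output cell keeps the bound.\<close>

lemma cz_matrix_hoelder2:
  assumes close: "4 * real CARD('n) * sup_dist m' m'' \<le> sup_dist m m'"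
  shows "norm (cz_matrix N j m m' - cz_matrix N j m m'')
    \<le> hoelder_const * (sup_dist m' m'' powr \<delta> * sup_dist m m' powr (- (real CARD('n) + \<delta>)))" (is "_ \<le> ?C")
proof (cases "m' = m''")
  case True
  thus ?thesis using hoelder_const_nonneg by simp
next
  case False
  define v where "v = cell_corner j m'' - cell_corner j m'"
  define b where "b m = cell_bump N j m" for m :: "int ^ 'n"
  note sep = close_cells[OF close False]
  have point: "norm (T (b m') x - T (b m'') x) \<le> ?C"
    if x: "x \<in> cell j m" and f1: "T (b m') x = (LINT z|lebesgue. K x z * b m' z)"
      and f2: "T (b m'') x = (LINT z|lebesgue. K x z * b m'' z)" for x
  proof -
    have i1: "integrable lebesgue (\<lambda>z. K x z * b m' z)" and i2: "integrable lebesgue (\<lambda>z. K x z * b m'' z)"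
      unfolding b_def using kernel_bump_integrable[OF x] sep by auto
    have i3: "integrable lebesgue (\<lambda>z. K x (v + z) * b m' z)"
      using integrable_lebesgue_translation[OF i2, of v] by (simp add: b_def v_def cell_bump_translate)
    have eq: "(LINT z|lebesgue. K x z * b m'' z) = (LINT z|lebesgue. K x (v + z) * b m'' (v + z))"
      by (rule integral_lebesgue_translation[symmetric]) (rule borel_measurable_integrable[OF i2])
    have "T (b m') x - T (b m'') x = (LINT z|lebesgue. K x z * b m' z) - (LINT z|lebesgue. K x (v + z) * b m' z)"
      unfolding f1 f2 eq by (simp add: b_def v_def cell_bump_translate)
    also have "\<dots> = (LINT z|lebesgue. (K x z - K x (v + z)) * b m' z)"
      using i1 i3 by (simp add: left_diff_distrib)
    also have "norm \<dots> \<le> ?C" unfolding b_def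
    proof (rule norm_integral_bump_le)
      show "integrable lebesgue (\<lambda>z. (K x z - K x (v + z)) * cell_bump N j m' z)"
        using i1 i3 by (simp add: left_diff_distrib b_def)
      fix z assume z: "z \<in> cell j m'"
      have d: "sup_dist m m' / 2 ^ Suc j \<le> norm (x - z)" by (rule cell_separation[OF x z sep(2)])
      have "v + z \<in> cell j m''" unfolding v_def using z by (simp only: cell_translate)
      hence d2: "sup_dist m m'' / 2 ^ Suc j \<le> norm (x - (v + z))" by (rule cell_separation[OF x _ sep(3)])
      have "0 < sup_dist m' m''" using sep by linarith
      note sc = hoelder_scaling[OF close this d norm_cell_corner_diff, folded v_def]
      have "0 < sup_dist m m' / 2 ^ Suc j" "0 < sup_dist m m'' / 2 ^ Suc j" using sep by auto
      hence "x \<noteq> z" "x \<noteq> v + z" using d d2 by auto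
      hence "norm (K x z - K x (v + z)) \<le> c2 * (norm (z - (v + z)) powr \<delta> * norm (x - z) powr (- (real CARD('n) + \<delta>)))"
        by (rule regular2') (use sc(1) in simp)
      thus "norm (K x z - K x (v + z)) \<le> (2 ^ j) ^ CARD('n) * ?C" using sc(2) by (simp add: mult_ac)
    qed (simp add: hoelder_const_nonneg)
    finally show ?thesis .
  qed
  have int: "integrable lebesgue (\<lambda>x. (T (b m') x - T (b m'') x) * indicator (cell j m) x)"
    unfolding b_def left_diff_distrib using T_bump_integrable by (intro Bochner_Integration.integrable_diff)
  have "AE x in lebesgue. x \<in> cell j m \<longrightarrow> T (b m') x = (LINT z|lebesgue. K x z * b m' z)"
    "AE x in lebesgue. x \<in> cell j m \<longrightarrow> T (b m'') x = (LINT z|lebesgue. K x z * b m'' z)"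
    unfolding b_def by (rule T_bump_formula[OF sep(2)], rule T_bump_formula[OF sep(3)])
  hence "AE x in lebesgue. x \<in> cell j m \<longrightarrow> norm (T (b m') x - T (b m'') x) \<le> ?C"
    by (rule AE_mp[OF _ AE_mp]) (use point in \<open>auto intro!: AE_I2\<close>)
  from cell_average_le[OF int this] show ?thesis
    unfolding cz_matrix_def b_def using T_bump_integrable by (simp add: left_diff_distrib right_diff_distrib)
qed

text \<open>Uses regularity in the first kernel variable. Here the output cell moves while the bump
  stays, so translating the indicator compares \<open>T b\<close> at x and at v + x; the exceptional
  null set of the kernel formula has to be translated as well.\<close>

lemma cz_matrix_hoelder1:
  assumes close: "4 * real CARD('n) * sup_dist m' m'' \<le> sup_dist m m'"
  shows "norm (cz_matrix N j m' m - cz_matrix N j m'' m)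
    \<le> hoelder_const * (sup_dist m' m'' powr \<delta> * sup_dist m m' powr (- (real CARD('n) + \<delta>)))" (is "_ \<le> ?C")
proof (cases "m' = m''")
  case True
  thus ?thesis using hoelder_const_nonneg by simp
next
  case False
  define v where "v = cell_corner j m'' - cell_corner j m'"
  define b where "b = cell_bump N j m"
  note sep = close_cells[OF close False]
  have sep': "2 \<le> sup_dist m' m" "2 \<le> sup_dist m'' m" using sep by (simp_all add: sup_dist_commute)
  have point: "norm (T b x - T b (v + x)) \<le> ?C"
    if x: "x \<in> cell j m'" and f1: "T b x = (LINT z|lebesgue. K x z * b z)"
      and f2: "T b (v + x) = (LINT z|lebesgue. K (v + x) z * b z)" for x
  proof -
    have x2: "v + x \<in> cell j m''" unfolding v_def using x by (simp only: cell_translate)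
    have i1: "integrable lebesgue (\<lambda>z. K x z * b z)" and i2: "integrable lebesgue (\<lambda>z. K (v + x) z * b z)"
      unfolding b_def using kernel_bump_integrable[OF x sep'(1)] kernel_bump_integrable[OF x2 sep'(2)] by auto
    have "T b x - T b (v + x) = (LINT z|lebesgue. (K x z - K (v + x) z) * b z)"
      using i1 i2 by (simp add: f1 f2 left_diff_distrib)
    also have "norm \<dots> \<le> ?C" unfolding b_def
    proof (rule norm_integral_bump_le)
      show "integrable lebesgue (\<lambda>z. (K x z - K (v + x) z) * cell_bump N j m z)"
        using i1 i2 by (simp add: left_diff_distrib b_def)
      fix z assume z: "z \<in> cell j m"
      have d: "sup_dist m m' / 2 ^ Suc j \<le> norm (x - z)"
        using cell_separation[OF x z sep'(1)] by (simp add: sup_dist_commute)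
      have d2: "sup_dist m'' m / 2 ^ Suc j \<le> norm ((v + x) - z)" by (rule cell_separation[OF x2 z sep'(2)])
      have "0 < sup_dist m' m''" using sep by linarith
      note sc = hoelder_scaling[OF close this d norm_cell_corner_diff, folded v_def]
      have "0 < sup_dist m m' / 2 ^ Suc j" "0 < sup_dist m'' m / 2 ^ Suc j" using sep sep' by auto
      hence "x \<noteq> z" "v + x \<noteq> z" using d d2 by auto
      hence "norm (K x z - K (v + x) z) \<le> c2 * (norm (x - (v + x)) powr \<delta> * norm (x - z) powr (- (real CARD('n) + \<delta>)))"
        by (rule regular1') (use sc(1) in simp)
      thus "norm (K x z - K (v + x) z) \<le> (2 ^ j) ^ CARD('n) * ?C" using sc(2) by (simp add: mult_ac)
    qed (simp add: hoelder_const_nonneg)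
    finally show ?thesis .
  qed
  have int: "integrable lebesgue (\<lambda>x. T b x * indicator (cell j m') x)" for m'
    unfolding b_def by (rule T_bump_integrable)
  have shift: "indicator (cell j m'') (v + x) = (indicator (cell j m') x :: complex)" for x
    by (simp add: indicator_def v_def cell_translate)
  have int': "integrable lebesgue (\<lambda>x. T b (v + x) * indicator (cell j m') x)"
    using integrable_lebesgue_translation[OF int[of m''], of v] by (simp add: shift)
  have tr: "(LINT x|lebesgue. T b x * indicator (cell j m'') x) = (LINT x|lebesgue. T b (v + x) * indicator (cell j m') x)"
    using integral_lebesgue_translation[OF borel_measurable_integrable[OF int[of m'']], of v] by (simp add: shift)
  have intd: "integrable lebesgue (\<lambda>x. (T b x - T b (v + x)) * indicator (cell j m') x)"
    unfolding left_diff_distrib using int int' by (intro Bochner_Integration.integrable_diff)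
  have 1: "AE x in lebesgue. x \<in> cell j m' \<longrightarrow> T b x = (LINT z|lebesgue. K x z * b z)"
    unfolding b_def by (rule T_bump_formula[OF sep'(1)])
  have 2: "AE x in lebesgue. v + x \<in> cell j m'' \<longrightarrow> T b (v + x) = (LINT z|lebesgue. K (v + x) z * b z)"
    unfolding b_def by (rule AE_lebesgue_translation) (rule T_bump_formula[OF sep'(2)])
  have imp: "v + x \<in> cell j m''" if "x \<in> cell j m'" for x using that by (simp add: v_def cell_translate)
  have "AE x in lebesgue. x \<in> cell j m' \<longrightarrow> norm (T b x - T b (v + x)) \<le> ?C"
    using 1 2 by (rule AE_mp[OF _ AE_mp]) (use point imp in \<open>auto intro!: AE_I2\<close>)
  from cell_average_le[OF intd this] show ?thesis
    unfolding cz_matrix_def b_def[symmetric] tr using int int' by (simp add: left_diff_distrib right_diff_distrib)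
qed

lemma cz_matrix_singular_integral:
  "discrete_singular_integral (cz_matrix N j) (max 0 c1) hoelder_const (4 * real CARD('n)) \<delta>"
  "discrete_singular_integral (\<lambda>m m'. cz_matrix N j m' m) (max 0 c1) hoelder_const (4 * real CARD('n)) \<delta>"
proof -
  have n1: "1 \<le> 4 * real CARD('n)" using zero_less_card_finite[where 'a = 'n] by linarith
  show "discrete_singular_integral (cz_matrix N j) (max 0 c1) hoelder_const (4 * real CARD('n)) \<delta>"
    by unfold_locales (use n1 \<delta> hoelder_const_nonneg cz_matrix_l2 cz_matrix_hoelder2 in auto)
  show "discrete_singular_integral (\<lambda>m m'. cz_matrix N j m' m) (max 0 c1) hoelder_const (4 * real CARD('n)) \<delta>"
  proof (unfold_locales)
    fix S G :: "(int ^ 'n) set" and f g assume fin: "finite S" "finite G"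
    have "(\<Sum>m\<in>G. \<Sum>m'\<in>S. cz_matrix N j m' m * f m' * g m) = (\<Sum>m'\<in>S. \<Sum>m\<in>G. cz_matrix N j m' m * g m * f m')"
      by (subst sum.swap) (simp add: mult_ac)
    thus "norm (\<Sum>m\<in>G. \<Sum>m'\<in>S. cz_matrix N j m' m * f m' * g m)
        \<le> max 0 c1 * sqrt (\<Sum>m'\<in>S. (norm (f m'))\<^sup>2) * sqrt (\<Sum>m\<in>G. (norm (g m))\<^sup>2)"
      using cz_matrix_l2[OF fin(2,1), of N j g f] by (simp add: mult_ac)
  qed (use n1 \<delta> hoelder_const_nonneg cz_matrix_hoelder1 in auto)
qed

end

section \<open>Boundedness of the operator in Lebesgue spaces\<close>

definition grid_step :: "nat \<Rightarrow> nat \<Rightarrow> (real ^ 'n \<Rightarrow> complex) \<Rightarrow> real ^ 'n \<Rightarrow> complex"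
  where "grid_step R j f x = (\<Sum>m\<in>grid j R. f (cell_corner j m) * indicator (cell j m) x)"

lemma bounded_subset_half_open_cube:
  fixes S :: "(real ^ 'n) set"
  assumes "bounded S" obtains R where "S \<subseteq> half_open_cube R"
proof -
  obtain B where B: "\<And>x. x \<in> S \<Longrightarrow> norm x \<le> B" using assms by (auto simp: bounded_iff)
  obtain R where R: "B < real R" using reals_Archimedean2 by blast
  have "S \<subseteq> half_open_cube R" using B R norm_less_half_open_cube by (meson le_less_trans subsetI)
  thus ?thesis using that by blast
qed

lemma grid_step_tendsto:
  fixes f :: "real ^ 'n \<Rightarrow> complex"
  assumes f: "f \<in> test_functions" and R: "{x. f x \<noteq> 0} \<subseteq> half_open_cube R" and p: "1 \<le> p"
  shows "grid_step R j f \<in> Lp_space p" "Lp_tendsto p (\<lambda>j. grid_step R j f) f"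
proof -
  show Lp: "grid_step R j f \<in> Lp_space p" for j
    unfolding grid_step_def[abs_def] by (rule cell_step_in_Lp_space[OF p])
  obtain B where B: "\<And>x. norm (f x) \<le> B" using test_function_bounded[OF f] by blast
  have B0: "0 \<le> B" using order_trans[OF norm_ge_zero B] .
  define w where "w x = complex_of_real B * indicator (half_open_cube R) x" for x :: "real ^ 'n"
  have w: "w \<in> Lp_space p"
    unfolding w_def by (rule bounded_in_Lp_space[where B = B and S = "half_open_cube R"])
      (use p B0 in \<open>auto simp: bounded_half_open_cube indicator_def\<close>)
  have cont: "continuous_on UNIV f" using test_function_continuous[OF f, of "[]"] by (simp add: partial_derivs_def)
  show "Lp_tendsto p (\<lambda>j. grid_step R j f) f"
  proof (rule Lp_dominated_convergence(3)[OF p w Lp_spaceD(1)[OF Lp] test_function_measurable[OF f]])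
    show "AE x in lebesgue. (\<lambda>j. grid_step R j f x) \<longlonglongrightarrow> f x"
    proof (intro AE_I2)
      fix x
      have "(\<lambda>j. f (cell_corner j (cell_index j x))) \<longlonglongrightarrow> f x"
        by (rule continuous_on_tendsto_compose[OF cont cell_corner_tendsto]) auto
      thus "(\<lambda>j. grid_step R j f x) \<longlonglongrightarrow> f x"
      proof (cases "x \<in> half_open_cube R")
        case False
        hence "f x = 0" using R by blast
        thus ?thesis using False unfolding grid_step_def sum_over_grid by simp
      qed (simp add: grid_step_def sum_over_grid)
    qed
    show "AE x in lebesgue. norm (grid_step R j f x) \<le> norm (w x)" for j
      unfolding grid_step_def sum_over_grid w_def using B B0 by (intro AE_I2) (simp add: norm_mult)
  qed
qed

lemma bump_sum_tendsto:
  fixes c :: "int ^ 'n \<Rightarrow> complex"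
  assumes M: "finite M" and p: "1 \<le> p"
  shows "(\<lambda>N. Lp_norm p (\<lambda>x. (\<Sum>m\<in>M. c m * indicator (cell j m) x) - (\<Sum>m\<in>M. c m * cell_bump N j m x))) \<longlonglongrightarrow> 0"
proof (rule Lp_dominated_convergence(3)[OF p cell_step_in_Lp_space[OF p, where M = M and c = c and j = j]])
  show "(\<lambda>x. \<Sum>m\<in>M. c m * cell_bump N j m x) \<in> borel_measurable lebesgue" for N
    by (rule test_function_measurable, rule test_functions_sum) (rule cell_bump_test_function)
  show "(\<lambda>x. \<Sum>m\<in>M. c m * indicator (cell j m) x) \<in> borel_measurable lebesgue" by measurable
  have "AE x in lebesgue. \<forall>m\<in>M. (\<lambda>N. cell_bump N j m x) \<longlonglongrightarrow> indicator (cell j m) x"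
    unfolding AE_finite_all[OF M] using cell_bump_tendsto by blast
  thus "AE x in lebesgue. (\<lambda>N. \<Sum>m\<in>M. c m * cell_bump N j m x) \<longlonglongrightarrow> (\<Sum>m\<in>M. c m * indicator (cell j m) x)"
    by (rule AE_mp) (auto intro!: AE_I2 tendsto_sum tendsto_mult)
  show "AE x in lebesgue. norm (\<Sum>m\<in>M. c m * cell_bump N j m x) \<le> norm (\<Sum>m\<in>M. c m * indicator (cell j m) x)" for N
    by (intro AE_I2 norm_bump_sum_le M)
qed

lemma Lp_pairing_tendsto2:
  assumes q: "1 < q" "1 / q + 1 / q' = 1"
    and a: "a \<in> Lp_space q" "\<And>j. u j \<in> Lp_space q" "Lp_tendsto q u a"
    and b: "b \<in> Lp_space q'" "\<And>j. v j \<in> Lp_space q'" "Lp_tendsto q' v b"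
  shows "(\<lambda>j. LINT x|lebesgue. u j x * v j x) \<longlonglongrightarrow> (LINT x|lebesgue. a x * b x)"
proof -
  have q1: "1 \<le> q" "1 \<le> q'" using q conjugate_exponent[OF q] by auto
  have "(\<lambda>j. (LINT x|lebesgue. u j x * v j x) - (LINT x|lebesgue. a x * v j x)) \<longlonglongrightarrow> 0"
  proof (rule Lim_null_comparison)
    have "(\<lambda>j. Lp_norm q (\<lambda>x. a x - u j x) * (Lp_norm q' b + Lp_norm q' (\<lambda>x. b x - v j x))) \<longlonglongrightarrow> 0 * (Lp_norm q' b + 0)"
      by (intro tendsto_intros a b)
    thus "(\<lambda>j. Lp_norm q (\<lambda>x. a x - u j x) * (Lp_norm q' b + Lp_norm q' (\<lambda>x. b x - v j x))) \<longlonglongrightarrow> 0" by simp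
    show "\<forall>\<^sub>F j in sequentially. norm ((LINT x|lebesgue. u j x * v j x) - (LINT x|lebesgue. a x * v j x))
        \<le> Lp_norm q (\<lambda>x. a x - u j x) * (Lp_norm q' b + Lp_norm q' (\<lambda>x. b x - v j x))"
    proof (intro always_eventually allI)
      fix j
      have d: "(\<lambda>x. a x - u j x) \<in> Lp_space q" by (rule Lp_space_diff[OF q1(1) a(1,2)])
      have "(LINT x|lebesgue. u j x * v j x) - (LINT x|lebesgue. a x * v j x) = - (LINT x|lebesgue. (a x - u j x) * v j x)"
        using Lp_hoelder_integrable[OF q a(1) b(2)] Lp_hoelder_integrable[OF q a(2) b(2)] by (simp add: left_diff_distrib)
      also have "norm \<dots> \<le> Lp_norm q (\<lambda>x. a x - u j x) * Lp_norm q' (v j)"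
        unfolding norm_minus_cancel by (rule Lp_hoelder[OF q d b(2)])
      also have "\<dots> \<le> Lp_norm q (\<lambda>x. a x - u j x) * (Lp_norm q' b + Lp_norm q' (\<lambda>x. b x - v j x))"
        using Lp_norm_diff[OF q1(2) b(1) Lp_space_diff[OF q1(2) b(1,2)]] by (intro mult_left_mono Lp_norm_nonneg) simp
      finally show "norm ((LINT x|lebesgue. u j x * v j x) - (LINT x|lebesgue. a x * v j x))
        \<le> Lp_norm q (\<lambda>x. a x - u j x) * (Lp_norm q' b + Lp_norm q' (\<lambda>x. b x - v j x))" .
    qed
  qed
  from tendsto_add[OF this Lp_pairing_tendsto[OF q a(1) b]] show ?thesis by simp
qed

context calderon_zygmund
begin

lemma T_diff_L2:
  assumes "f \<in> test_functions" "g \<in> test_functions"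
  shows "Lp_norm 2 (\<lambda>x. T f x - T g x) \<le> max 0 c1 * Lp_norm 2 (\<lambda>x. f x - g x)"
proof -
  have d: "(\<lambda>x. f x - g x) \<in> test_functions" using test_functions_linear[OF assms, of 1 "-1"] by simp
  have "AE x in lebesgue. T (\<lambda>x. f x - g x) x = T f x - T g x"
    using T_linear[OF assms, of 1 "-1"] by simp
  moreover have "(\<lambda>x. T f x - T g x) \<in> borel_measurable lebesgue"
    using T_L2[OF assms(1)] T_L2[OF assms(2)] Lp_spaceD(1) by (intro borel_measurable_diff) blast+
  ultimately have "Lp_norm 2 (\<lambda>x. T f x - T g x) = Lp_norm 2 (T (\<lambda>x. f x - g x))"
    using T_L2[OF d] by (intro Lp_norm_AE_cong) auto
  thus ?thesis using c1_bound[OF d] by simp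
qed

text \<open>Since \<open>T f\<close> is in L_2, the converse of Hoelder's inequality reduces the
  claim to pairings with test functions. Such a pairing is a limit of matrix forms on finer and
  finer grids, where \<open>f\<close> is replaced by sums of bumps and \<open>g\<close> by step
  functions.\<close>

theorem Lq_bounded:
  assumes q: "1 < q"
  shows "\<exists>C\<ge>0. \<forall>f\<in>test_functions. T f \<in> Lp_space q \<and> Lp_norm q (T f) \<le> C * Lp_norm q f"
proof -
  define q' where "q' = q / (q - 1)"
  have qq: "1 / q + 1 / q' = 1" using q by (simp add: q'_def divide_simps)
  have q'1: "1 < q'" by (rule conjugate_exponent[OF q qq])
  have n1: "1 \<le> 4 * real CARD('n)" using zero_less_card_finite[where 'a = 'n] by linarith
  have c10: "0 \<le> max 0 c1" by simp
  obtain C where C: "0 \<le> C" and bil: "\<And>(a :: int ^ 'n \<Rightarrow> int ^ 'n \<Rightarrow> complex) S G f g.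
      discrete_singular_integral a (max 0 c1) hoelder_const (4 * real CARD('n)) \<delta> \<Longrightarrow>
      discrete_singular_integral (\<lambda>m m'. a m' m) (max 0 c1) hoelder_const (4 * real CARD('n)) \<delta> \<Longrightarrow>
      finite S \<Longrightarrow> finite G \<Longrightarrow> norm (\<Sum>m\<in>G. \<Sum>m'\<in>S. a m m' * f m' * g m)
      \<le> C * (\<Sum>m'\<in>S. norm (f m') powr q) powr (1 / q) * (\<Sum>m\<in>G. norm (g m) powr q') powr (1 / q')"
    using discrete_calderon_zygmund[OF c10 hoelder_const_nonneg n1 \<delta> q qq, where 'n = 'n] by blast
  have main: "norm (LINT x|lebesgue. T f x * g x) \<le> C * Lp_norm q f * Lp_norm q' g"
    if f: "f \<in> test_functions" and g: "g \<in> test_functions" for f g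
  proof -
    have "bounded ({x. f x \<noteq> 0} \<union> {x. g x \<noteq> 0})" using f g by (simp add: test_functions_iff)
    then obtain R where R: "{x. f x \<noteq> 0} \<union> {x. g x \<noteq> 0} \<subseteq> half_open_cube R"
      by (rule bounded_subset_half_open_cube)
    hence Rf: "{x. f x \<noteq> 0} \<subseteq> half_open_cube R" and Rg: "{x. g x \<noteq> 0} \<subseteq> half_open_cube R" by auto
    define bs where "bs N j x = (\<Sum>m\<in>grid j R. f (cell_corner j m) * cell_bump N j m x)" for N j x
    have bst: "bs N j \<in> test_functions" for N j
      unfolding bs_def[abs_def] by (rule test_functions_sum) (rule cell_bump_test_function)
    have "\<exists>N. Lp_norm 2 (\<lambda>x. grid_step R j f x - bs N j x) < (1 / 2) ^ j" for j
    proof -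
      have "Lp_tendsto 2 (\<lambda>N. bs N j) (grid_step R j f)"
        unfolding grid_step_def bs_def by (rule bump_sum_tendsto[OF finite_grid]) simp
      from order_tendstoD(2)[OF this, of "(1 / 2) ^ j"] show ?thesis by (auto simp: eventually_sequentially)
    qed
    \<comment> \<open>For each mesh the bumps are made steep enough to be close in L_2 to the step
      function. Any \<open>N\<close> is affordable, because the matrix bound sees the sampled values
      of \<open>f\<close> but not \<open>N\<close>.\<close>
    then obtain N where N: "\<And>j. Lp_norm 2 (\<lambda>x. grid_step R j f x - bs (N j) j x) < (1 / 2) ^ j" by metis
    define h where "h j = bs (N j) j" for j
    have h: "h j \<in> test_functions" for j unfolding h_def by (rule bst)
    have L2: "g \<in> Lp_space 2" if "g \<in> test_functions" for g :: "real ^ 'n \<Rightarrow> complex"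
      by (rule test_function_in_Lp_space[OF _ that]) simp
    have hf: "Lp_tendsto 2 h f"
    proof (rule tendsto_sandwich[OF _ _ tendsto_const])
      have "(\<lambda>j. Lp_norm 2 (\<lambda>x. f x - grid_step R j f x) + (1 / 2) ^ j) \<longlonglongrightarrow> 0 + 0"
        by (intro tendsto_add grid_step_tendsto(2)[OF f Rf] LIMSEQ_power_zero) auto
      thus "(\<lambda>j. Lp_norm 2 (\<lambda>x. f x - grid_step R j f x) + (1 / 2) ^ j) \<longlonglongrightarrow> 0" by simp
      have "Lp_norm 2 (\<lambda>x. f x - h j x) \<le> Lp_norm 2 (\<lambda>x. f x - grid_step R j f x) + (1 / 2) ^ j" for j
      proof -
        have "Lp_norm 2 (\<lambda>x. f x - h j x) \<le> Lp_norm 2 (\<lambda>x. f x - grid_step R j f x) + Lp_norm 2 (\<lambda>x. grid_step R j f x - h j x)"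
          by (rule Lp_norm_triangle[OF _ L2[OF f] grid_step_tendsto(1)[OF f Rf] L2[OF h]]) auto
        thus ?thesis using N[of j] unfolding h_def by linarith
      qed
      thus "\<forall>\<^sub>F j in sequentially. Lp_norm 2 (\<lambda>x. f x - h j x) \<le> Lp_norm 2 (\<lambda>x. f x - grid_step R j f x) + (1 / 2) ^ j" by simp
    qed (simp add: Lp_norm_nonneg)
    have Th: "Lp_tendsto 2 (\<lambda>j. T (h j)) (T f)"
    proof (rule tendsto_sandwich[OF _ _ tendsto_const])
      show "(\<lambda>j. max 0 c1 * Lp_norm 2 (\<lambda>x. f x - h j x)) \<longlonglongrightarrow> 0" by (rule tendsto_mult_right_zero[OF hf])
    qed (simp_all add: Lp_norm_nonneg T_diff_L2[OF f h])
    have "(\<lambda>j. LINT x|lebesgue. T (h j) x * grid_step R j g x) \<longlonglongrightarrow> (LINT x|lebesgue. T f x * g x)"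
      by (rule Lp_pairing_tendsto2[where q = 2 and q' = 2])
        (use T_L2[OF f] T_L2[OF h] Th L2[OF g] grid_step_tendsto[OF g Rg, of 2] in auto)
    hence lim1: "(\<lambda>j. norm (LINT x|lebesgue. T (h j) x * grid_step R j g x)) \<longlonglongrightarrow> norm (LINT x|lebesgue. T f x * g x)"
      by (rule tendsto_norm)
    have q1: "1 \<le> q" "1 \<le> q'" "0 < q" "0 < q'" using q q'1 by auto
    have lim2: "(\<lambda>j. C * (Lp_norm q f + Lp_norm q (\<lambda>x. f x - grid_step R j f x)) * (Lp_norm q' g + Lp_norm q' (\<lambda>x. g x - grid_step R j g x)))
        \<longlonglongrightarrow> C * (Lp_norm q f + 0) * (Lp_norm q' g + 0)"
      by (intro tendsto_mult tendsto_add tendsto_const grid_step_tendsto(2)[OF f Rf q1(1)] grid_step_tendsto(2)[OF g Rg q1(2)])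
    have "norm (LINT x|lebesgue. T (h j) x * grid_step R j g x)
        \<le> C * (Lp_norm q f + Lp_norm q (\<lambda>x. f x - grid_step R j f x)) * (Lp_norm q' g + Lp_norm q' (\<lambda>x. g x - grid_step R j g x))" for j
    proof -
      \<comment> \<open>The cell volume. It is split as \<mu> powr (1 / q) * \<mu> powr (1 / q'),
        and the two factors turn the sequence norms \<open>F\<close> and \<open>H\<close> into norms
        of step functions.\<close>
      define \<mu> where "\<mu> = (1 / 2 ^ j :: real) ^ CARD('n)"
      have \<mu>: "0 < \<mu>" "(2 ^ j) ^ CARD('n) * \<mu> = 1" by (simp_all add: \<mu>_def power_divide)
      define F where "F = (\<Sum>m\<in>grid j R. norm (f (cell_corner j m)) powr q) powr (1 / q)"
      define H where "H = (\<Sum>m\<in>grid j R. norm (g (cell_corner j m)) powr q') powr (1 / q')"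
      have "norm (\<Sum>m\<in>grid j R. \<Sum>m'\<in>grid j R. cz_matrix (N j) j m m' * f (cell_corner j m') * g (cell_corner j m)) \<le> C * F * H"
        unfolding F_def H_def by (rule bil[OF cz_matrix_singular_integral finite_grid finite_grid])
      hence le: "(2 ^ j) ^ CARD('n) * norm (LINT x|lebesgue. T (h j) x * grid_step R j g x) \<le> C * F * H"
        unfolding cz_matrix_form[OF finite_grid finite_grid] h_def bs_def[abs_def] grid_step_def by (simp add: norm_mult norm_power)
      have "norm (LINT x|lebesgue. T (h j) x * grid_step R j g x)
          = \<mu> * ((2 ^ j) ^ CARD('n) * norm (LINT x|lebesgue. T (h j) x * grid_step R j g x))"
        using \<mu>(2) by (simp add: mult.assoc[symmetric] mult.commute)
      also have "\<dots> \<le> \<mu> * (C * F * H)" using \<mu>(1) by (intro mult_left_mono le) simp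
      also have "\<mu> = \<mu> powr (1 / q) * \<mu> powr (1 / q')" using qq \<mu>(1) by (simp flip: powr_add)
      also have "\<mu> powr (1 / q) * \<mu> powr (1 / q') * (C * F * H) = C * (F * \<mu> powr (1 / q)) * (H * \<mu> powr (1 / q'))" by (simp only: mult_ac)
      also have "F * \<mu> powr (1 / q) = Lp_norm q (grid_step R j f)"
        unfolding F_def \<mu>_def grid_step_def[abs_def] by (rule Lp_norm_cell_step[OF q1(3) finite_grid, symmetric])
      also have "H * \<mu> powr (1 / q') = Lp_norm q' (grid_step R j g)"
        unfolding H_def \<mu>_def grid_step_def[abs_def] by (rule Lp_norm_cell_step[OF q1(4) finite_grid, symmetric])
      also have "C * Lp_norm q (grid_step R j f) * Lp_norm q' (grid_step R j g)
        \<le> C * (Lp_norm q f + Lp_norm q (\<lambda>x. f x - grid_step R j f x)) * (Lp_norm q' g + Lp_norm q' (\<lambda>x. g x - grid_step R j g x))"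
      proof (intro mult_mono order_refl C mult_nonneg_nonneg add_nonneg_nonneg Lp_norm_nonneg)
        have fL: "f \<in> Lp_space q" "g \<in> Lp_space q'" using f g q1 test_function_in_Lp_space by blast+
        show "Lp_norm q (grid_step R j f) \<le> Lp_norm q f + Lp_norm q (\<lambda>x. f x - grid_step R j f x)"
          using Lp_norm_diff[OF q1(1) fL(1) Lp_space_diff[OF q1(1) fL(1) grid_step_tendsto(1)[OF f Rf q1(1), of j]]] by simp
        show "Lp_norm q' (grid_step R j g) \<le> Lp_norm q' g + Lp_norm q' (\<lambda>x. g x - grid_step R j g x)"
          using Lp_norm_diff[OF q1(2) fL(2) Lp_space_diff[OF q1(2) fL(2) grid_step_tendsto(1)[OF g Rg q1(2), of j]]] by simp
      qed
      finally show ?thesis .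
    qed
    thus ?thesis using LIMSEQ_le[OF lim1 lim2] by auto
  qed
  have "T f \<in> Lp_space q \<and> Lp_norm q (T f) \<le> C * Lp_norm q f" if f: "f \<in> test_functions" for f
  proof -
    have b: "norm (LINT x|lebesgue. T f x * g x) \<le> (C * Lp_norm q f) * Lp_norm q' g" if "g \<in> test_functions" for g
      by (rule main[OF f that])
    have c: "0 \<le> C * Lp_norm q f" by (intro mult_nonneg_nonneg C Lp_norm_nonneg)
    have t: "T f \<in> Lp_space 2" using T_L2[OF f] ..
    show ?thesis using Lp_converse_hoelder[OF q qq t c b] by simp
  qed
  thus ?thesis using C by blast
qed

end

section \<open>Extension to Lebesgue spaces\<close>

context calderon_zygmund
begin

text \<open>A relation rather than a limit along a fixed sequence, so that an image can be compared
  with arbitrary approximating test functions. \<open>Lq_extension\<close> then selects one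
  representative of the almost everywhere class.\<close>

definition extends_to :: "real \<Rightarrow> (real ^ 'n \<Rightarrow> complex) \<Rightarrow> (real ^ 'n \<Rightarrow> complex) \<Rightarrow> bool"
  where "extends_to q f h \<longleftrightarrow> h \<in> Lp_space q \<and>
    (\<forall>e>0. \<exists>g\<in>test_functions. Lp_norm q (\<lambda>x. f x - g x) < e \<and> Lp_norm q (\<lambda>x. h x - T g x) < e)"

definition Lq_extension :: "real \<Rightarrow> (real ^ 'n \<Rightarrow> complex) \<Rightarrow> real ^ 'n \<Rightarrow> complex"
  where "Lq_extension q f = (SOME h. extends_to q f h)"

definition Lq_const :: "real \<Rightarrow> real"
  where "Lq_const q = (SOME C. 0 \<le> C \<and> (\<forall>f\<in>test_functions. T f \<in> Lp_space q \<and> Lp_norm q (T f) \<le> C * Lp_norm q f))"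

lemma Lq_const:
  assumes "1 < q"
  shows "0 \<le> Lq_const q" "f \<in> test_functions \<Longrightarrow> T f \<in> Lp_space q"
    "f \<in> test_functions \<Longrightarrow> Lp_norm q (T f) \<le> Lq_const q * Lp_norm q f"
  using someI_ex[OF Lq_bounded[OF assms, unfolded Bex_def]] unfolding Lq_const_def[symmetric] by auto

lemma T_diff_Lq:
  assumes q: "1 < q" and fg: "f \<in> test_functions" "g \<in> test_functions"
  shows "Lp_norm q (\<lambda>x. T f x - T g x) \<le> Lq_const q * Lp_norm q (\<lambda>x. f x - g x)"
proof -
  have d: "(\<lambda>x. f x - g x) \<in> test_functions" using test_functions_linear[OF fg, of 1 "-1"] by simp
  have "AE x in lebesgue. T (\<lambda>x. f x - g x) x = T f x - T g x"
    using T_linear[OF fg, of 1 "-1"] by simp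
  moreover have "(\<lambda>x. T f x - T g x) \<in> borel_measurable lebesgue"
    using T_L2[OF fg(1)] T_L2[OF fg(2)] Lp_spaceD(1) by (intro borel_measurable_diff) blast+
  ultimately have "Lp_norm q (\<lambda>x. T f x - T g x) = Lp_norm q (T (\<lambda>x. f x - g x))"
    using Lq_const(2)[OF q d] q by (intro Lp_norm_AE_cong) auto
  thus ?thesis using Lq_const(3)[OF q d] by simp
qed

lemma extends_to_exists:
  assumes q: "1 < q" and f: "f \<in> Lp_space q"
  shows "\<exists>h. extends_to q f h"
proof -
  have q1: "1 \<le> q" "0 < q" using q by auto
  obtain g where g: "\<And>i. g i \<in> test_functions" "\<And>i. Lp_norm q (\<lambda>x. f x - g i x) < (1 / 2) ^ i"
      "\<And>i. Lp_norm q (\<lambda>x. f x - g i x) < (1 / 2) ^ i" "\<And>i x. g i x \<noteq> 0 \<Longrightarrow> \<exists>y. f y \<noteq> 0 \<and> dist x y < 1"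
    by (rule test_functions_dense_seq[of q q f 1]) (use f q1 in auto)
  have gL: "g i \<in> Lp_space q" for i by (rule test_function_in_Lp_space[OF q1(2) g(1)])
  have "Lp_norm q (\<lambda>x. T (g (Suc i)) x - T (g i) x) \<le> (2 * Lq_const q) * (1 / 2) ^ i" for i
  proof -
    have "Lp_norm q (\<lambda>x. g (Suc i) x - g i x) \<le> Lp_norm q (\<lambda>x. g (Suc i) x - f x) + Lp_norm q (\<lambda>x. f x - g i x)"
      by (rule Lp_norm_triangle[OF q1(1) gL f gL])
    also have "\<dots> = Lp_norm q (\<lambda>x. f x - g (Suc i) x) + Lp_norm q (\<lambda>x. f x - g i x)"
      by (simp only: Lp_norm_diff_commute[of q "g (Suc i)" f])
    also have "\<dots> \<le> 2 * (1 / 2) ^ i"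
    proof -
      have "(1 / 2) ^ Suc i \<le> (1 / 2 :: real) ^ i" by simp
      thus ?thesis using g(2)[of "Suc i"] g(2)[of i] by linarith
    qed
    finally have "Lq_const q * Lp_norm q (\<lambda>x. g (Suc i) x - g i x) \<le> Lq_const q * (2 * (1 / 2) ^ i)"
      by (rule mult_left_mono[OF _ Lq_const(1)[OF q]])
    thus ?thesis using T_diff_Lq[OF q g(1) g(1), of "Suc i" i] by simp
  qed
  from Lp_complete[OF q1(1) Lq_const(2)[OF q g(1)] this]
  obtain h where h: "h \<in> Lp_space q" "Lp_tendsto q (\<lambda>i. T (g i)) h" by blast
  have "extends_to q f h"
    unfolding extends_to_def
  proof (intro conjI h(1) allI impI)
    fix e :: real assume e: "0 < e"
    have "(\<lambda>i. (1 / 2) ^ i :: real) \<longlonglongrightarrow> 0" by (rule LIMSEQ_power_zero) simp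
    hence "\<forall>\<^sub>F i in sequentially. (1 / 2) ^ i < e \<and> Lp_norm q (\<lambda>x. h x - T (g i) x) < e"
      using order_tendstoD(2)[OF _ e] h(2) by (intro eventually_conj) auto
    then obtain i where "(1 / 2) ^ i < e" "Lp_norm q (\<lambda>x. h x - T (g i) x) < e" by (auto simp: eventually_sequentially)
    thus "\<exists>g\<in>test_functions. Lp_norm q (\<lambda>x. f x - g x) < e \<and> Lp_norm q (\<lambda>x. h x - T g x) < e"
      using g(1)[of i] g(2)[of i] by (intro bexI[of _ "g i"]) auto
  qed
  thus ?thesis by (intro exI[where x = h])
qed

lemma extends_to_Lq_extension: "1 < q \<Longrightarrow> f \<in> Lp_space q \<Longrightarrow> extends_to q f (Lq_extension q f)"
  unfolding Lq_extension_def by (rule someI_ex[of "extends_to q f"]) (rule extends_to_exists)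

lemma Lq_extension_in: "1 < q \<Longrightarrow> f \<in> Lp_space q \<Longrightarrow> Lq_extension q f \<in> Lp_space q"
  using extends_to_Lq_extension unfolding extends_to_def by blast

text \<open>Continuity against an arbitrary test function, not only against those that witness
  \<open>extends_to\<close>. Uniqueness, linearity, consistency and the norm bound all rest on
  it.\<close>

lemma Lq_extension_approx:
  assumes q: "1 < q" and f: "f \<in> Lp_space q" and g: "g \<in> test_functions"
  shows "Lp_norm q (\<lambda>x. Lq_extension q f x - T g x) \<le> Lq_const q * Lp_norm q (\<lambda>x. f x - g x)"
proof (rule field_le_epsilon)
  fix e :: real assume e: "0 < e"
  let ?C = "Lq_const q"
  have q1: "1 \<le> q" "0 < q" using q by auto
  have C: "0 \<le> ?C" by (rule Lq_const(1)[OF q])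
  \<comment> \<open>Chosen so that the two errors, d and \<open>?C\<close> times d, add up to
    \<open>e\<close>.\<close>
  define d where "d = e / (?C + 1)"
  have d: "0 < d" "d * (?C + 1) = e" using e C by (auto simp: d_def)
  obtain u where u: "u \<in> test_functions" "Lp_norm q (\<lambda>x. f x - u x) < d" "Lp_norm q (\<lambda>x. Lq_extension q f x - T u x) < d"
    using extends_to_Lq_extension[OF q f] d(1) unfolding extends_to_def by blast
  note L = test_function_in_Lp_space[OF q1(2)]
  have "Lp_norm q (\<lambda>x. Lq_extension q f x - T g x)
      \<le> Lp_norm q (\<lambda>x. Lq_extension q f x - T u x) + Lp_norm q (\<lambda>x. T u x - T g x)"
    by (rule Lp_norm_triangle[OF q1(1) Lq_extension_in[OF q f] Lq_const(2)[OF q u(1)] Lq_const(2)[OF q g]])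
  also have "\<dots> \<le> d + ?C * Lp_norm q (\<lambda>x. u x - g x)"
    by (intro add_mono less_imp_le[OF u(3)] T_diff_Lq[OF q u(1) g])
  also have "Lp_norm q (\<lambda>x. u x - g x) \<le> Lp_norm q (\<lambda>x. u x - f x) + Lp_norm q (\<lambda>x. f x - g x)"
    by (rule Lp_norm_triangle[OF q1(1) L[OF u(1)] f L[OF g]])
  also have "Lp_norm q (\<lambda>x. u x - f x) \<le> d"
    using u(2) by (subst Lp_norm_diff_commute) simp
  finally have "Lp_norm q (\<lambda>x. Lq_extension q f x - T g x) \<le> d + ?C * (d + Lp_norm q (\<lambda>x. f x - g x))"
    using C by (simp add: mult_left_mono)
  also have "\<dots> = ?C * Lp_norm q (\<lambda>x. f x - g x) + d * (?C + 1)" by (simp add: algebra_simps)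
  finally show "Lp_norm q (\<lambda>x. Lq_extension q f x - T g x) \<le> ?C * Lp_norm q (\<lambda>x. f x - g x) + e" unfolding d(2) .
qed

lemma Lq_extension_tendsto:
  assumes q: "1 < q" and f: "f \<in> Lp_space q" and g: "\<And>i. g i \<in> test_functions"
    and lim: "Lp_tendsto q g f"
  shows "Lp_tendsto q (\<lambda>i. T (g i)) (Lq_extension q f)"
proof (rule tendsto_sandwich[OF _ _ tendsto_const])
  show "(\<lambda>i. Lq_const q * Lp_norm q (\<lambda>x. f x - g i x)) \<longlonglongrightarrow> 0" by (rule tendsto_mult_right_zero[OF lim])
qed (simp_all add: Lp_norm_nonneg Lq_extension_approx[OF q f g])

lemma Lq_extension_unique:
  assumes q: "1 < q" and f: "f \<in> Lp_space q" and h: "h \<in> Lp_space q" and g: "\<And>i. g i \<in> test_functions"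
    and lim: "Lp_tendsto q g f" "Lp_tendsto q (\<lambda>i. T (g i)) h"
  shows "AE x in lebesgue. Lq_extension q f x = h x"
  using q by (intro Lp_limit_unique[where p = q and q = q and u = "\<lambda>i. T (g i)"] Lq_const(2) g Lq_extension_in f h
      Lq_extension_tendsto lim) auto

lemma Lq_dense_seq:
  assumes q: "1 < q" and f: "f \<in> Lp_space q"
  obtains g where "\<And>i. g i \<in> test_functions" "Lp_tendsto q g f"
proof -
  obtain g where g: "\<And>i. g i \<in> test_functions" "\<And>i. Lp_norm q (\<lambda>x. f x - g i x) < (1 / 2) ^ i"
      "\<And>i. Lp_norm q (\<lambda>x. f x - g i x) < (1 / 2) ^ i" "\<And>i x. g i x \<noteq> 0 \<Longrightarrow> \<exists>y. f y \<noteq> 0 \<and> dist x y < 1"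
    by (rule test_functions_dense_seq[of q q f 1]) (use f q in auto)
  have "Lp_tendsto q g f"
    by (rule half_power_tendsto_0[where C = 1]) (use g(2) less_imp_le in \<open>auto simp: Lp_norm_nonneg\<close>)
  thus ?thesis using that g(1) by blast
qed

lemma Lq_extension_test_function:
  assumes q: "1 < q" and f: "f \<in> test_functions"
  shows "AE x in lebesgue. Lq_extension q f x = T f x"
proof (rule Lq_extension_unique[OF q _ Lq_const(2)[OF q f], where g = "\<lambda>i. f"])
  show "f \<in> Lp_space q" using q by (intro test_function_in_Lp_space f) simp
qed (simp_all add: f)

lemma Lq_extension_bounded:
  assumes q: "1 < q" and f: "f \<in> Lp_space q"
  shows "Lp_norm q (Lq_extension q f) \<le> Lq_const q * Lp_norm q f"
proof -
  have "Lp_norm q (\<lambda>x. Lq_extension q f x - T (\<lambda>x. 0) x) \<le> Lq_const q * Lp_norm q (\<lambda>x. f x - 0)"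
    by (rule Lq_extension_approx[OF q f zero_test_function])
  moreover have "Lp_norm q (\<lambda>x. Lq_extension q f x - T (\<lambda>x. 0) x) = Lp_norm q (Lq_extension q f)"
  proof (rule Lp_norm_AE_cong[OF _ Lq_extension_in[OF q f]])
    show "(\<lambda>x. Lq_extension q f x - T (\<lambda>x. 0) x) \<in> borel_measurable lebesgue"
      using Lp_spaceD(1)[OF Lq_extension_in[OF q f]] Lp_spaceD(1)[OF Lq_const(2)[OF q zero_test_function]]
      by (rule borel_measurable_diff)
    show "AE x in lebesgue. Lq_extension q f x = Lq_extension q f x - T (\<lambda>x. 0) x"
      using T_zero by (rule AE_mp) (auto intro!: AE_I2)
  qed (use q in simp)
  ultimately show ?thesis by simp
qed

lemma Lq_extension_linear:
  assumes q: "1 < q" and f: "f \<in> Lp_space q" and g: "g \<in> Lp_space q"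
  shows "AE x in lebesgue. Lq_extension q (\<lambda>x. c * f x + d * g x) x = c * Lq_extension q f x + d * Lq_extension q g x"
proof -
  have q1: "1 \<le> q" "0 < q" using q by auto
  obtain u where u: "\<And>i. u i \<in> test_functions" "Lp_tendsto q u f" by (rule Lq_dense_seq[OF q f]) blast
  obtain v where v: "\<And>i. v i \<in> test_functions" "Lp_tendsto q v g" by (rule Lq_dense_seq[OF q g]) blast
  note L = test_function_in_Lp_space[OF q1(2)]
  have comb: "Lp_norm q (\<lambda>x. (c * a x + d * b x) - (c * a' x + d * b' x))
      \<le> norm c * Lp_norm q (\<lambda>x. a x - a' x) + norm d * Lp_norm q (\<lambda>x. b x - b' x)"
    if "a \<in> Lp_space q" "a' \<in> Lp_space q" "b \<in> Lp_space q" "b' \<in> Lp_space q" for a a' b b'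
  proof -
    have 1: "(\<lambda>x. a x - a' x) \<in> Lp_space q" "(\<lambda>x. b x - b' x) \<in> Lp_space q" using that by (auto intro: Lp_space_diff[OF q1(1)])
    have "Lp_norm q (\<lambda>x. c * (a x - a' x) + d * (b x - b' x)) \<le> Lp_norm q (\<lambda>x. c * (a x - a' x)) + Lp_norm q (\<lambda>x. d * (b x - b' x))"
      by (rule Lp_norm_add[OF q1(1) Lp_space_scale[OF q1(2) 1(1)] Lp_space_scale[OF q1(2) 1(2)]])
    thus ?thesis unfolding Lp_norm_scale[OF q1(2) 1(1)] Lp_norm_scale[OF q1(2) 1(2)] by (simp add: algebra_simps)
  qed
  have conv: "(\<lambda>i. Lp_norm q (\<lambda>x. (c * a x + d * b x) - (c * a' i x + d * b' i x))) \<longlonglongrightarrow> 0"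
    if "a \<in> Lp_space q" "\<And>i. a' i \<in> Lp_space q" "b \<in> Lp_space q" "\<And>i. b' i \<in> Lp_space q"
      and l: "Lp_tendsto q a' a" "Lp_tendsto q b' b" for a b a' b'
  proof (rule tendsto_sandwich[OF _ _ tendsto_const])
    show "(\<lambda>i. norm c * Lp_norm q (\<lambda>x. a x - a' i x) + norm d * Lp_norm q (\<lambda>x. b x - b' i x)) \<longlonglongrightarrow> 0"
      using tendsto_add[OF tendsto_mult_right_zero[OF l(1), of "norm c"] tendsto_mult_right_zero[OF l(2), of "norm d"]] by simp
  qed (use that in \<open>simp_all add: Lp_norm_nonneg comb\<close>)
  let ?w = "\<lambda>i x. c * u i x + d * v i x"
  have w: "?w i \<in> test_functions" for i by (rule test_functions_linear[OF u(1) v(1)])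
  show ?thesis
  proof (rule Lq_extension_unique[OF q _ _ w])
    show "(\<lambda>x. c * f x + d * g x) \<in> Lp_space q"
      by (intro Lp_space_add[OF q1(1)] Lp_space_scale[OF q1(2)] f g)
    show h: "(\<lambda>x. c * Lq_extension q f x + d * Lq_extension q g x) \<in> Lp_space q"
      by (intro Lp_space_add[OF q1(1)] Lp_space_scale[OF q1(2)] Lq_extension_in q f g)
    show "(\<lambda>i. Lp_norm q (\<lambda>x. c * f x + d * g x - ?w i x)) \<longlonglongrightarrow> 0"
      by (rule conv[OF f L[OF u(1)] g L[OF v(1)] u(2) v(2)])
    have "Lp_norm q (\<lambda>x. c * Lq_extension q f x + d * Lq_extension q g x - T (?w i) x)
        = Lp_norm q (\<lambda>x. c * Lq_extension q f x + d * Lq_extension q g x - (c * T (u i) x + d * T (v i) x))" for i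
    proof (rule Lp_norm_AE_cong[OF q1(2)])
      show "(\<lambda>x. c * Lq_extension q f x + d * Lq_extension q g x - (c * T (u i) x + d * T (v i) x)) \<in> Lp_space q"
        by (intro Lp_space_diff[OF q1(1) h] Lp_space_add[OF q1(1)] Lp_space_scale[OF q1(2)] Lq_const(2)[OF q] u v)
      show "(\<lambda>x. c * Lq_extension q f x + d * Lq_extension q g x - T (?w i) x) \<in> borel_measurable lebesgue"
        by (rule Lp_spaceD(1)[OF Lp_space_diff[OF q1(1) h Lq_const(2)[OF q w]]])
      show "AE x in lebesgue. c * Lq_extension q f x + d * Lq_extension q g x - (c * T (u i) x + d * T (v i) x)
          = c * Lq_extension q f x + d * Lq_extension q g x - T (?w i) x"
        using T_linear[OF u(1)[of i] v(1)[of i], of c d] by (rule AE_mp) (auto intro!: AE_I2)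
    qed
    moreover have "(\<lambda>i. Lp_norm q (\<lambda>x. c * Lq_extension q f x + d * Lq_extension q g x - (c * T (u i) x + d * T (v i) x))) \<longlonglongrightarrow> 0"
      by (rule conv[OF Lq_extension_in[OF q f] Lq_const(2)[OF q u(1)] Lq_extension_in[OF q g] Lq_const(2)[OF q v(1)]
            Lq_extension_tendsto[OF q f u] Lq_extension_tendsto[OF q g v]])
    ultimately show "(\<lambda>i. Lp_norm q (\<lambda>x. c * Lq_extension q f x + d * Lq_extension q g x - T (?w i) x)) \<longlonglongrightarrow> 0" by simp
  qed
qed

text \<open>One sequence of test functions approximates \<open>f\<close> in both spaces, so both
  extensions are limits of the same images.\<close>

lemma Lq_extension_consistent:
  assumes q: "1 < q" "1 < s" and f: "f \<in> Lp_space q" "f \<in> Lp_space s"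
  shows "AE x in lebesgue. Lq_extension q f x = Lq_extension s f x"
proof -
  obtain g where g: "\<And>i. g i \<in> test_functions" "\<And>i. Lp_norm q (\<lambda>x. f x - g i x) < (1 / 2) ^ i"
      "\<And>i. Lp_norm s (\<lambda>x. f x - g i x) < (1 / 2) ^ i" "\<And>i x. g i x \<noteq> 0 \<Longrightarrow> \<exists>y. f y \<noteq> 0 \<and> dist x y < 1"
    by (rule test_functions_dense_seq[of q s f 1]) (use f q in auto)
  have lq: "Lp_tendsto q g f"
    by (rule half_power_tendsto_0[where C = 1]) (use g(2) less_imp_le in \<open>auto simp: Lp_norm_nonneg\<close>)
  have ls: "Lp_tendsto s g f"
    by (rule half_power_tendsto_0[where C = 1]) (use g(3) less_imp_le in \<open>auto simp: Lp_norm_nonneg\<close>)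
  show ?thesis
    using q by (intro Lp_limit_unique[where p = q and q = s and u = "\<lambda>i. T (g i)"] Lq_const(2) g(1) Lq_extension_in f
      Lq_extension_tendsto lq ls) auto
qed

lemma Lq_extension_AE_cong:
  assumes q: "1 < q" and f: "f \<in> Lp_space q" and g: "g \<in> Lp_space q" and eq: "AE x in lebesgue. f x = g x"
  shows "AE x in lebesgue. Lq_extension q f x = Lq_extension q g x"
proof -
  have q1: "1 \<le> q" "0 < q" using q by auto
  obtain u where u: "\<And>i. u i \<in> test_functions" "Lp_tendsto q u g" by (rule Lq_dense_seq[OF q g]) blast
  have "Lp_norm q (\<lambda>x. f x - u i x) = Lp_norm q (\<lambda>x. g x - u i x)" for i
  proof (rule Lp_norm_AE_cong[OF q1(2)])
    show "(\<lambda>x. g x - u i x) \<in> Lp_space q" by (rule Lp_space_diff[OF q1(1) g test_function_in_Lp_space[OF q1(2) u(1)]])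
    show "(\<lambda>x. f x - u i x) \<in> borel_measurable lebesgue"
      by (rule Lp_spaceD(1)[OF Lp_space_diff[OF q1(1) f test_function_in_Lp_space[OF q1(2) u(1)]]])
    show "AE x in lebesgue. g x - u i x = f x - u i x" using eq by (rule AE_mp) (auto intro!: AE_I2)
  qed
  hence "Lp_tendsto q u f" using u(2) by simp
  from Lq_extension_unique[OF q f Lq_extension_in[OF q g] u(1) this Lq_extension_tendsto[OF q g u]] show ?thesis .
qed

text \<open>The formula is inherited from approximating test functions whose supports stay close to
  that of \<open>f\<close>. For a fixed far point the kernel, restricted to the region containing
  these supports, lies in the conjugate space, so the integrals converge.\<close>

lemma Lq_extension_off_support:
  assumes q: "1 < q" and f: "f \<in> Lp_space q" and bdd: "bounded {x. f x \<noteq> 0}" and d: "0 < d"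
  shows "AE y in lebesgue. (\<forall>z. f z \<noteq> 0 \<longrightarrow> d \<le> norm (y - z)) \<longrightarrow> Lq_extension q f y = (LINT z|lebesgue. K y z * f z)"
proof -
  have q1: "1 \<le> q" "0 < q" using q by auto
  define q' where "q' = q / (q - 1)"
  have qq: "1 / q' + 1 / q = 1" using q by (simp add: q'_def divide_simps)
  have q'1: "1 < q'" by (rule conjugate_exponent[of q]) (use q qq in auto)
  \<comment> \<open>The bound d / 2 keeps the approximants at distance d / 2 from \<open>y\<close>;
    the bound 1 keeps all their supports in one ball.\<close>
  have d2: "0 < min (d / 2) 1" using d by simp
  obtain g where g: "\<And>i. g i \<in> test_functions" "\<And>i. Lp_norm q (\<lambda>x. f x - g i x) < (1 / 2) ^ i"
      "\<And>i. Lp_norm q (\<lambda>x. f x - g i x) < (1 / 2) ^ i" "\<And>i x. g i x \<noteq> 0 \<Longrightarrow> \<exists>y. f y \<noteq> 0 \<and> dist x y < min (d / 2) 1"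
    by (rule test_functions_dense_seq[of q q f "min (d / 2) 1"]) (use f q1 d2 in auto)
  have lim: "Lp_tendsto q g f"
    by (rule half_power_tendsto_0[where C = 1]) (use g(2) less_imp_le in \<open>auto simp: Lp_norm_nonneg\<close>)
  note Tlim = Lq_extension_tendsto[OF q f g(1) lim]
  obtain r where r: "strict_mono r" "AE y in lebesgue. (\<lambda>i. T (g (r i)) y) \<longlonglongrightarrow> Lq_extension q f y"
    using Lp_limit_subseq[OF q1(1) Lq_const(2)[OF q g(1)] Lq_extension_in[OF q f] Tlim] by blast
  obtain B where B: "\<And>x. f x \<noteq> 0 \<Longrightarrow> norm x \<le> B" using bdd by (auto simp: bounded_iff)
  have form: "AE y in lebesgue. \<forall>i. \<forall>d>0. (\<forall>z. g i z \<noteq> 0 \<longrightarrow> d \<le> norm (y - z)) \<longrightarrow> T (g i) y = (LINT z|lebesgue. K y z * g i z)"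
    unfolding AE_all_countable using T_off_support[OF g(1)] by blast
  show ?thesis using r(2) form
  proof (rule AE_mp[OF _ AE_mp], intro AE_I2 impI)
    fix y assume conv: "(\<lambda>i. T (g (r i)) y) \<longlonglongrightarrow> Lq_extension q f y"
      and form: "\<forall>i. \<forall>d>0. (\<forall>z. g i z \<noteq> 0 \<longrightarrow> d \<le> norm (y - z)) \<longrightarrow> T (g i) y = (LINT z|lebesgue. K y z * g i z)"
      and far: "\<forall>z. f z \<noteq> 0 \<longrightarrow> d \<le> norm (y - z)"
    \<comment> \<open>Contains the nonzero sets of \<open>f\<close> and of all approximants, is
      bounded, and stays d / 2 away from \<open>y\<close>; hence the kernel is bounded on
      it.\<close>
    define A where "A = {z. d / 2 \<le> norm (y - z)} \<inter> cball 0 (B + 1)"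
    have [measurable]: "A \<in> sets lebesgue"
    proof -
      have "closed A" unfolding A_def by (intro closed_Int closed_Collect_le continuous_intros) auto
      thus ?thesis by (intro borel_set_lebesgue borel_closed)
    qed
    have fA: "z \<in> A" if "f z \<noteq> 0" for z using far B[OF that] that d unfolding A_def by auto
    have gA: "z \<in> A" if gz: "g i z \<noteq> 0" for i z
    proof -
      obtain w where w: "f w \<noteq> 0" "dist z w < min (d / 2) 1" using g(4)[OF gz] by blast
      have "d \<le> norm (y - w)" using far w(1) by blast
      also have "\<dots> \<le> norm (y - z) + dist z w" using norm_triangle_ineq[of "y - z" "z - w"] by (simp add: dist_norm)
      finally have 1: "d / 2 \<le> norm (y - z)" using w(2) by simp
      have "norm z \<le> norm w + dist z w" using norm_triangle_ineq[of w "z - w"] by (simp add: dist_norm)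
      hence "norm z \<le> B + 1" using B[OF w(1)] w(2) by simp
      thus ?thesis using 1 by (simp add: A_def)
    qed
    define k where "k z = indicator A z * K y z" for z
    have k: "k \<in> Lp_space q'"
    proof (rule bounded_in_Lp_space[where B = "c2 * (d / 2) powr (- real CARD('n))" and S = A])
      show "k \<in> borel_measurable lebesgue" unfolding k_def by measurable
      have dh: "0 < d / 2" using d by simp
      show "norm (k z) \<le> c2 * (d / 2) powr (- real CARD('n))" for z
        using size_far[OF dh, of y z] c2 by (auto simp: k_def A_def indicator_def norm_mult)
      show "bounded A" unfolding A_def by (rule bounded_subset[OF bounded_cball]) auto
    qed (use q'1 in \<open>auto simp: k_def\<close>)
    have "(\<lambda>i. LINT z|lebesgue. k z * g i z) \<longlonglongrightarrow> (LINT z|lebesgue. k z * f z)"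
      by (rule Lp_pairing_tendsto[OF q'1 qq k f test_function_in_Lp_space[OF q1(2) g(1)] lim])
    moreover have "k z * g i z = K y z * g i z" for i z using gA[of i z] by (cases "g i z = 0") (auto simp: k_def)
    moreover have "k z * f z = K y z * f z" for z using fA[of z] by (cases "f z = 0") (auto simp: k_def)
    ultimately have "(\<lambda>i. LINT z|lebesgue. K y z * g i z) \<longlonglongrightarrow> (LINT z|lebesgue. K y z * f z)" by simp
    moreover have "T (g i) y = (LINT z|lebesgue. K y z * g i z)" for i
    proof (rule form[rule_format])
      show "0 < d / 2" using d by simp
      show "d / 2 \<le> norm (y - z)" if "g i z \<noteq> 0" for z using gA[OF that] by (simp add: A_def)
    qed
    ultimately have "(\<lambda>i. T (g i) y) \<longlonglongrightarrow> (LINT z|lebesgue. K y z * f z)" by simp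
    from LIMSEQ_subseq_LIMSEQ[OF this r(1)] have "(\<lambda>i. T (g (r i)) y) \<longlonglongrightarrow> (LINT z|lebesgue. K y z * f z)" by (simp add: o_def)
    from LIMSEQ_unique[OF conv this] show "Lq_extension q f y = (LINT z|lebesgue. K y z * f z)" .
  qed
qed

end

section \<open>Dyadic cubes and Morrey spaces\<close>

text \<open>Hoelder's inequality with exponent u / p for |f|^p against the indicator of
  \<open>A\<close>.\<close>

lemma Lp_inclusion:
  fixes f :: "real ^ 'n \<Rightarrow> complex"
  assumes pu: "0 < p" "p < u" and f: "f \<in> Lp_space u" and A: "A \<in> lmeasurable"
  shows "cut A f \<in> Lp_space p"
    and "Lp_norm p (cut A f) \<le> measure lebesgue A powr (1 / p - 1 / u) * Lp_norm u f"
proof -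
  define a where "a = u / p"
  define b where "b = a / (a - 1)"
  have a: "1 < a" using pu by (simp add: a_def)
  have ab: "1 / a + 1 / b = 1" using a by (simp add: b_def divide_simps)
  have b: "1 < b" by (rule conjugate_exponent[OF a ab])
  have [measurable]: "f \<in> borel_measurable lebesgue" "A \<in> sets lebesgue"
    using Lp_spaceD[OF f] A by auto
  define F where "F x = norm (f x) powr p" for x
  define G where "G = (indicator A :: real ^ 'n \<Rightarrow> real)"
  have Fa: "norm (F x) powr a = norm (f x) powr u" for x using pu by (simp add: F_def a_def powr_powr)
  have Gb: "norm (G x) powr b = indicator A x" for x using b by (simp add: G_def indicator_def)
  have F: "F \<in> borel_measurable lebesgue" "integrable lebesgue (\<lambda>x. norm (F x) powr a)"
    unfolding Fa using Lp_spaceD(2)[OF f] by (auto simp: F_def[abs_def])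
  have G: "G \<in> borel_measurable lebesgue" "integrable lebesgue (\<lambda>x. norm (G x) powr b)"
    unfolding Gb using A by (auto simp: G_def lmeasurable_iff_integrable)
  have eq: "norm (cut A f x) powr p = norm (F x) * norm (G x)" for x
    by (simp add: F_def G_def indicator_def)
  note h = hoelder_inequality[OF a b ab F G]
  have "cut A f \<in> borel_measurable lebesgue" by measurable
  moreover have "integrable lebesgue (\<lambda>x. norm (cut A f x) powr p)" using h(1) by (simp only: eq)
  ultimately show "cut A f \<in> Lp_space p" by (simp add: Lp_space_def)
  have "(LINT x|lebesgue. norm (cut A f x) powr p) \<le>
      (LINT x|lebesgue. norm (f x) powr u) powr (1 / a) * measure lebesgue A powr (1 / b)"
    unfolding eq using h(2) unfolding Fa Gb by simp
  hence "Lp_norm p (cut A f) \<le> ((LINT x|lebesgue. norm (f x) powr u) powr (1 / a) * measure lebesgue A powr (1 / b)) powr (1 / p)"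
    unfolding Lp_norm_eq using pu by (intro powr_mono2) auto
  also have "\<dots> = (LINT x|lebesgue. norm (f x) powr u) powr (1 / a * (1 / p)) * measure lebesgue A powr (1 / b * (1 / p))"
    by (simp only: powr_mult powr_powr)
  also have "1 / a * (1 / p) = 1 / u" using pu by (simp add: a_def)
  also have "1 / b * (1 / p) = 1 / p - 1 / u"
  proof -
    have "1 / b = 1 - 1 / a" using ab by simp
    thus ?thesis using pu by (simp add: a_def diff_divide_distrib)
  qed
  finally show "Lp_norm p (cut A f) \<le> measure lebesgue A powr (1 / p - 1 / u) * Lp_norm u f"
    by (simp add: Lp_norm_eq mult.commute)
qed

text \<open>Half the edge length of \<open>dyadic_cube J M\<close>, and also the spacing of the
  centres at that scale; cubes of one scale therefore overlap.\<close>

definition side :: "int \<Rightarrow> real"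
  where "side J = 2 powr (- real_of_int J)"

definition cube_nbhd :: "real \<Rightarrow> int \<Rightarrow> int ^ 'n \<Rightarrow> (real ^ 'n) set"
  where "cube_nbhd R J M = {x. \<forall>i. \<bar>x $ i - side J * real_of_int (M $ i)\<bar> \<le> R * side J}"

text \<open>Rounding to the nearest coarse centre moves each coordinate by at most half a coarse
  unit. The other half is left for a dilated cube, which is where the bound 2 ^ k / 2 on the
  dilation comes from.\<close>

definition ancestor :: "nat \<Rightarrow> int ^ 'n \<Rightarrow> int ^ 'n"
  where "ancestor k M = (\<chi> i. round (real_of_int (M $ i) / 2 ^ k))"

lemma side_pos [simp]: "0 < side J" "side J \<noteq> 0" "0 \<le> side J"
  by (simp_all add: side_def)

lemma side_shift: "side (J - int k) = 2 ^ k * side J"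
  by (simp add: side_def powr_diff powr_minus powr_realpow field_simps)

lemma dyadic_cube_eq_nbhd: "dyadic_cube J M = cube_nbhd 1 J (M :: int ^ 'n)"
proof -
  have pow: "2 powi (- J) = side J" by (simp add: side_def powr_real_of_int' flip: of_int_minus)
  show ?thesis
  proof (intro set_eqI iffI)
    fix x assume "x \<in> dyadic_cube J M"
    then obtain y where y: "\<And>i. y $ i \<in> {-1..1}" "x = side J *\<^sub>R ((\<chi> i. real_of_int (M $ i)) + y)"
      unfolding dyadic_cube_def pow by auto
    have "\<bar>x $ i - side J * real_of_int (M $ i)\<bar> \<le> 1 * side J" for i
    proof -
      have "x $ i - side J * real_of_int (M $ i) = side J * y $ i" unfolding y(2) by (simp add: algebra_simps)
      moreover have "\<bar>y $ i\<bar> \<le> 1" using y(1)[of i] by auto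
      ultimately show ?thesis by (simp add: abs_mult)
    qed
    thus "x \<in> cube_nbhd 1 J M" by (simp add: cube_nbhd_def)
  next
    fix x assume x: "x \<in> cube_nbhd 1 J M"
    define y where "y = (\<chi> i. (x $ i - side J * real_of_int (M $ i)) / side J)"
    have "\<bar>y $ i\<bar> \<le> 1" for i using x unfolding y_def cube_nbhd_def by (simp add: abs_divide divide_le_eq)
    hence "\<forall>i. y $ i \<in> {-1..1}" by (auto simp: abs_le_iff)
    moreover have "x = side J *\<^sub>R ((\<chi> i. real_of_int (M $ i)) + y)"
      by (simp add: vec_eq_iff y_def distrib_left)
    ultimately show "x \<in> dyadic_cube J M" unfolding dyadic_cube_def pow by blast
  qed
qed

lemma cube_nbhd_mono: "R \<le> R' \<Longrightarrow> cube_nbhd R J M \<subseteq> cube_nbhd R' J M"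
  unfolding cube_nbhd_def by (auto intro: order_trans mult_right_mono)

lemma cube_nbhd_cbox:
  "cube_nbhd R J M = cbox (\<chi> i. side J * real_of_int (M $ i) - R * side J) (\<chi> i. side J * real_of_int (M $ i) + R * side J)"
  by (auto simp: cube_nbhd_def mem_box_cart abs_le_iff algebra_simps)

lemma cube_nbhd_closed: "closed (cube_nbhd R J M)"
  unfolding cube_nbhd_cbox by (rule closed_cbox)

lemma cube_nbhd_bounded: "bounded (cube_nbhd R J M)"
  unfolding cube_nbhd_cbox by (rule bounded_cbox)

lemma cube_nbhd_lmeasurable: "cube_nbhd R J M \<in> lmeasurable"
  unfolding cube_nbhd_cbox by (rule lmeasurable_cbox)

lemma cube_nbhd_sets [measurable]: "cube_nbhd R J M \<in> sets lebesgue"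
  using cube_nbhd_lmeasurable by blast

lemma measure_cube_nbhd:
  "0 \<le> R \<Longrightarrow> measure lebesgue (cube_nbhd R J (M :: int ^ 'n)) = (2 * R * side J) ^ CARD('n)"
  unfolding cube_nbhd_cbox
  by (simp, subst content_cbox_cart) (auto simp: interval_ne_empty_cart mult_nonneg_nonneg power_mult_distrib)

lemma cube_nbhd_subset_ancestor:
  assumes "R \<le> 2 ^ k / 2" shows "cube_nbhd R J M \<subseteq> dyadic_cube (J - int k) (ancestor k M)"
proof
  fix x assume x: "x \<in> cube_nbhd R J M"
  have "\<bar>x $ i - side (J - int k) * real_of_int (ancestor k M $ i)\<bar> \<le> 1 * side (J - int k)" for i
  proof -
    let ?m = "real_of_int (M $ i)" and ?a = "real_of_int (ancestor k M $ i)"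
    have "\<bar>?a - ?m / 2 ^ k\<bar> \<le> 1 / 2" unfolding ancestor_def vec_lambda_beta by (rule of_int_round_abs_le)
    hence 1: "2 ^ k * side J * \<bar>?a - ?m / 2 ^ k\<bar> \<le> 2 ^ k * side J * (1 / 2)" by (intro mult_left_mono) auto
    have 2: "\<bar>side J * ?m - 2 ^ k * side J * ?a\<bar> = 2 ^ k * side J * \<bar>?a - ?m / 2 ^ k\<bar>"
    proof -
      have "2 ^ k * side J * \<bar>?a - ?m / 2 ^ k\<bar> = \<bar>2 ^ k * side J * (?a - ?m / 2 ^ k)\<bar>" by (simp add: abs_mult)
      also have "2 ^ k * side J * (?a - ?m / 2 ^ k) = - (side J * ?m - 2 ^ k * side J * ?a)" by (simp add: algebra_simps)
      finally show ?thesis by simp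
    qed
    have 3: "\<bar>x $ i - side J * ?m\<bar> \<le> R * side J" using x by (simp add: cube_nbhd_def)
    have 4: "R * side J \<le> 2 ^ k * side J * (1 / 2)" using mult_right_mono[OF assms, of "side J"] by simp
    have "\<bar>x $ i - 2 ^ k * side J * ?a\<bar> \<le> \<bar>x $ i - side J * ?m\<bar> + \<bar>side J * ?m - 2 ^ k * side J * ?a\<bar>"
      using abs_triangle_ineq[of "x $ i - side J * ?m" "side J * ?m - 2 ^ k * side J * ?a"] by simp
    also have "\<dots> \<le> 2 ^ k * side J * (1 / 2) + 2 ^ k * side J * (1 / 2)"
      using order_trans[OF 3 4] 1 unfolding 2 by (rule add_mono)
    finally have "\<bar>x $ i - 2 ^ k * side J * ?a\<bar> \<le> 2 ^ k * side J * (1 / 2) + 2 ^ k * side J * (1 / 2)" .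
    thus ?thesis unfolding side_shift mult_1_left distrib_left[symmetric] by simp
  qed
  thus "x \<in> dyadic_cube (J - int k) (ancestor k M)" unfolding dyadic_cube_eq_nbhd cube_nbhd_def by simp
qed

lemma cube_nbhd_separation:
  fixes M :: "int ^ 'n"
  assumes "y \<in> dyadic_cube J M" "z \<notin> cube_nbhd R J M"
  shows "(R - 1) * side J \<le> norm (y - z)"
proof -
  obtain i where "R * side J < \<bar>z $ i - side J * real_of_int (M $ i)\<bar>"
    using assms(2) by (auto simp: cube_nbhd_def not_le)
  moreover have "\<bar>y $ i - side J * real_of_int (M $ i)\<bar> \<le> 1 * side J"
    using assms(1) by (simp add: dyadic_cube_eq_nbhd cube_nbhd_def)
  ultimately have "(R - 1) * side J \<le> \<bar>(y - z) $ i\<bar>" by (simp add: algebra_simps)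
  also have "\<dots> \<le> norm (y - z)" by (rule component_le_norm_cart)
  finally show ?thesis .
qed

lemma bounded_subset_cube_nbhd:
  fixes M :: "int ^ 'n"
  assumes "bounded S" obtains i where "S \<subseteq> cube_nbhd (2 ^ i) J M"
proof -
  obtain B where B: "\<And>x. x \<in> S \<Longrightarrow> norm x \<le> B" using assms by (auto simp: bounded_iff)
  define c where "c = (\<chi> i. side J * real_of_int (M $ i))"
  obtain i where i: "(B + norm c) / side J < 2 ^ i" using real_arch_pow[of 2] by auto
  have "S \<subseteq> cube_nbhd (2 ^ i) J M"
  proof
    fix x assume x: "x \<in> S"
    have "\<bar>x $ k - side J * real_of_int (M $ k)\<bar> \<le> 2 ^ i * side J" for k
    proof -
      have "\<bar>(x - c) $ k\<bar> \<le> norm (x - c)" by (rule component_le_norm_cart)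
      also have "\<dots> \<le> norm x + norm c" by (rule norm_triangle_ineq4)
      also have "\<dots> \<le> B + norm c" using B[OF x] by simp
      also have "\<dots> \<le> 2 ^ i * side J" using i by (simp add: divide_less_eq less_imp_le)
      finally show ?thesis by (simp add: c_def)
    qed
    thus "x \<in> cube_nbhd (2 ^ i) J M" by (simp add: cube_nbhd_def)
  qed
  thus ?thesis using that by blast
qed

text \<open>Level 0 is the whole doubled cube, so the annuli partition the space. Only the levels
  \<open>Suc i\<close> keep a positive distance from the cube itself.\<close>

definition annulus :: "nat \<Rightarrow> int \<Rightarrow> int ^ 'n \<Rightarrow> (real ^ 'n) set"
  where "annulus i J M = cube_nbhd (2 ^ Suc i) J M - (if i = 0 then {} else cube_nbhd (2 ^ i) J M)"

lemma annulus_sets [measurable]: "annulus i J M \<in> sets lebesgue"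
  unfolding annulus_def by auto

lemma annulus_exists: "\<exists>i. x \<in> annulus i J M"
proof -
  obtain k where "{x} \<subseteq> cube_nbhd (2 ^ k) J M" by (rule bounded_subset_cube_nbhd[of "{x}"]) auto
  hence ex: "\<exists>k. x \<in> cube_nbhd (2 ^ Suc k) J M" using cube_nbhd_mono[of "2 ^ k" "2 ^ Suc k" J M] by auto
  define i where "i = (LEAST k. x \<in> cube_nbhd (2 ^ Suc k) J M)"
  have "x \<in> cube_nbhd (2 ^ Suc i) J M" unfolding i_def by (rule LeastI_ex[OF ex])
  moreover have "x \<notin> cube_nbhd (2 ^ i) J M" if "i \<noteq> 0"
    using not_less_Least[of "i - 1" "\<lambda>k. x \<in> cube_nbhd (2 ^ Suc k) J M"] that unfolding i_def[symmetric] by auto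
  ultimately have "x \<in> annulus i J M" unfolding annulus_def by simp
  thus ?thesis by blast
qed

lemma annulus_unique:
  assumes "x \<in> annulus i J M" "x \<in> annulus k J M" shows "i = k"
proof -
  have *: False if "a < b" "x \<in> annulus a J M" "x \<in> annulus b J M" for a b
  proof -
    have "cube_nbhd (2 ^ Suc a) J M \<subseteq> cube_nbhd (2 ^ b) J M"
      using that(1) by (intro cube_nbhd_mono power_increasing) auto
    thus False using that unfolding annulus_def by (auto split: if_splits)
  qed
  show ?thesis using *[of i k] *[of k i] assms by (meson nat_neq_iff)
qed

text \<open>The shift by 2 is forced by 2 ^ Suc i = 2 ^ (i + 2) / 2: one level for the doubling in
  the annulus, one for the rounding of the centre.\<close>

lemma annulus_subset_ancestor: "annulus i J M \<subseteq> dyadic_cube (J - int (i + 2)) (ancestor (i + 2) M)"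
proof -
  have "annulus i J M \<subseteq> cube_nbhd (2 ^ Suc i) J M" unfolding annulus_def by auto
  also have "\<dots> \<subseteq> dyadic_cube (J - int (i + 2)) (ancestor (i + 2) M)" by (rule cube_nbhd_subset_ancestor) simp
  finally show ?thesis .
qed

lemma annulus_separation:
  assumes "y \<in> dyadic_cube J M" "z \<in> annulus (Suc i) J M"
  shows "2 ^ i * side J \<le> norm (y - z)"
proof -
  have "z \<notin> cube_nbhd (2 ^ Suc i) J M" using assms(2) by (simp add: annulus_def)
  from cube_nbhd_separation[OF assms(1) this] have "(2 ^ Suc i - 1) * side J \<le> norm (y - z)" .
  moreover have "2 ^ i * side J \<le> (2 ^ Suc i - 1) * side J" by (intro mult_right_mono) auto
  ultimately show ?thesis by linarith
qed

lemma Lp_norm_bounded_on: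
  assumes p: "1 \<le> p" and g: "g \<in> borel_measurable lebesgue" and A: "A \<in> lmeasurable" and c: "0 \<le> c"
    and le: "AE x in lebesgue. norm (g x) \<le> c * indicator A x"
  shows "g \<in> Lp_space p" "Lp_norm p g \<le> c * measure lebesgue A powr (1 / p)"
proof -
  let ?w = "\<lambda>x. complex_of_real c * indicator A x"
  have nw: "norm (?w x) powr p = c powr p * indicator A x" for x
    using c p by (simp add: indicator_def norm_mult)
  have [measurable]: "A \<in> sets lebesgue" using A by blast
  have "integrable lebesgue (\<lambda>x. c powr p * indicator A x)" using A by (simp add: lmeasurable_iff_integrable)
  hence "integrable lebesgue (\<lambda>x. norm (?w x) powr p)" by (simp only: nw)
  moreover have "?w \<in> borel_measurable lebesgue" by measurable
  ultimately have w: "?w \<in> Lp_space p" by (simp add: Lp_space_def)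
  have le': "AE x in lebesgue. norm (g x) \<le> norm (?w x)"
    using le by (rule AE_mp) (use c in \<open>auto intro!: AE_I2 simp: norm_mult indicator_def\<close>)
  show "g \<in> Lp_space p" by (rule Lp_space_dominated[OF _ w g le']) (use p in simp)
  have "Lp_norm p g \<le> Lp_norm p ?w" by (rule Lp_norm_mono[OF _ w g le']) (use p in simp)
  also have "Lp_norm p ?w = (c powr p * measure lebesgue A) powr (1 / p)"
    unfolding Lp_norm_eq nw using A by (simp add: lmeasurable_iff_integrable)
  also have "\<dots> = c * measure lebesgue A powr (1 / p)"
    using c p by (simp add: powr_mult powr_powr)
  finally show "Lp_norm p g \<le> c * measure lebesgue A powr (1 / p)" .
qed

lemma Lp_loc_cut:
  assumes p: "0 < p" and f: "f \<in> Lp_loc p" and A: "bounded A" "A \<in> sets lebesgue"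
  shows "cut A f \<in> Lp_space p"
proof -
  have fm [measurable]: "f \<in> borel_measurable lebesgue" using f by (simp add: Lp_loc_def)
  have [measurable]: "A \<in> sets lebesgue" by (rule A(2))
  have "compact (closure A)" using A(1) by (simp add: compact_closure)
  hence "set_integrable lebesgue (closure A) (\<lambda>x. norm (f x) powr p)" using f by (simp add: Lp_loc_def)
  hence i: "integrable lebesgue (\<lambda>x. indicator (closure A) x *\<^sub>R norm (f x) powr p)" by (simp add: set_integrable_def)
  have "integrable lebesgue (\<lambda>x. norm (cut A f x) powr p)"
  proof (rule Bochner_Integration.integrable_bound[OF i])
    show "AE x in lebesgue. norm (norm (cut A f x) powr p) \<le> norm (indicator (closure A) x *\<^sub>R norm (f x) powr p)"
      using closure_subset[of A] p by (intro AE_I2) (auto simp: indicator_def)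
  qed measurable
  thus ?thesis by (simp add: Lp_space_def)
qed

text \<open>A compact set lies in a single large dyadic cube.\<close>

lemma Lp_locI:
  fixes f :: "real ^ 'n \<Rightarrow> complex"
  assumes p: "0 < p" and f: "f \<in> borel_measurable lebesgue" and Q: "\<And>J M. cut (dyadic_cube J M) f \<in> Lp_space p"
  shows "f \<in> Lp_loc p"
  unfolding Lp_loc_def
proof (intro CollectI conjI f allI impI)
  fix A :: "(real ^ 'n) set" assume A: "compact A"
  obtain i where i: "A \<subseteq> cube_nbhd (2 ^ i) 0 0" by (rule bounded_subset_cube_nbhd[OF compact_imp_bounded[OF A]])
  let ?Q = "dyadic_cube (0 - int (Suc i)) (ancestor (Suc i) 0) :: (real ^ 'n) set"
  have sub: "A \<subseteq> ?Q" using i cube_nbhd_subset_ancestor[of "2 ^ i" "Suc i" 0 0] by auto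
  have [measurable]: "A \<in> sets lebesgue" using A by (intro borel_set_lebesgue) (auto intro: borel_compact)
  note [measurable] = f
  show "set_integrable lebesgue A (\<lambda>x. norm (f x) powr p)"
    unfolding set_integrable_def
  proof (rule Bochner_Integration.integrable_bound[OF Lp_spaceD(2)[OF Q]])
    show "AE x in lebesgue. norm (indicator A x *\<^sub>R norm (f x) powr p) \<le> norm (norm (cut ?Q f x) powr p)"
    proof (intro AE_I2)
      fix x
      show "norm (indicator A x *\<^sub>R norm (f x) powr p) \<le> norm (norm (cut ?Q f x) powr p)"
      proof (cases "x \<in> A")
        case True
        hence "x \<in> ?Q" using sub by blast
        thus ?thesis by (simp add: indicator_def)
      qed simp
    qed
  qed measurable
qed

lemma dyadic_cube_lmeasurable: "dyadic_cube J M \<in> lmeasurable"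
  by (simp add: dyadic_cube_eq_nbhd cube_nbhd_lmeasurable)

lemma dyadic_cube_sets [measurable]: "dyadic_cube J M \<in> sets lebesgue"
  by (simp add: dyadic_cube_eq_nbhd)

lemma dyadic_cube_bounded: "bounded (dyadic_cube J M)"
  by (simp add: dyadic_cube_eq_nbhd cube_nbhd_bounded)

lemma measure_dyadic_cube: "measure lebesgue (dyadic_cube J (M :: int ^ 'n)) = (2 * side J) ^ CARD('n)"
  using measure_cube_nbhd[of 1 J M] by (simp add: dyadic_cube_eq_nbhd)

text \<open>Translates the normalised terms of the supremum into the form in which cubes are
  estimated below, a constant times a power of the side.\<close>

lemma morrey_term_le_iff:
  "2 powr (real_of_int J * s) * a \<le> N \<longleftrightarrow> a \<le> N * side J powr s"
proof -
  have "side J powr s = 1 / 2 powr (real_of_int J * s)"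
    unfolding side_def powr_powr by (simp add: powr_minus divide_inverse)
  thus ?thesis by (simp add: pos_le_divide_eq mult.commute)
qed

lemma
  fixes f :: "real ^ 'n \<Rightarrow> complex"
  assumes f: "f \<in> morrey_space p r"
  shows morrey_cube_le: "Lp_norm p (cut (dyadic_cube J M) f) \<le> morrey_norm p r f * side J powr (real CARD('n) / p + r)"
    and morrey_norm_nonneg: "0 \<le> morrey_norm p r f"
proof -
  let ?t = "\<lambda>(J, M). 2 powr (real_of_int J * (real CARD('n) / p + r)) * Lp_norm_on p (dyadic_cube J M) f"
  have le: "?t (J, M) \<le> morrey_norm p r f" for J M
  proof -
    have "bdd_above (range ?t)" using f by (simp add: morrey_space_def)
    from cSUP_upper[of "(J, M)" UNIV ?t, OF UNIV_I this] show ?thesis by (simp only: morrey_norm_def)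
  qed
  show "Lp_norm p (cut (dyadic_cube J M) f) \<le> morrey_norm p r f * side J powr (real CARD('n) / p + r)"
    using le[of J M] by (simp add: morrey_term_le_iff Lp_norm_on_eq_cut[of p "dyadic_cube J M" f])
  have "0 \<le> ?t (0, 0)" by (simp add: Lp_norm_on_def)
  thus "0 \<le> morrey_norm p r f" using le[of 0 0] by linarith
qed

lemma
  fixes f :: "real ^ 'n \<Rightarrow> complex"
  assumes f: "f \<in> Lp_loc p" and le: "\<And>J M. Lp_norm p (cut (dyadic_cube J M) f) \<le> N * side J powr (real CARD('n) / p + r)"
  shows morrey_spaceI: "f \<in> morrey_space p r" and morrey_norm_le: "morrey_norm p r f \<le> N"
proof -
  let ?t = "\<lambda>(J, M). 2 powr (real_of_int J * (real CARD('n) / p + r)) * Lp_norm_on p (dyadic_cube J M) f"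
  have b: "?t k \<le> N" for k
  proof (cases k)
    case (Pair J M)
    thus ?thesis using le[of J M] by (simp add: morrey_term_le_iff Lp_norm_on_eq_cut[of p "dyadic_cube J M" f])
  qed
  have "bdd_above (range ?t)" using b by (intro bdd_aboveI2)
  thus "f \<in> morrey_space p r" using f by (simp add: morrey_space_def)
  show "morrey_norm p r f \<le> N" unfolding morrey_norm_def by (rule cSUP_least[OF UNIV_not_empty b])
qed

lemma morrey_space_Lp_loc: "f \<in> morrey_space p r \<Longrightarrow> f \<in> Lp_loc p"
  by (simp add: morrey_space_def)

lemma morrey_space_measurable: "f \<in> morrey_space p r \<Longrightarrow> f \<in> borel_measurable lebesgue"
  by (simp add: morrey_space_def Lp_loc_def)

lemma morrey_cut: "0 < p \<Longrightarrow> f \<in> morrey_space p r \<Longrightarrow> bounded A \<Longrightarrow> A \<in> sets lebesgue \<Longrightarrow> cut A f \<in> Lp_space p"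
  by (rule Lp_loc_cut[OF _ morrey_space_Lp_loc])

lemma
  fixes f g :: "real ^ 'n \<Rightarrow> complex"
  assumes p: "1 \<le> p" and f: "f \<in> morrey_space p r" and g: "g \<in> morrey_space p r"
  shows morrey_space_linear: "(\<lambda>x. c * f x + d * g x) \<in> morrey_space p r"
    and morrey_norm_linear: "morrey_norm p r (\<lambda>x. c * f x + d * g x) \<le> norm c * morrey_norm p r f + norm d * morrey_norm p r g"
proof -
  have p0: "0 < p" using p by simp
  have eq: "cut A (\<lambda>x. c * f x + d * g x) = (\<lambda>x. c * cut A f x + d * cut A g x)" for A by (auto simp: algebra_simps)
  note fQ = morrey_cut[OF p0 f dyadic_cube_bounded dyadic_cube_sets]
  note gQ = morrey_cut[OF p0 g dyadic_cube_bounded dyadic_cube_sets]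
  note [measurable] = morrey_space_measurable[OF f] morrey_space_measurable[OF g]
  have loc: "(\<lambda>x. c * f x + d * g x) \<in> Lp_loc p"
  proof (rule Lp_locI[OF p0])
    show "cut (dyadic_cube J M) (\<lambda>x. c * f x + d * g x) \<in> Lp_space p" for J M
      unfolding eq by (intro Lp_space_add[OF p] Lp_space_scale[OF p0] fQ gQ)
  qed measurable
  have le: "Lp_norm p (cut (dyadic_cube J M) (\<lambda>x. c * f x + d * g x))
      \<le> (norm c * morrey_norm p r f + norm d * morrey_norm p r g) * side J powr (real CARD('n) / p + r)" for J M
  proof -
    have "Lp_norm p (cut (dyadic_cube J M) (\<lambda>x. c * f x + d * g x))
        \<le> norm c * Lp_norm p (cut (dyadic_cube J M) f) + norm d * Lp_norm p (cut (dyadic_cube J M) g)"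
      unfolding eq using Lp_norm_add[OF p Lp_space_scale[OF p0 fQ] Lp_space_scale[OF p0 gQ], of c J M d J M]
      by (simp only: Lp_norm_scale[OF p0 fQ] Lp_norm_scale[OF p0 gQ])
    also have "\<dots> \<le> norm c * (morrey_norm p r f * side J powr (real CARD('n) / p + r))
        + norm d * (morrey_norm p r g * side J powr (real CARD('n) / p + r))"
      by (intro add_mono mult_left_mono morrey_cube_le f g) auto
    finally show ?thesis by (simp add: algebra_simps)
  qed
  show "(\<lambda>x. c * f x + d * g x) \<in> morrey_space p r" by (rule morrey_spaceI[OF loc le])
  show "morrey_norm p r (\<lambda>x. c * f x + d * g x) \<le> norm c * morrey_norm p r f + norm d * morrey_norm p r g"
    by (rule morrey_norm_le[OF loc le])
qed

lemma
  assumes p: "1 \<le> p" and f: "f \<in> morrey_space p r" and g: "g \<in> morrey_space p r"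
  shows morrey_space_diff: "(\<lambda>x. f x - g x) \<in> morrey_space p r"
    and morrey_norm_diff: "morrey_norm p r (\<lambda>x. f x - g x) \<le> morrey_norm p r f + morrey_norm p r g"
  using morrey_space_linear[OF assms, of 1 "-1"] morrey_norm_linear[OF assms, of 1 "-1"] by auto

lemma morrey_norm_triangle:
  assumes p: "1 \<le> p" and "f \<in> morrey_space p r" "g \<in> morrey_space p r" "h \<in> morrey_space p r"
  shows "morrey_norm p r (\<lambda>x. f x - h x) \<le> morrey_norm p r (\<lambda>x. f x - g x) + morrey_norm p r (\<lambda>x. g x - h x)"
  using morrey_norm_linear[OF p morrey_space_diff[OF p assms(2,3)] morrey_space_diff[OF p assms(3,4)], of 1 1] by simp

lemma morrey_AE_cong:
  fixes f g :: "real ^ 'n \<Rightarrow> complex"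
  assumes p: "1 \<le> p" and f: "f \<in> morrey_space p r" and g: "g \<in> borel_measurable lebesgue"
    and eq: "AE x in lebesgue. f x = g x"
  shows "g \<in> morrey_space p r" "morrey_norm p r g \<le> morrey_norm p r f"
proof -
  have p0: "0 < p" using p by simp
  note fQ = morrey_cut[OF p0 f dyadic_cube_bounded dyadic_cube_sets]
  note [measurable] = g
  have gm: "cut (dyadic_cube J M) g \<in> borel_measurable lebesgue" for J M by measurable
  have eq': "AE x in lebesgue. cut (dyadic_cube J M) f x = cut (dyadic_cube J M) g x" for J M
    using eq by (rule AE_mp) (auto intro!: AE_I2)
  have loc: "g \<in> Lp_loc p" by (rule Lp_locI[OF p0 g Lp_space_AE_cong[OF p0 fQ gm eq']])
  have le: "Lp_norm p (cut (dyadic_cube J M) g) \<le> morrey_norm p r f * side J powr (real CARD('n) / p + r)" for J M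
    unfolding Lp_norm_AE_cong[OF p0 fQ gm eq'] by (rule morrey_cube_le[OF f])
  show "g \<in> morrey_space p r" by (rule morrey_spaceI[OF loc le])
  show "morrey_norm p r g \<le> morrey_norm p r f" by (rule morrey_norm_le[OF loc le])
qed

text \<open>The cubes of scale -k around the origin exhaust the space and are countable in number,
  so the exceptional sets of the single cubes may be united.\<close>

lemma AE_on_all_cubes:
  assumes "\<And>J. AE x in lebesgue. x \<in> dyadic_cube J (ancestor (nat (- J)) 0) \<longrightarrow> P (x :: real ^ 'n)"
  shows "AE x in lebesgue. P x"
proof -
  have "AE x in lebesgue. \<forall>J. x \<in> dyadic_cube J (ancestor (nat (- J)) 0) \<longrightarrow> P x"
    unfolding AE_all_countable using assms by blast
  thus ?thesis
  proof (rule AE_mp, intro AE_I2 impI)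
    fix x assume *: "\<forall>J. x \<in> dyadic_cube J (ancestor (nat (- J)) 0) \<longrightarrow> P x"
    obtain i where "{x} \<subseteq> cube_nbhd (2 ^ i) 0 0" by (rule bounded_subset_cube_nbhd[of "{x}"]) auto
    hence "x \<in> dyadic_cube (0 - int (Suc i)) (ancestor (Suc i) 0)"
      using cube_nbhd_subset_ancestor[of "2 ^ i" "Suc i" 0 "0 :: int ^ 'n"] by auto
    thus "P x" using *[rule_format, of "- int (Suc i)"] by (simp del: of_nat_Suc)
  qed
qed

lemma morrey_norm_zero_imp:
  fixes f :: "real ^ 'n \<Rightarrow> complex"
  assumes p: "1 \<le> p" and f: "f \<in> morrey_space p r" and z: "morrey_norm p r f \<le> 0"
  shows "AE x in lebesgue. f x = 0"
proof (rule AE_on_all_cubes)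
  fix J
  let ?Q = "dyadic_cube J (ancestor (nat (- J)) 0) :: (real ^ 'n) set"
  have p0: "0 < p" using p by simp
  have fQ: "cut ?Q f \<in> Lp_space p" by (rule morrey_cut[OF p0 f dyadic_cube_bounded dyadic_cube_sets])
  have "Lp_norm p (cut ?Q f) \<le> morrey_norm p r f * side J powr (real CARD('n) / p + r)" by (rule morrey_cube_le[OF f])
  also have "\<dots> \<le> 0" using z by (intro mult_nonpos_nonneg) auto
  finally have "Lp_norm p (cut ?Q f) = 0" using Lp_norm_nonneg[of p "cut ?Q f"] by linarith
  hence "AE x in lebesgue. cut ?Q f x = 0" using Lp_norm_eq_0_iff[OF p0 fQ] by blast
  thus "AE x in lebesgue. x \<in> ?Q \<longrightarrow> f x = 0" by (rule AE_mp) (auto intro!: AE_I2)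
qed

text \<open>On a cube of side length \<open>l\<close>, Hoelder's inequality gains the power \<open>n / p - n / u = n / p + r\<close> of \<open>l\<close>.\<close>

lemma Lu_in_morrey_space:
  fixes f :: "real ^ 'n \<Rightarrow> complex"
  assumes p: "1 < p" and r: "- real CARD('n) / p < r" "r < 0" and u: "u = - real CARD('n) / r" and f: "f \<in> Lp_space u"
  shows "f \<in> morrey_space p r" "morrey_norm p r f \<le> 2 powr (real CARD('n) / p + r) * Lp_norm u f"
proof -
  have p0: "0 < p" using p by simp
  have pu: "p < u" using p r by (simp add: u field_simps)
  have nu: "real CARD('n) * (1 / p - 1 / u) = real CARD('n) / p + r" using r by (simp add: u field_simps)
  note incl = Lp_inclusion[OF p0 pu f dyadic_cube_lmeasurable]
  have loc: "f \<in> Lp_loc p" by (rule Lp_locI[OF p0 Lp_spaceD(1)[OF f] incl(1)])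
  have le: "Lp_norm p (cut (dyadic_cube J M) f) \<le> (2 powr (real CARD('n) / p + r) * Lp_norm u f) * side J powr (real CARD('n) / p + r)" for J M
  proof -
    have "measure lebesgue (dyadic_cube J M) powr (1 / p - 1 / u) = (2 * side J) powr (real CARD('n) / p + r)"
    proof -
      have "(2 * side J) ^ CARD('n) = (2 * side J) powr real CARD('n)" by (rule powr_realpow[symmetric]) simp
      thus ?thesis by (simp only: measure_dyadic_cube powr_powr nu)
    qed
    also have "\<dots> = 2 powr (real CARD('n) / p + r) * side J powr (real CARD('n) / p + r)" by (rule powr_mult)
    finally show ?thesis using incl(2)[of J M] by (simp add: mult_ac)
  qed
  show "f \<in> morrey_space p r" by (rule morrey_spaceI[OF loc le])
  show "morrey_norm p r f \<le> 2 powr (real CARD('n) / p + r) * Lp_norm u f" by (rule morrey_norm_le[OF loc le])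
qed

text \<open>Monotone convergence over the annuli. The function vanishes on the innermost annulus
  because the estimates in question hold only at a distance from the central cube.\<close>

lemma nonneg_integral_over_annuli:
  fixes h :: "real ^ 'n \<Rightarrow> complex"
  assumes h: "h \<in> borel_measurable lebesgue" and zero: "\<And>x. x \<in> annulus 0 J M \<Longrightarrow> h x = 0"
    and int: "\<And>i. integrable lebesgue (\<lambda>x. indicator (annulus (Suc i) J M) x * norm (h x))"
    and le: "\<And>i. (LINT x|lebesgue. indicator (annulus (Suc i) J M) x * norm (h x)) \<le> b i"
    and b: "summable b"
  shows "integrable lebesgue h" "(LINT x|lebesgue. norm (h x)) \<le> suminf b"
proof -
  have b0: "0 \<le> b i" for i by (rule order_trans[OF _ le[of i]]) (simp add: integral_nonneg_AE)
  have eq: "ennreal (norm (h x)) = (\<Sum>i. ennreal (indicator (annulus (Suc i) J M) x * norm (h x)))" for x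
  proof -
    obtain k where k: "x \<in> annulus k J M" using annulus_exists by blast
    show ?thesis
    proof (cases k)
      case 0
      hence "h x = 0" using zero k by simp
      thus ?thesis by simp
    next
      case (Suc i)
      have "(\<lambda>j. ennreal (indicator (annulus (Suc j) J M) x * norm (h x))) = (\<lambda>j. if j = i then ennreal (norm (h x)) else 0)"
        using k annulus_unique unfolding Suc by (fastforce simp: indicator_def fun_eq_iff)
      thus ?thesis using sums_unique[OF sums_single[of i "\<lambda>_. ennreal (norm (h x))"]] by simp
    qed
  qed
  note [measurable] = h
  have "(\<integral>\<^sup>+x. ennreal (norm (h x)) \<partial>lebesgue) = (\<Sum>i. \<integral>\<^sup>+x. ennreal (indicator (annulus (Suc i) J M) x * norm (h x)) \<partial>lebesgue)"
    unfolding eq by (rule nn_integral_suminf) measurable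
  also have "\<dots> \<le> (\<Sum>i. ennreal (b i))"
  proof (intro suminf_le summableI)
    fix i
    have "(\<integral>\<^sup>+x. ennreal (indicator (annulus (Suc i) J M) x * norm (h x)) \<partial>lebesgue)
        = ennreal (LINT x|lebesgue. indicator (annulus (Suc i) J M) x * norm (h x))"
      by (rule nn_integral_eq_integral[OF int]) simp
    thus "(\<integral>\<^sup>+x. ennreal (indicator (annulus (Suc i) J M) x * norm (h x)) \<partial>lebesgue) \<le> ennreal (b i)"
      using ennreal_leI[OF le[of i]] by simp
  qed
  also have "\<dots> = ennreal (suminf b)" by (rule suminf_ennreal2[OF b0 b])
  finally have le2: "(\<integral>\<^sup>+x. ennreal (norm (h x)) \<partial>lebesgue) \<le> ennreal (suminf b)" .
  have "(\<integral>\<^sup>+x. ennreal (norm (h x)) \<partial>lebesgue) < \<infinity>" using le_less_trans[OF le2] by simp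
  thus ih: "integrable lebesgue h" using h by (intro integrableI_bounded)
  have "(\<integral>\<^sup>+x. ennreal (norm (h x)) \<partial>lebesgue) = ennreal (LINT x|lebesgue. norm (h x))"
    by (rule nn_integral_eq_integral) (use ih in auto)
  thus "(LINT x|lebesgue. norm (h x)) \<le> suminf b" using le2 suminf_nonneg[OF b b0] by simp
qed

lemma half_open_cube_mono: "N \<le> N' \<Longrightarrow> half_open_cube N \<subseteq> half_open_cube N'"
proof
  fix x assume "N \<le> N'" and x: "x \<in> half_open_cube N"
  hence "real N \<le> real N'" by simp
  moreover have "- real N \<le> x $ i" "x $ i < real N" for i using x by (auto simp: half_open_cube_def)
  ultimately have "- real N' \<le> x $ i" "x $ i < real N'" for i by (meson le_imp_neg_le order_trans less_le_trans)+
  thus "x \<in> half_open_cube N'" by (simp add: half_open_cube_def)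
qed

section \<open>The operator on Morrey spaces\<close>

context calderon_zygmund
begin

text \<open>The annulus at distance X = 2 ^ i * side J sits in a dyadic cube of half edge 8 X. Its
  edge 16 X enters through the passage from L_p to L_1, and 8 X through the Morrey norm on that
  cube; the denominator sums a geometric series of ratio 2 powr r.\<close>

definition morrey_far_const :: "real \<Rightarrow> real \<Rightarrow> real"
  where "morrey_far_const p r = c2 * 16 powr (real CARD('n) * (1 - 1 / p)) * 8 powr (real CARD('n) / p + r) / (1 - 2 powr r)"

text \<open>Test functions are not dense in the Morrey space, so continuity alone does not determine
  an operator, and truncations are used instead. They converge almost everywhere; elsewhere
  \<open>lim\<close> has an arbitrary value.\<close>

definition morrey_op :: "real \<Rightarrow> (real ^ 'n \<Rightarrow> complex) \<Rightarrow> real ^ 'n \<Rightarrow> complex"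
  where "morrey_op p f y = lim (\<lambda>N. Lq_extension p (cut (half_open_cube N) f) y)"

context
  fixes p r :: real
  assumes p: "1 < p" and r: "- real CARD('n) / p < r" "r < 0"
begin

lemma p_pos: "0 < p" "1 \<le> p" using p by auto

lemma two_powr_r: "2 powr r < 1" using r by (simp add: powr_less_one)

lemma morrey_far_const_nonneg: "0 \<le> morrey_far_const p r"
  unfolding morrey_far_const_def using c2 two_powr_r by simp

lemma morrey_annulus_integral:
  fixes f :: "real ^ 'n \<Rightarrow> complex"
  assumes f: "f \<in> morrey_space p r"
  shows "integrable lebesgue (\<lambda>z. indicator (annulus (Suc i) J M) z * norm (f z))"
    and "(LINT z|lebesgue. indicator (annulus (Suc i) J M) z * norm (f z)) \<le> 
      (16 * (2 ^ i * side J)) powr (real CARD('n) * (1 - 1 / p)) * (morrey_norm p r f * (8 * (2 ^ i * side J)) powr (real CARD('n) / p + r))"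
proof -
  let ?A = "annulus (Suc i) J M"
  let ?J = "J - int (Suc i + 2)"
  let ?R = "dyadic_cube ?J (ancestor (Suc i + 2) M)"
  have side: "side ?J = 8 * (2 ^ i * side J)" unfolding side_shift by simp
  have sub: "?A \<subseteq> ?R" by (rule annulus_subset_ancestor)
  have fR: "cut ?R f \<in> Lp_space p" by (rule morrey_cut[OF p_pos(1) f dyadic_cube_bounded dyadic_cube_sets])
  have one: "0 < (1::real)" by simp
  note incl = Lp_inclusion[OF one p fR dyadic_cube_lmeasurable[of ?J "ancestor (Suc i + 2) M"]]
  have cc: "cut ?R (cut ?R f) = cut ?R f" by (auto simp: indicator_def)
  have "cut ?R f \<in> Lp_space 1" using incl(1) unfolding cc .
  from Lp_spaceD(2)[OF this] have fR1: "integrable lebesgue (\<lambda>z. norm (cut ?R f z))" by simp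
  note [measurable] = morrey_space_measurable[OF f]
  have le: "indicator ?A z * norm (f z) \<le> norm (cut ?R f z)" for z using sub by (auto simp: indicator_def)
  show int: "integrable lebesgue (\<lambda>z. indicator ?A z * norm (f z))"
    by (rule Bochner_Integration.integrable_bound[OF fR1]) (measurable, use le in \<open>auto intro!: AE_I2 simp: abs_mult\<close>)
  have "(LINT z|lebesgue. indicator ?A z * norm (f z)) \<le> (LINT z|lebesgue. norm (cut ?R f z))"
    by (rule integral_mono[OF int fR1 le])
  also have "\<dots> = Lp_norm 1 (cut ?R f)" by (simp add: Lp_norm_eq)
  also have "\<dots> \<le> measure lebesgue ?R powr (1 / 1 - 1 / p) * Lp_norm p (cut ?R f)" using incl(2) unfolding cc .
  also have "\<dots> \<le> measure lebesgue ?R powr (1 / 1 - 1 / p) * (morrey_norm p r f * side ?J powr (real CARD('n) / p + r))"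
    by (intro mult_left_mono morrey_cube_le f) simp
  also have "measure lebesgue ?R powr (1 / 1 - 1 / p) = (16 * (2 ^ i * side J)) powr (real CARD('n) * (1 - 1 / p))"
  proof -
    have "measure lebesgue ?R = (16 * (2 ^ i * side J)) powr real CARD('n)"
      unfolding measure_dyadic_cube side by (subst powr_realpow) auto
    thus ?thesis by (simp add: powr_powr)
  qed
  finally show "(LINT z|lebesgue. indicator ?A z * norm (f z)) \<le> 
      (16 * (2 ^ i * side J)) powr (real CARD('n) * (1 - 1 / p)) * (morrey_norm p r f * (8 * (2 ^ i * side J)) powr (real CARD('n) / p + r))"
    unfolding side .
qed

text \<open>At distance X the kernel contributes X^-n, the passage to L_1 contributes X^(n - n / p),
  and the Morrey norm contributes X^(n / p + r). The product is X^r, and r < 0 makes the sum over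
  the annuli converge.\<close>

lemma morrey_far_integral:
  assumes f: "f \<in> morrey_space p r" and y: "y \<in> dyadic_cube J M"
  shows "integrable lebesgue (\<lambda>z. K y z * cut (- cube_nbhd 2 J M) f z)"
    and "(LINT z|lebesgue. norm (K y z * cut (- cube_nbhd 2 J M) f z)) \<le> morrey_far_const p r * morrey_norm p r f * side J powr r"
proof -
  let ?n = "real CARD('n)" and ?h = "\<lambda>z. K y z * cut (- cube_nbhd 2 J M) f z"
  define C where "C = c2 * 16 powr (?n * (1 - 1 / p)) * 8 powr (?n / p + r) * morrey_norm p r f * side J powr r"
  note [measurable] = morrey_space_measurable[OF f]
  have hm: "?h \<in> borel_measurable lebesgue" by measurable
  have zero: "?h x = 0" if "x \<in> annulus 0 J M" for x using that by (simp add: annulus_def)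
  have pw: "indicator (annulus (Suc i) J M) z * norm (?h z)
      \<le> c2 * (2 ^ i * side J) powr (- ?n) * (indicator (annulus (Suc i) J M) z * norm (f z))" for i z
  proof (cases "z \<in> annulus (Suc i) J M")
    case True
    have "norm (K y z) \<le> c2 * (2 ^ i * side J) powr (- ?n)"
      by (rule size_far[OF _ annulus_separation[OF y True]]) simp
    moreover have "norm (cut (- cube_nbhd 2 J M) f z) \<le> norm (f z)" by (simp add: indicator_def)
    ultimately have "norm (?h z) \<le> c2 * (2 ^ i * side J) powr (- ?n) * norm (f z)"
      unfolding norm_mult[of "K y z"] using c2 by (intro mult_mono) auto
    thus ?thesis using True by simp
  qed simp
  have intm: "integrable lebesgue (\<lambda>z. c2 * (2 ^ i * side J) powr (- ?n) * (indicator (annulus (Suc i) J M) z * norm (f z)))" for i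
    using morrey_annulus_integral(1)[OF f, of i J M] by simp
  have int: "integrable lebesgue (\<lambda>z. indicator (annulus (Suc i) J M) z * norm (?h z))" for i
    by (rule Bochner_Integration.integrable_bound[OF intm[of i]])
      (measurable, use pw c2 in \<open>auto intro!: AE_I2 order_trans[OF _ abs_ge_self] simp: abs_mult\<close>)
  have le: "(LINT z|lebesgue. indicator (annulus (Suc i) J M) z * norm (?h z)) \<le> C * (2 powr r) ^ i" for i
  proof -
    define X where "X = 2 ^ i * side J"
    have X: "0 < X" by (simp add: X_def)
    have "(LINT z|lebesgue. indicator (annulus (Suc i) J M) z * norm (?h z))
        \<le> (LINT z|lebesgue. c2 * X powr (- ?n) * (indicator (annulus (Suc i) J M) z * norm (f z)))"
      unfolding X_def by (rule integral_mono[OF int intm pw])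
    also have "\<dots> = c2 * X powr (- ?n) * (LINT z|lebesgue. indicator (annulus (Suc i) J M) z * norm (f z))" by simp
    also have "\<dots> \<le> c2 * X powr (- ?n) * ((16 * X) powr (?n * (1 - 1 / p)) * (morrey_norm p r f * (8 * X) powr (?n / p + r)))"
      unfolding X_def using c2 by (intro mult_left_mono morrey_annulus_integral(2) f) auto
    also have "\<dots> = c2 * 16 powr (?n * (1 - 1 / p)) * 8 powr (?n / p + r) * morrey_norm p r f *
        (X powr (- ?n) * X powr (?n * (1 - 1 / p)) * X powr (?n / p + r))"
      by (simp only: powr_mult mult_ac)
    also have "X powr (- ?n) * X powr (?n * (1 - 1 / p)) * X powr (?n / p + r) = X powr r"
      by (simp add: algebra_simps flip: powr_add)
    also have "X powr r = side J powr r * (2 powr r) ^ i"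
    proof -
      have "(2 ^ i) powr r = (2 powr r) ^ i" by (induction i) (simp_all add: powr_mult)
      thus ?thesis unfolding X_def by (simp add: powr_mult)
    qed
    finally show ?thesis by (simp add: C_def mult_ac)
  qed
  have summ: "summable (\<lambda>i. C * (2 powr r) ^ i)" using two_powr_r by (intro summable_mult summable_geometric) simp
  note * = nonneg_integral_over_annuli[OF hm zero int le summ]
  show "integrable lebesgue ?h" by (rule *(1))
  have "(\<Sum>i. C * (2 powr r) ^ i) = C / (1 - 2 powr r)"
    using two_powr_r by (subst suminf_mult) (auto simp: suminf_geometric summable_geometric)
  also have "\<dots> = morrey_far_const p r * morrey_norm p r f * side J powr r" by (simp add: C_def morrey_far_const_def)
  finally show "(LINT z|lebesgue. norm (?h z)) \<le> morrey_far_const p r * morrey_norm p r f * side J powr r" using *(2) by simp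
qed

text \<open>Once the truncation contains the doubled cube, the near part no longer changes. On the
  cube the remaining part is a kernel integral, and it converges by dominated convergence with the
  absolutely integrable far integrand as majorant.\<close>

lemma morrey_op_on_cube:
  assumes f: "f \<in> morrey_space p r"
  shows "AE y in lebesgue. y \<in> dyadic_cube J M \<longrightarrow>
    (\<lambda>N. Lq_extension p (cut (half_open_cube N) f) y) \<longlonglongrightarrow>
      Lq_extension p (cut (cube_nbhd 2 J M) f) y + (LINT z|lebesgue. K y z * cut (- cube_nbhd 2 J M) f z)"
proof -
  let ?B = "cube_nbhd 2 J M"
  note fL = morrey_cut[OF p_pos(1) f]
  obtain N0 where N0: "?B \<subseteq> half_open_cube N0" by (rule bounded_subset_half_open_cube[OF cube_nbhd_bounded])
  have sub: "?B \<subseteq> half_open_cube N" if "N0 \<le> N" for N using N0 half_open_cube_mono[OF that] by blast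
  define g where "g N = cut (half_open_cube N - ?B) f" for N
  have gL: "g N \<in> Lp_space p" for N
    unfolding g_def by (rule fL) (auto intro: bounded_subset[OF bounded_half_open_cube])
  have BL: "cut ?B f \<in> Lp_space p" by (rule fL[OF cube_nbhd_bounded cube_nbhd_sets])
  have split: "AE y in lebesgue. N0 \<le> N \<longrightarrow> Lq_extension p (cut (half_open_cube N) f) y
      = Lq_extension p (cut ?B f) y + Lq_extension p (g N) y" for N
  proof (cases "N0 \<le> N")
    case True
    have "cut (half_open_cube N) f = (\<lambda>x. 1 * cut ?B f x + 1 * g N x)"
      using sub[OF True] by (auto simp: g_def indicator_def fun_eq_iff)
    thus ?thesis using Lq_extension_linear[OF p BL gL[of N], of 1 1] by simp
  qed simp
  have off: "AE y in lebesgue. y \<in> dyadic_cube J M \<longrightarrow> Lq_extension p (g N) y = (LINT z|lebesgue. K y z * g N z)" for N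
  proof -
    have "bounded {x. g N x \<noteq> 0}"
      by (rule bounded_subset[OF bounded_half_open_cube[of N]]) (auto simp: g_def indicator_def split: if_splits)
    from Lq_extension_off_support[OF p gL this, of "side J"]
    have "AE y in lebesgue. (\<forall>z. g N z \<noteq> 0 \<longrightarrow> side J \<le> norm (y - z)) \<longrightarrow> Lq_extension p (g N) y = (LINT z|lebesgue. K y z * g N z)" by simp
    thus ?thesis
    proof (rule AE_mp, intro AE_I2 impI)
      fix y assume "(\<forall>z. g N z \<noteq> 0 \<longrightarrow> side J \<le> norm (y - z)) \<longrightarrow> Lq_extension p (g N) y = (LINT z|lebesgue. K y z * g N z)"
        and y: "y \<in> dyadic_cube J M"
      moreover have "side J \<le> norm (y - z)" if "g N z \<noteq> 0" for z
      proof -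
        have "z \<notin> ?B" using that by (auto simp: g_def)
        from cube_nbhd_separation[OF y this] show ?thesis by simp
      qed
      ultimately show "Lq_extension p (g N) y = (LINT z|lebesgue. K y z * g N z)" by blast
    qed
  qed
  have "AE y in lebesgue. \<forall>N. N0 \<le> N \<longrightarrow> Lq_extension p (cut (half_open_cube N) f) y
      = Lq_extension p (cut ?B f) y + Lq_extension p (g N) y"
    unfolding AE_all_countable using split by blast
  moreover have "AE y in lebesgue. \<forall>N. y \<in> dyadic_cube J M \<longrightarrow> Lq_extension p (g N) y = (LINT z|lebesgue. K y z * g N z)"
    unfolding AE_all_countable using off by blast
  ultimately show ?thesis
  proof (rule AE_mp[OF _ AE_mp], intro AE_I2 impI)
    fix y assume 1: "\<forall>N. N0 \<le> N \<longrightarrow> Lq_extension p (cut (half_open_cube N) f) y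
        = Lq_extension p (cut ?B f) y + Lq_extension p (g N) y"
      and 2: "\<forall>N. y \<in> dyadic_cube J M \<longrightarrow> Lq_extension p (g N) y = (LINT z|lebesgue. K y z * g N z)"
      and y: "y \<in> dyadic_cube J M"
    note [measurable] = morrey_space_measurable[OF f]
    have lim: "(\<lambda>N. LINT z|lebesgue. K y z * g N z) \<longlonglongrightarrow> (LINT z|lebesgue. K y z * cut (- ?B) f z)"
    proof (rule integral_dominated_convergence[where w = "\<lambda>z. norm (K y z * cut (- ?B) f z)"])
      show "integrable lebesgue (\<lambda>z. norm (K y z * cut (- ?B) f z))" by (rule integrable_norm[OF morrey_far_integral(1)[OF f y]])
      show "AE z in lebesgue. (\<lambda>N. K y z * g N z) \<longlonglongrightarrow> K y z * cut (- ?B) f z"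
      proof (intro AE_I2)
        fix z :: "real ^ 'n"
        obtain N1 where "{z} \<subseteq> half_open_cube N1" by (rule bounded_subset_half_open_cube[of "{z}"]) auto
        hence "K y z * cut (- ?B) f z = K y z * g N z" if "N1 \<le> N" for N
          using half_open_cube_mono[OF that] by (auto simp: g_def indicator_def)
        hence "\<forall>\<^sub>F N in sequentially. K y z * cut (- ?B) f z = K y z * g N z" by (rule eventually_sequentiallyI)
        thus "(\<lambda>N. K y z * g N z) \<longlonglongrightarrow> K y z * cut (- ?B) f z" by (rule Lim_transform_eventually[OF tendsto_const])
      qed
      show "AE z in lebesgue. norm (K y z * g N z) \<le> norm (K y z * cut (- ?B) f z)" for N
        by (intro AE_I2) (simp add: g_def indicator_def)
      show "(\<lambda>z. K y z * g N z) \<in> borel_measurable lebesgue" for N unfolding g_def by measurable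
    qed measurable
    have "\<forall>\<^sub>F N in sequentially. Lq_extension p (cut ?B f) y + (LINT z|lebesgue. K y z * g N z) = Lq_extension p (cut (half_open_cube N) f) y"
      using 1 2 y by (intro eventually_sequentiallyI[of N0]) simp
    from Lim_transform_eventually[OF tendsto_add[OF tendsto_const lim] this]
    show "(\<lambda>N. Lq_extension p (cut (half_open_cube N) f) y) \<longlonglongrightarrow>
      Lq_extension p (cut ?B f) y + (LINT z|lebesgue. K y z * cut (- ?B) f z)" .
  qed
qed

lemma morrey_op_convergent:
  assumes f: "f \<in> morrey_space p r"
  shows "AE y in lebesgue. (\<lambda>N. Lq_extension p (cut (half_open_cube N) f) y) \<longlonglongrightarrow> morrey_op p f y"
proof (rule AE_on_all_cubes)
  fix J
  show "AE y in lebesgue. y \<in> dyadic_cube J (ancestor (nat (- J)) 0) \<longrightarrow>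
      (\<lambda>N. Lq_extension p (cut (half_open_cube N) f) y) \<longlonglongrightarrow> morrey_op p f y"
    using morrey_op_on_cube[OF f, of J "ancestor (nat (- J)) 0"]
    by (rule AE_mp) (auto intro!: AE_I2 simp: morrey_op_def limI)
qed

lemma morrey_op_measurable:
  assumes f: "f \<in> morrey_space p r" shows "morrey_op p f \<in> borel_measurable lebesgue"
  unfolding morrey_op_def[abs_def]
  by (rule borel_measurable_lim_metric)
    (rule Lp_spaceD(1)[OF Lq_extension_in[OF p morrey_cut[OF p_pos(1) f bounded_half_open_cube half_open_cube_sets]]])

definition "morrey_const = Lq_const p * 4 powr (real CARD('n) / p + r) + morrey_far_const p r * 2 powr (real CARD('n) / p)"

text \<open>The near part is controlled by the L_p bound on the doubled cube, which lies in the
  ancestor two levels up. The far part is bounded on the cube by a multiple of side^r, so its L_p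
  norm gains the volume to the power 1 / p and the exponents add up to n / p + r.\<close>

theorem morrey_op_bounded:
  assumes f: "f \<in> morrey_space p r"
  shows "morrey_op p f \<in> morrey_space p r" "morrey_norm p r (morrey_op p f) \<le> morrey_const * morrey_norm p r f"
proof -
  let ?s = "real CARD('n) / p + r"
  have main: "cut (dyadic_cube J M) (morrey_op p f) \<in> Lp_space p \<and>
    Lp_norm p (cut (dyadic_cube J M) (morrey_op p f)) \<le> (morrey_const * morrey_norm p r f) * side J powr ?s" for J M
  proof -
    let ?Q = "dyadic_cube J M" and ?B = "cube_nbhd 2 J M"
    define E where "E = Lq_extension p (cut ?B f)"
    have BL: "cut ?B f \<in> Lp_space p" by (rule morrey_cut[OF p_pos(1) f cube_nbhd_bounded cube_nbhd_sets])
    have EL: "E \<in> Lp_space p" unfolding E_def by (rule Lq_extension_in[OF p BL])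
    note [measurable] = morrey_op_measurable[OF f] Lp_spaceD(1)[OF EL]
    define B where "B = morrey_far_const p r * morrey_norm p r f * side J powr r"
    have B0: "0 \<le> B" unfolding B_def by (intro mult_nonneg_nonneg morrey_far_const_nonneg morrey_norm_nonneg[OF f]) simp
    define g where "g = cut ?Q (\<lambda>x. morrey_op p f x - E x)"
    have gm: "g \<in> borel_measurable lebesgue" unfolding g_def by measurable
    have gb: "AE x in lebesgue. norm (g x) \<le> B * indicator ?Q x"
      using morrey_op_on_cube[OF f, of J M] morrey_op_convergent[OF f]
    proof (rule AE_mp[OF _ AE_mp], intro AE_I2 impI)
      fix y assume 1: "y \<in> ?Q \<longrightarrow> (\<lambda>N. Lq_extension p (cut (half_open_cube N) f) y) \<longlonglongrightarrow>
          Lq_extension p (cut ?B f) y + (LINT z|lebesgue. K y z * cut (- ?B) f z)"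
        and 2: "(\<lambda>N. Lq_extension p (cut (half_open_cube N) f) y) \<longlonglongrightarrow> morrey_op p f y"
      show "norm (g y) \<le> B * indicator ?Q y"
      proof (cases "y \<in> ?Q")
        case True
        have "morrey_op p f y = E y + (LINT z|lebesgue. K y z * cut (- ?B) f z)"
          using LIMSEQ_unique[OF 2 1[rule_format, OF True]] by (simp add: E_def)
        hence "norm (g y) = norm (LINT z|lebesgue. K y z * cut (- ?B) f z)" using True by (simp add: g_def)
        also have "\<dots> \<le> (LINT z|lebesgue. norm (K y z * cut (- ?B) f z))" by (rule integral_norm_bound)
        also have "\<dots> \<le> B" unfolding B_def by (rule morrey_far_integral(2)[OF f True])
        finally show ?thesis using True by simp
      qed (simp add: g_def)
    qed
    note gL = Lp_norm_bounded_on[OF p_pos(2) gm dyadic_cube_lmeasurable B0 gb]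
    note QE = cut_in_Lp_space[OF p_pos(1) EL dyadic_cube_sets[of J M]]
    have eq: "cut ?Q (morrey_op p f) = (\<lambda>x. cut ?Q E x + g x)" by (auto simp: g_def algebra_simps)
    have Epart: "Lp_norm p (cut ?Q E) \<le> Lq_const p * (morrey_norm p r f * (4 powr ?s * side J powr ?s))"
    proof -
      let ?R = "dyadic_cube (J - int 2) (ancestor 2 M)"
      have RL: "cut ?R f \<in> Lp_space p" by (rule morrey_cut[OF p_pos(1) f dyadic_cube_bounded dyadic_cube_sets])
      have sub: "?B \<subseteq> ?R" by (rule cube_nbhd_subset_ancestor) simp
      have cc: "cut ?B (cut ?R f) = cut ?B f" using sub by (auto simp: indicator_def fun_eq_iff)
      have "Lp_norm p (cut ?Q E) \<le> Lp_norm p E" by (rule QE(2))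
      also have "\<dots> \<le> Lq_const p * Lp_norm p (cut ?B f)" unfolding E_def by (rule Lq_extension_bounded[OF p BL])
      also have "\<dots> \<le> Lq_const p * Lp_norm p (cut ?R f)"
        using cut_in_Lp_space(2)[OF p_pos(1) RL cube_nbhd_sets[of 2 J M]] unfolding cc by (rule mult_left_mono[OF _ Lq_const(1)[OF p]])
      also have "\<dots> \<le> Lq_const p * (morrey_norm p r f * side (J - int 2) powr ?s)"
        by (intro mult_left_mono morrey_cube_le f Lq_const(1) p)
      also have "side (J - int 2) powr ?s = 4 powr ?s * side J powr ?s"
        unfolding side_shift by (simp add: powr_mult)
      finally show ?thesis .
    qed
    have gpart: "B * measure lebesgue ?Q powr (1 / p) = morrey_far_const p r * morrey_norm p r f * 2 powr (real CARD('n) / p) * side J powr ?s"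
    proof -
      have "measure lebesgue ?Q = (2 * side J) powr real CARD('n)" unfolding measure_dyadic_cube by (subst powr_realpow) auto
      hence "measure lebesgue ?Q powr (1 / p) = 2 powr (real CARD('n) / p) * side J powr (real CARD('n) / p)"
        by (simp add: powr_powr powr_mult)
      moreover have "side J powr ?s = side J powr r * side J powr (real CARD('n) / p)" by (simp add: add.commute flip: powr_add)
      ultimately show ?thesis by (simp add: B_def)
    qed
    have "Lp_norm p (cut ?Q (morrey_op p f)) \<le> Lp_norm p (cut ?Q E) + Lp_norm p g"
      unfolding eq by (rule Lp_norm_add[OF p_pos(2) QE(1) gL(1)])
    also have "\<dots> \<le> Lq_const p * (morrey_norm p r f * (4 powr ?s * side J powr ?s)) +
        morrey_far_const p r * morrey_norm p r f * 2 powr (real CARD('n) / p) * side J powr ?s"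
      using Epart gL(2) unfolding gpart by (rule add_mono)
    also have "\<dots> = (morrey_const * morrey_norm p r f) * side J powr ?s" by (simp add: morrey_const_def algebra_simps)
    finally show ?thesis using Lp_space_add[OF p_pos(2) QE(1) gL(1)] unfolding eq by simp
  qed
  have loc: "morrey_op p f \<in> Lp_loc p" by (rule Lp_locI[OF p_pos(1) morrey_op_measurable[OF f]]) (use main in blast)
  show "morrey_op p f \<in> morrey_space p r" by (rule morrey_spaceI[OF loc]) (use main in blast)
  show "morrey_norm p r (morrey_op p f) \<le> morrey_const * morrey_norm p r f" by (rule morrey_norm_le[OF loc]) (use main in blast)
qed

end

end

section \<open>Extension to the Morrey space and to the closure of the test functions\<close>

lemma test_functions_in_morrey_space:
  fixes p r :: real
  assumes p: "1 < p" and r: "- real CARD('n) / p < r" "r < 0"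
  shows "test_functions \<subseteq> (morrey_space p r :: (real ^ 'n \<Rightarrow> complex) set)"
proof
  fix f :: "real ^ 'n \<Rightarrow> complex" assume f: "f \<in> test_functions"
  have "0 < - real CARD('n) / r" by (intro divide_neg_neg) (use r in auto)
  from Lu_in_morrey_space(1)[OF p r refl test_function_in_Lp_space[OF this f]] show "f \<in> morrey_space p r" .
qed

lemma test_functions_diff: "f \<in> test_functions \<Longrightarrow> g \<in> test_functions \<Longrightarrow> (\<lambda>x. f x - g x) \<in> test_functions"
  using test_functions_linear[of f g 1 "-1"] by simp

lemma linear_bounded_extensionD:
  assumes "linear_bounded_extension X N T R"
  shows "test_functions \<subseteq> X" and "f \<in> X \<Longrightarrow> R f \<in> X"
    and "f \<in> X \<Longrightarrow> g \<in> X \<Longrightarrow> AE x in lebesgue. f x = g x \<Longrightarrow> AE x in lebesgue. R f x = R g x"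
    and "f \<in> X \<Longrightarrow> g \<in> X \<Longrightarrow> AE x in lebesgue. R (\<lambda>y. f y + g y) x = R f x + R g x"
    and "f \<in> X \<Longrightarrow> AE x in lebesgue. R (\<lambda>y. c * f y) x = c * R f x"
    and "\<exists>C. \<forall>f\<in>X. N (R f) \<le> C * N f"
    and "f \<in> test_functions \<Longrightarrow> AE x in lebesgue. R f x = T f x"
  using assms unfolding linear_bounded_extension_def by simp_all

text \<open>Both operators agree with \<open>T\<close> on a test function \<open>g\<close>, so by
  additivity their difference at \<open>f\<close> equals their difference at f - g, which is small
  by boundedness. Absolute values appear because the constants supplied by the two extensions may be
  negative.\<close>

lemma linear_bounded_extension_unique:
  fixes T :: "(real ^ 'n \<Rightarrow> complex) \<Rightarrow> real ^ 'n \<Rightarrow> complex"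
  assumes p: "1 \<le> p"
    and S: "linear_bounded_extension (morrey_space0 p r) (morrey_norm p r) T S"
    and S': "linear_bounded_extension (morrey_space0 p r) (morrey_norm p r) T S'"
    and f: "f \<in> morrey_space0 p r"
  shows "AE x in lebesgue. S f x = S' f x"
proof -
  let ?X = "morrey_space0 p r :: (real ^ 'n \<Rightarrow> complex) set" and ?N = "morrey_norm p r :: (real ^ 'n \<Rightarrow> complex) \<Rightarrow> real"
  have sub: "?X \<subseteq> morrey_space p r" by (auto simp: morrey_space0_def)
  have fM: "f \<in> morrey_space p r" using f sub by blast
  obtain C C' where C: "\<And>u. u \<in> ?X \<Longrightarrow> ?N (S u) \<le> C * ?N u" "\<And>u. u \<in> ?X \<Longrightarrow> ?N (S' u) \<le> C' * ?N u"
    using linear_bounded_extensionD(6)[OF S] linear_bounded_extensionD(6)[OF S'] by blast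
  have mem: "S u \<in> morrey_space p r" "S' u \<in> morrey_space p r" if "u \<in> ?X" for u
    using linear_bounded_extensionD(2)[OF S that] linear_bounded_extensionD(2)[OF S' that] sub by auto
  note SM = morrey_space_diff[OF p mem(1)[OF f] mem(2)[OF f]]
  have le: "?N (\<lambda>x. S f x - S' f x) \<le> (\<bar>C\<bar> + \<bar>C'\<bar>) * ?N (\<lambda>x. f x - g x)" if g: "g \<in> test_functions" for g
  proof -
    let ?u = "\<lambda>x. f x - g x"
    have gX: "g \<in> ?X" using g linear_bounded_extensionD(1)[OF S] by blast
    have uM: "?u \<in> morrey_space p r" by (rule morrey_space_diff[OF p fM]) (use gX sub in blast)
    \<comment> \<open>Subtracting a test function does not leave the closure: the approximants of
      \<open>f\<close> are shifted by \<open>g\<close>.\<close>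
    have uX: "?u \<in> ?X"
      unfolding morrey_space0_def
    proof (intro CollectI conjI uM allI impI)
      fix e :: real assume "0 < e"
      then obtain h where "h \<in> test_functions" "?N (\<lambda>x. f x - h x) < e" using f unfolding morrey_space0_def by blast
      thus "\<exists>v\<in>test_functions. ?N (\<lambda>x. f x - g x - v x) < e"
        by (intro bexI[of _ "\<lambda>x. h x - g x"] test_functions_diff g) auto
    qed
    have split: "AE x in lebesgue. R f x = R ?u x + T g x" if R: "linear_bounded_extension ?X ?N T R" for R
    proof -
      have "AE x in lebesgue. R (\<lambda>x. ?u x + g x) x = R ?u x + R g x" by (rule linear_bounded_extensionD(4)[OF R uX gX])
      with linear_bounded_extensionD(7)[OF R g] show ?thesis by (rule AE_mp[OF _ AE_mp]) (auto intro!: AE_I2)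
    qed
    have ae: "AE x in lebesgue. S ?u x - S' ?u x = S f x - S' f x"
      using split[OF S] split[OF S'] by (rule AE_mp[OF _ AE_mp]) (auto intro!: AE_I2)
    have "?N (\<lambda>x. S f x - S' f x) \<le> ?N (\<lambda>x. S ?u x - S' ?u x)"
      by (rule morrey_AE_cong(2)[where f = "\<lambda>x. S ?u x - S' ?u x" and g = "\<lambda>x. S f x - S' f x"])
        (fact p morrey_space_diff[OF p mem(1)[OF uX] mem(2)[OF uX]] morrey_space_measurable[OF SM] ae)+
    also have "\<dots> \<le> ?N (S ?u) + ?N (S' ?u)" by (rule morrey_norm_diff[OF p mem(1)[OF uX] mem(2)[OF uX]])
    also have "\<dots> \<le> C * ?N ?u + C' * ?N ?u" by (rule add_mono[OF C(1)[OF uX] C(2)[OF uX]])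
    also have "\<dots> \<le> (\<bar>C\<bar> + \<bar>C'\<bar>) * ?N ?u"
      unfolding distrib_right by (intro add_mono mult_right_mono morrey_norm_nonneg[OF uM]) auto
    finally show ?thesis .
  qed
  have "?N (\<lambda>x. S f x - S' f x) \<le> 0 + e" if e: "0 < e" for e
  proof -
    \<comment> \<open>The added 1 keeps the denominator positive when both constants vanish.\<close>
    let ?d = "e / (\<bar>C\<bar> + \<bar>C'\<bar> + 1)"
    have d: "0 < ?d" using e by (intro divide_pos_pos) auto
    then obtain g where g: "g \<in> test_functions" "?N (\<lambda>x. f x - g x) < ?d"
      using f unfolding morrey_space0_def by blast
    have "(\<bar>C\<bar> + \<bar>C'\<bar>) * ?N (\<lambda>x. f x - g x) \<le> (\<bar>C\<bar> + \<bar>C'\<bar>) * ?d" using g(2) by (intro mult_left_mono) auto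
    also have "\<dots> \<le> (\<bar>C\<bar> + \<bar>C'\<bar> + 1) * ?d" using d by (intro mult_right_mono) auto
    also have "\<dots> = e" by simp
    finally show ?thesis using le[OF g(1)] by simp
  qed
  hence "?N (\<lambda>x. S f x - S' f x) \<le> 0" by (rule field_le_epsilon)
  from morrey_norm_zero_imp[OF p SM this]
  show ?thesis by (rule AE_mp) (auto intro!: AE_I2)
qed

context calderon_zygmund
begin

lemma morrey_op_linear:
  assumes p: "1 < p" and r: "- real CARD('n) / p < r" "r < 0"
    and f: "f \<in> morrey_space p r" and g: "g \<in> morrey_space p r"
  shows "AE x in lebesgue. morrey_op p (\<lambda>y. c * f y + d * g y) x = c * morrey_op p f x + d * morrey_op p g x"
proof -
  have p1: "0 < p" "1 \<le> p" using p by auto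
  let ?E = "\<lambda>N f. Lq_extension p (cut (half_open_cube N) f)"
  have fg: "(\<lambda>y. c * f y + d * g y) \<in> morrey_space p r" by (rule morrey_space_linear[OF p1(2) f g])
  have "AE x in lebesgue. \<forall>N. ?E N (\<lambda>y. c * f y + d * g y) x = c * ?E N f x + d * ?E N g x"
    unfolding AE_all_countable
  proof
    fix N
    have eq: "cut (half_open_cube N) (\<lambda>y. c * f y + d * g y) = (\<lambda>x. c * cut (half_open_cube N) f x + d * cut (half_open_cube N) g x)"
      by (auto simp: algebra_simps)
    show "AE x in lebesgue. ?E N (\<lambda>y. c * f y + d * g y) x = c * ?E N f x + d * ?E N g x"
      unfolding eq 
      by (rule Lq_extension_linear[OF p morrey_cut[OF p1(1) f bounded_half_open_cube half_open_cube_sets]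
            morrey_cut[OF p1(1) g bounded_half_open_cube half_open_cube_sets]])
  qed
  with morrey_op_convergent[OF p r f] morrey_op_convergent[OF p r g] morrey_op_convergent[OF p r fg] show ?thesis
  proof (rule AE_mp[OF _ AE_mp[OF _ AE_mp[OF _ AE_mp]]], intro AE_I2 impI)
    fix x assume lim: "(\<lambda>N. ?E N f x) \<longlonglongrightarrow> morrey_op p f x" "(\<lambda>N. ?E N g x) \<longlonglongrightarrow> morrey_op p g x"
      "(\<lambda>N. ?E N (\<lambda>y. c * f y + d * g y) x) \<longlonglongrightarrow> morrey_op p (\<lambda>y. c * f y + d * g y) x"
      and eq: "\<forall>N. ?E N (\<lambda>y. c * f y + d * g y) x = c * ?E N f x + d * ?E N g x"
    have "(\<lambda>N. c * ?E N f x + d * ?E N g x) \<longlonglongrightarrow> c * morrey_op p f x + d * morrey_op p g x"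
      by (intro tendsto_intros lim)
    moreover have "(\<lambda>N. c * ?E N f x + d * ?E N g x) \<longlonglongrightarrow> morrey_op p (\<lambda>y. c * f y + d * g y) x"
      using lim(3) unfolding eq[rule_format] .
    ultimately show "morrey_op p (\<lambda>y. c * f y + d * g y) x = c * morrey_op p f x + d * morrey_op p g x"
      using LIMSEQ_unique by blast
  qed
qed

text \<open>Truncations of \<open>f\<close> coincide with \<open>f\<close> from some index on, so
  the defining sequence is eventually constant.\<close>

lemma morrey_op_test_function:
  assumes p: "1 < p" and r: "- real CARD('n) / p < r" "r < 0" and f: "f \<in> test_functions"
  shows "AE x in lebesgue. morrey_op p f x = T f x"
proof -
  have fM: "f \<in> morrey_space p r" using test_functions_in_morrey_space[OF p r] f by blast
  have "bounded {x. f x \<noteq> 0}" using f by (simp add: test_functions_iff)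
  then obtain R where R: "{x. f x \<noteq> 0} \<subseteq> half_open_cube R" by (rule bounded_subset_half_open_cube)
  have eq: "cut (half_open_cube N) f = f" if N: "R \<le> N" for N
  proof
    fix x show "cut (half_open_cube N) f x = f x"
    proof (cases "f x = 0")
      case False
      hence "x \<in> half_open_cube N" using R half_open_cube_mono[OF N] by blast
      thus ?thesis by simp
    qed simp
  qed
  show ?thesis using morrey_op_convergent[OF p r fM] Lq_extension_test_function[OF p f]
  proof (rule AE_mp[OF _ AE_mp], intro AE_I2 impI)
    fix x assume lim: "(\<lambda>N. Lq_extension p (cut (half_open_cube N) f) x) \<longlonglongrightarrow> morrey_op p f x"
      and Tf: "Lq_extension p f x = T f x"
    have "\<forall>\<^sub>F N in sequentially. T f x = Lq_extension p (cut (half_open_cube N) f) x"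
      using eq Tf by (intro eventually_sequentiallyI[of R]) simp
    hence "(\<lambda>N. Lq_extension p (cut (half_open_cube N) f) x) \<longlonglongrightarrow> T f x" by (rule Lim_transform_eventually[OF tendsto_const])
    thus "morrey_op p f x = T f x" using lim LIMSEQ_unique by blast
  qed
qed

theorem morrey_extension:
  assumes p: "1 < p" and r: "- real CARD('n) / p < r" "r < 0"
  shows "linear_bounded_extension (morrey_space p r) (morrey_norm p r) T (morrey_op p)"
  unfolding linear_bounded_extension_def
proof (intro conjI ballI allI impI)
  have p1: "0 < p" "1 \<le> p" using p by auto
  show "test_functions \<subseteq> (morrey_space p r :: (real ^ 'n \<Rightarrow> complex) set)" by (rule test_functions_in_morrey_space[OF p r])
  show "morrey_op p f \<in> morrey_space p r" if "f \<in> morrey_space p r" for f by (rule morrey_op_bounded(1)[OF p r that])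
  show "\<exists>C. \<forall>f\<in>morrey_space p r. morrey_norm p r (morrey_op p f) \<le> C * morrey_norm p r f"
    using morrey_op_bounded(2)[OF p r] by blast
  show "AE x in lebesgue. morrey_op p f x = T f x" if "f \<in> test_functions" for f by (rule morrey_op_test_function[OF p r that])
  show "AE x in lebesgue. morrey_op p (\<lambda>y. f y + g y) x = morrey_op p f x + morrey_op p g x"
    if "f \<in> morrey_space p r" "g \<in> morrey_space p r" for f g
    using morrey_op_linear[OF p r that, of 1 1] by simp
  show "AE x in lebesgue. morrey_op p (\<lambda>y. c * f y) x = c * morrey_op p f x" if "f \<in> morrey_space p r" for f c
    using morrey_op_linear[OF p r that that, of c 0] by simp
  show "AE x in lebesgue. morrey_op p f x = morrey_op p g x"
    if f: "f \<in> morrey_space p r" and g: "g \<in> morrey_space p r" and eq: "AE x in lebesgue. f x = g x" for f g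
  proof -
    have "AE x in lebesgue. \<forall>N. Lq_extension p (cut (half_open_cube N) f) x = Lq_extension p (cut (half_open_cube N) g) x"
      unfolding AE_all_countable
    proof
      fix N
      have "AE x in lebesgue. cut (half_open_cube N) f x = cut (half_open_cube N) g x"
        using eq by (rule AE_mp) (auto intro!: AE_I2)
      thus "AE x in lebesgue. Lq_extension p (cut (half_open_cube N) f) x = Lq_extension p (cut (half_open_cube N) g) x"
        by (rule Lq_extension_AE_cong[OF p morrey_cut[OF p1(1) f bounded_half_open_cube half_open_cube_sets]
            morrey_cut[OF p1(1) g bounded_half_open_cube half_open_cube_sets]])
    qed
    thus ?thesis by (rule AE_mp) (auto intro!: AE_I2 simp: morrey_op_def)
  qed
qed

text \<open>What is new is that the closure is mapped into itself. The image \<open>T g\<close> of a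
  test function lies in L_u with u = - n / r, is approximated there by test functions, and the
  embedding of L_u turns this into approximation in the Morrey norm.\<close>

theorem morrey_extension0:
  assumes p: "1 < p" and r: "- real CARD('n) / p < r" "r < 0"
  shows "linear_bounded_extension (morrey_space0 p r) (morrey_norm p r) T (morrey_op p)"
proof -
  let ?N = "morrey_norm p r :: (real ^ 'n \<Rightarrow> complex) \<Rightarrow> real"
  have p1: "0 < p" "1 \<le> p" using p by auto
  note ext = morrey_extension[OF p r]
  have sub: "morrey_space0 p r \<subseteq> (morrey_space p r :: (real ^ 'n \<Rightarrow> complex) set)" by (auto simp: morrey_space0_def)
  define u where "u = - real CARD('n) / r"
  have u: "1 < u"
  proof -
    have "p < u" using p r by (simp add: u_def field_simps)
    thus ?thesis using p by linarith
  qed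
  have D: "test_functions \<subseteq> (morrey_space0 p r :: (real ^ 'n \<Rightarrow> complex) set)"
  proof
    fix f :: "real ^ 'n \<Rightarrow> complex" assume f: "f \<in> test_functions"
    have "?N (\<lambda>x. f x - f x) = 0"
    proof (rule antisym)
      have "(\<lambda>x :: real ^ 'n. 0 :: complex) \<in> morrey_space p r" using test_functions_in_morrey_space[OF p r] zero_test_function by blast
      thus "0 \<le> ?N (\<lambda>x. f x - f x)" using morrey_norm_nonneg by simp
      show "?N (\<lambda>x. f x - f x) \<le> 0"
        by (rule morrey_norm_le[OF Lp_locI[OF p1(1)]]) auto
    qed
    thus "f \<in> morrey_space0 p r"
      using f test_functions_in_morrey_space[OF p r] unfolding morrey_space0_def by (auto intro!: bexI[of _ f])
  qed
  have mem: "morrey_op p f \<in> morrey_space0 p r" if f: "f \<in> morrey_space0 p r" for f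
    unfolding morrey_space0_def
  proof (intro CollectI conjI allI impI)
    have fM: "f \<in> morrey_space p r" using f sub by blast
    show opM: "morrey_op p f \<in> morrey_space p r" by (rule morrey_op_bounded(1)[OF p r fM])
    fix e :: real assume e: "0 < e"
    \<comment> \<open>The constant is made nonnegative so that e / (2 * (C + 1)) is positive and
      \<open>C\<close> times it stays strictly below e / 2.\<close>
    define C where "C = max 0 (morrey_const p r)"
    have "0 < e / (2 * (C + 1))" using e by (simp add: C_def)
    then obtain g where g: "g \<in> test_functions" "?N (\<lambda>x. f x - g x) < e / (2 * (C + 1))"
      using f unfolding morrey_space0_def by blast
    have gM: "g \<in> morrey_space p r" using g(1) D sub by blast
    have TL: "T g \<in> Lp_space u" by (rule Lq_const(2)[OF u g(1)])
    have TM: "T g \<in> morrey_space p r" by (rule Lu_in_morrey_space(1)[OF p r u_def TL])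
    define e2 where "e2 = e / 2 / 2 powr (real CARD('n) / p + r)"
    have "0 < e2" using e by (simp add: e2_def)
    then obtain h where h: "h \<in> test_functions" "Lp_norm u (\<lambda>x. T g x - h x) < e2"
      using test_functions_dense[of u u "T g" e2 1] u TL by auto
    have hL: "h \<in> Lp_space u" using u by (intro test_function_in_Lp_space h(1)) simp
    have hM: "h \<in> morrey_space p r" using h(1) D sub by blast
    have dM: "(\<lambda>x. f x - g x) \<in> morrey_space p r" by (rule morrey_space_diff[OF p1(2) fM gM])
    have "?N (\<lambda>x. morrey_op p f x - T g x) \<le> ?N (morrey_op p (\<lambda>x. f x - g x))"
    proof (rule morrey_AE_cong(2)[OF p1(2) morrey_op_bounded(1)[OF p r dM]])
      show "(\<lambda>x. morrey_op p f x - T g x) \<in> borel_measurable lebesgue"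
        using morrey_space_measurable[OF opM] morrey_space_measurable[OF TM] by (rule borel_measurable_diff)
      show "AE x in lebesgue. morrey_op p (\<lambda>x. f x - g x) x = morrey_op p f x - T g x"
        using morrey_op_linear[OF p r fM gM, of 1 "-1"] morrey_op_test_function[OF p r g(1)]
        by (rule AE_mp[OF _ AE_mp]) (auto intro!: AE_I2)
    qed
    also have "\<dots> \<le> morrey_const p r * ?N (\<lambda>x. f x - g x)" by (rule morrey_op_bounded(2)[OF p r dM])
    also have "\<dots> \<le> C * ?N (\<lambda>x. f x - g x)" by (intro mult_right_mono morrey_norm_nonneg[OF dM]) (simp add: C_def)
    also have "\<dots> \<le> C * (e / (2 * (C + 1)))" using g(2) by (intro mult_left_mono) (auto simp: C_def)
    also have "\<dots> < e / 2"
    proof -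
      have "0 \<le> C" by (simp add: C_def)
      thus ?thesis using e by (simp add: divide_less_eq distrib_left)
    qed
    finally have 1: "?N (\<lambda>x. morrey_op p f x - T g x) < e / 2" .
    have "?N (\<lambda>x. T g x - h x) \<le> 2 powr (real CARD('n) / p + r) * Lp_norm u (\<lambda>x. T g x - h x)"
      by (rule Lu_in_morrey_space(2)[OF p r u_def Lp_space_diff[OF _ TL hL]]) (use u in simp)
    also have "\<dots> < 2 powr (real CARD('n) / p + r) * e2" using h(2) by simp
    also have "\<dots> = e / 2" by (simp add: e2_def)
    finally have 2: "?N (\<lambda>x. T g x - h x) < e / 2" .
    have "?N (\<lambda>x. morrey_op p f x - h x) \<le> ?N (\<lambda>x. morrey_op p f x - T g x) + ?N (\<lambda>x. T g x - h x)"
      by (rule morrey_norm_triangle[OF p1(2) opM TM hM])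
    thus "\<exists>h\<in>test_functions. ?N (\<lambda>x. morrey_op p f x - h x) < e" using 1 2 h(1) by (intro bexI[of _ h]) auto
  qed
  show ?thesis
    unfolding linear_bounded_extension_def
  proof (intro conjI ballI allI impI)
    show "test_functions \<subseteq> (morrey_space0 p r :: (real ^ 'n \<Rightarrow> complex) set)" by (rule D)
    show "morrey_op p f \<in> morrey_space0 p r" if "f \<in> morrey_space0 p r" for f by (rule mem[OF that])
    show "\<exists>C. \<forall>f\<in>morrey_space0 p r. ?N (morrey_op p f) \<le> C * ?N f"
      using morrey_op_bounded(2)[OF p r] sub by blast
    show "AE x in lebesgue. morrey_op p f x = T f x" if "f \<in> test_functions" for f by (rule morrey_op_test_function[OF p r that])
    fix f :: "real ^ 'n \<Rightarrow> complex" assume "f \<in> morrey_space0 p r"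
    hence f: "f \<in> morrey_space p r" using sub by blast
    show "AE x in lebesgue. morrey_op p (\<lambda>y. c * f y) x = c * morrey_op p f x" for c
      using morrey_op_linear[OF p r f f, of c 0] by simp
    fix g :: "real ^ 'n \<Rightarrow> complex" assume "g \<in> morrey_space0 p r"
    hence g: "g \<in> morrey_space p r" using sub by blast
    show "AE x in lebesgue. morrey_op p (\<lambda>y. f y + g y) x = morrey_op p f x + morrey_op p g x"
      using morrey_op_linear[OF p r f g, of 1 1] by simp
    show "AE x in lebesgue. morrey_op p f x = morrey_op p g x" if "AE x in lebesgue. f x = g x"
      by (rule linear_bounded_extensionD(3)[OF ext f g that])
  qed
qed

end

section \<open>Schwartz functions and regular distributions\<close>

lemma conjugate_exponent_sum: "1 < q \<Longrightarrow> 1 / q + 1 / (q / (q - 1)) = (1 :: real)"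
  by (simp add: divide_simps)

text \<open>The open sets on which \<open>f\<close> vanishes almost everywhere may be uncountably
  many; by Lindelof a countable subfamily has the same union, so \<open>f\<close> vanishes almost
  everywhere on the union.\<close>

lemma ess_support_subset_iff:
  fixes f :: "real ^ 'n \<Rightarrow> complex"
  assumes "closed Q"
  shows "ess_support f \<subseteq> Q \<longleftrightarrow> (AE x in lebesgue. x \<notin> Q \<longrightarrow> f x = 0)"
proof
  let ?F = "{U. open U \<and> (AE x in lebesgue. x \<in> U \<longrightarrow> f x = 0)}"
  assume "ess_support f \<subseteq> Q"
  hence sub: "- Q \<subseteq> \<Union>?F" unfolding ess_support_def by blast
  obtain \<G> where G: "\<G> \<subseteq> ?F" "countable \<G>" "\<Union>\<G> = \<Union>?F" by (rule Lindelof[of ?F]) auto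
  have "AE x in lebesgue. \<forall>U\<in>\<G>. x \<in> U \<longrightarrow> f x = 0"
    by (subst AE_ball_countable[OF G(2)]) (use G(1) in auto)
  thus "AE x in lebesgue. x \<notin> Q \<longrightarrow> f x = 0"
    by (rule AE_mp) (use sub G(3) in \<open>blast intro!: AE_I2\<close>)
next
  assume "AE x in lebesgue. x \<notin> Q \<longrightarrow> f x = 0"
  thus "ess_support f \<subseteq> Q" unfolding ess_support_def using assms by auto
qed

abbreviation reg :: "(real ^ 'n \<Rightarrow> complex) \<Rightarrow> (real ^ 'n \<Rightarrow> complex) \<Rightarrow> complex"
  where "reg \<equiv> regular_distribution"

text \<open>The power n + 1 is the smallest integer one that is integrable. It ties Lebesgue norms
  of Schwartz functions to a single seminorm without derivatives.\<close>

definition decay :: "real ^ 'n \<Rightarrow> real"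
  where "decay x = 1 / (1 + norm x) ^ Suc CARD('n)"

lemma decay_bounds: "0 < decay x" "decay x \<le> 1"
proof -
  have "0 < 1 + norm x" using norm_ge_zero[of x] by linarith
  thus "0 < decay x" by (simp add: decay_def)
  have "1 ^ Suc CARD('a) \<le> (1 + norm x) ^ Suc CARD('a)" by (rule power_mono) auto
  thus "decay x \<le> 1" by (simp add: decay_def divide_le_eq)
qed

lemma decay_measurable [measurable]: "decay \<in> borel_measurable lebesgue"
proof -
  have "1 + norm x \<noteq> 0" for x :: "real ^ 'n" using norm_ge_zero[of x] by linarith
  thus ?thesis unfolding decay_def[abs_def]
    by (intro continuous_measurable_lebesgue continuous_intros) auto
qed

text \<open>On the annulus \<open>Suc i\<close> around the cube of scale 0 the function is at most
  (2^i)^-(n + 1), and the annulus lies in a cube of volume (8 * 2^i)^n; the products 8^n 2^-i are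
  summable.\<close>

lemma decay_integrable: "integrable lebesgue (decay :: real ^ 'n \<Rightarrow> real)"
proof -
  let ?M = "0 :: int ^ 'n" and ?n = "CARD('n)"
  define h :: "real ^ 'n \<Rightarrow> complex" where "h = cut (- cube_nbhd 2 0 ?M) (\<lambda>x. complex_of_real (decay x))"
  have hm: "h \<in> borel_measurable lebesgue" unfolding h_def by measurable
  have zero: "h x = 0" if "x \<in> annulus 0 0 ?M" for x using that by (simp add: h_def annulus_def)
  have pw: "indicator (annulus (Suc i) 0 ?M) x * norm (h x) \<le> (1 / (2 ^ i) ^ Suc ?n) * indicator (cube_nbhd (2 ^ (i + 2)) 0 ?M) x" for i x
  proof (cases "x \<in> annulus (Suc i) 0 ?M")
    case True
    have "(0 :: real ^ 'n) \<in> dyadic_cube 0 ?M" by (simp add: dyadic_cube_eq_nbhd cube_nbhd_def)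
    from annulus_separation[OF this True] have "2 ^ i \<le> norm x" by (simp add: side_def)
    hence "(2 ^ i) ^ Suc ?n \<le> (1 + norm x) ^ Suc ?n" by (intro power_mono) auto
    hence "decay x \<le> 1 / (2 ^ i) ^ Suc ?n" unfolding decay_def by (intro divide_left_mono) (auto intro!: mult_pos_pos zero_less_power add_pos_nonneg)
    moreover have "norm (h x) \<le> decay x" using decay_bounds(1)[of x] by (simp add: h_def indicator_def)
    moreover have "x \<in> cube_nbhd (2 ^ (i + 2)) 0 ?M" using True by (simp add: annulus_def)
    ultimately show ?thesis using True by simp
  qed simp
  have intc: "integrable lebesgue (\<lambda>x. (1 / (2 ^ i) ^ Suc ?n) * indicator (cube_nbhd (2 ^ (i + 2)) 0 ?M) x :: real)" for i
    using cube_nbhd_lmeasurable[of "2 ^ (i + 2)" 0 ?M] by (simp add: lmeasurable_iff_integrable)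
  have int: "integrable lebesgue (\<lambda>x. indicator (annulus (Suc i) 0 ?M) x * norm (h x))" for i
  proof (rule Bochner_Integration.integrable_bound[OF intc[of i]])
    show "(\<lambda>x. indicator (annulus (Suc i) 0 ?M) x * norm (h x)) \<in> borel_measurable lebesgue" using hm by measurable
    show "AE x in lebesgue. norm (indicator (annulus (Suc i) 0 ?M) x * norm (h x)) \<le> norm ((1 / (2 ^ i) ^ Suc ?n) * indicator (cube_nbhd (2 ^ (i + 2)) 0 ?M) x :: real)"
      using pw[of i] by (intro AE_I2) (simp add: abs_mult)
  qed
  have le: "(LINT x|lebesgue. indicator (annulus (Suc i) 0 ?M) x * norm (h x)) \<le> 8 ^ ?n * (1 / 2) ^ i" for i
  proof -
    have "(LINT x|lebesgue. indicator (annulus (Suc i) 0 ?M) x * norm (h x)) \<le> (LINT x|lebesgue. (1 / (2 ^ i) ^ Suc ?n) * indicator (cube_nbhd (2 ^ (i + 2)) 0 ?M) x)"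
      by (rule integral_mono[OF int intc pw])
    also have "\<dots> = (1 / (2 ^ i) ^ Suc ?n) * (2 * 2 ^ (i + 2)) ^ ?n"
      using measure_cube_nbhd[of "2 ^ (i + 2)" 0 ?M] by (simp add: side_def)
    also have "(2 * 2 ^ (i + 2)) ^ ?n = (8 * 2 ^ i :: real) ^ ?n" by (simp add: power_add)
    also have "(8 * 2 ^ i :: real) ^ ?n = 8 ^ ?n * (2 ^ i) ^ ?n" by (rule power_mult_distrib)
    also have "(1 / (2 ^ i) ^ Suc ?n) * (8 ^ ?n * (2 ^ i) ^ ?n) = 8 ^ ?n * (1 / 2 :: real) ^ i" by (simp add: power_divide)
    finally show ?thesis .
  qed
  have "summable (\<lambda>i. 8 ^ ?n * (1 / 2 :: real) ^ i)" by (intro summable_mult summable_geometric) simp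
  from nonneg_integral_over_annuli(1)[OF hm zero int le this] have ih: "integrable lebesgue (\<lambda>x. norm (h x))" by (rule integrable_norm)
  have ic: "integrable lebesgue (\<lambda>x. indicator (cube_nbhd 2 0 ?M) x :: real)"
    using cube_nbhd_lmeasurable[of 2 0 ?M] by (simp add: lmeasurable_iff_integrable)
  show ?thesis
  proof (rule Bochner_Integration.integrable_bound[OF Bochner_Integration.integrable_add[OF ih ic]])
    show "AE x in lebesgue. norm (decay x) \<le> norm (norm (h x) + indicator (cube_nbhd 2 0 ?M) x)"
    proof (intro AE_I2)
      fix x
      show "norm (decay x) \<le> norm (norm (h x) + indicator (cube_nbhd 2 0 ?M) x)"
        using decay_bounds[of x] by (auto simp: h_def indicator_def)
    qed
  qed measurable
qed

lemma schwartz_measurable: "\<phi> \<in> schwartz_space \<Longrightarrow> \<phi> \<in> borel_measurable lebesgue"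
proof (rule continuous_measurable_lebesgue, rule differentiable_imp_continuous_on)
  assume "\<phi> \<in> schwartz_space"
  hence "partial_derivs [] \<phi> differentiable (at x)" for x by (simp add: schwartz_space_def smooth_def)
  thus "\<phi> differentiable_on UNIV" by (simp add: partial_derivs_def differentiable_on_def)
qed

lemma schwartz_linear:
  assumes "\<phi> \<in> schwartz_space" "\<psi> \<in> schwartz_space" shows "(\<lambda>x. c * \<phi> x + d * \<psi> x) \<in> schwartz_space"
proof -
  have sm: "smooth \<phi>" "smooth \<psi>" using assms by (auto simp: schwartz_space_def)
  have "bounded (range (\<lambda>x. (1 + norm x) ^ k *\<^sub>R partial_derivs is (\<lambda>x. c * \<phi> x + d * \<psi> x) x))" for k "is"
  proof -
    have "bounded (range (\<lambda>x. (1 + norm x) ^ k *\<^sub>R partial_derivs is \<phi> x))"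
      "bounded (range (\<lambda>x. (1 + norm x) ^ k *\<^sub>R partial_derivs is \<psi> x))"
      using assms by (auto simp: schwartz_space_def)
    then obtain A B where AB: "\<And>x. norm ((1 + norm x) ^ k *\<^sub>R partial_derivs is \<phi> x) \<le> A"
      "\<And>x. norm ((1 + norm x) ^ k *\<^sub>R partial_derivs is \<psi> x) \<le> B" by (auto simp: bounded_iff)
    show ?thesis unfolding bounded_iff
    proof (intro exI ballI, elim imageE)
      fix y x assume y: "y = (1 + norm x) ^ k *\<^sub>R partial_derivs is (\<lambda>x. c * \<phi> x + d * \<psi> x) x"
      have "y = c * ((1 + norm x) ^ k *\<^sub>R partial_derivs is \<phi> x) + d * ((1 + norm x) ^ k *\<^sub>R partial_derivs is \<psi> x)"
        unfolding y partial_derivs_linear[OF sm] by (simp add: scaleR_add_right)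
      thus "norm y \<le> norm c * A + norm d * B"
        using mult_left_mono[OF AB(1)[of x], of "norm c"] mult_left_mono[OF AB(2)[of x], of "norm d"]
          norm_triangle_ineq[of "c * ((1 + norm x) ^ k *\<^sub>R partial_derivs is \<phi> x)" "d * ((1 + norm x) ^ k *\<^sub>R partial_derivs is \<psi> x)"]
        unfolding norm_mult[of c] norm_mult[of d] by (meson norm_ge_zero add_mono order_trans)
    qed
  qed
  thus ?thesis using smooth_linear[OF sm] by (simp add: schwartz_space_def)
qed

text \<open>The seminorm of order n + 1 bounds the function by a multiple of \<open>decay\<close>,
  whose powers with exponent at least 1 are integrable because \<open>decay\<close> does not exceed
  1.\<close>

lemma
  fixes \<phi> :: "real ^ 'n \<Rightarrow> complex"
  assumes p: "1 \<le> p" and \<phi>: "\<phi> \<in> schwartz_space"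
  shows schwartz_in_Lp_space: "\<phi> \<in> Lp_space p"
    and schwartz_Lp_norm: "Lp_norm p \<phi> \<le>
      Lp_norm p (\<lambda>x :: real ^ 'n. complex_of_real (decay x)) * schwartz_seminorm (Suc CARD('n)) 0 \<phi>"
proof -
  let ?S = "schwartz_seminorm (Suc CARD('n)) 0 \<phi>"
  have eq: "?S = (SUP x. (1 + norm x) ^ Suc CARD('n) * norm (\<phi> x))"
    by (simp add: schwartz_seminorm_def partial_derivs_def)
  have "bounded (range (\<lambda>x. (1 + norm x) ^ Suc CARD('n) *\<^sub>R partial_derivs [] \<phi> x))"
    using \<phi> unfolding schwartz_space_def by blast
  then obtain B where B: "\<And>x. norm ((1 + norm x) ^ Suc CARD('n) *\<^sub>R partial_derivs [] \<phi> x) \<le> B"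
    by (auto simp: bounded_iff)
  have "bdd_above (range (\<lambda>x. (1 + norm x) ^ Suc CARD('n) * norm (\<phi> x)))"
  proof (rule bdd_aboveI2)
    fix x
    show "(1 + norm x) ^ Suc CARD('n) * norm (\<phi> x) \<le> B" using B[of x] by (simp add: partial_derivs_def)
  qed
  hence le: "(1 + norm x) ^ Suc CARD('n) * norm (\<phi> x) \<le> ?S" for x unfolding eq by (rule cSUP_upper[OF UNIV_I])
  have S0: "0 \<le> ?S" using order_trans[OF norm_ge_zero[of "\<phi> 0"], of ?S] le[of 0] by simp
  have pw: "norm (\<phi> x) \<le> norm (complex_of_real ?S * complex_of_real (decay x))" for x
  proof -
    have "0 < 1 + norm x" using norm_ge_zero[of x] by linarith
    hence "0 < (1 + norm x) ^ Suc CARD('n)" by simp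
    hence "norm (\<phi> x) \<le> ?S / (1 + norm x) ^ Suc CARD('n)" using le[of x] by (simp add: le_divide_eq mult.commute)
    also have "\<dots> = ?S * decay x" by (simp add: decay_def)
    also have "\<dots> = norm (complex_of_real ?S * complex_of_real (decay x))"
      using S0 decay_bounds(1)[of x] by (simp add: norm_mult)
    finally show ?thesis .
  qed
  have w: "(\<lambda>x :: real ^ 'n. complex_of_real (decay x)) \<in> Lp_space p"
  proof -
    have "integrable lebesgue (\<lambda>x :: real ^ 'n. norm (complex_of_real (decay x)) powr p)"
    proof (rule Bochner_Integration.integrable_bound[OF decay_integrable])
      show "AE x in lebesgue. norm (norm (complex_of_real (decay (x :: real ^ 'n))) powr p) \<le> norm (decay x)"
      proof (intro AE_I2)
        fix x :: "real ^ 'n"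
        have "decay x powr p \<le> decay x powr 1" by (rule powr_mono') (use p decay_bounds[of x] in auto)
        thus "norm (norm (complex_of_real (decay x)) powr p) \<le> norm (decay x)" using decay_bounds(1)[of x] by simp
      qed
    qed measurable
    thus ?thesis by (simp add: Lp_space_def)
  qed
  have p0: "0 < p" using p by simp
  note sw = Lp_space_scale[OF p0 w, of "complex_of_real ?S"]
  note m = schwartz_measurable[OF \<phi>]
  show "\<phi> \<in> Lp_space p" by (rule Lp_space_dominated[OF p0 sw m AE_I2]) (rule pw)
  have "Lp_norm p \<phi> \<le> Lp_norm p (\<lambda>x :: real ^ 'n. complex_of_real ?S * complex_of_real (decay x))"
    by (rule Lp_norm_mono[OF p0 sw m AE_I2]) (rule pw)
  also have "\<dots> = ?S * Lp_norm p (\<lambda>x :: real ^ 'n. complex_of_real (decay x))"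
    unfolding Lp_norm_scale[OF p0 w] using S0 by simp
  finally show "Lp_norm p \<phi> \<le> Lp_norm p (\<lambda>x :: real ^ 'n. complex_of_real (decay x)) * ?S" by (simp add: mult.commute)
qed

lemma regular_distribution_bound:
  assumes s: "1 < s" "1 / s + 1 / s' = 1" and f: "f \<in> Lp_space s"
  shows "norm (reg f \<phi>) \<le> Lp_norm s f * Lp_norm s' \<phi>"
proof (cases "\<phi> \<in> schwartz_space")
  case True
  have "1 \<le> s'" using conjugate_exponent[OF s] by simp
  from Lp_hoelder[OF s f schwartz_in_Lp_space[OF this True]] show ?thesis
    using True by (simp add: regular_distribution_def)
qed (simp add: regular_distribution_def Lp_norm_nonneg)

lemma regular_distribution_integrable:
  assumes s: "1 < s" and f: "f \<in> Lp_space s" and "\<phi> \<in> schwartz_space"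
  shows "integrable lebesgue (\<lambda>x. f x * \<phi> x)"
proof -
  define s' where "s' = s / (s - 1)"
  have s': "1 / s + 1 / s' = 1" unfolding s'_def by (rule conjugate_exponent_sum[OF s])
  have "1 \<le> s'" using conjugate_exponent[OF s s'] by simp
  from Lp_hoelder_integrable[OF s s' f schwartz_in_Lp_space[OF this assms(3)]] show ?thesis .
qed

lemma regular_distribution_tempered:
  fixes f :: "real ^ 'n \<Rightarrow> complex"
  assumes s: "1 < s" and f: "f \<in> Lp_space s"
  shows "reg f \<in> tempered_distributions"
proof -
  define s' where "s' = s / (s - 1)"
  have s': "1 / s + 1 / s' = 1" unfolding s'_def by (rule conjugate_exponent_sum[OF s])
  have s'1: "1 \<le> s'" using conjugate_exponent[OF s s'] by simp
  let ?w = "Lp_norm s' (\<lambda>x :: real ^ 'n. complex_of_real (decay x))"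
  note int = regular_distribution_integrable[OF s f]
  have add: "reg f (\<lambda>x. \<phi> x + \<psi> x) = reg f \<phi> + reg f \<psi>"
    if "\<phi> \<in> schwartz_space" "\<psi> \<in> schwartz_space" for \<phi> \<psi>
    using schwartz_linear[OF that, of 1 1] that int[OF that(1)] int[OF that(2)]
    by (simp add: regular_distribution_def distrib_left)
  have mult: "reg f (\<lambda>x. c * \<phi> x) = c * reg f \<phi>"
    if "\<phi> \<in> schwartz_space" for \<phi> c
    using schwartz_linear[OF that that, of c 0] that by (simp add: regular_distribution_def mult.left_commute)
  have bd: "norm (reg f \<phi>) \<le> (Lp_norm s f * ?w) * schwartz_seminorm (Suc CARD('n)) 0 \<phi>"
    if "\<phi> \<in> schwartz_space" for \<phi>
  proof -
    have "norm (reg f \<phi>) \<le> Lp_norm s f * Lp_norm s' \<phi>" by (rule regular_distribution_bound[OF s s' f])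
    also have "\<dots> \<le> Lp_norm s f * (?w * schwartz_seminorm (Suc CARD('n)) 0 \<phi>)"
      by (rule mult_left_mono[OF schwartz_Lp_norm[OF s'1 that] Lp_norm_nonneg])
    finally show ?thesis by (simp add: mult.assoc)
  qed
  have zero: "reg f \<phi> = 0" if "\<phi> \<notin> schwartz_space" for \<phi>
    using that by (simp add: regular_distribution_def)
  show ?thesis unfolding tempered_distributions_def using add mult bd zero by blast
qed

lemma regular_distribution_AE_cong:
  assumes "f \<in> borel_measurable lebesgue" "g \<in> borel_measurable lebesgue" "AE x in lebesgue. f x = g x"
  shows "reg f = reg g"
proof
  fix \<phi>
  have "(LINT x|lebesgue. f x * \<phi> x) = (LINT x|lebesgue. g x * \<phi> x)" if "\<phi> \<in> schwartz_space"
  proof (rule integral_cong_AE)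
    note [measurable] = assms(1,2) schwartz_measurable[OF that]
    show "(\<lambda>x. f x * \<phi> x) \<in> borel_measurable lebesgue" "(\<lambda>x. g x * \<phi> x) \<in> borel_measurable lebesgue" by measurable
    show "AE x in lebesgue. f x * \<phi> x = g x * \<phi> x" using assms(3) by (rule AE_mp) (auto intro!: AE_I2)
  qed
  thus "reg f \<phi> = reg g \<phi>" by (simp add: regular_distribution_def)
qed

lemma regular_distribution_linear:
  assumes s: "1 < s" and f: "f \<in> Lp_space s" and g: "g \<in> Lp_space s"
  shows "reg (\<lambda>x. c * f x + d * g x) = (\<lambda>\<phi>. c * reg f \<phi> + d * reg g \<phi>)"
proof
  fix \<phi>
  have "(LINT x|lebesgue. (c * f x + d * g x) * \<phi> x) = c * (LINT x|lebesgue. f x * \<phi> x) + d * (LINT x|lebesgue. g x * \<phi> x)"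
    if "\<phi> \<in> schwartz_space"
  proof -
    note i = regular_distribution_integrable[OF s f that] regular_distribution_integrable[OF s g that]
    have "(LINT x|lebesgue. (c * f x + d * g x) * \<phi> x) = (LINT x|lebesgue. c * (f x * \<phi> x) + d * (g x * \<phi> x))"
      by (simp add: distrib_right mult.assoc)
    also have "\<dots> = c * (LINT x|lebesgue. f x * \<phi> x) + d * (LINT x|lebesgue. g x * \<phi> x)"
      using i by simp
    finally show ?thesis .
  qed
  thus "reg (\<lambda>x. c * f x + d * g x) \<phi> = c * reg f \<phi> + d * reg g \<phi>"
    by (simp add: regular_distribution_def)
qed

text \<open>Density extends the vanishing of the pairings from test functions to the whole conjugate
  space. It contains the truncated conjugate of \<open>f\<close>, and the pairing with it is the
  squared L_2 norm of the truncation.\<close>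

lemma regular_distribution_eq_0:
  fixes f :: "real ^ 'n \<Rightarrow> complex"
  assumes s: "1 < s" and f: "f \<in> Lp_space s" and z: "\<And>\<phi>. reg f \<phi> = 0"
  shows "AE x in lebesgue. f x = 0"
proof -
  define s' where "s' = s / (s - 1)"
  have s': "1 / s + 1 / s' = 1" unfolding s'_def by (rule conjugate_exponent_sum[OF s])
  have s'1: "1 < s'" using conjugate_exponent[OF s s'] .
  note [measurable] = Lp_spaceD(1)[OF f]
  have zero: "(LINT x|lebesgue. f x * g x) = 0" if g: "g \<in> Lp_space s'" for g
  proof -
    obtain u where u: "\<And>i. u i \<in> test_functions" "\<And>i. Lp_norm s' (\<lambda>x. g x - u i x) < (1 / 2) ^ i"
        "\<And>i. Lp_norm s' (\<lambda>x. g x - u i x) < (1 / 2) ^ i" "\<And>i x. u i x \<noteq> 0 \<Longrightarrow> \<exists>y. g y \<noteq> 0 \<and> dist x y < 1"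
      by (rule test_functions_dense_seq[of s' s' g 1]) (use g s'1 in auto)
    have uL: "u i \<in> Lp_space s'" for i by (rule test_function_in_Lp_space[OF _ u(1)]) (use s'1 in simp)
    have lim: "Lp_tendsto s' u g"
      by (rule half_power_tendsto_0[where C = 1]) (use u(2) less_imp_le in \<open>auto simp: Lp_norm_nonneg\<close>)
    have "(LINT x|lebesgue. f x * u i x) = 0" for i
      using z[of "u i"] test_function_is_schwartz[OF u(1)[of i]] by (simp add: regular_distribution_def)
    hence "(\<lambda>i. LINT x|lebesgue. f x * u i x) \<longlonglongrightarrow> 0" by simp
    thus ?thesis using LIMSEQ_unique[OF Lp_pairing_tendsto[OF s s' f g uL lim]] by blast
  qed
  define A where "A = truncation_set f"
  have A [measurable]: "A k \<in> sets lebesgue" for k unfolding A_def by (rule truncation_set_sets[OF Lp_spaceD(1)[OF f]])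
  have "AE x in lebesgue. cut (A k) f x = 0" for k
  proof -
    have cutL: "cut (A k) f \<in> Lp_space 2"
      by (rule bounded_in_Lp_space[where B = "real k" and S = "half_open_cube k"])
        (measurable, auto simp: A_def truncation_set_def indicator_def bounded_half_open_cube)
    define g where "g x = indicator (A k) x * cnj (f x)" for x
    have [measurable]: "(\<lambda>x. cnj (f x)) \<in> borel_measurable lebesgue"
      by (rule measurable_compose[OF _ borel_measurable_continuous_onI]) (auto intro: continuous_intros)
    have "g \<in> Lp_space s'"
      by (rule bounded_in_Lp_space[where B = "real k" and S = "half_open_cube k"])
        (use s'1 in \<open>simp, unfold g_def, measurable, auto simp: A_def truncation_set_def indicator_def bounded_half_open_cube\<close>)
    hence 0: "(LINT x|lebesgue. f x * g x) = 0" by (rule zero)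
    have fg: "f x * g x = complex_of_real (norm (cut (A k) f x) powr 2)" for x
      by (simp add: g_def indicator_def powr_numeral complex_norm_square del: of_real_power)
    have "complex_of_real (LINT x|lebesgue. norm (cut (A k) f x) powr 2) = 0"
      using 0 unfolding fg by (simp only: integral_complex_of_real)
    hence "Lp_norm 2 (cut (A k) f) = 0" unfolding of_real_eq_0_iff Lp_norm_eq by simp
    thus ?thesis using Lp_norm_eq_0_iff[OF _ cutL] by simp
  qed
  hence "AE x in lebesgue. \<forall>k. cut (A k) f x = 0" unfolding AE_all_countable by blast
  thus ?thesis
  proof (rule AE_mp, intro AE_I2 impI)
    fix x assume "\<forall>k. cut (A k) f x = 0"
    hence "(\<lambda>k. 0) \<longlonglongrightarrow> f x" using truncation_tendsto[of f x] unfolding A_def by (simp only:)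
    thus "f x = 0" by (rule LIMSEQ_unique) (rule tendsto_const)
  qed
qed

lemma regular_distribution_inject:
  assumes s: "1 < s" and f: "f \<in> Lp_space s" and g: "g \<in> Lp_space s" and eq: "reg f = reg g"
  shows "AE x in lebesgue. f x = g x"
proof -
  have "reg (\<lambda>x. f x - g x) \<phi> = 0" for \<phi>
    using regular_distribution_linear[OF s f g, of 1 "-1"] by (simp add: eq)
  from regular_distribution_eq_0[OF s Lp_space_diff[OF _ f g] this] s
  have "AE x in lebesgue. f x - g x = 0" by simp
  thus ?thesis by simp
qed

section \<open>Atomic series\<close>

text \<open>Sums over a countable index set are moved to the natural numbers, with zeros outside the
  range of the encoding, so that series indexed by naturals can be used.\<close>

lemma has_sum_to_nat:
  fixes u :: "'i :: countable \<Rightarrow> 'c :: {comm_monoid_add, topological_space}"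
  shows "((\<lambda>n. if n \<in> range (to_nat :: 'i \<Rightarrow> nat) then u (from_nat n) else 0) has_sum s) UNIV \<longleftrightarrow> (u has_sum s) UNIV"
proof -
  have "((\<lambda>n. if n \<in> range (to_nat :: 'i \<Rightarrow> nat) then u (from_nat n) else 0) has_sum s) UNIV \<longleftrightarrow>
      ((\<lambda>n. u (from_nat n)) has_sum s) (range (to_nat :: 'i \<Rightarrow> nat))"
    by (rule has_sum_cong_neutral) auto
  also have "\<dots> \<longleftrightarrow> (((\<lambda>n. u (from_nat n)) \<circ> (to_nat :: 'i \<Rightarrow> nat)) has_sum s) UNIV"
    by (rule has_sum_reindex) (rule inj_to_nat)
  finally show ?thesis by (simp add: o_def)
qed

text \<open>Summation by fibres: \<open>i\<close> is identified with the pair (\<kappa> i, i), and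
  the family is extended by zero to all pairs so that iterated summation applies.\<close>

lemma has_sum_group:
  fixes g :: "'i \<Rightarrow> 'c :: banach" and \<kappa> :: "'i \<Rightarrow> 'k"
  assumes g: "(g has_sum s) UNIV" and b: "\<And>k. ((\<lambda>i. if \<kappa> i = k then g i else 0) has_sum b k) UNIV"
  shows "(b has_sum s) UNIV"
proof -
  let ?G = "\<lambda>(k, i). if \<kappa> i = k then g i else 0"
  have inj: "inj_on (\<lambda>i. (\<kappa> i, i)) UNIV" by (auto simp: inj_on_def)
  have "((?G \<circ> (\<lambda>i. (\<kappa> i, i))) has_sum s) UNIV" using g by (simp add: o_def)
  hence 1: "(?G has_sum s) (range (\<lambda>i. (\<kappa> i, i)))" unfolding has_sum_reindex[OF inj] .
  have "(?G has_sum s) (Sigma UNIV (\<lambda>_. UNIV)) \<longleftrightarrow> (?G has_sum s) (range (\<lambda>i. (\<kappa> i, i)))"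
    by (rule has_sum_cong_neutral) auto
  hence 2: "(?G has_sum s) (Sigma UNIV (\<lambda>_. UNIV))" using 1 by blast
  show ?thesis by (rule has_sum_SigmaD[OF 2]) (use b in simp)
qed

text \<open>Additivity and the bound carry a functional through a norm-convergent series. Two kinds
  occur: pairing with a Schwartz function, and this pairing taken after the extension of
  \<open>T\<close>.\<close>

definition bounded_functional :: "real \<Rightarrow> ((real ^ 'n \<Rightarrow> complex) \<Rightarrow> complex) \<Rightarrow> bool"
  where "bounded_functional p \<Lambda> \<longleftrightarrow> (\<forall>g\<in>Lp_space p. \<forall>h\<in>Lp_space p. \<Lambda> (\<lambda>x. g x + h x) = \<Lambda> g + \<Lambda> h) \<and>
    (\<exists>C\<ge>0. \<forall>g\<in>Lp_space p. norm (\<Lambda> g) \<le> C * Lp_norm p g)"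

lemma bounded_functional_regular_distribution:
  assumes s: "1 < s" shows "bounded_functional s (\<lambda>g. reg g \<phi>)"
  unfolding bounded_functional_def
proof (intro conjI ballI exI)
  show "reg (\<lambda>x. g x + h x) \<phi> = reg g \<phi> + reg h \<phi>"
    if "g \<in> Lp_space s" "h \<in> Lp_space s" for g h
    using regular_distribution_linear[OF s that, of 1 1] by simp
  show "norm (reg g \<phi>) \<le> Lp_norm (s / (s - 1)) \<phi> * Lp_norm s g" if "g \<in> Lp_space s" for g
    using regular_distribution_bound[OF s conjugate_exponent_sum[OF s] that, of \<phi>] by (simp add: mult.commute)
qed (rule Lp_norm_nonneg)

text \<open>Norm, zero set and interchange with functionals have to refer to one and the same limit,
  which is why they are obtained together.\<close>

lemma Lp_countable_series:
  fixes f :: "'i :: countable \<Rightarrow> real ^ 'n \<Rightarrow> complex"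
  assumes p: "1 \<le> p" and f: "\<And>i. f i \<in> Lp_space p" and summ: "(\<lambda>i. Lp_norm p (f i)) summable_on UNIV"
  obtains F where "F \<in> Lp_space p" "Lp_norm p F \<le> (\<Sum>\<^sub>\<infinity>i. Lp_norm p (f i))"
    "\<And>Q. (\<And>i. AE x in lebesgue. x \<notin> Q \<longrightarrow> f i x = 0) \<Longrightarrow> AE x in lebesgue. x \<notin> Q \<longrightarrow> F x = 0"
    "\<And>\<Lambda>. bounded_functional p \<Lambda> \<Longrightarrow> ((\<lambda>i. \<Lambda> (f i)) has_sum \<Lambda> F) UNIV"
proof -
  let ?R = "range (to_nat :: 'i \<Rightarrow> nat)"
  define g where "g n = (if n \<in> ?R then f (from_nat n :: 'i) else (\<lambda>x. 0))" for n
  have gL: "g n \<in> Lp_space p" for n using f by (simp add: g_def)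
  have ng: "(\<lambda>n. Lp_norm p (g n)) = (\<lambda>n. if n \<in> ?R then Lp_norm p (f (from_nat n :: 'i)) else 0)"
    by (auto simp: g_def fun_eq_iff)
  have hs: "((\<lambda>n. Lp_norm p (g n)) has_sum (\<Sum>\<^sub>\<infinity>i. Lp_norm p (f i))) UNIV"
    unfolding ng has_sum_to_nat[of "\<lambda>i. Lp_norm p (f i)"] using summ by (rule has_sum_infsum)
  note sums = has_sum_imp_sums[OF hs]
  note gsum = sums_summable[OF sums]
  define F where "F x = (\<Sum>n. g n x)" for x
  note S = Lp_series[OF p gL gsum, folded F_def]
  have FL: "F \<in> Lp_space p" using S(2) .
  have bd: "Lp_norm p F \<le> (\<Sum>\<^sub>\<infinity>i. Lp_norm p (f i))" using S(3)[of 0] sums_unique[OF sums] by simp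
  have van: "AE x in lebesgue. x \<notin> Q \<longrightarrow> F x = 0" if "\<And>i. AE x in lebesgue. x \<notin> Q \<longrightarrow> f i x = 0" for Q
  proof -
    have "AE x in lebesgue. x \<notin> Q \<longrightarrow> g n x = 0" for n using that[of "from_nat n"] by (simp add: g_def)
    hence "AE x in lebesgue. \<forall>n. x \<notin> Q \<longrightarrow> g n x = 0" unfolding AE_all_countable by blast
    thus ?thesis by (rule AE_mp) (auto intro!: AE_I2 simp: F_def)
  qed
  have functional: "((\<lambda>i. \<Lambda> (f i)) has_sum \<Lambda> F) UNIV" if \<Lambda>: "bounded_functional p \<Lambda>" for \<Lambda>
  proof -
    have add: "\<And>g h. g \<in> Lp_space p \<Longrightarrow> h \<in> Lp_space p \<Longrightarrow> \<Lambda> (\<lambda>x. g x + h x) = \<Lambda> g + \<Lambda> h"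
      using \<Lambda> by (simp add: bounded_functional_def)
    obtain C where C: "0 \<le> C" and le: "\<And>g. g \<in> Lp_space p \<Longrightarrow> norm (\<Lambda> g) \<le> C * Lp_norm p g"
      using \<Lambda> unfolding bounded_functional_def by blast
    have z: "\<Lambda> (\<lambda>x. 0) = 0" using le[of "\<lambda>x. 0"] by simp
    have part: "(\<lambda>x. \<Sum>n<N. g n x) \<in> Lp_space p" for N by (rule Lp_space_sum[OF p gL])
    have fin: "\<Lambda> (\<lambda>x. \<Sum>n<N. g n x) = (\<Sum>n<N. \<Lambda> (g n))" for N
      by (induction N) (simp_all add: z add[OF part gL])
    let ?t = "\<lambda>N. (\<Sum>i. Lp_norm p (g (i + N)))"
    have "(\<lambda>N. suminf (\<lambda>n. Lp_norm p (g n)) - (\<Sum>n<N. Lp_norm p (g n))) \<longlonglongrightarrow>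
        suminf (\<lambda>n. Lp_norm p (g n)) - suminf (\<lambda>n. Lp_norm p (g n))"
      by (intro tendsto_intros summable_LIMSEQ gsum)
    hence t0: "?t \<longlonglongrightarrow> 0" by (simp add: suminf_minus_initial_segment[OF gsum])
    have "(\<lambda>N. (\<Sum>n<N. \<Lambda> (g n)) - \<Lambda> F) \<longlonglongrightarrow> 0"
    proof (rule Lim_null_comparison)
      show "(\<lambda>N. C * ?t N) \<longlonglongrightarrow> 0" by (rule tendsto_mult_right_zero[OF t0])
      show "\<forall>\<^sub>F N in sequentially. norm ((\<Sum>n<N. \<Lambda> (g n)) - \<Lambda> F) \<le> C * ?t N"
      proof (intro always_eventually allI)
        fix N
        let ?D = "\<lambda>x. F x - (\<Sum>n<N. g n x)"
        have D: "?D \<in> Lp_space p" by (rule Lp_space_diff[OF p FL part])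
        have "\<Lambda> F = \<Lambda> ?D + (\<Sum>n<N. \<Lambda> (g n))" using add[OF D part[of N]] by (simp add: fin)
        hence "norm ((\<Sum>n<N. \<Lambda> (g n)) - \<Lambda> F) = norm (\<Lambda> ?D)" by (simp add: norm_minus_commute)
        also have "\<dots> \<le> C * Lp_norm p ?D" by (rule le[OF D])
        also have "\<dots> \<le> C * ?t N" by (rule mult_left_mono[OF S(3) C])
        finally show "norm ((\<Sum>n<N. \<Lambda> (g n)) - \<Lambda> F) \<le> C * ?t N" .
      qed
    qed
    hence "(\<lambda>n. \<Lambda> (g n)) sums \<Lambda> F" unfolding sums_def by (simp add: LIM_zero_iff)
    moreover have "summable (\<lambda>n. norm (\<Lambda> (g n)))"
      by (rule summable_comparison_test'[OF summable_mult[OF gsum, of C], of 0]) (use le[OF gL] in simp)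
    ultimately have "((\<lambda>n. \<Lambda> (g n)) has_sum \<Lambda> F) UNIV" by (intro norm_summable_imp_has_sum)
    also have "(\<lambda>n. \<Lambda> (g n)) = (\<lambda>n. if n \<in> ?R then \<Lambda> (f (from_nat n)) else 0)" by (auto simp: g_def z)
    finally show ?thesis unfolding has_sum_to_nat[of "\<lambda>i. \<Lambda> (f i)"] .
  qed
  show ?thesis by (rule that[OF FL bd van functional])
qed

definition atom :: "real \<Rightarrow> real \<Rightarrow> int \<times> (int ^ 'n) \<Rightarrow> (real ^ 'n \<Rightarrow> complex) \<Rightarrow> bool"
  where "atom q \<rho> k a \<longleftrightarrow> a \<in> Lp_space q \<and> (AE x in lebesgue. x \<notin> dyadic_cube (fst k) (snd k) \<longrightarrow> a x = 0) \<and>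
    Lp_norm q a \<le> side (fst k) powr (real CARD('n) / q + \<rho>)"

lemma atomic_representation_iff:
  fixes h :: "(real ^ 'n \<Rightarrow> complex) \<Rightarrow> complex"
  shows "atomic_representation q \<rho> h lam a \<longleftrightarrow> (\<forall>k. atom q \<rho> k (a k)) \<and> (\<lambda>k. norm (lam k)) summable_on UNIV \<and>
    (\<forall>\<phi>\<in>schwartz_space. ((\<lambda>k. lam k * reg (a k) \<phi>) has_sum h \<phi>) UNIV)"
proof -
  have "closed (dyadic_cube J M)" for J and M :: "int ^ 'n"
    by (simp add: dyadic_cube_eq_nbhd cube_nbhd_closed)
  thus ?thesis unfolding atomic_representation_def
    by (simp add: atom_def ess_support_subset_iff side_def powr_powr)
qed

lemma atom_LpD: "atom q \<rho> k a \<Longrightarrow> a \<in> Lp_space q"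
  by (simp add: atom_def)

text \<open>A representation admits exactly one atom per cube, whereas constructions produce many.
  The terms that share the cube \<open>k\<close> are summed in L_q; the norm of the sum is at most
  the mass of their coefficients times the size allowed for an atom, so dividing by this mass gives
  an atom again and the total does not grow.\<close>

lemma regroup_atoms:
  fixes e :: "'i :: countable \<Rightarrow> real ^ 'n \<Rightarrow> complex"
  assumes q: "1 < q" and e: "\<And>i. atom q \<rho> (\<kappa> i) (e i)" and c: "(\<lambda>i. norm (c i)) summable_on UNIV"
    and h: "\<And>\<phi>. \<phi> \<in> schwartz_space \<Longrightarrow> ((\<lambda>i. c i * reg (e i) \<phi>) has_sum h \<phi>) UNIV"
  obtains lam a where "atomic_representation q \<rho> h lam a" "(\<Sum>\<^sub>\<infinity>k. norm (lam k)) \<le> (\<Sum>\<^sub>\<infinity>i. norm (c i))"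
proof -
  have q1: "1 \<le> q" "0 < q" using q by auto
  define q' where "q' = q / (q - 1)"
  have q': "1 / q + 1 / q' = 1" unfolding q'_def by (rule conjugate_exponent_sum[OF q])
  note eL = atom_LpD[OF e]
  define \<sigma> where "\<sigma> k = side (fst k) powr (real CARD('n) / q + \<rho>)" for k :: "int \<times> (int ^ 'n)"
  define f where "f k i = (if \<kappa> i = k then (\<lambda>x. c i * e i x) else (\<lambda>x. 0))" for k i
  define n where "n k i = (if \<kappa> i = k then norm (c i) else 0)" for k i
  have fL: "f k i \<in> Lp_space q" for k i unfolding f_def using Lp_space_scale[OF q1(2) eL] by simp
  have nsum: "n k summable_on UNIV" for k
    by (rule summable_on_comparison_test[OF c]) (auto simp: n_def)
  have nf: "Lp_norm q (f k i) \<le> n k i * \<sigma> k" for k i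
    unfolding f_def n_def \<sigma>_def using Lp_norm_scale[OF q1(2) eL] e[of i] by (auto simp: atom_def mult_left_mono)
  have fsum: "(\<lambda>i. Lp_norm q (f k i)) summable_on UNIV" for k
    by (rule summable_on_comparison_test[OF summable_on_cmult_left[OF nsum[of k], of "\<sigma> k"]])
      (use nf Lp_norm_nonneg in auto)
  have ex: "\<exists>F. F \<in> Lp_space q \<and> Lp_norm q F \<le> infsum (n k) UNIV * \<sigma> k \<and>
      (AE x in lebesgue. x \<notin> dyadic_cube (fst k) (snd k) \<longrightarrow> F x = 0) \<and>
      (\<forall>\<phi>\<in>schwartz_space. ((\<lambda>i. reg (f k i) \<phi>) has_sum reg F \<phi>) UNIV)" for k
  proof -
    obtain F where F: "F \<in> Lp_space q" "Lp_norm q F \<le> (\<Sum>\<^sub>\<infinity>i. Lp_norm q (f k i))"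
      "\<And>Q. (\<And>i. AE x in lebesgue. x \<notin> Q \<longrightarrow> f k i x = 0) \<Longrightarrow> AE x in lebesgue. x \<notin> Q \<longrightarrow> F x = 0"
      "\<And>\<Lambda>. bounded_functional q \<Lambda> \<Longrightarrow> ((\<lambda>i. \<Lambda> (f k i)) has_sum \<Lambda> F) UNIV"
      by (rule Lp_countable_series[OF q1(1) fL fsum]) blast
    have "Lp_norm q F \<le> (\<Sum>\<^sub>\<infinity>i. n k i * \<sigma> k)"
      by (rule order_trans[OF F(2) infsum_mono[OF fsum summable_on_cmult_left[OF nsum] nf]])
    also have "\<dots> = infsum (n k) UNIV * \<sigma> k" by (rule infsum_cmult_left) (rule nsum)
    finally have 1: "Lp_norm q F \<le> infsum (n k) UNIV * \<sigma> k" .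
    have 2: "AE x in lebesgue. x \<notin> dyadic_cube (fst k) (snd k) \<longrightarrow> F x = 0"
    proof (rule F(3))
      fix i
      show "AE x in lebesgue. x \<notin> dyadic_cube (fst k) (snd k) \<longrightarrow> f k i x = 0"
      proof (cases "\<kappa> i = k")
        case True
        have "AE x in lebesgue. x \<notin> dyadic_cube (fst (\<kappa> i)) (snd (\<kappa> i)) \<longrightarrow> e i x = 0" using e[of i] by (simp add: atom_def)
        thus ?thesis unfolding True by (rule AE_mp) (auto intro!: AE_I2 simp: f_def True)
      qed (simp add: f_def)
    qed
    have 3: "((\<lambda>i. reg (f k i) \<phi>) has_sum reg F \<phi>) UNIV" for \<phi>
      by (rule F(4)[OF bounded_functional_regular_distribution[OF q]])
    show ?thesis using F(1) 1 2 3 by blast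
  qed
  have "\<exists>F. \<forall>k. F k \<in> Lp_space q \<and> Lp_norm q (F k) \<le> infsum (n k) UNIV * \<sigma> k \<and>
      (AE x in lebesgue. x \<notin> dyadic_cube (fst k) (snd k) \<longrightarrow> F k x = 0) \<and>
      (\<forall>\<phi>\<in>schwartz_space. ((\<lambda>i. reg (f k i) \<phi>) has_sum reg (F k) \<phi>) UNIV)"
    by (rule choice) (use ex in blast)
  then obtain F where FL: "\<And>k. F k \<in> Lp_space q" and Fn: "\<And>k. Lp_norm q (F k) \<le> infsum (n k) UNIV * \<sigma> k"
    and F0: "\<And>k. AE x in lebesgue. x \<notin> dyadic_cube (fst k) (snd k) \<longrightarrow> F k x = 0"
    and Fs: "\<And>k \<phi>. \<phi> \<in> schwartz_space \<Longrightarrow> ((\<lambda>i. reg (f k i) \<phi>) has_sum reg (F k) \<phi>) UNIV"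
    by blast
  define N where "N k = infsum (n k) UNIV" for k
  have N0: "0 \<le> N k" for k unfolding N_def by (rule infsum_nonneg) (simp add: n_def)
  define lam where "lam k = complex_of_real (N k)" for k
  \<comment> \<open>If the mass at \<open>k\<close> is zero, inverse 0 = 0 makes \<open>a k\<close>
    the zero function, which is still an atom.\<close>
  define a where "a k = (\<lambda>x. inverse (lam k) * F k x)" for k
  have nl: "norm (lam k) = N k" for k using N0 by (simp add: lam_def)
  have "(N has_sum (\<Sum>\<^sub>\<infinity>i. norm (c i))) UNIV"
  proof (rule has_sum_group[OF has_sum_infsum[OF c]])
    fix k
    show "((\<lambda>i. if \<kappa> i = k then norm (c i) else 0) has_sum N k) UNIV"
      using has_sum_infsum[OF nsum[of k]] by (simp add: n_def[abs_def] N_def)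
  qed
  hence Ns: "((\<lambda>k. norm (lam k)) has_sum (\<Sum>\<^sub>\<infinity>i. norm (c i))) UNIV" by (simp add: nl)
  have at: "atom q \<rho> k (a k)" for k
  proof -
    have 1: "a k \<in> Lp_space q" unfolding a_def by (rule Lp_space_scale[OF q1(2) FL])
    have 2: "AE x in lebesgue. x \<notin> dyadic_cube (fst k) (snd k) \<longrightarrow> a k x = 0"
      using F0[of k] by (rule AE_mp) (auto intro!: AE_I2 simp: a_def)
    have "Lp_norm q (a k) = inverse (N k) * Lp_norm q (F k)"
      unfolding a_def Lp_norm_scale[OF q1(2) FL] by (simp add: norm_inverse nl)
    also have "\<dots> \<le> inverse (N k) * (N k * \<sigma> k)" unfolding N_def[of k] by (rule mult_left_mono[OF Fn]) (simp add: N0[unfolded N_def])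
    also have "\<dots> \<le> \<sigma> k" by (cases "N k = 0") (auto simp: \<sigma>_def)
    finally show ?thesis using 1 2 by (simp add: atom_def \<sigma>_def)
  qed
  have "((\<lambda>k. lam k * reg (a k) \<phi>) has_sum h \<phi>) UNIV" if \<phi>: "\<phi> \<in> schwartz_space" for \<phi>
  proof -
    have "lam k * reg (a k) \<phi> = reg (F k) \<phi>" for k
    proof (cases "N k = 0")
      case True
      hence "Lp_norm q (F k) \<le> 0" using Fn[of k] by (simp add: N_def)
      hence "Lp_norm q (F k) = 0" using Lp_norm_nonneg[of q "F k"] by simp
      hence "norm (reg (F k) \<phi>) \<le> 0" using regular_distribution_bound[OF q q' FL, of k \<phi>] by simp
      thus ?thesis using True by (simp add: lam_def)
    next
      case False
      hence "lam k \<noteq> 0" by (simp add: lam_def)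
      thus ?thesis using regular_distribution_linear[OF q FL FL, of "inverse (lam k)" k 0 k] by (simp add: a_def)
    qed
    moreover have "((\<lambda>k. reg (F k) \<phi>) has_sum h \<phi>) UNIV"
    proof (rule has_sum_group[OF h[OF \<phi>]])
      fix k
      have "reg (\<lambda>x. c i * e i x) \<phi> = c i * reg (e i) \<phi>" for i
        using regular_distribution_linear[OF q eL eL, of "c i" i 0 i] by simp
      hence "(\<lambda>i. if \<kappa> i = k then c i * reg (e i) \<phi> else 0) = (\<lambda>i. reg (f k i) \<phi>)"
        by (auto simp: f_def fun_eq_iff regular_distribution_def)
      thus "((\<lambda>i. if \<kappa> i = k then c i * reg (e i) \<phi> else 0) has_sum reg (F k) \<phi>) UNIV"
        using Fs[OF \<phi>, of k] by simp
    qed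
    ultimately show ?thesis by simp
  qed
  hence "atomic_representation q \<rho> h lam a"
    unfolding atomic_representation_iff using at has_sum_imp_summable[OF Ns] by blast
  thus ?thesis using that infsumI[OF Ns] by simp
qed

text \<open>The exponent \<open>s\<close> is the one for which scaling disappears: n / s + \<rho> =
  0, so the volume factor of Hoelder's inequality cancels the size of the atom and the bound does
  not depend on the cube.\<close>

lemma atom_in_Ls:
  fixes a :: "real ^ 'n \<Rightarrow> complex"
  assumes q: "1 < q" and \<rho>: "\<rho> < - real CARD('n) / q" and s: "s = - real CARD('n) / \<rho>" and a: "atom q \<rho> k a"
  shows "a \<in> Lp_space s" "Lp_norm s a \<le> 2 powr (real CARD('n) / s - real CARD('n) / q)"
proof -
  let ?n = "real CARD('n)" and ?Q = "dyadic_cube (fst k) (snd k)"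
  have n: "0 < ?n" by simp
  have \<rho>0: "\<rho> < 0" using \<rho> n q by (smt (verit) divide_neg_pos)
  have s0: "0 < s" unfolding s by (rule divide_neg_neg) (use \<rho>0 n in auto)
  have ns: "?n / s = - \<rho>" unfolding s using \<rho>0 by simp
  have sq: "s < q"
  proof -
    have "?n / q < ?n / s" unfolding ns using \<rho> by simp
    thus ?thesis using n s0 q by (simp add: divide_simps split: if_splits)
  qed
  have aq: "a \<in> Lp_space q" "AE x in lebesgue. x \<notin> ?Q \<longrightarrow> a x = 0" "Lp_norm q a \<le> side (fst k) powr (?n / q + \<rho>)"
    using a by (auto simp: atom_def)
  note incl = Lp_inclusion[OF s0 sq aq(1) dyadic_cube_lmeasurable[of "fst k" "snd k"]]
  have eq: "AE x in lebesgue. cut ?Q a x = a x" using aq(2) by (rule AE_mp) (auto intro!: AE_I2 simp: indicator_def)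
  note m = Lp_spaceD(1)[OF aq(1)]
  show "a \<in> Lp_space s" by (rule Lp_space_AE_cong[OF s0 incl(1) m eq])
  have "Lp_norm s a = Lp_norm s (cut ?Q a)" by (rule Lp_norm_AE_cong[OF s0 incl(1) m eq])
  also have "\<dots> \<le> measure lebesgue ?Q powr (1 / s - 1 / q) * Lp_norm q a" by (rule incl(2))
  also have "\<dots> \<le> measure lebesgue ?Q powr (1 / s - 1 / q) * side (fst k) powr (?n / q + \<rho>)"
    by (rule mult_left_mono[OF aq(3)]) simp
  also have "measure lebesgue ?Q powr (1 / s - 1 / q) = (2 * side (fst k)) powr (?n / s - ?n / q)"
  proof -
    have "measure lebesgue ?Q = (2 * side (fst k)) powr ?n"
      unfolding measure_dyadic_cube by (subst powr_realpow) auto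
    thus ?thesis by (simp add: powr_powr right_diff_distrib)
  qed
  also have "(2 * side (fst k)) powr (?n / s - ?n / q) * side (fst k) powr (?n / q + \<rho>) = 2 powr (?n / s - ?n / q)"
    unfolding ns powr_mult mult.assoc powr_add[symmetric] by simp
  finally show "Lp_norm s a \<le> 2 powr (?n / s - ?n / q)" .
qed

section \<open>Preduals of Morrey spaces\<close>

lemma le_mult_Inf:
  fixes y B :: real
  assumes "0 \<le> B" "S \<noteq> {}" "\<And>x. x \<in> S \<Longrightarrow> y \<le> B * x"
  shows "y \<le> B * Inf S"
proof (cases "B = 0")
  case False
  hence B: "0 < B" using assms(1) by simp
  have "y / B \<le> Inf S"
  proof (rule cInf_greatest[OF assms(2)])
    fix x assume "x \<in> S"
    from assms(3)[OF this] show "y / B \<le> x" using B by (simp add: divide_le_eq mult.commute)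
  qed
  thus ?thesis using B by (simp add: divide_le_eq mult.commute)
qed (use assms in auto)

lemma predual_norm_le: "atomic_representation q \<rho> h lam a \<Longrightarrow> predual_morrey_norm q \<rho> h \<le> (\<Sum>\<^sub>\<infinity>k. norm (lam k))"
  unfolding predual_morrey_norm_def
proof (rule cInf_lower)
  show "bdd_below {(\<Sum>\<^sub>\<infinity>k. norm (lam k)) | lam a. atomic_representation q \<rho> h lam a}"
    by (rule bdd_belowI[of _ 0]) (auto intro: infsum_nonneg)
qed blast

text \<open>The norm is an infimum over representations, so an estimate valid for each of them
  passes to it.\<close>

lemma le_mult_predual_norm:
  assumes "h \<in> predual_morrey_space q \<rho>" "0 \<le> B"
    and le: "\<And>lam a. atomic_representation q \<rho> h lam a \<Longrightarrow> y \<le> B * (\<Sum>\<^sub>\<infinity>k. norm (lam k))"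
  shows "y \<le> B * predual_morrey_norm q \<rho> h"
  unfolding predual_morrey_norm_def
proof (rule le_mult_Inf[OF assms(2)])
  show "{(\<Sum>\<^sub>\<infinity>k. norm (lam k)) | lam a. atomic_representation q \<rho> h lam a} \<noteq> {}"
    using assms(1) by (auto simp: predual_morrey_space_def)
qed (use le in auto)

lemma predual_spaceI:
  fixes e :: "'i :: countable \<Rightarrow> real ^ 'n \<Rightarrow> complex"
  assumes q: "1 < q" and s: "1 < s" and F: "F \<in> Lp_space s"
    and e: "\<And>i. atom q \<rho> (\<kappa> i) (e i)" and c: "(\<lambda>i. norm (c i)) summable_on UNIV"
    and sum: "\<And>\<phi>. \<phi> \<in> schwartz_space \<Longrightarrow> ((\<lambda>i. c i * reg (e i) \<phi>) has_sum reg F \<phi>) UNIV"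
  shows "reg F \<in> predual_morrey_space q \<rho>"
    and "predual_morrey_norm q \<rho> (reg F) \<le> (\<Sum>\<^sub>\<infinity>i. norm (c i))"
proof -
  obtain lam a where la: "atomic_representation q \<rho> (reg F) lam a" "(\<Sum>\<^sub>\<infinity>k. norm (lam k)) \<le> (\<Sum>\<^sub>\<infinity>i. norm (c i))"
    by (rule regroup_atoms[OF q e c sum]) auto
  show "reg F \<in> predual_morrey_space q \<rho>"
    unfolding predual_morrey_space_def using regular_distribution_tempered[OF s F] la(1) by blast
  show "predual_morrey_norm q \<rho> (reg F) \<le> (\<Sum>\<^sub>\<infinity>i. norm (c i))"
    by (rule order_trans[OF predual_norm_le[OF la(1)] la(2)])
qed

lemma predual_exponent:
  fixes q \<rho> s n :: real
  assumes "1 < q" "- n < \<rho>" "\<rho> < - n / q" "s = - n / \<rho>" "0 < n"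
  shows "1 < s" "s < q"
proof -
  have "0 < n / q" using assms by simp
  hence \<rho>0: "\<rho> < 0" using assms(3) by simp
  have "1 < n / (- \<rho>)" using assms(2) \<rho>0 by (subst less_divide_eq) auto
  thus s: "1 < s" using assms(4) by simp
  have "n / s = - \<rho>" using assms(4,5) \<rho>0 by simp
  hence "n / q < n / s" using assms(3) by simp
  thus "s < q" using assms(1,5) s by (simp add: divide_simps split: if_splits)
qed

context
  fixes q \<rho> s :: real
  assumes q: "1 < q" and \<rho>: "- real CARD('n :: finite) < \<rho>" "\<rho> < - real CARD('n) / q" and s: "s = - real CARD('n) / \<rho>"
begin

lemma s_gt_1: "1 < s" and s_pos: "0 < s" "1 \<le> s" and q_pos: "0 < q" "1 \<le> q"
  using predual_exponent(1)[OF q \<rho> s] q by simp_all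

lemmas atom_in_Ls' = atom_in_Ls[OF q \<rho>(2) s]

text \<open>Atoms are uniformly bounded in L_s, so summable coefficients make the series converge in
  norm there, and testing identifies the sum with \<open>h\<close>. The condition outside the
  Schwartz space is what gives equality of total functions.\<close>

lemma predual_regular:
  fixes a :: "int \<times> (int ^ 'n) \<Rightarrow> real ^ 'n \<Rightarrow> complex"
  assumes rep: "atomic_representation q \<rho> h lam a" and h0: "\<forall>\<phi>. \<phi> \<notin> schwartz_space \<longrightarrow> h \<phi> = 0"
  obtains F where "F \<in> Lp_space s" "h = reg F"
    "Lp_norm s F \<le> 2 powr (real CARD('n) / s - real CARD('n) / q) * (\<Sum>\<^sub>\<infinity>k. norm (lam k))"
    "\<And>\<Lambda>. bounded_functional s \<Lambda> \<Longrightarrow> ((\<lambda>k. \<Lambda> (\<lambda>x. lam k * a k x)) has_sum \<Lambda> F) UNIV"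
proof -
  let ?A = "2 powr (real CARD('n) / s - real CARD('n) / q)"
  have at: "atom q \<rho> k (a k)" for k using rep unfolding atomic_representation_iff by blast
  have lam: "(\<lambda>k. norm (lam k)) summable_on UNIV" using rep by (simp add: atomic_representation_iff)
  note aL = atom_in_Ls'(1)[OF at]
  have fL: "(\<lambda>x. lam k * a k x) \<in> Lp_space s" for k by (rule Lp_space_scale[OF s_pos(1) aL])
  have fn: "Lp_norm s (\<lambda>x. lam k * a k x) \<le> norm (lam k) * ?A" for k
    unfolding Lp_norm_scale[OF s_pos(1) aL] by (rule mult_left_mono[OF atom_in_Ls'(2)[OF at]]) simp
  note lamA = summable_on_cmult_left[OF lam, of ?A]
  have fsum: "(\<lambda>k. Lp_norm s (\<lambda>x. lam k * a k x)) summable_on UNIV"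
    by (rule summable_on_comparison_test[OF lamA]) (use fn Lp_norm_nonneg in auto)
  obtain F where F: "F \<in> Lp_space s" "Lp_norm s F \<le> (\<Sum>\<^sub>\<infinity>k. Lp_norm s (\<lambda>x. lam k * a k x))"
    "\<And>\<Lambda>. bounded_functional s \<Lambda> \<Longrightarrow> ((\<lambda>k. \<Lambda> (\<lambda>x. lam k * a k x)) has_sum \<Lambda> F) UNIV"
    by (rule Lp_countable_series[OF s_pos(2) fL fsum]) blast
  have "h \<phi> = reg F \<phi>" for \<phi>
  proof (cases "\<phi> \<in> schwartz_space")
    case True
    have "((\<lambda>k. reg (\<lambda>x. lam k * a k x) \<phi>) has_sum reg F \<phi>) UNIV"
      by (rule F(3)[OF bounded_functional_regular_distribution[OF s_gt_1]])
    moreover have "reg (\<lambda>x. lam k * a k x) \<phi> = lam k * reg (a k) \<phi>" for k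
      using regular_distribution_linear[OF s_gt_1 aL aL, of "lam k" k 0 k] by simp
    moreover have "((\<lambda>k. lam k * reg (a k) \<phi>) has_sum h \<phi>) UNIV"
      using rep True by (simp add: atomic_representation_iff)
    ultimately show ?thesis using has_sum_unique by fastforce
  next
    case False
    thus ?thesis using h0 by (simp add: regular_distribution_def)
  qed
  hence "h = reg F" by blast
  moreover have "Lp_norm s F \<le> ?A * (\<Sum>\<^sub>\<infinity>k. norm (lam k))"
  proof -
    have "Lp_norm s F \<le> (\<Sum>\<^sub>\<infinity>k. norm (lam k) * ?A)"
      by (rule order_trans[OF F(2) infsum_mono[OF fsum lamA fn]])
    also have "\<dots> = (\<Sum>\<^sub>\<infinity>k. norm (lam k)) * ?A" by (rule infsum_cmult_left) (rule lam)
    finally show ?thesis by (simp add: mult.commute)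
  qed
  ultimately show ?thesis using that F(1,3) by blast
qed

lemma predual_spaceD:
  fixes h :: "(real ^ 'n \<Rightarrow> complex) \<Rightarrow> complex"
  assumes "h \<in> predual_morrey_space q \<rho>"
  obtains F where "F \<in> Lp_space s" "h = reg F"
proof -
  obtain lam and a :: "int \<times> (int ^ 'n) \<Rightarrow> real ^ 'n \<Rightarrow> complex" where rep: "atomic_representation q \<rho> h lam a"
    using assms by (auto simp: predual_morrey_space_def)
  have h0: "\<forall>\<phi>. \<phi> \<notin> schwartz_space \<longrightarrow> h \<phi> = 0"
    using assms by (simp add: predual_morrey_space_def tempered_distributions_def)
  show ?thesis by (rule predual_regular[OF rep h0 that])
qed

text \<open>The norm dominates every single pairing; uniqueness of the extension will be read off
  from pairings.\<close>

lemma predual_norm_bound: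
  fixes h :: "(real ^ 'n \<Rightarrow> complex) \<Rightarrow> complex"
  assumes h: "h \<in> predual_morrey_space q \<rho>"
  shows "norm (h \<phi>) \<le> 2 powr (real CARD('n) / s - real CARD('n) / q) * Lp_norm (s / (s - 1)) \<phi> * predual_morrey_norm q \<rho> h"
proof (rule le_mult_predual_norm[OF h])
  let ?s' = "s / (s - 1)"
  note s' = conjugate_exponent_sum[OF s_gt_1]
  fix lam and a :: "int \<times> (int ^ 'n) \<Rightarrow> real ^ 'n \<Rightarrow> complex"
  assume rep: "atomic_representation q \<rho> h lam a"
  have h0: "\<forall>\<phi>. \<phi> \<notin> schwartz_space \<longrightarrow> h \<phi> = 0"
    using assms by (simp add: predual_morrey_space_def tempered_distributions_def)
  obtain F where F: "F \<in> Lp_space s" "h = reg F"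
    "Lp_norm s F \<le> 2 powr (real CARD('n) / s - real CARD('n) / q) * (\<Sum>\<^sub>\<infinity>k. norm (lam k))"
    by (rule predual_regular[OF rep h0])
  have "norm (h \<phi>) \<le> Lp_norm s F * Lp_norm ?s' \<phi>"
    unfolding F(2) by (rule regular_distribution_bound[OF s_gt_1 s' F(1)])
  also have "\<dots> \<le> 2 powr (real CARD('n) / s - real CARD('n) / q) * (\<Sum>\<^sub>\<infinity>k. norm (lam k)) * Lp_norm ?s' \<phi>"
    by (rule mult_right_mono[OF F(3) Lp_norm_nonneg])
  finally show "norm (h \<phi>) \<le> 2 powr (real CARD('n) / s - real CARD('n) / q) * Lp_norm ?s' \<phi> * (\<Sum>\<^sub>\<infinity>k. norm (lam k))"
    by (simp add: mult_ac)
qed (simp add: Lp_norm_nonneg)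

lemma test_function_in_predual:
  fixes f :: "real ^ 'n \<Rightarrow> complex"
  assumes f: "f \<in> test_functions" shows "reg f \<in> predual_morrey_space q \<rho>"
proof -
  have "bounded {x. f x \<noteq> 0}" using f by (simp add: test_functions_iff)
  then obtain i where i: "{x. f x \<noteq> 0} \<subseteq> cube_nbhd (2 ^ i) 0 (0 :: int ^ 'n)" by (rule bounded_subset_cube_nbhd)
  define J where "J = 0 - int (Suc i)"
  define M where "M = ancestor (Suc i) (0 :: int ^ 'n)"
  have sub: "{x. f x \<noteq> 0} \<subseteq> dyadic_cube J M"
    using i cube_nbhd_subset_ancestor[of "2 ^ i" "Suc i" 0 "0 :: int ^ 'n"] unfolding J_def M_def by simp
  define \<sigma> where "\<sigma> = side J powr (real CARD('n) / q + \<rho>)"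
  have \<sigma>: "0 < \<sigma>" by (simp add: \<sigma>_def)
  \<comment> \<open>The summand 1 keeps \<open>c\<close> positive when \<open>f\<close>
    vanishes.\<close>
  define c where "c = (Lp_norm q f + 1) / \<sigma>"
  have c: "0 < c" unfolding c_def using \<sigma> Lp_norm_nonneg[of q f] by simp
  note fq = test_function_in_Lp_space[OF q_pos(1) f] and fs = test_function_in_Lp_space[OF s_pos(1) f]
  let ?e = "\<lambda>x. complex_of_real (inverse c) * f x"
  have at: "atom q \<rho> (J, M) ?e"
    unfolding atom_def
  proof (intro conjI)
    show "?e \<in> Lp_space q" by (rule Lp_space_scale[OF q_pos(1) fq])
    show "AE x in lebesgue. x \<notin> dyadic_cube (fst (J, M)) (snd (J, M)) \<longrightarrow> ?e x = 0" using sub by (auto intro!: AE_I2)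
    have "Lp_norm q ?e = Lp_norm q f / c" unfolding Lp_norm_scale[OF q_pos(1) fq] using c by (simp add: divide_inverse norm_inverse mult.commute)
    also have "\<dots> \<le> \<sigma>" using c \<sigma> Lp_norm_nonneg[of q f] by (simp add: c_def divide_le_eq)
    finally show "Lp_norm q ?e \<le> side (fst (J, M)) powr (real CARD('n) / q + \<rho>)" by (simp add: \<sigma>_def)
  qed
  have sum: "((\<lambda>_ :: unit. complex_of_real c * reg ?e \<phi>) has_sum reg f \<phi>) UNIV" for \<phi>
  proof -
    have "reg f \<phi> = complex_of_real c * reg ?e \<phi>"
      using regular_distribution_linear[OF q fq fq, of "complex_of_real (inverse c)" 0] c by simp
    thus ?thesis using has_sum_finite[of "UNIV :: unit set" "\<lambda>_. complex_of_real c * reg ?e \<phi>"]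
      by (simp add: UNIV_unit)
  qed
  show ?thesis
    by (rule predual_spaceI(1)[where e = "\<lambda>_ :: unit. ?e" and c = "\<lambda>_. complex_of_real c" and \<kappa> = "\<lambda>_. (J, M)",
          OF q s_gt_1 fs at summable_on_finite sum]) simp
qed

text \<open>Finitely many atoms carry all but \<epsilon> / 2 of the coefficient mass. Each of them
  is replaced by a test function that is close in L_q and supported in the doubled cube. The error
  is \<eta> times an atom of a larger cube, so the finite part costs at most \<eta> times the total
  mass, again at most \<epsilon> / 2.\<close>

lemma test_functions_dense_in_predual:
  fixes h :: "(real ^ 'n \<Rightarrow> complex) \<Rightarrow> complex"
  assumes h: "h \<in> predual_morrey_space q \<rho>" and \<epsilon>: "0 < \<epsilon>"
  obtains g where "g \<in> test_functions" "(\<lambda>\<phi>. h \<phi> - reg g \<phi>) \<in> predual_morrey_space q \<rho>"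
    "predual_morrey_norm q \<rho> (\<lambda>\<phi>. h \<phi> - reg g \<phi>) \<le> \<epsilon>"
proof -
  obtain lam and a :: "int \<times> (int ^ 'n) \<Rightarrow> real ^ 'n \<Rightarrow> complex" where rep: "atomic_representation q \<rho> h lam a"
    using h by (auto simp: predual_morrey_space_def)
  have at: "\<And>k. atom q \<rho> k (a k)" and lam: "(\<lambda>k. norm (lam k)) summable_on UNIV"
    and sum: "\<And>\<phi>. \<phi> \<in> schwartz_space \<Longrightarrow> ((\<lambda>k. lam k * reg (a k) \<phi>) has_sum h \<phi>) UNIV"
    using rep by (auto simp: atomic_representation_iff)
  note aL = atom_LpD[OF at]
  obtain F where F: "F \<in> Lp_space s" "h = reg F" by (rule predual_spaceD[OF h])
  let ?N = "\<Sum>\<^sub>\<infinity>k. norm (lam k)"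
  have N0: "0 \<le> ?N" by (rule infsum_nonneg) simp
  obtain S where S: "finite S" "dist (\<Sum>k\<in>S. norm (lam k)) ?N \<le> \<epsilon> / 2"
    using infsum_finite_approximation[OF lam, of "\<epsilon> / 2"] \<epsilon> by auto
  define \<eta> where "\<eta> = \<epsilon> / 2 / (?N + 1)"
  have \<eta>: "0 < \<eta>" using \<epsilon> N0 by (simp add: \<eta>_def)
  have \<eta>N: "\<eta> * ?N \<le> \<epsilon> / 2"
  proof -
    have "\<eta> * ?N \<le> \<eta> * (?N + 1)" using \<eta> by (intro mult_left_mono) auto
    also have "\<dots> = \<epsilon> / 2" unfolding \<eta>_def using N0 by (intro nonzero_divide_eq_eq[THEN iffD1, symmetric]) auto
    finally show ?thesis .
  qed
  \<comment> \<open>The test functions stay within one unit \<open>side\<close> of their cube, hence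
    in the doubled cube, which the ancestor two levels up contains.\<close>
  define up where "up k = (fst k - int 2, ancestor 2 (snd k))" for k :: "int \<times> (int ^ 'n)"
  define \<sigma> where "\<sigma> k = side (fst (up k)) powr (real CARD('n) / q + \<rho>)" for k
  have \<sigma>: "0 < \<sigma> k" for k by (simp add: \<sigma>_def)
  have ex: "\<exists>g. g \<in> test_functions \<and> atom q \<rho> (up k) (\<lambda>x. inverse (complex_of_real \<eta>) * (a k x - g x))" for k
  proof -
    let ?Q = "dyadic_cube (fst k) (snd k)"
    have ae: "AE x in lebesgue. x \<notin> ?Q \<longrightarrow> a k x = 0" using at[of k] by (simp add: atom_def)
    note cL = cut_in_Lp_space(1)[OF q_pos(1) aL dyadic_cube_sets[of "fst k" "snd k"], of k]
    have eq: "AE x in lebesgue. cut ?Q (a k) x = a k x" using ae by (rule AE_mp) (auto intro!: AE_I2 simp: indicator_def)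
    obtain g where g: "g \<in> test_functions" "Lp_norm q (\<lambda>x. cut ?Q (a k) x - g x) < \<eta> * \<sigma> k"
        "\<And>x. g x \<noteq> 0 \<Longrightarrow> \<exists>y. cut ?Q (a k) y \<noteq> 0 \<and> dist x y < side (fst k)"
      using test_functions_dense[OF q_pos(2) q_pos(2) cL cL, of "\<eta> * \<sigma> k" "side (fst k)"] \<eta> \<sigma> by auto
    have Q2: "?Q \<subseteq> dyadic_cube (fst (up k)) (snd (up k))" "{x. g x \<noteq> 0} \<subseteq> dyadic_cube (fst (up k)) (snd (up k))"
    proof -
      have up: "cube_nbhd 2 (fst k) (snd k) \<subseteq> dyadic_cube (fst (up k)) (snd (up k))"
        using cube_nbhd_subset_ancestor[of 2 2 "fst k" "snd k"] by (simp add: up_def)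
      have "?Q \<subseteq> cube_nbhd 2 (fst k) (snd k)" unfolding dyadic_cube_eq_nbhd by (rule cube_nbhd_mono) simp
      thus "?Q \<subseteq> dyadic_cube (fst (up k)) (snd (up k))" using up by blast
      have "x \<in> cube_nbhd 2 (fst k) (snd k)" if x: "g x \<noteq> 0" for x
      proof (rule ccontr)
        assume out: "x \<notin> cube_nbhd 2 (fst k) (snd k)"
        obtain y where y: "cut ?Q (a k) y \<noteq> 0" "dist x y < side (fst k)" using g(3)[OF x] by blast
        have "y \<in> ?Q" using y(1) by (auto simp: indicator_def split: if_splits)
        from cube_nbhd_separation[OF this out] y(2) show False by (simp add: dist_norm norm_minus_commute)
      qed
      thus "{x. g x \<noteq> 0} \<subseteq> dyadic_cube (fst (up k)) (snd (up k))" using up by blast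
    qed
    note gL = test_function_in_Lp_space[OF q_pos(1) g(1)]
    note dL = Lp_space_diff[OF q_pos(2) aL[of k] gL] and dcL = Lp_space_diff[OF q_pos(2) cL gL]
    have "Lp_norm q (\<lambda>x. a k x - g x) = Lp_norm q (\<lambda>x. cut ?Q (a k) x - g x)"
    proof (rule Lp_norm_AE_cong[OF q_pos(1) dcL Lp_spaceD(1)[OF dL]])
      show "AE x in lebesgue. cut ?Q (a k) x - g x = a k x - g x" using eq by (rule AE_mp) (auto intro!: AE_I2)
    qed
    hence le: "Lp_norm q (\<lambda>x. a k x - g x) \<le> \<eta> * \<sigma> k" using g(2) by simp
    let ?e = "\<lambda>x. inverse (complex_of_real \<eta>) * (a k x - g x)"
    have "Lp_norm q ?e = Lp_norm q (\<lambda>x. a k x - g x) / \<eta>"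
      unfolding Lp_norm_scale[OF q_pos(1) dL] using \<eta> by (simp add: divide_inverse norm_inverse mult.commute)
    also have "\<dots> \<le> \<sigma> k" using le \<eta> by (simp add: divide_le_eq mult.commute)
    finally have 1: "Lp_norm q ?e \<le> \<sigma> k" .
    have 2: "AE x in lebesgue. x \<notin> dyadic_cube (fst (up k)) (snd (up k)) \<longrightarrow> ?e x = 0"
      using ae by (rule AE_mp) (use Q2 in \<open>auto intro!: AE_I2\<close>)
    have "atom q \<rho> (up k) ?e"
      using 1 2 Lp_space_scale[OF q_pos(1) dL, of "inverse (complex_of_real \<eta>)"] by (simp add: atom_def \<sigma>_def)
    thus ?thesis using g(1) by blast
  qed
  then obtain g where g: "\<And>k. g k \<in> test_functions" "\<And>k. atom q \<rho> (up k) (\<lambda>x. inverse (complex_of_real \<eta>) * (a k x - g k x))"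
    by metis
  define G where "G x = (\<Sum>k\<in>S. lam k * g k x)" for x
  have G: "G \<in> test_functions" unfolding G_def by (rule test_functions_sum[OF g(1)])
  note GL = test_function_in_Lp_space[OF _ G]
  define \<kappa> where "\<kappa> k = (if k \<in> S then up k else k)" for k
  define c where "c k = (if k \<in> S then lam k * complex_of_real \<eta> else lam k)" for k
  define e where "e k = (if k \<in> S then (\<lambda>x. inverse (complex_of_real \<eta>) * (a k x - g k x)) else a k)" for k
  have eat: "atom q \<rho> (\<kappa> k) (e k)" for k using at g(2) by (simp add: \<kappa>_def e_def)
  \<comment> \<open>Written as a finite correction of the original coefficients, so that the total
    is the full sum plus a finite sum.\<close>
  have nc: "norm (c k) = norm (lam k) + (if k \<in> S then (\<eta> - 1) * norm (lam k) else 0)" for k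
    using \<eta> by (simp add: c_def norm_mult algebra_simps)
  have "((\<lambda>k. if k \<in> S then (\<eta> - 1) * norm (lam k) else 0) has_sum (\<Sum>k\<in>S. (\<eta> - 1) * norm (lam k))) UNIV"
    by (rule has_sum_finite_neutralI[OF S(1)]) auto
  hence cs: "((\<lambda>k. norm (c k)) has_sum (?N + (\<Sum>k\<in>S. (\<eta> - 1) * norm (lam k)))) UNIV"
    unfolding nc using has_sum_add[OF has_sum_infsum[OF lam]] by blast
  have small: "?N + (\<Sum>k\<in>S. (\<eta> - 1) * norm (lam k)) \<le> \<epsilon>"
  proof -
    have "(\<Sum>k\<in>S. norm (lam k)) \<le> ?N"
      by (rule finite_sum_le_infsum[OF lam S(1)]) auto
    hence "\<eta> * (\<Sum>k\<in>S. norm (lam k)) \<le> \<eta> * ?N" using \<eta> by simp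
    moreover have "(\<Sum>k\<in>S. (\<eta> - 1) * norm (lam k)) = \<eta> * (\<Sum>k\<in>S. norm (lam k)) - (\<Sum>k\<in>S. norm (lam k))"
      
      by (simp add: sum_distrib_left left_diff_distrib sum_subtractf)
    moreover have "?N - (\<Sum>k\<in>S. norm (lam k)) \<le> \<epsilon> / 2" using S(2) unfolding dist_real_def by linarith
    ultimately show ?thesis using \<eta>N by linarith
  qed
  have hG: "(\<lambda>\<phi>. h \<phi> - reg G \<phi>) = reg (\<lambda>x. F x - G x)"
    unfolding F(2) using regular_distribution_linear[OF s_gt_1 F(1) GL[OF s_pos(1)], of 1 "-1"] by simp
  have FG: "(\<lambda>x. F x - G x) \<in> Lp_space s" by (rule Lp_space_diff[OF s_pos(2) F(1) GL[OF s_pos(1)]])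
  have esum: "((\<lambda>k. c k * reg (e k) \<phi>) has_sum reg (\<lambda>x. F x - G x) \<phi>) UNIV"
    if \<phi>: "\<phi> \<in> schwartz_space" for \<phi>
  proof -
    note gL = test_function_in_Lp_space[OF q_pos(1) g(1)]
    have 1: "c k * reg (e k) \<phi> = lam k * reg (a k) \<phi>
        + (if k \<in> S then - (lam k * reg (g k) \<phi>) else 0)" for k
    proof (cases "k \<in> S")
      case True
      have "(\<lambda>x. inverse (complex_of_real \<eta>) * (a k x - g k x)) =
          (\<lambda>x. inverse (complex_of_real \<eta>) * a k x + (- inverse (complex_of_real \<eta>)) * g k x)"
        by (simp add: right_diff_distrib)
      hence eq: "reg (e k) \<phi> = inverse (complex_of_real \<eta>) * reg (a k) \<phi>
          + (- inverse (complex_of_real \<eta>)) * reg (g k) \<phi>"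
        using True by (simp only: e_def if_True regular_distribution_linear[OF q aL gL])
      have "complex_of_real \<eta> * inverse (complex_of_real \<eta>) = 1" using \<eta> by simp
      hence "lam k * complex_of_real \<eta> * (inverse (complex_of_real \<eta>) * A + (- inverse (complex_of_real \<eta>)) * B)
          = lam k * A + - (lam k * B)" for A B by algebra
      thus ?thesis using True by (simp only: c_def eq if_True)
    qed (simp add: c_def e_def)
    have "((\<lambda>k. if k \<in> S then - (lam k * reg (g k) \<phi>) else 0) has_sum
        (\<Sum>k\<in>S. - (lam k * reg (g k) \<phi>))) UNIV"
      by (rule has_sum_finite_neutralI[OF S(1)]) auto
    from has_sum_add[OF sum[OF \<phi>] this]
    have "((\<lambda>k. c k * reg (e k) \<phi>) has_sum (h \<phi> + (\<Sum>k\<in>S. - (lam k * reg (g k) \<phi>)))) UNIV"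
      unfolding 1 .
    moreover have "reg G \<phi> = (\<Sum>k\<in>S. lam k * reg (g k) \<phi>)"
    proof -
      note i = regular_distribution_integrable[OF q gL \<phi>]
      have "reg G \<phi> = (LINT x|lebesgue. (\<Sum>k\<in>S. lam k * (g k x * \<phi> x)))"
        using \<phi> by (simp add: regular_distribution_def G_def sum_distrib_right mult.assoc)
      also have "\<dots> = (\<Sum>k\<in>S. LINT x|lebesgue. lam k * (g k x * \<phi> x))"
        by (rule Bochner_Integration.integral_sum) (use i in simp)
      also have "\<dots> = (\<Sum>k\<in>S. lam k * reg (g k) \<phi>)" using \<phi> by (simp add: regular_distribution_def)
      finally show ?thesis .
    qed
    moreover have "reg (\<lambda>x. F x - G x) \<phi> = h \<phi> - reg G \<phi>"
      using fun_cong[OF hG, of \<phi>] by simp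
    ultimately show ?thesis by (simp add: sum_negf)
  qed
  note pI = predual_spaceI[OF q s_gt_1 FG eat has_sum_imp_summable[OF cs] esum]
  show ?thesis
  proof (rule that[OF G])
    show "(\<lambda>\<phi>. h \<phi> - reg G \<phi>) \<in> predual_morrey_space q \<rho>" unfolding hG by (rule pI(1))
    show "predual_morrey_norm q \<rho> (\<lambda>\<phi>. h \<phi> - reg G \<phi>) \<le> \<epsilon>"
      unfolding hG using pI(2) small infsumI[OF cs] by linarith
  qed
qed

end

lemma integral_over_annuli:
  fixes h :: "real ^ 'n \<Rightarrow> complex"
  assumes h: "integrable lebesgue h" and summ: "summable (\<lambda>i. norm (LINT x|lebesgue. indicator (annulus i J M) x * h x))"
  shows "((\<lambda>i. LINT x|lebesgue. indicator (annulus i J M) x * h x) has_sum (LINT x|lebesgue. h x)) UNIV"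
proof (rule norm_summable_imp_has_sum[OF summ])
  have ind: "indicat_real A x *\<^sub>R h x = indicator A x * h x" for A x by (simp add: indicator_def)
  have U: "(\<Union>i. annulus i J M) = UNIV" using annulus_exists by blast
  have "(LINT x:(\<Union>i. annulus i J M)|lebesgue. h x) = (\<Sum>i. (LINT x:(annulus i J M)|lebesgue. h x))"
  proof (rule lebesgue_integral_countable_add)
    show "annulus i J M \<inter> annulus j J M = {}" if "i \<noteq> j" for i j using annulus_unique that by blast
    show "set_integrable lebesgue (\<Union>i. annulus i J M) h" unfolding U using h by (simp add: set_integrable_def)
  qed (rule annulus_sets)
  hence "(LINT x|lebesgue. h x) = (\<Sum>i. LINT x|lebesgue. indicator (annulus i J M) x * h x)"
    unfolding U set_lebesgue_integral_def ind by simp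
  thus "(\<lambda>i. LINT x|lebesgue. indicator (annulus i J M) x * h x) sums (LINT x|lebesgue. h x)"
    using summable_sums[OF summable_norm_cancel[OF summ]] by simp
qed

lemma linear_bounded_distr_extensionD:
  assumes "linear_bounded_distr_extension X N T R"
  shows "f \<in> test_functions \<Longrightarrow> reg f \<in> X" and "h \<in> X \<Longrightarrow> R h \<in> X"
    and "h \<in> X \<Longrightarrow> g \<in> X \<Longrightarrow> R (\<lambda>\<phi>. h \<phi> + g \<phi>) = (\<lambda>\<phi>. R h \<phi> + R g \<phi>)"
    and "\<exists>C. \<forall>h\<in>X. N (R h) \<le> C * N h"
    and "f \<in> test_functions \<Longrightarrow> R (reg f) = reg (T f)"
  using assms unfolding linear_bounded_distr_extension_def by (simp_all add: image_subset_iff)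

section \<open>The operator on the predual\<close>

context calderon_zygmund
begin

context
  fixes q \<rho> s :: real
  assumes q: "1 < q" and \<rho>: "- real CARD('n) < \<rho>" "\<rho> < - real CARD('n) / q" and s: "s = - real CARD('n) / \<rho>"
begin

lemmas s_gt_1' = s_gt_1[OF q \<rho> s] and s_pos' = s_pos[OF q \<rho> s] and q_pos' = q_pos[OF q \<rho> s]

definition "atom_far_const = c2 * 2 powr (real CARD('n) * (1 - 1 / q)) * 8 powr (real CARD('n) / q)"

text \<open>Bound for the norm of the i-th annular piece relative to the size allowed for an atom of
  the ancestor i + 2. The exponent n / q + \<rho> is negative, so enlarging the cube costs powers of
  4 and 8; the ratio 2 powr - (n + \<rho>) is below 1 because \<rho> > - n. The added 1 keeps the
  weight at 0 positive, since pieces are divided by it.\<close>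

definition atom_weight :: "nat \<Rightarrow> real"
  where "atom_weight i = (case i of 0 \<Rightarrow> (Lq_const q + 1) * 4 powr - (real CARD('n) / q + \<rho>)
    | Suc j \<Rightarrow> atom_far_const * 8 powr - (real CARD('n) / q + \<rho>) * (2 powr - (real CARD('n) + \<rho>)) ^ j)"

lemma atom_weight_pos: "0 < atom_weight i"
  using c2 Lq_const(1)[OF q] by (auto simp: atom_weight_def atom_far_const_def split: nat.split)

lemma atom_weight_summable: "summable atom_weight"
proof -
  have "2 powr - (real CARD('n) + \<rho>) < 2 powr 0" by (rule powr_less_mono) (use \<rho> in auto)
  hence "summable (\<lambda>j. atom_far_const * 8 powr - (real CARD('n) / q + \<rho>) * (2 powr - (real CARD('n) + \<rho>)) ^ j)"
    by (intro summable_mult summable_geometric) simp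
  hence "summable (\<lambda>j. atom_weight (Suc j))" by (simp add: atom_weight_def)
  thus ?thesis by (simp only: summable_Suc_iff)
qed

definition "atom_cube i k = (fst k - int (i + 2), ancestor (i + 2) (snd k))"

text \<open>Near the cube the L_q bound is enough. At distance X the kernel estimate and the L_1
  norm of the atom bound the image by a multiple of X^-n side^(n + \<rho>). Against the size allowed
  for an atom on that scale this gains (side / X)^(n + \<rho>), which is geometric in the index of
  the annulus.\<close>

lemma atom_image:
  assumes a: "atom q \<rho> k a"
  shows "atom q \<rho> (atom_cube i k) (\<lambda>x. inverse (complex_of_real (atom_weight i)) * cut (annulus i (fst k) (snd k)) (Lq_extension q a) x)"
proof -
  define J where "J = fst k"
  define M where "M = snd k"
  let ?n = "real CARD('n)" and ?A = "annulus i J M" and ?Q = "dyadic_cube J M"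
  define \<tau> where "\<tau> = ?n / q + \<rho>"
  define b where "b = Lq_extension q a"
  have aL: "a \<in> Lp_space q" and a0: "AE x in lebesgue. x \<notin> ?Q \<longrightarrow> a x = 0" and an: "Lp_norm q a \<le> side J powr \<tau>"
    using a by (auto simp: atom_def J_def M_def \<tau>_def)
  have bL: "b \<in> Lp_space q" unfolding b_def by (rule Lq_extension_in[OF q aL])
  note cL = cut_in_Lp_space[OF q_pos'(1) bL annulus_sets[of i J M]]
  have le: "Lp_norm q (cut ?A b) \<le> atom_weight i * (2 ^ (i + 2) * side J) powr \<tau>"
  proof (cases i)
    case 0
    have "Lp_norm q (cut ?A b) \<le> Lp_norm q b" by (rule cL(2))
    also have "\<dots> \<le> Lq_const q * Lp_norm q a" unfolding b_def by (rule Lq_extension_bounded[OF q aL])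
    also have "\<dots> \<le> (Lq_const q + 1) * side J powr \<tau>"
      using Lq_const(1)[OF q] an Lp_norm_nonneg by (intro mult_mono) auto
    also have "\<dots> = atom_weight i * (2 ^ (i + 2) * side J) powr \<tau>"
      unfolding 0 by (simp add: atom_weight_def \<tau>_def[symmetric] powr_mult powr_minus)
    finally show ?thesis .
  next
    case (Suc j)
    define X where "X = 2 ^ j * side J"
    have X: "0 < X" by (simp add: X_def)
    \<comment> \<open>The kernel formula refers to the exact set where the function is nonzero,
      while an atom vanishes off its cube only almost everywhere; cutting provides the right
      representative.\<close>
    let ?a = "cut ?Q a"
    define b0 where "b0 = Lq_extension q ?a"
    have a0L: "?a \<in> Lp_space q" by (rule cut_in_Lp_space(1)[OF q_pos'(1) aL dyadic_cube_sets])
    have aeq: "AE x in lebesgue. a x = ?a x" using a0 by (rule AE_mp) (auto intro!: AE_I2 simp: indicator_def)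
    have beq: "AE y in lebesgue. b y = b0 y" unfolding b_def b0_def by (rule Lq_extension_AE_cong[OF q aL a0L aeq])
    have one: "0 < (1::real)" by simp
    note incl = Lp_inclusion[OF one q aL dyadic_cube_lmeasurable[of J M]]
    have int: "integrable lebesgue (\<lambda>z. norm (?a z))" using Lp_spaceD(2)[OF incl(1)] by simp
    define L where "L = measure lebesgue ?Q powr (1 - 1 / q) * side J powr \<tau>"
    have L: "(LINT z|lebesgue. norm (?a z)) \<le> L"
    proof -
      have "(LINT z|lebesgue. norm (?a z)) = Lp_norm 1 ?a" by (simp add: Lp_norm_eq)
      also have "\<dots> \<le> measure lebesgue ?Q powr (1 - 1 / q) * Lp_norm q a" using incl(2) by simp
      also have "\<dots> \<le> L" unfolding L_def by (rule mult_left_mono[OF an]) simp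
      finally show ?thesis .
    qed
    have L0: "0 \<le> L" by (simp add: L_def)
    have bdd: "bounded {x. ?a x \<noteq> 0}"
      by (rule bounded_subset[OF dyadic_cube_bounded[of J M]]) (auto simp: indicator_def split: if_splits)
    let ?c = "c2 * X powr (- ?n) * L"
    have point: "norm (b0 y) \<le> ?c" if y: "y \<in> ?A" and ker: "(\<forall>z. ?a z \<noteq> 0 \<longrightarrow> X \<le> norm (y - z)) \<longrightarrow> b0 y = (LINT z|lebesgue. K y z * ?a z)" for y
    proof -
      have far: "X \<le> norm (y - z)" if "z \<in> ?Q" for z
        using annulus_separation[OF that y[unfolded Suc]] by (simp add: X_def norm_minus_commute)
      have "?a z \<noteq> 0 \<longrightarrow> X \<le> norm (y - z)" for z using far by (auto simp: indicator_def split: if_splits)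
      hence "b0 y = (LINT z|lebesgue. K y z * ?a z)" using ker by blast
      hence "norm (b0 y) \<le> (LINT z|lebesgue. norm (K y z * ?a z))" by (simp only: integral_norm_bound)
      also have "\<dots> \<le> (LINT z|lebesgue. c2 * X powr (- ?n) * norm (?a z))"
      proof (rule integral_mono')
        show "integrable lebesgue (\<lambda>z. c2 * X powr (- ?n) * norm (?a z))" using int by simp
        fix z
        show "norm (K y z * ?a z) \<le> c2 * X powr (- ?n) * norm (?a z)"
        proof (cases "z \<in> ?Q")
          case True
          show ?thesis unfolding norm_mult[of "K y z"] by (rule mult_right_mono[OF size_far[OF X far[OF True]]]) simp
        qed simp
        show "0 \<le> c2 * X powr (- ?n) * norm (?a z)" using c2 by simp
      qed
      also have "\<dots> = c2 * X powr (- ?n) * (LINT z|lebesgue. norm (?a z))" by simp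
      also have "\<dots> \<le> ?c" using c2 by (intro mult_left_mono L) auto
      finally show ?thesis .
    qed
    have off: "AE y in lebesgue. (\<forall>z. ?a z \<noteq> 0 \<longrightarrow> X \<le> norm (y - z)) \<longrightarrow> b0 y = (LINT z|lebesgue. K y z * ?a z)"
      unfolding b0_def by (rule Lq_extension_off_support[OF q a0L bdd X])
    have bd: "AE y in lebesgue. norm (cut ?A b y) \<le> ?c * indicator (cube_nbhd (2 ^ (j + 2)) J M) y"
      using off beq
    proof (eventually_elim)
      case (elim y)
      show ?case
      proof (cases "y \<in> ?A")
        case True
        moreover have "y \<in> cube_nbhd (2 ^ (j + 2)) J M" using True by (simp add: annulus_def Suc)
        ultimately show ?thesis using point[OF True elim(1)] elim(2) by simp
      next
        case False
        thus ?thesis using c2 L0 by simp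
      qed
    qed
    have "Lp_norm q (cut ?A b) \<le> ?c * measure lebesgue (cube_nbhd (2 ^ (j + 2)) J M) powr (1 / q)"
      by (rule Lp_norm_bounded_on(2)[OF q_pos'(2) Lp_spaceD(1)[OF cL(1)] cube_nbhd_lmeasurable _ bd]) (use c2 L0 in auto)
    also have "measure lebesgue (cube_nbhd (2 ^ (j + 2)) J M) powr (1 / q) = (8 * X) powr (?n / q)"
    proof -
      have "measure lebesgue (cube_nbhd (2 ^ (j + 2)) J M) = (8 * X) ^ CARD('n)"
        by (subst measure_cube_nbhd) (simp_all add: X_def power_add mult_ac)
      also have "\<dots> = (8 * X) powr ?n" by (subst powr_realpow) (use X in auto)
      finally show ?thesis by (simp add: powr_powr)
    qed
    also have "L = 2 powr (?n * (1 - 1 / q)) * side J powr (?n + \<rho>)"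
    proof -
      have "measure lebesgue ?Q = (2 * side J) powr ?n" unfolding measure_dyadic_cube by (subst powr_realpow) auto
      hence "L = 2 powr (?n * (1 - 1 / q)) * (side J powr (?n * (1 - 1 / q)) * side J powr \<tau>)"
        by (simp add: L_def powr_powr powr_mult)
      also have "side J powr (?n * (1 - 1 / q)) * side J powr \<tau> = side J powr (?n + \<rho>)"
        by (simp add: \<tau>_def algebra_simps flip: powr_add)
      finally show ?thesis .
    qed
    also have "c2 * X powr (- ?n) * (2 powr (?n * (1 - 1 / q)) * side J powr (?n + \<rho>)) * (8 * X) powr (?n / q)
        = atom_far_const * (X powr (- ?n) * X powr (?n / q) * side J powr (?n + \<rho>))"
      by (simp add: atom_far_const_def powr_mult mult_ac)
    also have "X powr (- ?n) * X powr (?n / q) * side J powr (?n + \<rho>) = (2 powr - (?n + \<rho>)) ^ j * X powr \<tau>"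
    proof -
      have "(2 powr - (?n + \<rho>)) ^ j = (2 ^ j) powr - (?n + \<rho>)" by (induction j) (simp_all add: powr_mult)
      also have "\<dots> = X powr - (?n + \<rho>) * side J powr (?n + \<rho>)"
      proof -
        have "side J powr - (?n + \<rho>) * side J powr (?n + \<rho>) = 1" unfolding powr_add[symmetric] by simp
        thus ?thesis unfolding X_def powr_mult mult.assoc by simp
      qed
      finally have "(2 powr - (?n + \<rho>)) ^ j * X powr \<tau> = (X powr - (?n + \<rho>) * X powr \<tau>) * side J powr (?n + \<rho>)" by simp
      also have "X powr - (?n + \<rho>) * X powr \<tau> = X powr (- ?n) * X powr (?n / q)"
        by (simp add: \<tau>_def flip: powr_add)
      finally show ?thesis by simp
    qed
    also have "atom_far_const * ((2 powr - (?n + \<rho>)) ^ j * X powr \<tau>) = atom_weight i * (8 * X) powr \<tau>"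
      unfolding Suc by (simp add: atom_weight_def \<tau>_def[symmetric] powr_mult powr_minus)
    also have "8 * X = 2 ^ (i + 2) * side J" by (simp add: X_def Suc)
    finally show ?thesis .
  qed
  let ?e = "\<lambda>x. inverse (complex_of_real (atom_weight i)) * cut ?A b x"
  have "?e \<in> Lp_space q" by (rule Lp_space_scale[OF q_pos'(1) cL(1)])
  moreover have "AE x in lebesgue. x \<notin> dyadic_cube (fst (atom_cube i k)) (snd (atom_cube i k)) \<longrightarrow> ?e x = 0"
  proof (intro AE_I2 impI)
    fix x assume "x \<notin> dyadic_cube (fst (atom_cube i k)) (snd (atom_cube i k))"
    hence "x \<notin> ?A" using annulus_subset_ancestor[of i J M] unfolding atom_cube_def J_def M_def by auto
    thus "?e x = 0" by simp
  qed
  moreover have "Lp_norm q ?e \<le> side (fst (atom_cube i k)) powr \<tau>"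
  proof -
    have "Lp_norm q ?e = Lp_norm q (cut ?A b) / atom_weight i"
      unfolding Lp_norm_scale[OF q_pos'(1) cL(1)] using atom_weight_pos[of i] by (simp add: norm_inverse divide_inverse mult.commute)
    also have "\<dots> \<le> (2 ^ (i + 2) * side J) powr \<tau>" using le atom_weight_pos[of i] by (simp add: divide_le_eq mult.commute)
    also have "2 ^ (i + 2) * side J = side (fst (atom_cube i k))" using side_shift[of J "i + 2"] by (simp add: atom_cube_def J_def)
    finally show ?thesis .
  qed
  ultimately show ?thesis by (simp add: atom_def \<tau>_def b_def J_def M_def)
qed

text \<open>Elements of the predual are regular with a density in L_s that is unique up to null
  sets, so the choice of the density does not affect the result. The value 0 is a default for
  functionals that are not of this form.\<close>

definition predual_op :: "((real ^ 'n \<Rightarrow> complex) \<Rightarrow> complex) \<Rightarrow> (real ^ 'n \<Rightarrow> complex) \<Rightarrow> complex"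
  where "predual_op h = (if \<exists>F. F \<in> Lp_space s \<and> h = reg F
    then reg (Lq_extension s (SOME F. F \<in> Lp_space s \<and> h = reg F)) else (\<lambda>\<phi>. 0))"

lemma predual_op_regular:
  assumes F: "F \<in> Lp_space s"
  shows "predual_op (reg F) = reg (Lq_extension s F)"
proof -
  define G where "G = (SOME G. G \<in> Lp_space s \<and> reg F = reg G)"
  have G: "G \<in> Lp_space s \<and> reg F = reg G"
    unfolding G_def by (rule someI[of _ F]) (use F in simp)
  have op: "predual_op (reg F) = reg (Lq_extension s G)"
    unfolding predual_op_def G_def using F by auto
  have "AE x in lebesgue. F x = G x" by (rule regular_distribution_inject[OF s_gt_1' F]) (use G in auto)
  hence "AE x in lebesgue. Lq_extension s F x = Lq_extension s G x" using Lq_extension_AE_cong[OF s_gt_1' F] G by blast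
  hence "reg (Lq_extension s F) = reg (Lq_extension s G)"
    using G by (intro regular_distribution_AE_cong Lp_spaceD(1)[OF Lq_extension_in[OF s_gt_1']] F) auto
  thus ?thesis using op by simp
qed

lemma predual_op_linear:
  assumes F: "F \<in> Lp_space s" and G: "G \<in> Lp_space s"
  shows "predual_op (\<lambda>\<phi>. c * reg F \<phi> + d * reg G \<phi>) =
    (\<lambda>\<phi>. c * predual_op (reg F) \<phi> + d * predual_op (reg G) \<phi>)"
proof -
  have FG: "(\<lambda>x. c * F x + d * G x) \<in> Lp_space s"
    by (intro Lp_space_add Lp_space_scale s_pos' F G)
  note E = Lq_extension_in[OF s_gt_1']
  have EL: "(\<lambda>x. c * Lq_extension s F x + d * Lq_extension s G x) \<in> Lp_space s"
    by (intro Lp_space_add Lp_space_scale s_pos' E F G)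
  have "predual_op (\<lambda>\<phi>. c * reg F \<phi> + d * reg G \<phi>)
      = predual_op (reg (\<lambda>x. c * F x + d * G x))"
    by (simp only: regular_distribution_linear[OF s_gt_1' F G])
  also have "\<dots> = reg (Lq_extension s (\<lambda>x. c * F x + d * G x))" by (rule predual_op_regular[OF FG])
  also have "\<dots> = reg (\<lambda>x. c * Lq_extension s F x + d * Lq_extension s G x)"
    by (rule regular_distribution_AE_cong[OF Lp_spaceD(1)[OF E[OF FG]] Lp_spaceD(1)[OF EL] Lq_extension_linear[OF s_gt_1' F G]])
  finally show ?thesis
    by (simp only: regular_distribution_linear[OF s_gt_1' E[OF F] E[OF G]] predual_op_regular[OF F] predual_op_regular[OF G])
qed

text \<open>The pieces are cut from the L_q extension of the atom and reassembled into its L_s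
  extension; the two agree almost everywhere by consistency. The second bound is uniform in the atom
  and the annulus, as the double series requires.\<close>

lemma atom_image_has_sum:
  assumes a: "atom q \<rho> k a" and \<phi>: "\<phi> \<in> schwartz_space"
  shows "((\<lambda>i. complex_of_real (atom_weight i) * reg (\<lambda>x. inverse (complex_of_real (atom_weight i)) *
      cut (annulus i (fst k) (snd k)) (Lq_extension q a) x) \<phi>) has_sum reg (Lq_extension s a) \<phi>) UNIV"
    and "norm (reg (\<lambda>x. inverse (complex_of_real (atom_weight i)) *
      cut (annulus i (fst k) (snd k)) (Lq_extension q a) x) \<phi>) \<le> 2 powr (real CARD('n) / s - real CARD('n) / q) * Lp_norm (s / (s - 1)) \<phi>"
proof -
  let ?A = "\<lambda>i. annulus i (fst k) (snd k)" and ?s' = "s / (s - 1)" and ?B = "2 powr (real CARD('n) / s - real CARD('n) / q)"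
  define b where "b = Lq_extension q a"
  let ?e = "\<lambda>i x. inverse (complex_of_real (atom_weight i)) * cut (?A i) b x"
  note s' = conjugate_exponent_sum[OF s_gt_1']
  note aq = atom_LpD[OF a] and as = atom_in_Ls'(1)[OF q \<rho> s a]
  note e = atom_image[OF a, folded b_def]
  have bd: "norm (reg (?e i) \<phi>) \<le> ?B * Lp_norm ?s' \<phi>" for i
  proof -
    have "norm (reg (?e i) \<phi>) \<le> Lp_norm s (?e i) * Lp_norm ?s' \<phi>"
      by (rule regular_distribution_bound[OF s_gt_1' s' atom_in_Ls'(1)[OF q \<rho> s e]])
    also have "\<dots> \<le> ?B * Lp_norm ?s' \<phi>" by (rule mult_right_mono[OF atom_in_Ls'(2)[OF q \<rho> s e] Lp_norm_nonneg])
    finally show ?thesis .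
  qed
  have "AE x in lebesgue. b x = Lq_extension s a x" unfolding b_def by (rule Lq_extension_consistent[OF q s_gt_1' aq as])
  hence eq: "reg b = reg (Lq_extension s a)"
    unfolding b_def by (rule regular_distribution_AE_cong[OF Lp_spaceD(1)[OF Lq_extension_in[OF q aq]] Lp_spaceD(1)[OF Lq_extension_in[OF s_gt_1' as]]])
  have bL: "b \<in> Lp_space q" unfolding b_def by (rule Lq_extension_in[OF q aq])
  note int = regular_distribution_integrable[OF q bL \<phi>]
  have summand: "complex_of_real (atom_weight i) * reg (?e i) \<phi> = (LINT x|lebesgue. indicator (?A i) x * (b x * \<phi> x))" for i
  proof -
    have "reg (?e i) \<phi> = (LINT x|lebesgue. inverse (complex_of_real (atom_weight i)) * (indicator (?A i) x * (b x * \<phi> x)))"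
      using \<phi> by (simp add: regular_distribution_def mult.assoc)
    thus ?thesis using atom_weight_pos[of i] by simp
  qed
  have summ: "summable (\<lambda>i. norm (LINT x|lebesgue. indicator (?A i) x * (b x * \<phi> x)))"
  proof (rule summable_comparison_test'[OF summable_mult2[OF atom_weight_summable, of "?B * Lp_norm ?s' \<phi>"], of 0])
    fix i
    have "norm (complex_of_real (atom_weight i) * reg (?e i) \<phi>) \<le> atom_weight i * (?B * Lp_norm ?s' \<phi>)"
      unfolding norm_mult using bd[of i] atom_weight_pos[of i] by (simp add: mult_left_mono)
    thus "norm (norm (LINT x|lebesgue. indicator (?A i) x * (b x * \<phi> x))) \<le> atom_weight i * (?B * Lp_norm ?s' \<phi>)"
      unfolding summand by simp
  qed
  from integral_over_annuli[OF int summ]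
  have "((\<lambda>i. complex_of_real (atom_weight i) * reg (?e i) \<phi>) has_sum reg b \<phi>) UNIV"
    unfolding summand using \<phi> by (simp add: regular_distribution_def)
  thus "((\<lambda>i. complex_of_real (atom_weight i) * reg (\<lambda>x. inverse (complex_of_real (atom_weight i)) *
      cut (annulus i (fst k) (snd k)) (Lq_extension q a) x) \<phi>) has_sum reg (Lq_extension s a) \<phi>) UNIV"
    unfolding eq unfolding b_def .
  show "norm (reg (\<lambda>x. inverse (complex_of_real (atom_weight i)) *
      cut (annulus i (fst k) (snd k)) (Lq_extension q a) x) \<phi>) \<le> 2 powr (real CARD('n) / s - real CARD('n) / q) * Lp_norm (s / (s - 1)) \<phi>"
    using bd[of i] unfolding b_def .
qed

text \<open>The new family is indexed by pairs of an atom and an annulus. Its coefficients are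
  products of \<open>lam k\<close> and a weight independent of the atom, so the total factorises.
  Distinct pairs may share an ancestor cube, which \<open>predual_spaceI\<close> allows.\<close>

lemma predual_op_bound:
  assumes rep: "atomic_representation q \<rho> h lam a" and h0: "\<forall>\<phi>. \<phi> \<notin> schwartz_space \<longrightarrow> h \<phi> = 0"
  shows "predual_op h \<in> predual_morrey_space q \<rho>"
    and "predual_morrey_norm q \<rho> (predual_op h) \<le> suminf atom_weight * (\<Sum>\<^sub>\<infinity>k. norm (lam k))"
proof -
  let ?s' = "s / (s - 1)" and ?B = "2 powr (real CARD('n) / s - real CARD('n) / q)"
  note s' = conjugate_exponent_sum[OF s_gt_1']
  have at: "atom q \<rho> k (a k)" for k using rep unfolding atomic_representation_iff by blast
  have lam: "(\<lambda>k. norm (lam k)) summable_on UNIV" using rep by (simp add: atomic_representation_iff)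
  note as = atom_in_Ls'(1)[OF q \<rho> s at]
  obtain F where F: "F \<in> Lp_space s" "h = reg F"
    and "Lp_norm s F \<le> ?B * (\<Sum>\<^sub>\<infinity>k. norm (lam k))"
    and Fs: "\<And>\<Lambda>. bounded_functional s \<Lambda> \<Longrightarrow> ((\<lambda>k. \<Lambda> (\<lambda>x. lam k * a k x)) has_sum \<Lambda> F) UNIV"
    by (fact predual_regular[OF q \<rho> s rep h0])
  note E = Lq_extension_in[OF s_gt_1']
  define e where "e = (\<lambda>(k, i) x. inverse (complex_of_real (atom_weight i)) * cut (annulus i (fst k) (snd k)) (Lq_extension q (a k)) x)"
  define c where "c = (\<lambda>(k, i). lam k * complex_of_real (atom_weight i))"
  define \<kappa> :: "(int \<times> (int ^ 'n)) \<times> nat \<Rightarrow> int \<times> (int ^ 'n)" where "\<kappa> = (\<lambda>(k, i). atom_cube i k)"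
  have ee: "atom q \<rho> (\<kappa> j) (e j)" for j
  proof (cases j)
    case (Pair k i)
    show ?thesis using atom_image[OF at[of k], of i] unfolding Pair \<kappa>_def e_def by simp
  qed
  have ws: "(atom_weight has_sum suminf atom_weight) UNIV"
    by (rule sums_nonneg_imp_has_sum[OF summable_sums[OF atom_weight_summable] less_imp_le[OF atom_weight_pos]])
  have inner: "((\<lambda>i. norm (c (k, i))) has_sum norm (lam k) * suminf atom_weight) UNIV" for k
  proof -
    have "norm (c (k, i)) = norm (lam k) * atom_weight i" for i using atom_weight_pos[of i] by (simp add: c_def norm_mult)
    thus ?thesis using has_sum_cmult_right[OF ws, of "norm (lam k)"] by simp
  qed
  have outer: "((\<lambda>k. norm (lam k) * suminf atom_weight) has_sum (\<Sum>\<^sub>\<infinity>k. norm (lam k)) * suminf atom_weight) UNIV"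
    by (rule has_sum_cmult_left[OF has_sum_infsum[OF lam]])
  have csum: "(\<lambda>j. norm (c j)) summable_on Sigma UNIV (\<lambda>_. UNIV)"
    by (rule summable_on_SigmaI[OF inner has_sum_imp_summable[OF outer]]) auto
  have ctot: "((\<lambda>j. norm (c j)) has_sum (\<Sum>\<^sub>\<infinity>k. norm (lam k)) * suminf atom_weight) (Sigma UNIV (\<lambda>_. UNIV))"
    by (rule has_sum_SigmaI[OF inner outer csum])
  have csum': "(\<lambda>j. norm (c j)) summable_on UNIV" using csum by simp
  have sum: "((\<lambda>j. c j * reg (e j) \<phi>) has_sum reg (Lq_extension s F) \<phi>) UNIV"
    if \<phi>: "\<phi> \<in> schwartz_space" for \<phi>
  proof -
    have 1: "((\<lambda>i. c (k, i) * reg (e (k, i)) \<phi>) has_sum lam k * reg (Lq_extension s (a k)) \<phi>) UNIV" for k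
      using has_sum_cmult_right[OF atom_image_has_sum(1)[OF at[of k] \<phi>], of "lam k"] by (simp add: c_def e_def mult.assoc)
    \<comment> \<open>Extending a function and then pairing with \<phi> is a bounded functional on
      L_s, so it may be applied to the series of atoms term by term.\<close>
    have "((\<lambda>k. reg (Lq_extension s (\<lambda>x. lam k * a k x)) \<phi>) has_sum reg (Lq_extension s F) \<phi>) UNIV"
    proof (rule Fs, unfold bounded_functional_def, intro conjI ballI exI)
      show "reg (Lq_extension s (\<lambda>x. g x + h x)) \<phi> = reg (Lq_extension s g) \<phi> + reg (Lq_extension s h) \<phi>"
        if "g \<in> Lp_space s" "h \<in> Lp_space s" for g h
      proof -
        have EL: "(\<lambda>x. 1 * Lq_extension s g x + 1 * Lq_extension s h x) \<in> Lp_space s"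
          and L: "(\<lambda>x. 1 * g x + 1 * h x) \<in> Lp_space s"
          by (intro Lp_space_add Lp_space_scale s_pos' E that)+
        have "reg (Lq_extension s (\<lambda>x. 1 * g x + 1 * h x)) = reg (\<lambda>x. 1 * Lq_extension s g x + 1 * Lq_extension s h x)"
          by (rule regular_distribution_AE_cong[OF Lp_spaceD(1)[OF E[OF L]] Lp_spaceD(1)[OF EL] Lq_extension_linear[OF s_gt_1' that]])
        thus ?thesis using regular_distribution_linear[OF s_gt_1' E[OF that(1)] E[OF that(2)], of 1 1] by simp
      qed
      show "norm (reg (Lq_extension s g) \<phi>) \<le> Lq_const s * Lp_norm ?s' \<phi> * Lp_norm s g" if "g \<in> Lp_space s" for g
      proof -
        have "norm (reg (Lq_extension s g) \<phi>) \<le> Lp_norm s (Lq_extension s g) * Lp_norm ?s' \<phi>"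
          by (rule regular_distribution_bound[OF s_gt_1' s' E[OF that]])
        also have "\<dots> \<le> (Lq_const s * Lp_norm s g) * Lp_norm ?s' \<phi>"
          by (rule mult_right_mono[OF Lq_extension_bounded[OF s_gt_1' that] Lp_norm_nonneg])
        finally show ?thesis by (simp add: mult_ac)
      qed
      show "0 \<le> Lq_const s * Lp_norm ?s' \<phi>" using Lq_const(1)[OF s_gt_1'] by (simp add: Lp_norm_nonneg)
    qed
    moreover have "reg (Lq_extension s (\<lambda>x. lam k * a k x)) \<phi> = lam k * reg (Lq_extension s (a k)) \<phi>" for k
    proof -
      have "(\<lambda>x. lam k * a k x) \<in> Lp_space s" by (rule Lp_space_scale[OF s_pos'(1) as])
      thus ?thesis using fun_cong[OF predual_op_linear[OF as as, of "lam k" k 0 k], of \<phi>]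
          predual_op_regular[OF as, of k] predual_op_regular[of "\<lambda>x. lam k * a k x"]
          regular_distribution_linear[OF s_gt_1' as as, of "lam k" k 0 k] by simp
    qed
    ultimately have 2: "((\<lambda>k. lam k * reg (Lq_extension s (a k)) \<phi>) has_sum reg (Lq_extension s F) \<phi>) UNIV"
      by simp
    \<comment> \<open>Gives absolute summability over all pairs, which turns the iterated sums into
      one unordered sum.\<close>
    have 3: "norm (c j * reg (e j) \<phi>) \<le> norm (c j) * (?B * Lp_norm ?s' \<phi>)" for j
    proof (cases j)
      case (Pair k i)
      show ?thesis unfolding norm_mult[of "c j"] using atom_image_has_sum(2)[OF at[of k] \<phi>, of i]
        by (intro mult_left_mono) (simp_all add: Pair e_def)
    qed
    have "(\<lambda>j. c j * reg (e j) \<phi>) summable_on Sigma UNIV (\<lambda>_. UNIV)"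
      by (rule abs_summable_summable, rule summable_on_comparison_test[OF summable_on_cmult_left[OF csum]]) (rule 3, rule norm_ge_zero)
    from has_sum_SigmaI[OF 1 2 this] show ?thesis by simp
  qed
  have op: "predual_op h = reg (Lq_extension s F)" unfolding F(2) by (rule predual_op_regular[OF F(1)])
  note pI = predual_spaceI[OF q s_gt_1' E[OF F(1)] ee csum' sum]
  show "predual_op h \<in> predual_morrey_space q \<rho>" unfolding op by (rule pI(1))
  show "predual_morrey_norm q \<rho> (predual_op h) \<le> suminf atom_weight * (\<Sum>\<^sub>\<infinity>k. norm (lam k))"
    unfolding op using pI(2) infsumI[OF ctot] by (simp add: mult.commute)
qed

theorem predual_extension:
  "linear_bounded_distr_extension (predual_morrey_space q \<rho>) (predual_morrey_norm q \<rho>) T predual_op"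
  unfolding linear_bounded_distr_extension_def
proof (intro conjI ballI allI)
  let ?X = "predual_morrey_space q \<rho> :: ((real ^ 'n \<Rightarrow> complex) \<Rightarrow> complex) set"
  have h0: "h \<phi> = 0" if "h \<in> ?X" "\<phi> \<notin> schwartz_space" for h and \<phi> :: "real ^ 'n \<Rightarrow> complex"
    using that by (simp add: predual_morrey_space_def tempered_distributions_def)
  show "reg ` test_functions \<subseteq> ?X" using test_function_in_predual[OF q \<rho> s] by blast
  show "predual_op h \<in> ?X" if h: "h \<in> ?X" for h
  proof -
    obtain lam a where "atomic_representation q \<rho> h lam a" using h by (auto simp: predual_morrey_space_def)
    thus ?thesis by (rule predual_op_bound(1)) (use h0[OF h] in blast)
  qed
  show "predual_op (\<lambda>\<phi>. h \<phi> + g \<phi>) = (\<lambda>\<phi>. predual_op h \<phi> + predual_op g \<phi>)" if hg: "h \<in> ?X" "g \<in> ?X" for h g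
  proof -
    obtain F where F: "F \<in> Lp_space s" "h = reg F" by (rule predual_spaceD[OF q \<rho> s hg(1)])
    obtain G where G: "G \<in> Lp_space s" "g = reg G" by (rule predual_spaceD[OF q \<rho> s hg(2)])
    show ?thesis using predual_op_linear[OF F(1) G(1), of 1 1] by (simp add: F(2) G(2))
  qed
  show "predual_op (\<lambda>\<phi>. c * h \<phi>) = (\<lambda>\<phi>. c * predual_op h \<phi>)" if h: "h \<in> ?X" for c h
  proof -
    obtain F where F: "F \<in> Lp_space s" "h = reg F" by (rule predual_spaceD[OF q \<rho> s h])
    show ?thesis using predual_op_linear[OF F(1) F(1), of c 0] by (simp add: F(2))
  qed
  show "\<exists>C. \<forall>h\<in>?X. predual_morrey_norm q \<rho> (predual_op h) \<le> C * predual_morrey_norm q \<rho> h"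
  proof (intro exI ballI)
    fix h :: "(real ^ 'n \<Rightarrow> complex) \<Rightarrow> complex" assume h: "h \<in> ?X"
    show "predual_morrey_norm q \<rho> (predual_op h) \<le> suminf atom_weight * predual_morrey_norm q \<rho> h"
    proof (rule le_mult_predual_norm[OF h])
      show "0 \<le> suminf atom_weight" by (rule suminf_nonneg[OF atom_weight_summable less_imp_le[OF atom_weight_pos]])
      show "predual_morrey_norm q \<rho> (predual_op h) \<le> suminf atom_weight * (\<Sum>\<^sub>\<infinity>k. norm (lam k))"
        if "atomic_representation q \<rho> h lam a" for lam a
        by (rule predual_op_bound(2)[OF that]) (use h0[OF h] in blast)
    qed
  qed
  show "predual_op (reg f) = reg (T f)" if f: "f \<in> test_functions" for f
  proof -
    note fs = test_function_in_Lp_space[OF s_pos'(1) f]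
    have "reg (Lq_extension s f) = reg (T f)"
      by (rule regular_distribution_AE_cong[OF Lp_spaceD(1)[OF Lq_extension_in[OF s_gt_1' fs]]
            Lp_spaceD(1)[OF Lq_const(2)[OF s_gt_1' f]] Lq_extension_test_function[OF s_gt_1' f]])
    thus ?thesis using predual_op_regular[OF fs] by simp
  qed
qed

text \<open>Both operators agree on test functions, so their difference at \<open>h\<close> is the
  difference at \<open>h\<close> minus a test function. Every pairing is dominated by the norm, and
  density makes it vanish.\<close>

lemma predual_extension_unique:
  assumes S: "linear_bounded_distr_extension (predual_morrey_space q \<rho>) (predual_morrey_norm q \<rho>) T S"
    and h: "h \<in> predual_morrey_space q \<rho>"
  shows "S h = predual_op h"
proof
  fix \<phi> :: "real ^ 'n \<Rightarrow> complex"
  let ?X = "predual_morrey_space q \<rho> :: ((real ^ 'n \<Rightarrow> complex) \<Rightarrow> complex) set" and ?N = "predual_morrey_norm q \<rho>"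
  define B where "B = 2 powr (real CARD('n) / s - real CARD('n) / q) * Lp_norm (s / (s - 1)) \<phi>"
  have B0: "0 \<le> B" by (simp add: B_def Lp_norm_nonneg)
  obtain C C' where C: "\<And>u. u \<in> ?X \<Longrightarrow> ?N (S u) \<le> C * ?N u" "\<And>u. u \<in> ?X \<Longrightarrow> ?N (predual_op u) \<le> C' * ?N u"
    using linear_bounded_distr_extensionD(4)[OF S] linear_bounded_distr_extensionD(4)[OF predual_extension] by blast
  have le: "norm (S h \<phi> - predual_op h \<phi>) \<le> B * (\<bar>C\<bar> + \<bar>C'\<bar>) * ?N (\<lambda>\<phi>. h \<phi> - reg g \<phi>)"
    if g: "g \<in> test_functions" and u: "(\<lambda>\<phi>. h \<phi> - reg g \<phi>) \<in> ?X" for g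
  proof -
    let ?u = "\<lambda>\<phi>. h \<phi> - reg g \<phi>"
    have *: "R h \<phi> = R ?u \<phi> + reg (T g) \<phi>" "R ?u \<in> ?X"
      if R: "linear_bounded_distr_extension ?X ?N T R" for R
    proof -
      have "R (\<lambda>\<phi>. ?u \<phi> + reg g \<phi>) = (\<lambda>\<phi>. R ?u \<phi> + R (reg g) \<phi>)"
        by (rule linear_bounded_distr_extensionD(3)[OF R u linear_bounded_distr_extensionD(1)[OF R g]])
      thus "R h \<phi> = R ?u \<phi> + reg (T g) \<phi>"
        by (simp add: linear_bounded_distr_extensionD(5)[OF R g])
      show "R ?u \<in> ?X" by (rule linear_bounded_distr_extensionD(2)[OF R u])
    qed
    have "0 \<le> 1 * ?N ?u" by (rule le_mult_predual_norm[OF u]) (auto intro: infsum_nonneg)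
    hence N0: "0 \<le> ?N ?u" by simp
    have "norm (S h \<phi> - predual_op h \<phi>) = norm (S ?u \<phi> - predual_op ?u \<phi>)"
      by (simp only: *(1)[OF S] *(1)[OF predual_extension] add_diff_cancel_right)
    also have "\<dots> \<le> norm (S ?u \<phi>) + norm (predual_op ?u \<phi>)" by (rule norm_triangle_ineq4)
    also have "\<dots> \<le> B * ?N (S ?u) + B * ?N (predual_op ?u)"
      unfolding B_def by (rule add_mono[OF predual_norm_bound[OF q \<rho> s *(2)[OF S]] predual_norm_bound[OF q \<rho> s *(2)[OF predual_extension]]])
    also have "\<dots> \<le> B * (C * ?N ?u) + B * (C' * ?N ?u)"
      by (rule add_mono[OF mult_left_mono[OF C(1)[OF u] B0] mult_left_mono[OF C(2)[OF u] B0]])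
    also have "\<dots> \<le> B * (\<bar>C\<bar> * ?N ?u) + B * (\<bar>C'\<bar> * ?N ?u)"
      by (intro add_mono mult_left_mono mult_right_mono B0 N0) auto
    finally show ?thesis by (simp add: algebra_simps)
  qed
  have "norm (S h \<phi> - predual_op h \<phi>) \<le> 0 + \<epsilon>" if \<epsilon>: "0 < \<epsilon>" for \<epsilon>
  proof -
    define K where "K = B * (\<bar>C\<bar> + \<bar>C'\<bar>)"
    have K: "0 \<le> K" using B0 by (simp add: K_def)
    have d: "0 < \<epsilon> / (K + 1)" using \<epsilon> K by simp
    obtain g where g: "g \<in> test_functions" "(\<lambda>\<phi>. h \<phi> - reg g \<phi>) \<in> ?X"
      "?N (\<lambda>\<phi>. h \<phi> - reg g \<phi>) \<le> \<epsilon> / (K + 1)" by (rule test_functions_dense_in_predual[OF q \<rho> s h d])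
    have "norm (S h \<phi> - predual_op h \<phi>) \<le> K * (\<epsilon> / (K + 1))"
      using le[OF g(1,2)] mult_left_mono[OF g(3) K] unfolding K_def by linarith
    also have "\<dots> \<le> (K + 1) * (\<epsilon> / (K + 1))" using d by (intro mult_right_mono) auto
    also have "\<dots> = \<epsilon>" using K by simp
    finally show ?thesis by simp
  qed
  hence "norm (S h \<phi> - predual_op h \<phi>) \<le> 0" by (rule field_le_epsilon)
  thus "S h \<phi> = predual_op h \<phi>" by simp
qed

end

end

theorem theorem4p9:
  fixes T :: "(real ^ 'n \<Rightarrow> complex) \<Rightarrow> real ^ 'n \<Rightarrow> complex"
    and K :: "real ^ 'n \<Rightarrow> real ^ 'n \<Rightarrow> complex"
    and p p' r \<rho> c1 c2 \<delta> :: real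
  assumes "1 < p"
    and "- real CARD('n) / p < r" and "r < 0"
    and "1 / p + 1 / p' = 1"
    and "- real CARD('n) < \<rho>" and "\<rho> < - real CARD('n) / p'"
    and "\<forall>f\<in>test_functions. T f \<in> Lp_space 2 \<and> Lp_norm 2 (T f) \<le> c1 * Lp_norm 2 f"
    and "\<forall>f\<in>test_functions. AE y in lebesgue.
           ((\<lambda>\<epsilon>. LINT z:{z. norm (y - z) \<ge> \<epsilon>}|lebesgue. K y z * f z) \<longlongrightarrow> T f y) (at_right 0)"
    and "c2 > 0" and "\<delta> > 0"
    and "\<forall>x y. x \<noteq> y \<longrightarrow> norm (K x y) \<le> c2 * norm (x - y) powr (- real CARD('n))"
    and "\<forall>x x' y. x \<noteq> y \<longrightarrow> x' \<noteq> y \<longrightarrow>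
           2 * norm (x - x') \<le> max (norm (x - y)) (norm (x' - y)) \<longrightarrow>
           norm (K x y - K x' y) \<le>
             c2 * (norm (x - x') powr \<delta> / (norm (x - y) + norm (x' - y)) powr (real CARD('n) + \<delta>))"
    and "\<forall>x y y'. x \<noteq> y \<longrightarrow> x \<noteq> y' \<longrightarrow>
           2 * norm (y - y') \<le> max (norm (x - y)) (norm (x - y')) \<longrightarrow>
           norm (K x y - K x y') \<le>
             c2 * (norm (y - y') powr \<delta> / (norm (x - y) + norm (x - y')) powr (real CARD('n) + \<delta>))"
  shows "(\<exists>T'. linear_bounded_extension (morrey_space p r) (morrey_norm p r) T T') \<and>
    (\<exists>T'. linear_bounded_extension (morrey_space0 p r) (morrey_norm p r) T T' \<and>
       (\<forall>S. linear_bounded_extension (morrey_space0 p r) (morrey_norm p r) T S \<longrightarrow>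
          (\<forall>f\<in>morrey_space0 p r. AE x in lebesgue. S f x = T' f x))) \<and>
    (\<exists>T'. linear_bounded_distr_extension (predual_morrey_space p' \<rho>) (predual_morrey_norm p' \<rho>) T T' \<and>
       (\<forall>S. linear_bounded_distr_extension (predual_morrey_space p' \<rho>) (predual_morrey_norm p' \<rho>) T S \<longrightarrow>
          (\<forall>h\<in>predual_morrey_space p' \<rho>. S h = T' h)))"
proof -
  interpret calderon_zygmund T K c1 c2 \<delta>
    by unfold_locales (use assms(7-13) in blast)+
  have p': "1 < p'" by (rule conjugate_exponent[OF assms(1,4)])
  \<comment> \<open>\<open>p'\<close> is the exponent of the atoms, and \<open>refl\<close> fixes
    the auxiliary exponent as - n / \<rho>.\<close>
  note predual = predual_extension[OF p' assms(5,6) refl] predual_extension_unique[OF p' assms(5,6) refl]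
  note m = morrey_extension[OF assms(1-3)] and m0 = morrey_extension0[OF assms(1-3)]
  have "AE x in lebesgue. S f x = morrey_op p f x"
    if "linear_bounded_extension (morrey_space0 p r) (morrey_norm p r) T S" "f \<in> morrey_space0 p r" for S f
    by (rule linear_bounded_extension_unique[OF _ that(1) m0 that(2)]) (use assms(1) in simp)
  thus ?thesis using m m0 predual by (intro conjI exI allI impI ballI)
qed

end
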